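(* Let $v\in\mathbb{N}^{\ell+t+1}$. There exists $D_{v,n}\in\mathbb{N}$ such that for any ideal $I\subseteq R$ of minimal type $v$ with $\alpha(I)\ge D_{v,n}$, there exists an LPP ideal (for $I$ and $v$) with the same Hilbert function as $I$ in degrees $\le\alpha(I)+t$. Furthermore, if $I$ is generated in degrees $\le q$ with respect to $v$ and the EGH Bound is sharp in degree $q$, then the EGH Bound is sharp in degrees $q+1,q+2,\dots,\alpha(I)+t-1$.
   Context: $\mathbb{N}=\{0,1,2,\dots\}$. $K$ is a field of characteristic $0$, $n\ge 3$, $R=K[x_1,\dots,x_n]$ is standard graded, and all ideals are homogeneous. $\alpha(I)$ is the smallest degree of a minimal generator of $I$; $I_d$ is the degree-$d$ component. Type: let $\ell\ge1$, $t\ge 0$ be integers. $I$ is of type $v=(a_1,\dots,a_\ell,b_0,\dots,b_t)\in\mathbb{N}^{\ell+t+1}$ if there is a regular sequence of forms $f_1,\dots,f_\ell\in I$ with $\deg f_i=\alpha(I)+a_i$ and $\deg f_i\le\deg f_{i+1}$, and for all $j\in\{0,\dots,t\}$, $I$ has exactly $b_j$ minimal generators in degree $\alpha(I)+j$. For $d\in\mathbb{N}$, $\gamma_I(d)=\gamma_{v,I}(d)$ is the largest $i\in\{1,\dots,\ell\}$ with $\alpha(I)+a_i\le d$, and $0$ if $d<\alpha(I)+a_1$ (here $\alpha(I)+a_1\ge2$). Minimal type: $\rho_I(i)$ is the smallest degree $d$ such that $I_d$ contains a regular sequence of length $i$, and $\lambda_I(d)$ is the longest length of a regular sequence contained in $I_d$.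 $I$ is of minimal type $v$ ($v$ is minimal for $I$) if $I$ is of type $v$, witnessed by a regular sequence $f_1,\dots,f_\ell$ which is part of a minimal generating set of $I$, with $\rho_I(i)=\deg f_i$ for all $i\in\{1,\dots,\ell\}$ and $\lambda_I(d)=\gamma_I(d)$ for all $d\in\mathbb{N}$. $I$ is generated in degrees $\le q$ with respect to $v$ if all minimal generators of $I$ (in some minimal homogeneous generating set) in degrees $q+1,\dots,\alpha(I)+t$ belong to the ideal $(f_1,\dots,f_\ell)$. Lex order: for monomials of the same degree, $x^p>x^q$ if the first nonzero entry of $p-q$ is positive. A lex ideal is a monomial ideal that, whenever it contains a monomial, contains every lex-larger monomial of the same degree. An LPP (lex plus powers) ideal for $I$ and $v$ is $J=L+(x_1^{\alpha(I)+a_1},\dots,x_\ell^{\alpha(I)+a_\ell})$ with $L$ a lex ideal. Same Hilbert function in degrees $\le N$ means $\dim_K J_d=\dim_K I_d$ for all $d\le N$. For $I$ of minimal type $v$ and $J$ an LPP ideal for $I$ and $v$ with the same Hilbert function as $I$ in degrees $\le\alpha(I)+t$, the EGH Bound is sharp in degree $d$ if $\dim_K I_{d+1}=\gamma_I(d+1)-\gamma_I(d)+\dim_K R_1J_d$. *)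

theory Defs
  imports Complex_Main "HOL-Library.Poly_Mapping" "HOL-Algebra.Ideal"
begin

text \<open>
  A polynomial is a finitely supported map from exponent vectors to coefficients. The variables
  $x_1, \dots, x_n$ are indexed by $0, \dots, n - 1$; an exponent vector of $R$ is a finitely
  supported map on the naturals that vanishes outside this range.
\<close>

type_synonym 'k mpoly = "(nat \<Rightarrow>\<^sub>0 nat) \<Rightarrow>\<^sub>0 'k"

definition exponents :: "nat \<Rightarrow> (nat \<Rightarrow>\<^sub>0 nat) set" where
  "exponents n = {p. Poly_Mapping.keys p \<subseteq> {..<n}}"

definition tdeg :: "(nat \<Rightarrow>\<^sub>0 nat) \<Rightarrow> nat" where
  "tdeg p = (\<Sum>i\<in>Poly_Mapping.keys p. Poly_Mapping.lookup p i)"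

definition pmonom :: "(nat \<Rightarrow>\<^sub>0 nat) \<Rightarrow> 'k::field mpoly" where
  "pmonom p = Poly_Mapping.single p 1"

definition poly_ring :: "nat \<Rightarrow> ('k::field mpoly) ring" where
  "poly_ring n = \<lparr>carrier = {f. Poly_Mapping.keys f \<subseteq> exponents n},
     monoid.mult = (*), one = 1, zero = 0, add = (+)\<rparr>"

lemma exponents_add: "p \<in> exponents n \<Longrightarrow> q \<in> exponents n \<Longrightarrow> p + q \<in> exponents n"
  using keys_add[of p q] unfolding exponents_def by blast

lemma cring_poly_ring: "cring (poly_ring n :: ('k::field mpoly) ring)"
proof (rule cringI)
  let ?R = "poly_ring n :: ('k mpoly) ring"
  show "abelian_group ?R"
  proof (rule abelian_groupI)
    fix f assume f: "f \<in> carrier ?R"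
    have "- f \<in> carrier ?R" "- f \<oplus>\<^bsub>?R\<^esub> f = \<zero>\<^bsub>?R\<^esub>"
      using f by (auto simp: poly_ring_def)
    then show "\<exists>g\<in>carrier ?R. g \<oplus>\<^bsub>?R\<^esub> f = \<zero>\<^bsub>?R\<^esub>" by blast
  next
    fix f g assume "f \<in> carrier ?R" "g \<in> carrier ?R"
    then show "f \<oplus>\<^bsub>?R\<^esub> g \<in> carrier ?R"
      using keys_add[of f g] by (auto simp: poly_ring_def)
  qed (auto simp: poly_ring_def algebra_simps)
  show "Group.comm_monoid ?R"
  proof (rule Group.comm_monoidI)
    fix f g assume "f \<in> carrier ?R" "g \<in> carrier ?R"
    then show "f \<otimes>\<^bsub>?R\<^esub> g \<in> carrier ?R"
      using keys_mult[of f g] by (fastforce simp: poly_ring_def intro: exponents_add)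
  next
    show "\<one>\<^bsub>?R\<^esub> \<in> carrier ?R"
      by (auto simp: poly_ring_def exponents_def)
  qed (auto simp: poly_ring_def algebra_simps)
qed (auto simp: poly_ring_def algebra_simps)

text \<open>The $K$-vector space structure; \<open>mpoly.span\<close> and \<open>mpoly.dim\<close> are span and dimension over $K$.\<close>

definition pscale :: "'k::field \<Rightarrow> 'k mpoly \<Rightarrow> 'k mpoly" where
  "pscale c f = Poly_Mapping.single 0 c * f"

global_interpretation mpoly: vector_space "pscale :: 'k::field \<Rightarrow> 'k mpoly \<Rightarrow> 'k mpoly"
  by unfold_locales
    (auto simp: pscale_def algebra_simps single_add mult_single mult.assoc[symmetric] simp flip: single_one)

definition forms :: "nat \<Rightarrow> nat \<Rightarrow> 'k::field mpoly set" where
  "forms n d = {f \<in> carrier (poly_ring n). \<forall>p\<in>Poly_Mapping.keys f. tdeg p = d}"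

definition component :: "nat \<Rightarrow> 'k::field mpoly set \<Rightarrow> nat \<Rightarrow> 'k mpoly set" where
  "component n I d = I \<inter> forms n d"

definition hom_ideal :: "nat \<Rightarrow> 'k::field mpoly set \<Rightarrow> bool" where
  "hom_ideal n I \<longleftrightarrow> (\<exists>G \<subseteq> (\<Union>d. forms n d). I = Idl\<^bsub>poly_ring n\<^esub> G)"

text \<open>Finiteness is automatic, since $R$ is Noetherian.\<close>

definition min_gens :: "nat \<Rightarrow> 'k::field mpoly set \<Rightarrow> 'k mpoly set \<Rightarrow> bool" where
  "min_gens n I G \<longleftrightarrow> finite G \<and> G \<subseteq> (\<Union>d. forms n d) \<and> Idl\<^bsub>poly_ring n\<^esub> G = I \<and>
     (\<forall>H. H \<subset> G \<longrightarrow> Idl\<^bsub>poly_ring n\<^esub> H \<noteq> I)"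

text \<open>A minimal generating set does not contain \<open>0\<close>, so membership in \<open>forms n d\<close> determines the degree.\<close>

definition initial_deg :: "nat \<Rightarrow> 'k::field mpoly set \<Rightarrow> nat" where
  "initial_deg n I = (LEAST d. \<exists>G. min_gens n I G \<and> G \<inter> forms n d \<noteq> {})"

definition regular_seq :: "nat \<Rightarrow> 'k::field mpoly list \<Rightarrow> bool" where
  "regular_seq n fs \<longleftrightarrow> set fs \<subseteq> carrier (poly_ring n) \<and>
     (\<forall>i<length fs. \<forall>g\<in>carrier (poly_ring n).
        g * fs ! i \<in> Idl\<^bsub>poly_ring n\<^esub> (set (take i fs)) \<longrightarrow> g \<in> Idl\<^bsub>poly_ring n\<^esub> (set (take i fs))) \<and>
     Idl\<^bsub>poly_ring n\<^esub> (set fs) \<noteq> carrier (poly_ring n)"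

text \<open>
  A type $v = (a_1, \dots, a_\ell, b_0, \dots, b_t)$ is given by the lists
  \<open>a\<close> of length $\ell$ and \<open>b\<close> of length $t + 1$; thus $a_i$ is \<open>a ! (i - 1)\<close>.
\<close>

definition of_type_via ::
    "nat \<Rightarrow> 'k::field mpoly set \<Rightarrow> nat list \<Rightarrow> nat list \<Rightarrow> 'k mpoly list \<Rightarrow> bool" where
  "of_type_via n I a b fs \<longleftrightarrow>
     2 \<le> initial_deg n I + a ! 0 \<and>
     length fs = length a \<and> set fs \<subseteq> I \<and> regular_seq n fs \<and>
     (\<forall>i<length a. fs ! i \<in> forms n (initial_deg n I + a ! i)) \<and> sorted a \<and>
     (\<exists>G. min_gens n I G \<and> (\<forall>j<length b. card (G \<inter> forms n (initial_deg n I + j)) = b ! j))"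

definition gamma :: "nat \<Rightarrow> 'k::field mpoly set \<Rightarrow> nat list \<Rightarrow> nat \<Rightarrow> nat" where
  "gamma n I a d = Max ({0} \<union> {i \<in> {1..length a}. initial_deg n I + a ! (i - 1) \<le> d})"

definition rho :: "nat \<Rightarrow> 'k::field mpoly set \<Rightarrow> nat \<Rightarrow> nat" where
  "rho n I i = (LEAST d. \<exists>gs. regular_seq n gs \<and> length gs = i \<and> set gs \<subseteq> component n I d)"

text \<open>The greatest element exists, since regular sequences in $R$ have length at most $n$.\<close>

definition lambda :: "nat \<Rightarrow> 'k::field mpoly set \<Rightarrow> nat \<Rightarrow> nat" where
  "lambda n I d = (GREATEST i. \<exists>gs. regular_seq n gs \<and> length gs = i \<and> set gs \<subseteq> component n I d)"

definition minimal_type_via ::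
    "nat \<Rightarrow> 'k::field mpoly set \<Rightarrow> nat list \<Rightarrow> nat list \<Rightarrow> 'k mpoly list \<Rightarrow> bool" where
  "minimal_type_via n I a b fs \<longleftrightarrow>
     of_type_via n I a b fs \<and>
     (\<exists>G. min_gens n I G \<and> set fs \<subseteq> G) \<and>
     (\<forall>i\<in>{1..length a}. rho n I i = initial_deg n I + a ! (i - 1)) \<and>
     (\<forall>d. lambda n I d = gamma n I a d)"

definition minimal_type :: "nat \<Rightarrow> 'k::field mpoly set \<Rightarrow> nat list \<Rightarrow> nat list \<Rightarrow> bool" where
  "minimal_type n I a b \<longleftrightarrow> (\<exists>fs. minimal_type_via n I a b fs)"

text \<open>Here \<open>length b - 1\<close> is $t$.\<close>

definition generated_le ::
    "nat \<Rightarrow> 'k::field mpoly set \<Rightarrow> nat list \<Rightarrow> nat list \<Rightarrow> nat \<Rightarrow> bool" where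
  "generated_le n I a b q \<longleftrightarrow>
     (\<exists>fs G. minimal_type_via n I a b fs \<and> min_gens n I G \<and>
        (\<forall>d. q < d \<and> d \<le> initial_deg n I + (length b - 1) \<longrightarrow>
           G \<inter> forms n d \<subseteq> Idl\<^bsub>poly_ring n\<^esub> (set fs)))"

definition lex_greater :: "(nat \<Rightarrow>\<^sub>0 nat) \<Rightarrow> (nat \<Rightarrow>\<^sub>0 nat) \<Rightarrow> bool" where
  "lex_greater p q \<longleftrightarrow>
     (\<exists>i. Poly_Mapping.lookup p i > Poly_Mapping.lookup q i \<and>
        (\<forall>j<i. Poly_Mapping.lookup p j = Poly_Mapping.lookup q j))"

definition monomial_ideal :: "nat \<Rightarrow> 'k::field mpoly set \<Rightarrow> bool" where
  "monomial_ideal n I \<longleftrightarrow> (\<exists>M \<subseteq> exponents n. I = Idl\<^bsub>poly_ring n\<^esub> (pmonom ` M))"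

definition lex_ideal :: "nat \<Rightarrow> 'k::field mpoly set \<Rightarrow> bool" where
  "lex_ideal n L \<longleftrightarrow> monomial_ideal n L \<and>
     (\<forall>p\<in>exponents n. \<forall>q\<in>exponents n.
        pmonom q \<in> L \<and> tdeg p = tdeg q \<and> lex_greater p q \<longrightarrow> pmonom p \<in> L)"

definition lpp_ideal :: "nat \<Rightarrow> 'k::field mpoly set \<Rightarrow> nat list \<Rightarrow> 'k mpoly set \<Rightarrow> bool" where
  "lpp_ideal n I a J \<longleftrightarrow>
     (\<exists>L. lex_ideal n L \<and>
        J = L <+>\<^bsub>poly_ring n\<^esub> Idl\<^bsub>poly_ring n\<^esub>
          ((\<lambda>i. pmonom (Poly_Mapping.single i (initial_deg n I + a ! i))) ` {..<length a}))"

definition same_hilbert_upto :: "nat \<Rightarrow> 'k::field mpoly set \<Rightarrow> 'k mpoly set \<Rightarrow> nat \<Rightarrow> bool" where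
  "same_hilbert_upto n J I N \<longleftrightarrow>
     (\<forall>d\<le>N. mpoly.dim (component n J d) = mpoly.dim (component n I d))"

text \<open>$R_1 V$ is the $K$-span of the products of linear forms with elements of $V$.\<close>

definition R1_mult :: "nat \<Rightarrow> 'k::field mpoly set \<Rightarrow> 'k mpoly set" where
  "R1_mult n V = mpoly.span {r * g | r g. r \<in> forms n 1 \<and> g \<in> V}"

text \<open>The subtraction does not truncate: \<open>gamma n I a\<close> is monotone.\<close>

definition egh_sharp ::
    "nat \<Rightarrow> 'k::field mpoly set \<Rightarrow> nat list \<Rightarrow> 'k mpoly set \<Rightarrow> nat \<Rightarrow> bool" where
  "egh_sharp n I a J d \<longleftrightarrow>
     mpoly.dim (component n I (d + 1)) =
       (gamma n I a (d + 1) - gamma n I a d) + mpoly.dim (R1_mult n (component n J d))"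

end

theory Submission
  imports Defs "HOL-Library.Product_Lexorder" "HOL-Library.Function_Algebras"
begin

text \<open>
  The proof compares the ideal $I$ with an LPP ideal degree by degree, through linear syzygies. For a
  finite-dimensional space $V$ of forms of one degree let $K_1(V)$ be the space of tuples in $V$ with
  $\sum_i x_i v_i = 0$, and $K_2(V)$ the space of alternating matrices over $V$ all of whose rows lie in
  $K_1(V)$; their dimensions are \<open>kd 1 n V\<close> and \<open>kd 2 n V\<close>. Then $\dim R_1 V = n \dim V - \dim K_1(V)$, and
  \<open>R2_bound\<close> says
  $\dim R_1 R_1 V \le n \dim R_1 V - {n \choose 2} \dim V + \dim K_2(V)$. For lex segments both
  are equalities, with dimensions given by the formulas of Eliahou and Kervaire. So upper bounds on
  $K_1$ are lower bounds on growth, and upper bounds on $K_2$ make minimal growth persist.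

  Among all spaces of forms with a given dimension, those spanned by lex segments have the largest
  $K_1$ and $K_2$ (\<open>kd_monspan_bound\<close>, \<open>kd_bound\<close>). To see this one passes to leading monomials, which
  cannot decrease $K_1$ and $K_2$; makes the set of monomials stable by substitutions
  $x_m \mapsto x_m + x_i$, where $x_m$ is the last variable; and restricts to the hyperplane $x_m = 0$.

  The space $V = I_{\alpha + j}$ contains the multiples of those $f_1, \dots, f_r$ of the regular
  sequence that have degree at most $\alpha + j$, and this improves the bound. The Hilbert function of
  $I$ in degrees $\alpha, \dots, \alpha + t$ is bounded by a number $H$ that depends on $n$ and the
  type only. If $\alpha$ is much larger than $H$, the $f_i$ have no relations with coefficients of the
  degrees that matter (\<open>regular_shifted_independent\<close>). Hence $V$ has coordinates, over a common
  denominator, with respect to a set containing shifts of all $f_i$ (\<open>common_denominator\<close>), and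
  splits into pieces, one of which contains the multiples of $f_1$, another one those of $f_2$, and so
  on (\<open>kd_coordinates\<close>). Each piece obeys the lex bound. Since this bound is superadditive
  (\<open>lexsum_superadd\<close>), the worst case is that of a single long lex segment together with nothing but
  the multiples of $f_2, \dots, f_r$ (\<open>kd_regular_bound\<close>). That is what an LPP ideal looks like: for large
  $\alpha$ its lex part is short, consists of multiples of a high power of $x_0$, and is disjoint from
  the multiples of the other pure powers (\<open>card_lex_plus_powers\<close>).

  As a result $I$ grows at least as fast as an LPP ideal with the same Hilbert function (\<open>R1_lower\<close>).
  So lex segments of the sizes left over when the multiples of $f_2, \dots, f_r$ are subtracted from
  the Hilbert function fit together to an ideal, which gives the LPP ideal (\<open>lpp_exists\<close>). The EGH bound is
  sharp in a degree exactly if the growth of $I$ from this degree is minimal and the next degree has no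
  generators besides the regular sequence. Minimal growth persists as long as such generators are
  absent, by \<open>R2_bound\<close> and the bound on $K_2$ (\<open>minimal_growth_step\<close>).
\<close>

section \<open>Linear algebra\<close>

definition (in vector_space) fin_dim :: "'b set \<Rightarrow> bool" where
  "fin_dim X \<longleftrightarrow> (\<exists>B. finite B \<and> X \<subseteq> span B)"

context vector_space
begin

lemma fin_dimI: "finite B \<Longrightarrow> X \<subseteq> span B \<Longrightarrow> fin_dim X"
  unfolding fin_dim_def by blast

lemma fin_dim_subset: "fin_dim Y \<Longrightarrow> X \<subseteq> Y \<Longrightarrow> fin_dim X"
  unfolding fin_dim_def by blast

lemma fin_dim_independent:
  assumes "fin_dim X" "independent B" "B \<subseteq> X"
  shows "finite B"
  using assms independent_span_bound unfolding fin_dim_def by (meson order_trans)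

lemma fin_dim_basis:
  assumes "fin_dim X"
  obtains B where "finite B" "B \<subseteq> X" "independent B" "X \<subseteq> span B" "card B = dim X"
  using basis_exists[of X] fin_dim_independent[OF assms] by metis

lemma card_independent_le_dim:
  assumes "fin_dim X" "independent B" "B \<subseteq> X"
  shows "card B \<le> dim X"
proof -
  obtain C where C: "finite C" "X \<subseteq> span C" "card C = dim X"
    using fin_dim_basis[OF assms(1)] by metis
  show ?thesis
    using independent_span_bound[of C B] C assms by auto
qed

lemma dim_mono_fin:
  assumes "fin_dim Y" "X \<subseteq> Y"
  shows "dim X \<le> dim Y"
proof -
  obtain B where B: "B \<subseteq> X" "independent B" "card B = dim X"
    using basis_exists[of X] by metis
  show ?thesis
    using card_independent_le_dim[OF assms(1) B(2)] B assms(2) by auto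
qed

lemma dim_zero_space [simp]: "dim {0} = 0"
  using dim_span[of "{}"] dim_eq_card_independent[OF independent_empty] by simp

lemma dim_eq_0_fin:
  assumes "fin_dim X" "dim X = 0"
  shows "X \<subseteq> {0}"
proof -
  obtain B where "finite B" "X \<subseteq> span B" "card B = dim X"
    using fin_dim_basis[OF assms(1)] by metis
  then show ?thesis using assms(2) by auto
qed

lemma subspace_eqI_dim:
  assumes "fin_dim Y" "subspace X" "X \<subseteq> Y" "dim Y \<le> dim X"
  shows "X = Y"
proof -
  obtain B where B: "finite B" "B \<subseteq> X" "independent B" "card B = dim X"
    using fin_dim_basis[OF fin_dim_subset[OF assms(1,3)]] by metis
  have "Y \<subseteq> span B"
  proof
    fix y assume y: "y \<in> Y"
    show "y \<in> span B"
    proof (rule ccontr)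
      assume n: "y \<notin> span B"
      then have "independent (insert y B)" by (rule independent_insertI[OF _ B(3)])
      then have "card (insert y B) \<le> dim Y"
        using card_independent_le_dim[OF assms(1)] B(2) assms(3) y by auto
      moreover have "y \<notin> B" using n span_base by blast
      ultimately show False using B(1,4) assms(4) by auto
    qed
  qed
  then show ?thesis
    using B(2) assms(2,3) span_minimal[OF B(2) assms(2)] by blast
qed

end

text \<open>Linearity is required on the subspace \<open>X\<close> only, because many maps below, such as the
  coordinates of an element over a common denominator, are not defined outside it.\<close>

definition lin_on :: "('k \<Rightarrow> 'a \<Rightarrow> 'a) \<Rightarrow> ('k \<Rightarrow> 'b \<Rightarrow> 'b) \<Rightarrow> 'a::plus set \<Rightarrow> ('a \<Rightarrow> 'b::plus) \<Rightarrow> bool" where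
  "lin_on s1 s2 X f \<longleftrightarrow>
     (\<forall>x\<in>X. \<forall>y\<in>X. f (x + y) = f x + f y) \<and> (\<forall>c. \<forall>x\<in>X. f (s1 c x) = s2 c (f x))"

context vector_space_pair
begin

lemma lin_onI:
  "(\<And>x y. x \<in> X \<Longrightarrow> y \<in> X \<Longrightarrow> f (x + y) = f x + f y) \<Longrightarrow>
   (\<And>c x. x \<in> X \<Longrightarrow> f (s1 c x) = s2 c (f x)) \<Longrightarrow> lin_on s1 s2 X f"
  unfolding lin_on_def by blast

lemma lin_on_subset: "lin_on s1 s2 Y f \<Longrightarrow> X \<subseteq> Y \<Longrightarrow> lin_on s1 s2 X f"
  unfolding lin_on_def by blast

lemma lin_on_add: "lin_on s1 s2 X f \<Longrightarrow> x \<in> X \<Longrightarrow> y \<in> X \<Longrightarrow> f (x + y) = f x + f y"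
  unfolding lin_on_def by blast

lemma lin_on_scale: "lin_on s1 s2 X f \<Longrightarrow> x \<in> X \<Longrightarrow> f (s1 c x) = s2 c (f x)"
  unfolding lin_on_def by blast

lemma lin_on_0:
  assumes "lin_on s1 s2 X f" "vs1.subspace X"
  shows "f 0 = 0"
  using lin_on_scale[OF assms(1) vs1.subspace_0[OF assms(2)], of 0] by simp

lemma lin_on_sum:
  assumes "lin_on s1 s2 X f" "vs1.subspace X" "\<And>a. a \<in> A \<Longrightarrow> g a \<in> X"
  shows "f (sum g A) = (\<Sum>a\<in>A. f (g a))"
  using assms(3)
proof (induction A rule: infinite_finite_induct)
  case (insert a A)
  then show ?case
    using vs1.subspace_sum[OF assms(2), of A g] lin_on_add[OF assms(1), of "g a" "sum g A"] by auto
qed (use lin_on_0[OF assms(1,2)] in auto)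

lemma lin_on_subspace_kernel:
  assumes "lin_on s1 s2 X f" "vs1.subspace X"
  shows "vs1.subspace {x \<in> X. f x = 0}"
  using assms lin_on_0[OF assms]
  by (auto simp: vs1.subspace_def lin_on_add[OF assms(1)] lin_on_scale[OF assms(1)])

lemma lin_on_subspace_image:
  assumes "lin_on s1 s2 X f" "vs1.subspace X"
  shows "vs2.subspace (f ` X)"
proof (rule vs2.subspaceI)
  show "0 \<in> f ` X" using lin_on_0[OF assms] vs1.subspace_0[OF assms(2)] by force
  fix x y c assume "x \<in> f ` X" "y \<in> f ` X"
  then obtain u v where uv: "u \<in> X" "v \<in> X" "x = f u" "y = f v" by blast
  then show "x + y \<in> f ` X"
    using lin_on_add[OF assms(1), of u v] vs1.subspace_add[OF assms(2)] by (metis imageI)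
  show "s2 c x \<in> f ` X"
    using lin_on_scale[OF assms(1), of u c] vs1.subspace_scale[OF assms(2)] uv by (metis imageI)
qed

lemma rank_nullity:
  assumes lin: "lin_on s1 s2 X f" and sub: "vs1.subspace X" and fd: "vs1.fin_dim X"
  shows "vs1.dim X = vs1.dim {x \<in> X. f x = 0} + vs2.dim (f ` X)" and "vs2.fin_dim (f ` X)"
proof -
  let ?N = "{x \<in> X. f x = 0}"
  have fdN: "vs1.fin_dim ?N" by (rule vs1.fin_dim_subset[OF fd]) auto
  obtain A where A: "finite A" "A \<subseteq> ?N" "vs1.independent A" "?N \<subseteq> vs1.span A" "card A = vs1.dim ?N"
    by (rule vs1.fin_dim_basis[OF fdN])
  have "A \<subseteq> X" using A(2) by blast
  then obtain B where B: "A \<subseteq> B" "B \<subseteq> X" "vs1.independent B" "X \<subseteq> vs1.span B"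
    using vs1.maximal_independent_subset_extend[OF _ A(3)] by metis
  have finB: "finite B" by (rule vs1.fin_dim_independent[OF fd B(3,2)])
  let ?C = "B - A"
  have fsum: "f (\<Sum>b\<in>D. s1 (u b) b) = (\<Sum>b\<in>D. s2 (u b) (f b))" if "D \<subseteq> B" for D u
  proof -
    have DX: "b \<in> X" if "b \<in> D" for b using that \<open>D \<subseteq> B\<close> B(2) by blast
    have "f (\<Sum>b\<in>D. s1 (u b) b) = (\<Sum>b\<in>D. f (s1 (u b) b))"
      by (rule lin_on_sum[OF lin sub]) (rule vs1.subspace_scale[OF sub DX])
    also have "\<dots> = (\<Sum>b\<in>D. s2 (u b) (f b))"
      by (rule sum.cong[OF refl], rule lin_on_scale[OF lin DX])
    finally show ?thesis .
  qed
  have key: "\<forall>c\<in>?C. u c = 0" if u: "(\<Sum>c\<in>?C. s2 (u c) (f c)) = 0" for u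
  proof -
    let ?x = "\<Sum>c\<in>?C. s1 (u c) c"
    have "?x \<in> X"
      by (rule vs1.subspace_sum[OF sub], rule vs1.subspace_scale[OF sub]) (use B(2) in blast)
    moreover have "f ?x = 0" using fsum[of ?C u] u by auto
    ultimately have "?x \<in> vs1.span A" using A(4) by blast
    then obtain w where w: "?x = (\<Sum>a\<in>A. s1 (w a) a)"
      using vs1.span_finite[OF A(1)] by auto
    let ?u = "\<lambda>b. if b \<in> A then - w b else u b"
    have "(\<Sum>b\<in>B. s1 (?u b) b) = (\<Sum>b\<in>A. s1 (?u b) b) + (\<Sum>b\<in>?C. s1 (?u b) b)"
      using B(1) finB by (simp add: sum.subset_diff)
    also have "(\<Sum>b\<in>A. s1 (?u b) b) = - ?x"
      unfolding w by (simp add: sum_negf)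
    also have "(\<Sum>b\<in>?C. s1 (?u b) b) = ?x" by (intro sum.cong) auto
    finally have "(\<Sum>b\<in>B. s1 (?u b) b) = 0" by simp
    then have "\<forall>b\<in>B. ?u b = 0"
      using vs1.independentD[OF B(3) finB subset_refl, of ?u] by blast
    then show ?thesis by force
  qed
  have inj: "inj_on f ?C"
  proof (rule inj_onI, rule ccontr)
    fix c d assume cd: "c \<in> ?C" "d \<in> ?C" "f c = f d" "c \<noteq> d"
    let ?u = "\<lambda>b. if b = c then 1 else if b = d then -1 else (0::'a)"
    have "(\<Sum>b\<in>?C. s2 (?u b) (f b)) = (\<Sum>b\<in>{c,d}. s2 (?u b) (f b))"
      by (rule sum.mono_neutral_right) (use cd finB in auto)
    also have "\<dots> = 0" using cd by simp
    finally show False using key[of ?u] cd by force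
  qed
  have ind: "vs2.independent (f ` ?C)"
  proof (rule vs2.independent_if_scalars_zero)
    show "finite (f ` ?C)" using finB by simp
    fix u x assume s: "(\<Sum>x\<in>f ` ?C. s2 (u x) x) = 0" and x: "x \<in> f ` ?C"
    have "(\<Sum>c\<in>?C. s2 (u (f c)) (f c)) = 0" using s by (simp add: sum.reindex[OF inj])
    then show "u x = 0" using key[of "\<lambda>c. u (f c)"] x by blast
  qed
  have span: "f ` X \<subseteq> vs2.span (f ` ?C)"
  proof
    fix y assume "y \<in> f ` X"
    then obtain x where x: "x \<in> X" "y = f x" by blast
    then obtain u where u: "x = (\<Sum>b\<in>B. s1 (u b) b)"
      using B(4) vs1.span_finite[OF finB] by auto
    have "y = (\<Sum>b\<in>B. s2 (u b) (f b))" using fsum[of B u] u x by simp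
    also have "\<dots> \<in> vs2.span (f ` ?C)"
    proof (rule vs2.span_sum)
      fix b assume "b \<in> B"
      then show "s2 (u b) (f b) \<in> vs2.span (f ` ?C)"
        using A(2) by (cases "b \<in> A") (auto intro!: vs2.span_scale simp: vs2.span_zero intro: vs2.span_base)
    qed
    finally show "y \<in> vs2.span (f ` ?C)" .
  qed
  show "vs2.fin_dim (f ` X)" using vs2.fin_dimI[OF _ span] finB by simp
  have "vs2.dim (f ` X) = card (f ` ?C)"
    by (rule vs2.dim_unique[OF _ span ind refl]) (use B(2) in auto)
  also have "\<dots> = card ?C" by (rule card_image[OF inj])
  finally have "vs2.dim (f ` X) + card A = card B"
    using B(1) finB by (simp add: card_Diff_subset A(1) card_mono)
  moreover have "card B = vs1.dim X" by (rule vs1.basis_card_eq_dim[OF B(2,4,3)])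
  ultimately show "vs1.dim X = vs1.dim ?N + vs2.dim (f ` X)" using A(5) by simp
qed

lemma dim_le_inj:
  assumes lin: "lin_on s1 s2 X f" and sub: "vs1.subspace X" and fdX: "vs1.fin_dim X"
    and inj: "\<And>x. x \<in> X \<Longrightarrow> f x = 0 \<Longrightarrow> x = 0" and Y: "f ` X \<subseteq> Y" and fd: "vs2.fin_dim Y"
  shows "vs1.dim X \<le> vs2.dim Y"
proof -
  have "{x \<in> X. f x = 0} = {0}"
    using inj lin_on_0[OF lin sub] vs1.subspace_0[OF sub] by auto
  then show ?thesis
    using rank_nullity(1)[OF lin sub fdX] vs2.dim_mono_fin[OF fd Y] by simp
qed

end

context vector_space_pair
begin

text \<open>Each functional cuts the dimension by at most one. The condition on \<open>u\<close> says that the target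
  space is one-dimensional.\<close>

lemma dim_le_functionals:
  assumes one: "vs2.span {u} = UNIV" and "finite \<Lambda>" and sub: "vs1.subspace X" and fd: "vs1.fin_dim X"
    and lin: "\<And>i. i \<in> \<Lambda> \<Longrightarrow> lin_on s1 s2 X (\<lambda>x. c x i)"
  shows "vs1.dim X \<le> card \<Lambda> + vs1.dim {x \<in> X. \<forall>i\<in>\<Lambda>. c x i = 0}"
proof -
  show ?thesis
    using assms(2) lin
  proof (induction \<Lambda> rule: finite_induct)
    case empty
    then show ?case by simp
  next
    case (insert i \<Lambda>)
    let ?Y = "{x \<in> X. \<forall>i\<in>\<Lambda>. c x i = 0}"
    have lin': "lin_on s1 s2 X (\<lambda>x. c x j)" if "j \<in> \<Lambda>" for j using insert.prems that by simp
    have "vs1.subspace ?Y"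
    proof (rule vs1.subspaceI)
      show "0 \<in> ?Y" using vs1.subspace_0[OF sub] lin_on_0[OF lin' sub] by simp
    next
      fix x y assume xy: "x \<in> ?Y" "y \<in> ?Y"
      have "c (x + y) j = 0" if "j \<in> \<Lambda>" for j
        using lin_on_add[OF lin'[OF that], of x y] xy that by simp
      then show "x + y \<in> ?Y" using xy vs1.subspace_add[OF sub] by simp
    next
      fix r x assume x: "x \<in> ?Y"
      have "c (s1 r x) j = 0" if "j \<in> \<Lambda>" for j
        using lin_on_scale[OF lin'[OF that], of x r] x that by simp
      then show "s1 r x \<in> ?Y" using x vs1.subspace_scale[OF sub] by simp
    qed
    moreover have fdY: "vs1.fin_dim ?Y" by (rule vs1.fin_dim_subset[OF fd]) auto
    moreover have "lin_on s1 s2 ?Y (\<lambda>x. c x i)" 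
      by (rule lin_on_subset[OF insert.prems[of i]]) auto
    ultimately have "vs1.dim ?Y = vs1.dim {x \<in> ?Y. c x i = 0} + vs2.dim ((\<lambda>x. c x i) ` ?Y)"
      by (intro rank_nullity) auto
    moreover have "vs2.dim ((\<lambda>x. c x i) ` ?Y) \<le> card {u}"
    proof (rule vs2.dim_le_card)
      show "(\<lambda>x. c x i) ` ?Y \<subseteq> vs2.span {u}" using one by auto
    qed simp
    moreover have "{x \<in> ?Y. c x i = 0} = {x \<in> X. \<forall>i\<in>insert i \<Lambda>. c x i = 0}" by auto
    moreover have "vs1.dim X \<le> card \<Lambda> + vs1.dim ?Y" using insert.IH insert.prems by simp
    ultimately show ?case using insert.hyps by simp
  qed
qed

text \<open>Gaussian elimination: vectors with different leading indices are independent, and a vector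
  whose coordinates vanish at all leading indices of \<open>X\<close> has no leading index, hence is zero.
  Dimensions of spaces of polynomials, and of tuples of polynomials, become cardinalities of sets of
  leading terms.\<close>

lemma leading_index_dim:
  fixes c :: "'b \<Rightarrow> 'i::linorder \<Rightarrow> 'c"
  assumes one: "vs2.span {u} = UNIV" and sub: "vs1.subspace X" and fd: "vs1.fin_dim X"
    and lin: "\<And>i. lin_on s1 s2 X (\<lambda>x. c x i)"
    and supp: "\<And>x. x \<in> X \<Longrightarrow> x \<noteq> 0 \<Longrightarrow> finite {i. c x i \<noteq> 0} \<and> {i. c x i \<noteq> 0} \<noteq> {}"
  defines "\<Lambda> \<equiv> (\<lambda>x. Max {i. c x i \<noteq> 0}) ` (X - {0})"
  shows "finite \<Lambda>" "vs1.dim X = card \<Lambda>"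
proof -
  note lin0 = lin_on_0[OF lin sub]
  have lead: "c x (Max {i. c x i \<noteq> 0}) \<noteq> 0" "\<And>j. Max {i. c x i \<noteq> 0} < j \<Longrightarrow> c x j = 0"
    if "x \<in> X" "x \<noteq> 0" for x
  proof -
    have fin: "finite {i. c x i \<noteq> 0}" and ne: "{i. c x i \<noteq> 0} \<noteq> {}" using supp[OF that] by blast+
    show "c x (Max {i. c x i \<noteq> 0}) \<noteq> 0" using Max_in[OF fin ne] by blast
    show "c x j = 0" if "Max {i. c x i \<noteq> 0} < j" for j
      using Max_ge[OF fin, of j] that by (auto simp: not_le[symmetric])
  qed
  have tri: "card L \<le> vs1.dim X" if "finite L" "L \<subseteq> \<Lambda>" for L
  proof -
    have "\<exists>B\<subseteq>X. finite B \<and> vs1.independent B \<and> card B = card L \<and> (\<forall>b\<in>B. \<forall>j. (\<forall>l\<in>L. l < j) \<longrightarrow> c b j = 0)"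
      using that
    proof (induction L rule: finite_linorder_max_induct)
      case empty
      show ?case by (intro exI[of _ "{}"]) (simp add: vs1.independent_empty)
    next
      case (insert l L)
      then obtain B where B: "B \<subseteq> X" "finite B" "vs1.independent B" "card B = card L"
        "\<forall>b\<in>B. \<forall>j. (\<forall>l\<in>L. l < j) \<longrightarrow> c b j = 0" by auto
      obtain x where x: "x \<in> X" "x \<noteq> 0" "l = Max {i. c x i \<noteq> 0}"
        using insert.prems unfolding \<Lambda>_def by auto
      have "vs1.subspace {y \<in> X. c y l = 0}"
        using lin_on_subspace_kernel[OF lin sub] .
      then have "vs1.span B \<subseteq> {y \<in> X. c y l = 0}"
        by (intro vs1.span_minimal) (use B(1,5) insert.hyps in auto)
      then have nx: "x \<notin> vs1.span B" using lead(1)[OF x(1,2)] x(3) by auto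
      show ?case
      proof (intro exI[of _ "insert x B"] conjI ballI allI impI)
        show "card (insert x B) = card (insert l L)"
          using nx vs1.span_base[of x B] B(2,4) insert.hyps by (metis card_insert_disjoint less_irrefl)
        fix b j assume b: "b \<in> insert x B" and j: "\<forall>l\<in>insert l L. l < j"
        then show "c b j = 0" using lead(2)[OF x(1,2), of j] x(3) B(5) by auto
      qed (use nx B x vs1.independent_insertI in auto)
    qed
    then show ?thesis using vs1.card_independent_le_dim[OF fd] by metis
  qed
  then show fin: "finite \<Lambda>"
    by (metis card.infinite finite_if_finite_subsets_card_bdd)
  have "{x \<in> X. \<forall>i\<in>\<Lambda>. c x i = 0} = {0}"
  proof -
    have "x = 0" if x: "x \<in> X" "\<forall>i\<in>\<Lambda>. c x i = 0" for x
    proof (rule ccontr)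
      assume "x \<noteq> 0"
      moreover from this have "Max {i. c x i \<noteq> 0} \<in> \<Lambda>" unfolding \<Lambda>_def using x(1) by blast
      ultimately show False using lead(1)[OF x(1)] x(2) by blast
    qed
    then show ?thesis using lin0 vs1.subspace_0[OF sub] by blast
  qed
  then have "vs1.dim X \<le> card \<Lambda>"
    using dim_le_functionals[OF one fin sub fd, of c, OF lin] by simp
  then show "vs1.dim X = card \<Lambda>" using tri[OF fin] by auto
qed

end


lemma vector_space_field: "vector_space ((*) :: 'k::field \<Rightarrow> 'k \<Rightarrow> 'k)"
  by unfold_locales (auto simp: algebra_simps)

section \<open>Monomials and lex segments\<close>

type_synonym expo = "nat \<Rightarrow>\<^sub>0 nat"

abbreviation lookup :: "('a \<Rightarrow>\<^sub>0 'b::zero) \<Rightarrow> 'a \<Rightarrow> 'b" where "lookup \<equiv> Poly_Mapping.lookup"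
abbreviation keys :: "('a \<Rightarrow>\<^sub>0 'b::zero) \<Rightarrow> 'a set" where "keys \<equiv> Poly_Mapping.keys"
abbreviation unit_expo :: "nat \<Rightarrow> expo" where "unit_expo i \<equiv> Poly_Mapping.single i (Suc 0)"

definition Mon :: "nat \<Rightarrow> nat \<Rightarrow> expo set" where
  "Mon n d = {p \<in> exponents n. tdeg p = d}"

lemma tdeg_sum:
  assumes "finite A" "keys p \<subseteq> A"
  shows "tdeg p = (\<Sum>i\<in>A. lookup p i)"
  unfolding tdeg_def by (rule sum.mono_neutral_left) (use assms in \<open>auto simp: in_keys_iff\<close>)

lemma tdeg_add: "tdeg (p + q) = tdeg p + tdeg q"
proof -
  let ?A = "keys p \<union> keys q"
  have "keys (p + q) \<subseteq> ?A" by (rule keys_add)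
  then show ?thesis
    using tdeg_sum[of ?A p] tdeg_sum[of ?A q] tdeg_sum[of ?A "p + q"]
    by (simp add: lookup_add sum.distrib)
qed

lemma tdeg_single [simp]: "tdeg (Poly_Mapping.single i c) = c"
  by (cases "c = 0") (auto simp: tdeg_def)

lemma tdeg_0 [simp]: "tdeg 0 = 0"
  by (simp add: tdeg_def)

lemma tdeg_eq_0_iff: "tdeg p = 0 \<longleftrightarrow> p = 0"
  by (auto simp: tdeg_def in_keys_iff intro: poly_mapping_eqI)

lemma lookup_le_tdeg: "lookup p i \<le> tdeg p"
proof (cases "i \<in> keys p")
  case True
  then show ?thesis unfolding tdeg_def by (intro member_le_sum) auto
qed (auto simp: in_keys_iff)

lemma exponents_iff: "p \<in> exponents n \<longleftrightarrow> (\<forall>i\<ge>n. lookup p i = 0)"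
  unfolding exponents_def by (auto simp: in_keys_iff subset_iff) (metis leI less_not_refl)

lemma expo_add_iff: "p + q \<in> exponents n \<longleftrightarrow> p \<in> exponents n \<and> q \<in> exponents n"
  by (auto simp: exponents_iff lookup_add)

lemma single_exponents: "i < n \<or> c = 0 \<Longrightarrow> Poly_Mapping.single i c \<in> exponents n"
  by (auto simp: exponents_def)

lemma zero_exponents [simp]: "0 \<in> exponents n"
  by (auto simp: exponents_def)

lemma Mon_exponents: "p \<in> Mon n d \<Longrightarrow> p \<in> exponents n"
  and Mon_tdeg: "p \<in> Mon n d \<Longrightarrow> tdeg p = d"
  by (auto simp: Mon_def)

lemma Mon_add: "p \<in> Mon n c \<Longrightarrow> q \<in> Mon n d \<Longrightarrow> p + q \<in> Mon n (c + d)"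
  by (auto simp: Mon_def tdeg_add exponents_add)

lemma Mon_add_unit: "p \<in> Mon n d \<Longrightarrow> i < n \<Longrightarrow> p + unit_expo i \<in> Mon n (Suc d)"
  using Mon_add[of p n d "unit_expo i" 1] by (simp add: Mon_def single_exponents)

lemma finite_Mon [simp]: "finite (Mon n d)"
proof -
  have "Mon n d \<subseteq> (\<lambda>f. \<Sum>i<n. Poly_Mapping.single i (f i)) ` ({..<n} \<rightarrow>\<^sub>E {..d})"
  proof
    fix p assume p: "p \<in> Mon n d"
    define f where "f = (\<lambda>i. if i < n then lookup p i else undefined)"
    have "p = (\<Sum>i<n. Poly_Mapping.single i (f i))"
    proof (rule poly_mapping_eqI)
      fix k
      show "lookup p k = lookup (\<Sum>i<n. Poly_Mapping.single i (f i)) k"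
        using Mon_exponents[OF p] unfolding f_def
        by (auto simp: lookup_sum lookup_single when_def exponents_iff sum.delta' cong: if_cong)
    qed
    moreover have "f \<in> {..<n} \<rightarrow>\<^sub>E {..d}"
      using lookup_le_tdeg[of p] Mon_tdeg[OF p] by (auto simp: f_def PiE_def extensional_def)
    ultimately show "p \<in> (\<lambda>f. \<Sum>i<n. Poly_Mapping.single i (f i)) ` ({..<n} \<rightarrow>\<^sub>E {..d})" by blast
  qed
  then show ?thesis by (rule finite_subset) (simp add: finite_PiE)
qed

lemma Mon_0 [simp]: "Mon n 0 = {0}"
  by (auto simp: Mon_def tdeg_eq_0_iff)

lemma less_expo_iff: "p < q \<longleftrightarrow> lex_greater q p" for p q :: expo
  unfolding less_poly_mapping.rep_eq less_fun_def lex_greater_def by (metis)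

lemma less_expoE:
  fixes p q :: expo
  assumes "p < q"
  obtains k where "lookup p k < lookup q k" "\<And>j. j < k \<Longrightarrow> lookup p j = lookup q j"
  using assms unfolding less_expo_iff lex_greater_def by metis

lemma less_expoI:
  fixes p q :: expo
  assumes "lookup p k < lookup q k" "\<And>j. j < k \<Longrightarrow> lookup p j = lookup q j"
  shows "p < q"
  using assms unfolding less_expo_iff lex_greater_def by metis

text \<open>The index of the last variable that divides the monomial. Variables are numbered from $0$, so
  this is one less than the index $\max(u)$ of Eliahou and Kervaire. The value at $1$ is the
  minimum $0$.\<close>

definition mxv :: "expo \<Rightarrow> nat" where
  "mxv p = (if p = 0 then 0 else Max (keys p))"

lemma mxv_in_keys: "p \<noteq> 0 \<Longrightarrow> mxv p \<in> keys p"
  unfolding mxv_def using Max_in[of "keys p"] by simp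

lemma mxv_ge: "i \<in> keys p \<Longrightarrow> i \<le> mxv p"
  unfolding mxv_def using Max_ge[of "keys p" i] by auto

lemma lookup_above_mxv: "mxv p < i \<Longrightarrow> lookup p i = 0"
  using mxv_ge[of i p] by (auto simp: in_keys_iff)

lemma mxv_less: "p \<in> exponents n \<Longrightarrow> 0 < n \<Longrightarrow> mxv p < n"
  using mxv_in_keys[of p] by (cases "p = 0") (auto simp: mxv_def exponents_def)

lemma mxv_eqI:
  assumes "0 < lookup p i" "\<And>j. i < j \<Longrightarrow> lookup p j = 0"
  shows "mxv p = i"
proof -
  have i: "i \<in> keys p" using assms(1) by (auto simp: in_keys_iff)
  then have "p \<noteq> 0" by auto
  then show ?thesis
    using mxv_in_keys[of p] mxv_ge[OF i] assms(2)[of "mxv p"]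
    by (metis in_keys_iff le_neq_implies_less)
qed

lemma mxv_add_unit: "mxv p \<le> i \<Longrightarrow> mxv (p + unit_expo i) = i"
  by (rule mxv_eqI) (auto simp: lookup_add lookup_single when_def lookup_above_mxv)

definition drop_mx :: "expo \<Rightarrow> expo" where
  "drop_mx p = p - unit_expo (mxv p)"

lemma drop_mx_add: "p \<noteq> 0 \<Longrightarrow> drop_mx p + unit_expo (mxv p) = p"
  unfolding drop_mx_def using mxv_in_keys[of p]
  by (intro poly_mapping_eqI) (auto simp: lookup_add lookup_minus lookup_single when_def in_keys_iff)

lemma lookup_drop_mx: "lookup (drop_mx p) j = (if j = mxv p then lookup p j - 1 else lookup p j)"
  unfolding drop_mx_def by (auto simp: lookup_minus lookup_single when_def)

lemma drop_mx_Mon: "p \<in> Mon n (Suc d) \<Longrightarrow> drop_mx p \<in> Mon n d"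
proof -
  assume p: "p \<in> Mon n (Suc d)"
  then have "p \<noteq> 0" by (auto simp: Mon_def)
  from drop_mx_add[OF this] have "drop_mx p + unit_expo (mxv p) \<in> Mon n (Suc d)" using p by simp
  then show ?thesis unfolding Mon_def mem_Collect_eq tdeg_add expo_add_iff by simp
qed

lemma drop_mx_add_unit: "mxv p \<le> i \<Longrightarrow> drop_mx (p + unit_expo i) = p"
  unfolding drop_mx_def by (simp add: mxv_add_unit)

lemma mxv_drop_mx: "mxv (drop_mx p) \<le> mxv p"
proof (cases "drop_mx p = 0")
  case False
  then show ?thesis
    using mxv_in_keys[OF False] lookup_above_mxv[of p "mxv (drop_mx p)"]
    by (metis (no_types, lifting) in_keys_iff linorder_not_less lookup_drop_mx less_irrefl)
qed (simp add: mxv_def)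

text \<open>Dividing by the last variable that occurs keeps the lex order; this is why
  \<open>up n A\<close> is a lex segment whenever \<open>A\<close> is.\<close>

lemma drop_mx_mono:
  assumes p: "p \<in> Mon n (Suc d)" and q: "q \<in> Mon n (Suc d)" and le: "q \<le> p"
  shows "drop_mx q \<le> drop_mx p"
proof (cases "p = q")
  case False
  then have "q < p" using le by simp
  then obtain k where k: "lookup q k < lookup p k" "\<And>j. j < k \<Longrightarrow> lookup q j = lookup p j"
    by (rule less_expoE) blast
  have pk: "k \<le> mxv p" using k(1) by (intro mxv_ge) (auto simp: in_keys_iff)
  let ?N = "n + k + 1"
  have deg: "tdeg u = (\<Sum>i<k. lookup u i) + lookup u k + (\<Sum>i\<in>{k<..<?N}. lookup u i)"
    if u: "keys u \<subseteq> {..<n}" for u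
  proof -
    have "tdeg u = (\<Sum>i\<in>{..<?N}. lookup u i)" by (rule tdeg_sum) (use u in auto)
    also have "{..<?N} = insert k ({..<k} \<union> {k<..<?N})" by auto
    also have "(\<Sum>i\<in>insert k ({..<k} \<union> {k<..<?N}). lookup u i)
        = lookup u k + ((\<Sum>i<k. lookup u i) + (\<Sum>i\<in>{k<..<?N}. lookup u i))"
      by (subst sum.insert) (auto intro!: sum.union_disjoint)
    finally show ?thesis by simp
  qed
  have keysn: "keys p \<subseteq> {..<n}" "keys q \<subseteq> {..<n}"
    using Mon_exponents[OF p] Mon_exponents[OF q] by (auto simp: exponents_def)
  have "(\<Sum>i<k. lookup q i) = (\<Sum>i<k. lookup p i)" using k(2) by (intro sum.cong) auto
  then have "(\<Sum>i\<in>{k<..<?N}. lookup q i) > (\<Sum>i\<in>{k<..<?N}. lookup p i)"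
    using deg[OF keysn(1)] deg[OF keysn(2)] Mon_tdeg[OF p] Mon_tdeg[OF q] k(1) by simp
  then obtain i where i: "k < i" "lookup q i > 0"
    by (metis (no_types, lifting) gr0I greaterThanLessThan_iff not_less_zero sum.neutral)
  then have qk: "k < mxv q" using mxv_ge[of i q] by (auto simp: in_keys_iff)
  show ?thesis
  proof (cases "k < mxv p \<or> lookup q k < lookup p k - 1")
    case True
    then have "drop_mx q < drop_mx p"
      using k pk qk by (intro less_expoI[of _ k]) (auto simp: lookup_drop_mx)
    then show ?thesis by simp
  next
    case False
    then have kp: "mxv p = k" "lookup q k = lookup p k - 1" using pk k(1) by auto
    have dk: "drop_mx p \<in> Mon n d" "drop_mx q \<in> Mon n d"
      using drop_mx_Mon p q by blast+
    have kn: "keys (drop_mx p) \<subseteq> {..<n}" "keys (drop_mx q) \<subseteq> {..<n}"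
      using dk by (auto simp: Mon_def exponents_def)
    have same: "lookup (drop_mx q) j = lookup (drop_mx p) j" if "j \<le> k" for j
      using that k(2)[of j] kp qk by (auto simp: lookup_drop_mx)
    have above: "lookup (drop_mx p) j = 0" if "k < j" for j
      using that kp lookup_above_mxv[of p j] by (auto simp: lookup_drop_mx)
    have "(\<Sum>i<k. lookup (drop_mx q) i) = (\<Sum>i<k. lookup (drop_mx p) i)"
      using same by (intro sum.cong) auto
    then have "(\<Sum>i\<in>{k<..<?N}. lookup (drop_mx q) i) = (\<Sum>i\<in>{k<..<?N}. lookup (drop_mx p) i)"
      using deg[OF kn(1)] deg[OF kn(2)] Mon_tdeg[OF dk(1)] Mon_tdeg[OF dk(2)] same[of k] by simp
    also have "\<dots> = 0" using above by simp
    finally have z: "lookup (drop_mx q) j = 0" if "k < j" "j < ?N" for j using that by simp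
    have "lookup (drop_mx q) j = lookup (drop_mx p) j" for j
      using same[of j] above[of j] z[of j] kn
      by (cases "j \<le> k"; cases "j < ?N") (auto simp: in_keys_iff subset_iff)
    then show ?thesis by (metis order_refl poly_mapping_eqI)
  qed
qed simp

definition up :: "nat \<Rightarrow> expo set \<Rightarrow> expo set" where
  "up n A = (\<Union>i<n. (\<lambda>p. p + unit_expo i) ` A)"

lemma upI: "p \<in> A \<Longrightarrow> i < n \<Longrightarrow> p + unit_expo i \<in> up n A"
  by (auto simp: up_def)

lemma upE: "w \<in> up n A \<Longrightarrow> (\<And>p i. p \<in> A \<Longrightarrow> i < n \<Longrightarrow> w = p + unit_expo i \<Longrightarrow> P) \<Longrightarrow> P"
  by (auto simp: up_def)

lemma up_mono: "A \<subseteq> B \<Longrightarrow> up n A \<subseteq> up n B"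
  by (auto simp: up_def)

lemma up_Un: "up n (A \<union> B) = up n A \<union> up n B"
  by (auto simp: up_def)

lemma finite_up: "finite A \<Longrightarrow> finite (up n A)"
  by (auto simp: up_def)

lemma up_subset_Mon: "A \<subseteq> Mon n d \<Longrightarrow> up n A \<subseteq> Mon n (Suc d)"
  using Mon_add_unit by (auto elim!: upE)

lemma up_Mon: "0 < n \<Longrightarrow> up n (Mon n d) = Mon n (Suc d)"
proof
  assume n: "0 < n"
  show "Mon n (Suc d) \<subseteq> up n (Mon n d)"
  proof
    fix p assume p: "p \<in> Mon n (Suc d)"
    then have "p \<noteq> 0" by (auto simp: Mon_def)
    from drop_mx_add[OF this] show "p \<in> up n (Mon n d)"
      using upI[OF drop_mx_Mon[OF p] mxv_less[OF Mon_exponents[OF p] n]] by simp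
  qed
qed (rule up_subset_Mon, simp)

lemma up_translate: "up n ((+) c ` A) = (+) c ` up n A"
  by (auto simp: up_def image_UN image_image add.assoc)

lemma card_translate: "card ((+) (c::expo) ` A) = card A"
  by (rule card_image) (auto intro: inj_onI)

definition lexseg :: "nat \<Rightarrow> nat \<Rightarrow> expo set \<Rightarrow> bool" where
  "lexseg n d A \<longleftrightarrow> A \<subseteq> Mon n d \<and> (\<forall>u\<in>A. \<forall>v\<in>Mon n d. u < v \<longrightarrow> v \<in> A)"

lemma lexseg_subset: "lexseg n d A \<Longrightarrow> A \<subseteq> Mon n d"
  and lexsegD: "lexseg n d A \<Longrightarrow> u \<in> A \<Longrightarrow> v \<in> Mon n d \<Longrightarrow> u \<le> v \<Longrightarrow> v \<in> A"
  unfolding lexseg_def by (blast, metis order_le_less)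

lemma lexseg_finite: "lexseg n d A \<Longrightarrow> finite A"
  using lexseg_subset finite_Mon finite_subset by metis

lemma lexseg_Mon: "lexseg n d (Mon n d)"
  by (simp add: lexseg_def)

lemma lexseg_empty: "lexseg n d {}"
  by (simp add: lexseg_def)

lemma lexseg_UN:
  assumes "\<And>i. i \<in> I \<Longrightarrow> lexseg n d (F i)"
  shows "lexseg n d (\<Union>i\<in>I. F i)"
  unfolding lexseg_def
proof (intro conjI ballI impI)
  show "(\<Union>i\<in>I. F i) \<subseteq> Mon n d" using lexseg_subset[OF assms] by (rule UN_least)
  fix u v assume "u \<in> (\<Union>i\<in>I. F i)" and v: "v \<in> Mon n d" "u < v"
  then obtain i where i: "i \<in> I" "u \<in> F i" by blast
  have "v \<in> F i" by (rule lexsegD[OF assms[OF i(1)] i(2) v(1) less_imp_le[OF v(2)]])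
  then show "v \<in> (\<Union>i\<in>I. F i)" using i(1) by blast
qed

lemma lexseg_Un:
  assumes "lexseg n d A" "lexseg n d B"
  shows "lexseg n d (A \<union> B)"
  using lexseg_UN[of "{A, B}" n d "\<lambda>X. X"] assms by auto

text \<open>The lex order on the monomials of one degree is total, so a lex segment is determined by its
  size.\<close>

lemma lexseg_chain:
  assumes A: "lexseg n d A" and B: "lexseg n d B"
  shows "A \<subseteq> B \<or> B \<subseteq> A"
proof (rule ccontr)
  assume "\<not> ?thesis"
  then obtain u v where uv: "u \<in> A" "u \<notin> B" "v \<in> B" "v \<notin> A" by blast
  then have "u \<in> Mon n d" "v \<in> Mon n d" using lexseg_subset[OF A] lexseg_subset[OF B] by auto
  then show False
    using uv lexsegD[OF A, of u v] lexsegD[OF B, of v u] by (metis linear)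
qed

lemma lexseg_le: "lexseg n d A \<Longrightarrow> lexseg n d B \<Longrightarrow> card A \<le> card B \<Longrightarrow> A \<subseteq> B"
  using lexseg_chain lexseg_finite by (metis card_seteq order_refl)

lemma lexseg_unique: "lexseg n d A \<Longrightarrow> lexseg n d B \<Longrightarrow> card A = card B \<Longrightarrow> A = B"
  by (simp add: lexseg_le subset_antisym)

lemma lexseg_exists:
  assumes "m \<le> card (Mon n d)"
  shows "\<exists>A. lexseg n d A \<and> card A = m"
  using assms
proof (induction m)
  case 0
  show ?case using lexseg_empty by (intro exI[of _ "{}"]) auto
next
  case (Suc m)
  then obtain A where A: "lexseg n d A" "card A = m" by auto
  then have "A \<noteq> Mon n d" using Suc.prems by auto
  then have ne: "Mon n d - A \<noteq> {}" using lexseg_subset[OF A(1)] by auto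
  let ?x = "Max (Mon n d - A)"
  have x: "?x \<in> Mon n d - A" "\<And>y. y \<in> Mon n d - A \<Longrightarrow> y \<le> ?x"
    using Max_in[OF _ ne] by auto
  have "lexseg n d (insert ?x A)"
    unfolding lexseg_def
  proof (intro conjI ballI impI)
    show "insert ?x A \<subseteq> Mon n d" using x lexseg_subset[OF A(1)] by auto
    fix u v assume u: "u \<in> insert ?x A" and v: "v \<in> Mon n d" "u < v"
    show "v \<in> insert ?x A"
    proof (cases "u \<in> A")
      case True
      then show ?thesis using lexsegD[OF A(1) True v(1)] v(2) by simp
    next
      case False
      then have "\<not> v \<le> ?x" using u v(2) by auto
      then show ?thesis using x(2)[of v] v(1) by blast
    qed
  qed
  moreover have "card (insert ?x A) = Suc m" using x(1) A lexseg_finite[OF A(1)] by simp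
  ultimately show ?case by blast
qed

text \<open>If $w = x_i u$ with $u \in A$, then $w / x_j \ge u$ for the last variable $x_j$ of $w$. So
  every monomial of \<open>up n A\<close> arises in exactly one way as $x_j u$ with $u \in A$ and $j$ at least the
  last index of $u$: the decomposition of Eliahou and Kervaire.\<close>

lemma lexseg_drop_mx:
  assumes A: "lexseg n d A" and w: "w \<in> up n A"
  shows "drop_mx w \<in> A"
proof -
  from w obtain u i where u: "u \<in> A" "i < n" "w = u + unit_expo i" by (rule upE)
  have wM: "w \<in> Mon n (Suc d)" using u lexseg_subset[OF A] Mon_add_unit by blast
  have "i \<le> mxv w" unfolding u(3) by (rule mxv_ge) (simp add: in_keys_iff lookup_add)
  moreover have "lookup w (mxv w) > 0"
    using mxv_in_keys[of w] wM by (cases "w = 0") (auto simp: Mon_def in_keys_iff)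
  ultimately have "u \<le> drop_mx w"
  proof (cases "i = mxv w")
    case True
    then show ?thesis by (simp add: drop_mx_def u(3))
  next
    case False
    with \<open>i \<le> mxv w\<close> have "u < drop_mx w"
      by (intro less_expoI[of _ i])
        (auto simp: lookup_drop_mx, simp_all add: u(3) lookup_add lookup_single when_def)
    then show ?thesis by simp
  qed
  then show ?thesis using lexsegD[OF A u(1) drop_mx_Mon[OF wM]] by simp
qed

lemma lexseg_up:
  assumes n: "0 < n" and A: "lexseg n d A"
  shows "lexseg n (Suc d) (up n A)"
  unfolding lexseg_def
proof (intro conjI ballI impI)
  show sub: "up n A \<subseteq> Mon n (Suc d)" by (rule up_subset_Mon[OF lexseg_subset[OF A]])
  fix u v assume u: "u \<in> up n A" and v: "v \<in> Mon n (Suc d)" and uv: "u < v"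
  have "drop_mx v \<in> A"
    using lexsegD[OF A lexseg_drop_mx[OF A u] drop_mx_Mon[OF v]] drop_mx_mono[OF v _ less_imp_le[OF uv]]
      sub u by blast
  moreover have "v \<noteq> 0" using v by (auto simp: Mon_def)
  ultimately show "v \<in> up n A"
    using upI[of "drop_mx v" A "mxv v" n] drop_mx_add[of v] mxv_less[OF Mon_exponents[OF v] n] by simp
qed

lemma lexseg_translate:
  assumes n: "0 < n" and A: "lexseg n d A"
  shows "lexseg n (c + d) ((+) (Poly_Mapping.single 0 c) ` A)"
proof -
  show ?thesis
    unfolding lexseg_def
  proof (intro conjI ballI impI)
    let ?s = "Poly_Mapping.single 0 c :: expo"
    have s: "?s \<in> Mon n c" using n by (simp add: Mon_def single_exponents)
    show "(+) ?s ` A \<subseteq> Mon n (c + d)" using Mon_add[OF s] lexseg_subset[OF A] by auto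
    fix u v assume "u \<in> (+) ?s ` A" and v: "v \<in> Mon n (c + d)" and uv: "u < v"
    then obtain u' where u': "u' \<in> A" "u = ?s + u'" by blast
    obtain k where k: "lookup u k < lookup v k" "\<And>j. j < k \<Longrightarrow> lookup u j = lookup v j"
      using uv by (rule less_expoE) blast
    have "c \<le> lookup v 0"
      using k(1) k(2)[of 0] u'(2) by (cases "k = 0") (auto simp: lookup_add)
    then have v': "v = ?s + (v - ?s)"
      by (intro poly_mapping_eqI) (auto simp: lookup_add lookup_minus lookup_single when_def)
    then have "?s + (v - ?s) \<in> Mon n (c + d)" using v by simp
    then have "v - ?s \<in> Mon n d" unfolding Mon_def mem_Collect_eq tdeg_add expo_add_iff by simp
    moreover have "u' < v - ?s" using uv v' u'(2) by (metis add_less_cancel_left)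
    ultimately have "v - ?s \<in> A" using lexsegD[OF A u'(1)] by simp
    then show "v \<in> (+) ?s ` A" using v' by blast
  qed
qed

text \<open>By Eliahou and Kervaire this is, for a lex segment \<open>A\<close>, the number of linear $p$-th
  syzygies of the ideal generated by \<open>A\<close>.\<close>

definition mxsum :: "nat \<Rightarrow> expo set \<Rightarrow> nat" where
  "mxsum p A = (\<Sum>u\<in>A. mxv u choose p)"

lemma sum_up_lexseg:
  assumes n: "0 < n" and A: "lexseg n d A"
  shows "(\<Sum>w\<in>up n A. f (mxv w)) = (\<Sum>u\<in>A. \<Sum>i\<in>{mxv u..<n}. f i)"
proof -
  have "(\<Sum>u\<in>A. \<Sum>i\<in>{mxv u..<n}. f i) = (\<Sum>(u,i)\<in>Sigma A (\<lambda>u. {mxv u..<n}). f i)"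
    by (rule sum.Sigma) (use lexseg_finite[OF A] in auto)
  also have "\<dots> = (\<Sum>w\<in>up n A. f (mxv w))"
  proof (rule sum.reindex_bij_witness[of _ "\<lambda>w. (drop_mx w, mxv w)" "\<lambda>(u,i). u + unit_expo i"])
    fix w assume w: "w \<in> up n A"
    then have wM: "w \<in> Mon n (Suc d)" using up_subset_Mon[OF lexseg_subset[OF A]] by blast
    then have "w \<noteq> 0" by (auto simp: Mon_def)
    then show "(case (drop_mx w, mxv w) of (u, i) \<Rightarrow> u + unit_expo i) = w"
      by (simp add: drop_mx_add)
    show "(drop_mx w, mxv w) \<in> Sigma A (\<lambda>u. {mxv u..<n})"
      using lexseg_drop_mx[OF A w] mxv_drop_mx[of w] mxv_less[OF Mon_exponents[OF wM] n] by simp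
  qed (auto simp: drop_mx_add_unit mxv_add_unit intro: upI)
  finally show ?thesis by simp
qed

lemma sum_atLeastLessThan_id: "m \<le> n \<Longrightarrow> (\<Sum>i\<in>{m..<n}. i) + (m choose 2) = n choose 2"
proof (induction n)
  case (Suc n)
  then show ?case by (cases "m = Suc n") (auto simp: numeral_2_eq_2)
qed (simp add: numeral_2_eq_2)

text \<open>In the Eliahou-Kervaire decomposition of \<open>up n A\<close> the monomial $u$ has
  \<open>n - mxv u\<close> multiples.\<close>

lemma card_up_lexseg:
  assumes n: "0 < n" and A: "lexseg n d A"
  shows "card (up n A) + mxsum 1 A = n * card A"
proof -
  have "card (up n A) = (\<Sum>u\<in>A. n - mxv u)" using sum_up_lexseg[OF n A, of "\<lambda>_. 1::nat"] by simp
  then have "card (up n A) + mxsum 1 A = (\<Sum>u\<in>A. (n - mxv u) + mxv u)"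
    by (simp add: mxsum_def sum.distrib)
  also have "\<dots> = (\<Sum>u\<in>A. n)"
  proof (rule sum.cong[OF refl])
    fix u assume "u \<in> A"
    then have "mxv u < n" using mxv_less lexseg_subset[OF A] Mon_exponents n by blast
    then show "n - mxv u + mxv u = n" by simp
  qed
  finally show ?thesis by simp
qed

lemma mxsum_up_lexseg:
  assumes n: "0 < n" and A: "lexseg n d A"
  shows "mxsum 1 (up n A) + mxsum 2 A = (n choose 2) * card A"
proof -
  have "mxsum 1 (up n A) + mxsum 2 A = (\<Sum>u\<in>A. (\<Sum>i\<in>{mxv u..<n}. i) + (mxv u choose 2))"
    using sum_up_lexseg[OF n A, of "\<lambda>i. i"] by (simp add: mxsum_def sum.distrib)
  also have "\<dots> = (\<Sum>u\<in>A. n choose 2)"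
  proof (rule sum.cong[OF refl])
    fix u assume "u \<in> A"
    then have "mxv u < n" using mxv_less lexseg_subset[OF A] Mon_exponents n by blast
    then show "(\<Sum>i\<in>{mxv u..<n}. i) + (mxv u choose 2) = n choose 2"
      by (intro sum_atLeastLessThan_id) simp
  qed
  finally show ?thesis by simp
qed

lemma mxv_translate: "mxv (Poly_Mapping.single 0 c + u) = mxv u"
proof (cases "u = 0")
  case True
  then show ?thesis by (cases "c = 0") (auto intro: mxv_eqI simp: mxv_def[of 0] lookup_single)
next
  case False
  show ?thesis
    using mxv_in_keys[OF False]
    by (intro mxv_eqI) (auto simp: lookup_add lookup_single when_def in_keys_iff lookup_above_mxv)
qed

lemma mxsum_translate: "mxsum p ((+) (Poly_Mapping.single 0 c) ` A) = mxsum p A"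
  unfolding mxsum_def by (subst sum.reindex) (auto intro: inj_onI simp: mxv_translate)

text \<open>If $u$ has exponent $e$ at $x_0$, a lex segment containing $u$ also contains the $d - e$ larger
  monomials $x_0^{d-c} x_1^c$ with $c < d - e$. So all elements of a short lex segment are divisible by
  a high power of $x_0$.\<close>

lemma lexseg_lookup_0:
  assumes n: "2 \<le> n" and A: "lexseg n d A" and u: "u \<in> A"
  shows "d < lookup u 0 + card A"
proof -
  have uM: "u \<in> Mon n d" using u lexseg_subset[OF A] by blast
  define f where "f c = Poly_Mapping.single 0 (d - c) + Poly_Mapping.single (Suc 0) c" for c :: nat
  let ?C = "{..<d - lookup u 0}"
  have lk: "lookup (f c) 0 = d - c" for c by (auto simp: f_def lookup_add lookup_single when_def)
  have "f c \<in> A" if "c \<in> ?C" for c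
  proof (rule lexsegD[OF A u])
    show "f c \<in> Mon n d" using n that by (auto simp: f_def Mon_def tdeg_add exponents_add single_exponents)
    have "u < f c" by (rule less_expoI[of _ 0]) (use that lk in auto)
    then show "u \<le> f c" by simp
  qed
  moreover have "u \<notin> f ` ?C" using lk by (auto dest!: arg_cong[of _ _ "\<lambda>p. lookup p 0"])
  ultimately have "insert u (f ` ?C) \<subseteq> A" using u by blast
  then have "card (insert u (f ` ?C)) \<le> card A" by (rule card_mono[OF lexseg_finite[OF A]])
  moreover have "card (insert u (f ` ?C)) = Suc (card (f ` ?C))"
    using \<open>u \<notin> f ` ?C\<close> by simp
  moreover have "inj_on f ?C"
    by (rule inj_onI, drule arg_cong[of _ _ "\<lambda>p. lookup p 0"]) (auto simp: lk)
  ultimately show ?thesis using card_image[of f ?C] lookup_le_tdeg[of u 0] by simp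
qed

lemma card_Mon_ge:
  assumes "2 \<le> n"
  shows "d < card (Mon n d)"
proof -
  let ?u = "Poly_Mapping.single (Suc 0) d :: expo"
  have "?u \<in> Mon n d" using assms by (simp add: Mon_def single_exponents)
  from lexseg_lookup_0[OF assms lexseg_Mon this] show ?thesis by (simp add: lookup_single)
qed

text \<open>Multiplication by a power of $x_0$ maps lex segments to lex segments and keeps last indices,
  so lex segments of equal size in different degrees can be compared in one degree.\<close>

lemma lexseg_mxsum_cong:
  assumes n: "0 < n" and A: "lexseg n d A" and B: "lexseg n e B" and c: "card A = card B"
  shows "mxsum p A = mxsum p B"
proof -
  have "lexseg n (e + d) ((+) (Poly_Mapping.single 0 e) ` A)"
    "lexseg n (e + d) ((+) (Poly_Mapping.single 0 d) ` B)"
    using lexseg_translate[OF n A, of e] lexseg_translate[OF n B, of d] by (simp_all add: add.commute)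
  then have "(+) (Poly_Mapping.single 0 e) ` A = (+) (Poly_Mapping.single 0 d) ` B"
    by (rule lexseg_unique) (simp add: card_translate c)
  then show ?thesis using mxsum_translate by metis
qed

text \<open>The value of \<open>mxsum p\<close> on any lex segment of size \<open>m\<close>. Degree $m$ is one in which such a
  segment exists, since for $n \ge 2$ there are more than $m$ monomials of degree $m$.\<close>

definition lexsum :: "nat \<Rightarrow> nat \<Rightarrow> nat \<Rightarrow> nat" where
  "lexsum n p m = mxsum p (SOME A. lexseg n m A \<and> card A = m)"

lemma lexsum_eq:
  assumes "2 \<le> n" "lexseg n d A"
  shows "mxsum p A = lexsum n p (card A)"
proof -
  let ?P = "\<lambda>B. lexseg n (card A) B \<and> card B = card A"
  have "\<exists>B. ?P B"
    using lexseg_exists card_Mon_ge[OF assms(1), of "card A"] by simp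
  then have "?P (SOME B. ?P B)" by (rule someI_ex)
  then show ?thesis
    unfolding lexsum_def using assms by (intro lexseg_mxsum_cong[of n d A "card A"]) auto
qed

section \<open>Spaces of polynomials and of tuples of polynomials\<close>

definition tscale :: "'k::field \<Rightarrow> ('b \<Rightarrow> 'k mpoly) \<Rightarrow> 'b \<Rightarrow> 'k mpoly" where
  "tscale c v = (\<lambda>b. pscale c (v b))"

lemma lookup_pscale [simp]: "lookup (pscale c f) p = c * lookup f p"
proof -
  have "pscale c f = Poly_Mapping.map ((*) c) f"
    unfolding pscale_def mult_map_scale_conv_mult ..
  then show ?thesis by (simp add: Poly_Mapping.map.rep_eq when_def)
qed

lemma vector_space_tscale: "vector_space (tscale :: 'k::field \<Rightarrow> ('b \<Rightarrow> 'k mpoly) \<Rightarrow> _)"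
  by unfold_locales
    (auto simp: tscale_def fun_eq_iff mpoly.scale_right_distrib mpoly.scale_left_distrib)

global_interpretation tup: vector_space "tscale :: 'k::field \<Rightarrow> ('b \<Rightarrow> 'k mpoly) \<Rightarrow> _"
  by (rule vector_space_tscale)

global_interpretation mf: vector_space_pair "pscale :: 'k::field \<Rightarrow> _" "(*) :: 'k \<Rightarrow> 'k \<Rightarrow> 'k"
  by (intro vector_space_pair.intro vector_space_field mpoly.vector_space_axioms)

global_interpretation tf: vector_space_pair "tscale :: 'k::field \<Rightarrow> ('b \<Rightarrow> 'k mpoly) \<Rightarrow> _" "(*) :: 'k \<Rightarrow> 'k \<Rightarrow> 'k"
  by (intro vector_space_pair.intro vector_space_field vector_space_tscale)

global_interpretation tt: vector_space_pair "tscale :: 'k::field \<Rightarrow> ('b \<Rightarrow> 'k mpoly) \<Rightarrow> _"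
    "tscale :: 'k::field \<Rightarrow> ('c \<Rightarrow> 'k mpoly) \<Rightarrow> _"
  by (intro vector_space_pair.intro vector_space_tscale)

global_interpretation tm: vector_space_pair "tscale :: 'k::field \<Rightarrow> ('b \<Rightarrow> 'k mpoly) \<Rightarrow> _"
    "pscale :: 'k::field \<Rightarrow> _"
  by (intro vector_space_pair.intro vector_space_tscale mpoly.vector_space_axioms)

global_interpretation mm: vector_space_pair "pscale :: 'k::field \<Rightarrow> _" "pscale :: 'k::field \<Rightarrow> _"
  by (intro vector_space_pair.intro mpoly.vector_space_axioms)

lemma span_one_field: "module.span ((*) :: 'k::field \<Rightarrow> 'k \<Rightarrow> 'k) {1} = UNIV"
proof -
  have "x \<in> module.span (*) {1}" for x :: 'k
    using mf.vs2.span_scale[OF mf.vs2.span_base[of 1 "{1}"], of x] by simp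
  then show ?thesis by blast
qed

lemma keys_pscale: "keys (pscale c f) \<subseteq> keys f"
  by (auto simp: in_keys_iff)

lemma lookup_monom_mult:
  "lookup (pmonom p * f) (p + q) = lookup f q"
proof -
  have "lookup (pmonom p * f) (p + q) = (\<Sum>l. (1 when p = l) * (\<Sum>r. lookup f r when p + q = l + r))"
    unfolding lookup_mult pmonom_def lookup_single by simp
  also have "\<dots> = (\<Sum>l. (\<Sum>r. lookup f r when p + q = l + r) when l = p)"
    by (rule arg_cong[of _ _ Sum_any]) (auto simp: when_def fun_eq_iff)
  also have "\<dots> = lookup f q" by simp
  finally show ?thesis .
qed

lemma keys_monom_mult: "keys (pmonom p * f) = (+) p ` keys f"
proof
  show "keys (pmonom p * f) \<subseteq> (+) p ` keys f"
    using keys_mult[of "pmonom p" f] by (auto simp: pmonom_def split: if_splits)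
  show "(+) p ` keys f \<subseteq> keys (pmonom p * f)"
    by (auto simp: in_keys_iff lookup_monom_mult)
qed

lemma lookup_monom_mult_eq_0: "\<forall>q. r \<noteq> p + q \<Longrightarrow> lookup (pmonom p * f) r = 0"
  using keys_monom_mult[of p f] by (metis imageE in_keys_iff)

lemma pmonom_mult: "pmonom p * pmonom q = pmonom (p + q)"
  by (simp add: pmonom_def mult_single)

lemma pmonom_0 [simp]: "pmonom 0 = 1"
  by (simp add: pmonom_def)

lemma lookup_pmonom: "lookup (pmonom p) q = (if p = q then 1 else 0)"
  by (simp add: pmonom_def lookup_single when_def)

lemma keys_pmonom [simp]: "keys (pmonom p :: 'k::field mpoly) = {p}"
  by (simp add: pmonom_def)

lemma pmonom_nonzero [simp]: "pmonom p \<noteq> (0 :: 'k::field mpoly)"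
  using keys_pmonom[of p] by (metis insert_not_empty keys_zero)

lemma pscale_mult_left: "pscale c f * g = pscale c (f * g)"
  and pscale_mult_right: "f * pscale c g = pscale c (f * g)"
  by (simp_all add: pscale_def algebra_simps)

lemma pmonom_inject: "(pmonom p :: 'k::field mpoly) = pmonom q \<longleftrightarrow> p = q"
  using keys_pmonom[of p] keys_pmonom[of q] by (metis singleton_inject)

lemma sum_fun_apply: "(\<Sum>a\<in>A. f a) b = (\<Sum>a\<in>A. f a b)"
  by (induction A rule: infinite_finite_induct) auto

lemma sum_mult_delta:
  "finite A \<Longrightarrow> (\<Sum>x\<in>A. f x * (if x = k then 1 else (0::'a::semiring_1))) = (if k \<in> A then f k else 0)"
  by (simp add: if_distrib[of "(*) _"] cong: if_cong)

lemma poly_expansion: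
  assumes "finite A" "keys f \<subseteq> A"
  shows "f = (\<Sum>p\<in>A. pscale (lookup f p) (pmonom p))"
proof (rule poly_mapping_eqI)
  fix k
  have "lookup (\<Sum>p\<in>A. pscale (lookup f p) (pmonom p)) k
      = (\<Sum>p\<in>A. lookup f p * (if p = k then 1 else 0))"
    unfolding lookup_sum lookup_pscale lookup_pmonom ..
  also have "\<dots> = (if k \<in> A then lookup f k else 0)" by (rule sum_mult_delta[OF assms(1)])
  also have "\<dots> = lookup f k"
    using assms(2) by (cases "k \<in> A") (auto simp: in_keys_iff)
  finally show "lookup f k = lookup (\<Sum>p\<in>A. pscale (lookup f p) (pmonom p)) k" ..
qed

text \<open>For infinite \<open>M\<close> this is still the span of the monomials in \<open>M\<close>, because polynomials have
  finite support; as a condition on supports it needs no linear algebra.\<close>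

definition monspan :: "expo set \<Rightarrow> 'k::field mpoly set" where
  "monspan M = {f. keys f \<subseteq> M}"

lemma monspan_iff: "f \<in> monspan M \<longleftrightarrow> keys f \<subseteq> M"
  by (simp add: monspan_def)

lemma monspan_subspace: "mpoly.subspace (monspan M :: 'k::field mpoly set)"
proof (rule mpoly.subspaceI)
  show "0 \<in> monspan M" by (simp add: monspan_def)
  show "f + g \<in> monspan M" if "f \<in> monspan M" "g \<in> monspan M" for f g :: "'k mpoly"
    using that keys_add[of f g] unfolding monspan_iff by blast
  show "pscale c f \<in> monspan M" if "f \<in> monspan M" for c and f :: "'k mpoly"
    using that keys_pscale[of c f] unfolding monspan_iff by blast
qed

lemma monspan_eq_span:
  assumes "finite M"
  shows "monspan M = mpoly.span (pmonom ` M :: 'k::field mpoly set)"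
proof
  show "mpoly.span (pmonom ` M :: 'k mpoly set) \<subseteq> monspan M"
    by (rule mpoly.span_minimal[OF _ monspan_subspace]) (auto simp: monspan_def)
  show "monspan M \<subseteq> mpoly.span (pmonom ` M :: 'k mpoly set)"
  proof
    fix f :: "'k mpoly" assume "f \<in> monspan M"
    then have f: "keys f \<subseteq> M" by (simp add: monspan_def)
    show "f \<in> mpoly.span (pmonom ` M)"
      by (subst poly_expansion[OF assms f], intro mpoly.span_sum mpoly.span_scale mpoly.span_base) auto
  qed
qed

lemma monspan_fin_dim: "finite M \<Longrightarrow> mpoly.fin_dim (monspan M)"
  using mpoly.fin_dimI[of "pmonom ` M"] monspan_eq_span by blast

lemma pmonom_independent: "mpoly.independent (pmonom ` M :: 'k::field mpoly set)"
  unfolding mpoly.independent_explicit_module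
proof (intro allI impI)
  fix T and u :: "'k mpoly \<Rightarrow> 'k" and v :: "'k mpoly"
  assume T: "finite T" "T \<subseteq> pmonom ` M" "(\<Sum>v\<in>T. pscale (u v) v) = 0" "v \<in> T"
  then obtain p where p: "v = pmonom p" by blast
  have "0 = lookup (\<Sum>v\<in>T. pscale (u v) v) p" using T(3) by simp
  also have "\<dots> = (\<Sum>w\<in>T. if w = v then u v else 0)"
    unfolding lookup_sum
  proof (rule sum.cong[OF refl])
    fix w assume "w \<in> T"
    then obtain q where "w = pmonom q" using T(2) by blast
    then show "lookup (pscale (u w) w) p = (if w = v then u v else 0)"
      by (auto simp: p lookup_pmonom pmonom_inject)
  qed
  also have "\<dots> = u v" using T by simp
  finally show "u v = 0" by simp
qed

lemma dim_monspan:
  assumes "finite M"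
  shows "mpoly.dim (monspan M :: 'k::field mpoly set) = card M"
proof -
  have "mpoly.dim (monspan M :: 'k mpoly set) = card (pmonom ` M :: 'k mpoly set)"
    unfolding monspan_eq_span[OF assms] by (rule mpoly.dim_span_eq_card_independent[OF pmonom_independent])
  also have "\<dots> = card M"
    by (rule card_image) (auto intro: inj_onI simp: pmonom_inject)
  finally show ?thesis .
qed

definition restr :: "expo set \<Rightarrow> 'k::field mpoly \<Rightarrow> 'k mpoly" where
  "restr M f = (\<Sum>p\<in>keys f \<inter> M. pscale (lookup f p) (pmonom p))"

lemma lookup_restr: "lookup (restr M f) p = (if p \<in> M then lookup f p else 0)"
proof -
  have "lookup (restr M f) p = (\<Sum>q\<in>keys f \<inter> M. lookup f q * (if q = p then 1 else 0))"
    unfolding restr_def lookup_sum lookup_pscale lookup_pmonom ..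
  also have "\<dots> = (if p \<in> keys f \<inter> M then lookup f p else 0)" by (rule sum_mult_delta) simp
  finally show ?thesis by (simp add: in_keys_iff)
qed

lemma restr_add: "restr M (f + g) = restr M f + restr M g"
  and restr_pscale: "restr M (pscale c f) = pscale c (restr M f)"
  by (rule poly_mapping_eqI, simp add: lookup_restr lookup_add)+

lemma restr_0 [simp]: "restr M 0 = 0"
  by (simp add: restr_def)

lemma keys_restr: "keys (restr M f) = keys f \<inter> M"
  by (auto simp: in_keys_iff lookup_restr split: if_splits)

lemma forms_iff: "f \<in> forms n d \<longleftrightarrow> keys f \<subseteq> Mon n d"
  unfolding forms_def poly_ring_def Mon_def by auto

lemma forms_eq_monspan: "forms n d = monspan (Mon n d)"
  by (auto simp: forms_iff monspan_iff)

lemma forms_subspace: "mpoly.subspace (forms n d)"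
  and forms_fin_dim: "mpoly.fin_dim (forms n d)"
  by (simp_all add: forms_eq_monspan monspan_subspace monspan_fin_dim)

lemma forms_mult: "f \<in> forms n c \<Longrightarrow> g \<in> forms n d \<Longrightarrow> f * g \<in> forms n (c + d)"
  unfolding forms_iff using keys_mult[of f g] Mon_add by blast

lemma pmonom_forms: "(pmonom p :: 'k::field mpoly) \<in> forms n d \<longleftrightarrow> p \<in> Mon n d"
  by (simp add: forms_iff)

section \<open>Leading monomials\<close>

definition LM :: "'k::field mpoly set \<Rightarrow> expo set" where
  "LM V = (\<lambda>f. Max (keys f)) ` (V - {0})"

text \<open>Elements with different leading monomials are independent.\<close>

lemma LM_dim:
  fixes V :: "'k::field mpoly set"
  assumes "mpoly.subspace V" "mpoly.fin_dim V"
  shows "finite (LM V)" "mpoly.dim V = card (LM V)"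
proof -
  have l: "lin_on pscale (*) V (\<lambda>f. lookup f p)" for p
    by (rule mf.lin_onI) (simp_all add: lookup_add)
  have k: "{p. lookup f p \<noteq> 0} = keys f" for f :: "'k mpoly" by (auto simp: in_keys_iff)
  have "finite {p. lookup f p \<noteq> 0} \<and> {p. lookup f p \<noteq> 0} \<noteq> {}" if "f \<noteq> 0" for f :: "'k mpoly"
    using that unfolding k by simp
  note * = mf.leading_index_dim[OF span_one_field assms(1,2) l, OF this, unfolded k, folded LM_def]
  show "finite (LM V)" "mpoly.dim V = card (LM V)" using * by blast+
qed

lemma LM_subset: "V \<subseteq> monspan M \<Longrightarrow> LM V \<subseteq> M"
proof
  fix p assume "V \<subseteq> monspan M" "p \<in> LM V"
  then obtain f where "p = Max (keys f)" "f \<in> V - {0}" unfolding LM_def by (elim imageE)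
  then have f: "f \<in> monspan M" "f \<noteq> 0" "p = Max (keys f)" using \<open>V \<subseteq> monspan M\<close> by auto
  then have "Max (keys f) \<in> keys f" by (intro Max_in) auto
  then show "p \<in> M" using f unfolding monspan_iff by blast
qed

section \<open>Spaces of relations\<close>

text \<open>Tuples \<open>v\<close> of elements of \<open>V\<close>, indexed by \<open>B\<close>, that satisfy one equation
  $\sum_b \epsilon_b x^{wt(b)} v_b = 0$ for each $\epsilon \in C$. In all equations the component
  $v_b$ has the same monomial weight $x^{wt(b)}$. This makes the equations homogeneous for the fine
  grading, which is what the comparison with leading monomials uses. With no equations one gets all
  tuples.\<close>

definition relsp ::
    "'b set \<Rightarrow> ('b \<Rightarrow> expo) \<Rightarrow> ('b \<Rightarrow> 'k) set \<Rightarrow> 'k::field mpoly set \<Rightarrow> ('b \<Rightarrow> 'k mpoly) set" where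
  "relsp B wt C V = {v. (\<forall>b\<in>B. v b \<in> V) \<and> (\<forall>b. b \<notin> B \<longrightarrow> v b = 0) \<and>
     (\<forall>\<epsilon>\<in>C. (\<Sum>b\<in>B. pscale (\<epsilon> b) (pmonom (wt b) * v b)) = 0)}"

abbreviation tuples :: "'b set \<Rightarrow> 'k::field mpoly set \<Rightarrow> ('b \<Rightarrow> 'k mpoly) set" where
  "tuples B V \<equiv> relsp B (\<lambda>_. 0) {} V"

lemma tuples_iff: "v \<in> tuples B V \<longleftrightarrow> (\<forall>b\<in>B. v b \<in> V) \<and> (\<forall>b. b \<notin> B \<longrightarrow> v b = 0)"
  by (simp add: relsp_def)

lemma relsp_subset_tuples: "relsp B wt C V \<subseteq> tuples B V"
  by (auto simp: relsp_def)

lemma relsp_mono: "V \<subseteq> W \<Longrightarrow> relsp B wt C V \<subseteq> relsp B wt C W"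
  by (auto simp: relsp_def)

lemma tuples_mono: "V \<subseteq> W \<Longrightarrow> tuples B V \<subseteq> tuples B W"
  by (rule relsp_mono)

lemma relsp_subspace:
  assumes "mpoly.subspace V"
  shows "tup.subspace (relsp B wt C V)"
proof (rule tup.subspaceI)
  show "0 \<in> relsp B wt C V" using mpoly.subspace_0[OF assms] by (simp add: relsp_def)
next
  fix x y assume xy: "x \<in> relsp B wt C V" "y \<in> relsp B wt C V"
  have "(\<Sum>b\<in>B. pscale (\<epsilon> b) (pmonom (wt b) * (x + y) b)) = 0" if "\<epsilon> \<in> C" for \<epsilon>
    using xy that
    by (simp add: relsp_def distrib_left mpoly.scale_right_distrib sum.distrib)
  then show "x + y \<in> relsp B wt C V"
    using xy mpoly.subspace_add[OF assms] by (simp add: relsp_def)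
next
  fix c x assume x: "x \<in> relsp B wt C V"
  have "(\<Sum>b\<in>B. pscale (\<epsilon> b) (pmonom (wt b) * tscale c x b)) = 0" if "\<epsilon> \<in> C" for \<epsilon>
  proof -
    have "(\<Sum>b\<in>B. pscale (\<epsilon> b) (pmonom (wt b) * tscale c x b))
      = pscale c (\<Sum>b\<in>B. pscale (\<epsilon> b) (pmonom (wt b) * x b))"
      unfolding mpoly.scale_sum_right tscale_def
      by (intro sum.cong) (simp_all add: pscale_mult_right mult.commute)
    then show ?thesis using x that by (simp add: relsp_def)
  qed
  then show "tscale c x \<in> relsp B wt C V"
    using x mpoly.subspace_scale[OF assms] by (simp add: relsp_def) (simp add: tscale_def)
qed

lemma tuples_fin_dim_dim:
  fixes B :: "'b set" and V :: "'k::field mpoly set"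
  assumes B: "finite B" and V: "mpoly.subspace V" "mpoly.fin_dim V"
  shows "tup.fin_dim (tuples B V) \<and> tup.dim (tuples B V) = card B * mpoly.dim V"
  using B
proof (induction B rule: finite_induct)
  case empty
  have "(tuples {} V :: ('b \<Rightarrow> 'k mpoly) set) = {0}" by (auto simp: tuples_iff)
  then show ?case using tup.fin_dimI[of "{}" "{0}"] by simp
next
  case (insert b B)
  note IH = conjunct1[OF insert.IH] conjunct2[OF insert.IH]
  let ?s = "\<lambda>f b'. if b' = b then f else 0"
  obtain D where D: "finite D" "D \<subseteq> V" "mpoly.independent D" "V \<subseteq> mpoly.span D" "card D = mpoly.dim V"
    by (rule mpoly.fin_dim_basis[OF V(2)])
  obtain E where E: "finite E" "tuples B V \<subseteq> tup.span E"
    using IH(1) unfolding tup.fin_dim_def by blast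
  have fd: "tup.fin_dim (tuples (insert b B) V)"
  proof (rule tup.fin_dimI)
    show "finite (?s ` D \<union> E)" using D E by simp
    show "tuples (insert b B) V \<subseteq> tup.span (?s ` D \<union> E)"
    proof
      fix v assume v: "v \<in> tuples (insert b B) V"
      have "v b \<in> mpoly.span D" using v D(4) by (auto simp: tuples_iff)
      then obtain u where u: "v b = (\<Sum>d\<in>D. pscale (u d) d)"
        using mpoly.span_finite[OF D(1)] by auto
      have "?s (v b) = (\<Sum>d\<in>D. tscale (u d) (?s d))"
        unfolding u by (rule ext) (simp add: tscale_def sum_fun_apply)
      also have "\<dots> \<in> tup.span (?s ` D \<union> E)"
        by (intro tup.span_sum tup.span_scale tup.span_base) auto
      finally have 1: "?s (v b) \<in> tup.span (?s ` D \<union> E)" .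
      have "v(b := 0) \<in> tuples B V" using v insert.hyps by (auto simp: tuples_iff)
      then have "v(b := 0) \<in> tup.span (?s ` D \<union> E)" using E(2) tup.span_mono by blast
      then have "?s (v b) + v(b := 0) \<in> tup.span (?s ` D \<union> E)" by (rule tup.span_add[OF 1])
      moreover have "?s (v b) + v(b := 0) = v" by (auto simp: fun_eq_iff)
      ultimately show "v \<in> tup.span (?s ` D \<union> E)" by simp
    qed
  qed
  have "tup.dim (tuples (insert b B) V)
      = tup.dim {v \<in> tuples (insert b B) V. v b = 0} + mpoly.dim ((\<lambda>v. v b) ` tuples (insert b B) V)"
    by (rule tm.rank_nullity(1)[OF _ relsp_subspace[OF V(1)] fd], rule tm.lin_onI)
      (simp_all add: tscale_def)
  moreover have "{v \<in> tuples (insert b B) V. v b = 0} = tuples B V"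
    using insert.hyps mpoly.subspace_0[OF V(1)] by (auto simp: tuples_iff)
  moreover have "(\<lambda>v. v b) ` tuples (insert b B) V = V"
  proof
    show "V \<subseteq> (\<lambda>v. v b) ` tuples (insert b B) V"
    proof
      fix f assume "f \<in> V"
      then have "?s f \<in> tuples (insert b B) V"
        using mpoly.subspace_0[OF V(1)] by (auto simp: tuples_iff)
      then have "?s f b \<in> (\<lambda>v. v b) ` tuples (insert b B) V" by (rule imageI)
      then show "f \<in> (\<lambda>v. v b) ` tuples (insert b B) V" by simp
    qed
  qed (auto simp: tuples_iff)
  ultimately show ?case using fd IH(2) insert.hyps by simp
qed

lemma relsp_fin_dim:
  assumes "finite B" "mpoly.fin_dim V"
  shows "tup.fin_dim (relsp B wt C V)"
proof -
  obtain D where D: "finite D" "V \<subseteq> mpoly.span D" using assms(2) unfolding mpoly.fin_dim_def by blast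
  then have "mpoly.fin_dim (mpoly.span D)" using mpoly.fin_dimI by blast
  then have "tup.fin_dim (tuples B (mpoly.span D))"
    using tuples_fin_dim_dim[OF assms(1) mpoly.subspace_span] by blast
  moreover have "relsp B wt C V \<subseteq> tuples B (mpoly.span D)"
    using relsp_subset_tuples tuples_mono[OF D(2)] by blast
  ultimately show ?thesis by (rule tup.fin_dim_subset)
qed

text \<open>Rank-nullity for \<open>\<phi>\<close> applied to every component: the hypothesis says that \<open>\<phi>\<close> maps relations
  to relations, and a relation in the kernel has all its components in the kernel of \<open>\<phi>\<close>.\<close>

lemma relsp_exact:
  assumes B: "finite B" and V: "mpoly.subspace V" "mpoly.fin_dim V"
    and lin: "lin_on pscale pscale V \<phi>"
    and compat: "\<And>v \<epsilon>. \<epsilon> \<in> C \<Longrightarrow> (\<forall>b\<in>B. v b \<in> V) \<Longrightarrow>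
      (\<Sum>b\<in>B. pscale (\<epsilon> b) (pmonom (wt b) * v b)) = 0 \<Longrightarrow>
      (\<Sum>b\<in>B. pscale (\<epsilon> b) (pmonom (wt b) * \<phi> (v b))) = 0"
  shows "tup.dim (relsp B wt C V)
    \<le> tup.dim (relsp B wt C {f \<in> V. \<phi> f = 0}) + tup.dim (relsp B wt C (\<phi> ` V))"
proof -
  let ?F = "\<lambda>v b. if b \<in> B then \<phi> (v b) else 0"
  have "tup.dim (relsp B wt C V)
      = tup.dim {v \<in> relsp B wt C V. ?F v = 0} + tup.dim (?F ` relsp B wt C V)"
  proof (rule tt.rank_nullity(1)[OF _ relsp_subspace[OF V(1)] relsp_fin_dim[OF B V(2)]])
    show "lin_on tscale tscale (relsp B wt C V) ?F"
      by (rule tt.lin_onI)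
        (auto simp: relsp_def fun_eq_iff tscale_def mm.lin_on_add[OF lin] mm.lin_on_scale[OF lin])
  qed
  also have "{v \<in> relsp B wt C V. ?F v = 0} = relsp B wt C {f \<in> V. \<phi> f = 0}"
    by (auto simp: relsp_def fun_eq_iff)
  also have "tup.dim (?F ` relsp B wt C V) \<le> tup.dim (relsp B wt C (\<phi> ` V))"
  proof (rule tup.dim_mono_fin)
    show "tup.fin_dim (relsp B wt C (\<phi> ` V))"
      by (rule relsp_fin_dim[OF B mm.rank_nullity(2)[OF lin V]])
    show "?F ` relsp B wt C V \<subseteq> relsp B wt C (\<phi> ` V)"
    proof
      fix w assume "w \<in> ?F ` relsp B wt C V"
      then obtain v where v: "v \<in> relsp B wt C V" "w = ?F v" by blast
      have "(\<Sum>b\<in>B. pscale (\<epsilon> b) (pmonom (wt b) * w b)) = 0" if "\<epsilon> \<in> C" for \<epsilon>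
        using compat[OF that, of v] v that by (simp add: relsp_def cong: sum.cong)
      then show "w \<in> relsp B wt C (\<phi> ` V)" using v by (auto simp: relsp_def)
    qed
  qed
  finally show ?thesis by simp
qed

text \<open>Deleting from every component the monomials in \<open>N\<close> is a linear map. Its kernel is the space of
  relations over \<open>M \<inter> N\<close> on the relations over \<open>M\<close>, and the space of relations over \<open>N\<close> on those over
  \<open>M \<union> N\<close>; the image of the former lies in the image of the latter.\<close>

lemma relsp_union:
  assumes B: "finite B" and M: "finite M" "finite N"
  shows "tup.dim (relsp B wt C (monspan M :: 'k::field mpoly set)) + tup.dim (relsp B wt C (monspan N :: 'k mpoly set))
    \<le> tup.dim (relsp B wt C (monspan (M \<union> N) :: 'k mpoly set))
      + tup.dim (relsp B wt C (monspan (M \<inter> N) :: 'k mpoly set))"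
proof -
  let ?K = "\<lambda>M. relsp B wt C (monspan M :: 'k mpoly set)"
  let ?F = "\<lambda>(v :: 'a \<Rightarrow> 'k mpoly) b. restr (- N) (v b)"
  have lin: "lin_on tscale tscale X ?F" for X
    by (rule tt.lin_onI) (auto simp: fun_eq_iff tscale_def restr_add restr_pscale)
  have fd: "tup.fin_dim (?K M)" if "finite M" for M by (rule relsp_fin_dim[OF B monspan_fin_dim[OF that]])
  have fdU: "tup.fin_dim (?K (M \<union> N))" using fd M by simp
  note rn = tt.rank_nullity[OF lin relsp_subspace[OF monspan_subspace] fd]
  have ker: "?F v = 0 \<longleftrightarrow> (\<forall>b. keys (v b) \<subseteq> N)" for v
    by (auto simp: fun_eq_iff keys_restr simp flip: keys_eq_empty)
  have 1: "{v \<in> ?K M. ?F v = 0} = ?K (M \<inter> N)"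
    unfolding ker by (auto simp: relsp_def monspan_def)
  have 2: "{v \<in> ?K (M \<union> N). ?F v = 0} = ?K N"
    unfolding ker by (auto simp: relsp_def monspan_def)
  have "?K M \<subseteq> ?K (M \<union> N)" by (rule relsp_mono) (auto simp: monspan_def)
  then have "tup.dim (?F ` ?K M) \<le> tup.dim (?F ` ?K (M \<union> N))"
    by (intro tup.dim_mono_fin rn(2) image_mono) (use M in auto)
  then show ?thesis
    using rn(1)[OF M(1)] rn(1)[of "M \<union> N"] M unfolding 1 2 by simp
qed

text \<open>Passing to leading monomials can only create relations. To a relation \<open>v\<close> assign the largest
  pair of a monomial \<open>w\<close> and an index \<open>b\<close> such that \<open>w\<close> occurs in $x^{wt(b)} v_b$. The part \<open>u\<close> of
  \<open>v\<close> in which only the monomial \<open>w\<close> of each $x^{wt(b)} v_b$ is kept satisfies the same equations. By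
  the choice of \<open>w\<close> its components are scalar multiples of leading monomials of elements of \<open>V\<close>, and it has the
  same largest pair. So the leading pairs for \<open>V\<close> are among those for the span of the leading monomials,
  and dimensions are numbers of leading pairs.\<close>

lemma relsp_LM:
  fixes wt :: "'b::linorder \<Rightarrow> expo" and V :: "'k::field mpoly set"
  assumes B: "finite B" and V: "mpoly.subspace V" "mpoly.fin_dim V"
  shows "tup.dim (relsp B wt C V) \<le> tup.dim (relsp B wt C (monspan (LM V) :: 'k mpoly set))"
proof -
  let ?W = "monspan (LM V) :: 'k mpoly set"
  define c :: "('b \<Rightarrow> 'k mpoly) \<Rightarrow> expo \<times> 'b \<Rightarrow> 'k"
    where "c v i = lookup (pmonom (wt (snd i)) * v (snd i)) (fst i)" for v i
  have lin: "lin_on tscale (*) X (\<lambda>v. c v i)" for X i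
    by (rule tf.lin_onI) (simp_all add: c_def tscale_def distrib_left lookup_add pscale_mult_right)
  have supp: "finite {i. c v i \<noteq> 0} \<and> {i. c v i \<noteq> 0} \<noteq> {}" if v: "v \<in> tuples B X" "v \<noteq> 0" for v X
  proof
    have "{i. c v i \<noteq> 0} \<subseteq> (\<Union>b\<in>B. keys (pmonom (wt b) * v b) \<times> {b})"
    proof
      fix i assume "i \<in> {i. c v i \<noteq> 0}"
      then have i: "lookup (pmonom (wt (snd i)) * v (snd i)) (fst i) \<noteq> 0" by (simp add: c_def)
      then have "v (snd i) \<noteq> 0" by auto
      then have "snd i \<in> B" using v(1) by (auto simp: tuples_iff)
      then show "i \<in> (\<Union>b\<in>B. keys (pmonom (wt b) * v b) \<times> {b})"
        using i by (cases i) (auto simp: in_keys_iff)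
    qed
    then show "finite {i. c v i \<noteq> 0}" by (rule finite_subset) (use B in auto)
    obtain b where b: "v b \<noteq> 0" using v(2) by (auto simp: fun_eq_iff)
    then obtain q where "q \<in> keys (v b)" by (metis all_not_in_conv keys_eq_empty)
    then have "c v (wt b + q, b) \<noteq> 0" by (simp add: c_def lookup_monom_mult in_keys_iff)
    then show "{i. c v i \<noteq> 0} \<noteq> {}" by blast
  qed
  define L where "L X = (\<lambda>v. Max {i. c v i \<noteq> 0}) ` (X - {0})" for X
  have finLM: "finite (LM V)" by (rule LM_dim(1)[OF V])
  have fdW: "mpoly.fin_dim ?W" by (rule monspan_fin_dim[OF finLM])
  have d: "finite (L (relsp B wt C X)) \<and> tup.dim (relsp B wt C X) = card (L (relsp B wt C X))"
    if "mpoly.subspace X" "mpoly.fin_dim X" for X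
  proof -
    have supp': "finite {i. c x i \<noteq> 0} \<and> {i. c x i \<noteq> 0} \<noteq> {}"
      if "x \<in> relsp B wt C X" "x \<noteq> 0" for x
      using supp[of x X] relsp_subset_tuples that by blast
    note * = tf.leading_index_dim[where c = c and X = "relsp B wt C X", OF span_one_field
      relsp_subspace[OF that(1)] relsp_fin_dim[OF B that(2)] lin supp']
    show ?thesis unfolding L_def using * by blast
  qed
  have "L (relsp B wt C V) \<subseteq> L (relsp B wt C ?W)"
  proof
    fix i assume "i \<in> L (relsp B wt C V)"
    then obtain v where v: "v \<in> relsp B wt C V" "v \<noteq> 0" and i: "i = Max {i. c v i \<noteq> 0}"
      unfolding L_def by blast
    have vt: "v \<in> tuples B V" using v(1) relsp_subset_tuples by blast
    note sv = supp[OF vt v(2)]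
    define w where "w = fst i"
    have "i \<in> {j. c v j \<noteq> 0}" unfolding i by (rule Max_in[OF conjunct1[OF sv] conjunct2[OF sv]])
    then have inz: "c v i \<noteq> 0" by simp
    have top: "c v j = 0" if "i < j" for j
    proof (rule ccontr)
      assume "c v j \<noteq> 0"
      then have "j \<le> i" unfolding i by (intro Max_ge[OF conjunct1[OF sv]]) simp
      then show False using that by simp
    qed
    define u where "u b = (if \<exists>q. w = wt b + q then
        pscale (lookup (pmonom (wt b) * v b) w) (pmonom (w - wt b)) else 0)" for b
    have mu: "pmonom (wt b) * u b = pscale (lookup (pmonom (wt b) * v b) w) (pmonom w)" for b
    proof (cases "\<exists>q. w = wt b + q")
      case True
      then obtain q where "w = wt b + q" by blast
      then show ?thesis by (simp add: u_def pscale_mult_right pmonom_mult)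
    next
      case False
      then have "lookup (pmonom (wt b) * v b) w = 0" by (intro lookup_monom_mult_eq_0) blast
      then show ?thesis using False by (simp add: u_def)
    qed
    have cu: "c u j = (if fst j = w then c v j else 0)" for j
      by (simp add: c_def mu lookup_pmonom)
    then have "c u i \<noteq> 0" using inz by (simp add: w_def)
    then have un: "u \<noteq> 0" by (auto simp: c_def)
    have "u \<in> relsp B wt C ?W"
      unfolding relsp_def mem_Collect_eq
    proof (intro conjI ballI allI impI)
      fix b assume b: "b \<in> B"
      show "u b \<in> ?W"
      proof (cases "u b = 0")
        case False
        then obtain q where q: "w = wt b + q" by (metis u_def)
        then have nz: "lookup (v b) q \<noteq> 0" using False by (auto simp: u_def lookup_monom_mult)
        then have qk: "q \<in> keys (v b)" by (simp add: in_keys_iff)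
        have "Max (keys (v b)) = q"
        proof (rule Max_eqI)
          fix r assume r: "r \<in> keys (v b)"
          show "r \<le> q"
          proof (rule ccontr)
            assume "\<not> r \<le> q"
            then have "w < wt b + r" unfolding q by simp
            then have "i < (wt b + r, b)" by (simp add: w_def less_prod_def')
            from top[OF this] show False using r by (simp add: c_def lookup_monom_mult in_keys_iff)
          qed
        qed (use qk in auto)
        moreover have "v b \<in> V - {0}" using vt b qk by (auto simp: tuples_iff)
        ultimately have "q \<in> LM V" unfolding LM_def by blast
        then show ?thesis
          using q by (auto simp: u_def monspan_iff dest: subsetD[OF keys_pscale])
      qed (simp add: monspan_iff)
    next
      fix b assume "b \<notin> B"
      then show "u b = 0" using vt by (simp add: u_def tuples_iff)
    next
      fix \<epsilon> assume e: "\<epsilon> \<in> C"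
      have "(\<Sum>b\<in>B. pscale (\<epsilon> b) (pmonom (wt b) * u b))
        = pscale (lookup (\<Sum>b\<in>B. pscale (\<epsilon> b) (pmonom (wt b) * v b)) w) (pmonom w)"
        unfolding mu lookup_sum by (simp add: mpoly.scale_sum_left)
      then show "(\<Sum>b\<in>B. pscale (\<epsilon> b) (pmonom (wt b) * u b)) = 0"
        using v(1) e by (simp add: relsp_def)
    qed
    moreover have "Max {j. c u j \<noteq> 0} = i"
    proof (rule Max_eqI)
      show "finite {j. c u j \<noteq> 0}"
        by (rule finite_subset[OF _ conjunct1[OF sv]]) (auto simp: cu)
      show "i \<in> {j. c u j \<noteq> 0}" using \<open>c u i \<noteq> 0\<close> by simp
      fix j assume "j \<in> {j. c u j \<noteq> 0}"
      then have "c v j \<noteq> 0" by (auto simp: cu split: if_splits)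
      then show "j \<le> i" using top[of j] by (meson not_le)
    qed
    ultimately show "i \<in> L (relsp B wt C ?W)" unfolding L_def using un by blast
  qed
  then show ?thesis using d[OF V] d[OF monspan_subspace fdW] card_mono by metis
qed

section \<open>Linear syzygies of a space of forms\<close>

abbreviation var :: "nat \<Rightarrow> 'k::field mpoly" where "var i \<equiv> pmonom (unit_expo i)"

lemma var_forms: "i < n \<Longrightarrow> (var i :: 'k::field mpoly) \<in> forms n 1"
  by (simp add: pmonom_forms Mon_def single_exponents)

text \<open>The tuples with $\sum_i x_i v_i = 0$, that is, the linear first syzygies.\<close>

definition K1 :: "nat \<Rightarrow> 'k::field mpoly set \<Rightarrow> (nat \<Rightarrow> 'k mpoly) set" where
  "K1 n V = relsp {..<n} unit_expo {\<lambda>_. 1} V"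

text \<open>The equations of the alternating matrices $(v_{ij})$ over \<open>V\<close> all of whose rows satisfy
  $\sum_j x_j v_{ij} = 0$. In order that every entry has a fixed weight, here $x_i x_j$, the equation
  of row $i$ is multiplied by $x_i$, and the equation $v_{ij} + v_{ji} = 0$ by $x_i x_j$.\<close>

definition K2_rel :: "nat \<Rightarrow> (nat \<times> nat \<Rightarrow> 'k::field) set" where
  "K2_rel n = {\<lambda>b. if fst b = i then 1 else 0 | i. i < n} \<union>
     {\<lambda>b. (if b = (i, j) then 1 else 0) + (if b = (j, i) then 1 else 0) | i j. i < n \<and> j < n}"

text \<open>The kernel of the Koszul differential on the second exterior power of $R_1$ tensored with
  \<open>V\<close>, that is, the linear second syzygies.\<close>

definition K2 :: "nat \<Rightarrow> 'k::field mpoly set \<Rightarrow> (nat \<times> nat \<Rightarrow> 'k mpoly) set" where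
  "K2 n V = relsp ({..<n} \<times> {..<n}) (\<lambda>b. unit_expo (fst b) + unit_expo (snd b)) (K2_rel n) V"

lemma K1_iff:
  "v \<in> K1 n V \<longleftrightarrow> (\<forall>i<n. v i \<in> V) \<and> (\<forall>i\<ge>n. v i = 0) \<and> (\<Sum>i<n. var i * v i) = 0"
  unfolding K1_def relsp_def by (simp add: not_less Ball_def)

lemma sum_pscale_delta:
  fixes f :: "'b \<Rightarrow> 'k::field mpoly"
  assumes "finite A"
  shows "(\<Sum>b\<in>A. pscale (if b = a then 1 else 0) (f b)) = (if a \<in> A then f a else 0)"
proof -
  have "(\<Sum>b\<in>A. pscale (if b = a then 1 else 0) (f b)) = (\<Sum>b\<in>A. if b = a then f b else 0)"
    by (rule sum.cong) auto
  then show ?thesis using assms by simp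
qed

lemma ball_family:
  "(\<forall>x\<in>{f i | i. P i} \<union> {g i j | i j. Q i \<and> Q' j}. R x) \<longleftrightarrow>
    (\<forall>i. P i \<longrightarrow> R (f i)) \<and> (\<forall>i. Q i \<longrightarrow> (\<forall>j. Q' j \<longrightarrow> R (g i j)))"
  by blast

lemma K2_iff:
  fixes V :: "'k::field mpoly set"
  shows "v \<in> K2 n V \<longleftrightarrow> (\<forall>i<n. \<forall>j<n. v (i,j) \<in> V) \<and> (\<forall>i j. \<not> (i < n \<and> j < n) \<longrightarrow> v (i,j) = 0) \<and>
     (\<forall>i<n. (\<Sum>j<n. var j * v (i,j)) = 0) \<and> (\<forall>i<n. \<forall>j<n. v (i,j) + v (j,i) = 0)"
proof -
  let ?wt = "\<lambda>b. unit_expo (fst b) + unit_expo (snd b)"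
  let ?B = "{..<n} \<times> {..<n}"
  have row: "(\<Sum>b\<in>?B. pscale (if fst b = i then 1 else 0) (pmonom (?wt b) * v b))
      = var i * (\<Sum>j<n. var j * v (i,j))" if "i < n" for i
  proof -
    have "(\<Sum>b\<in>?B. pscale (if fst b = i then 1 else 0) (pmonom (?wt b) * v b))
       = (\<Sum>a<n. \<Sum>j<n. pscale (if a = i then 1 else 0) (pmonom (unit_expo a + unit_expo j) * v (a,j)))"
      by (simp add: sum.cartesian_product case_prod_beta)
    also have "\<dots> = (\<Sum>a<n. pscale (if a = i then 1 else 0) (\<Sum>j<n. pmonom (unit_expo a + unit_expo j) * v (a,j)))"
      by (simp add: mpoly.scale_sum_right)
    also have "\<dots> = (\<Sum>j<n. pmonom (unit_expo i + unit_expo j) * v (i,j))"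
      using that by (simp add: sum_pscale_delta)
    also have "\<dots> = var i * (\<Sum>j<n. var j * v (i,j))"
      by (simp add: sum_distrib_left pmonom_mult[symmetric] mult.assoc)
    finally show ?thesis .
  qed
  have anti: "(\<Sum>b\<in>?B. pscale ((if b = (i, j) then 1 else 0) + (if b = (j, i) then 1 else 0)) (pmonom (?wt b) * v b))
      = var i * var j * (v (i,j) + v (j,i))" if "i < n" "j < n" for i j
  proof -
    have "(\<Sum>b\<in>?B. pscale ((if b = (i, j) then 1 else 0) + (if b = (j, i) then 1 else 0)) (pmonom (?wt b) * v b))
      = (\<Sum>b\<in>?B. pscale (if b = (i, j) then 1 else 0) (pmonom (?wt b) * v b))
        + (\<Sum>b\<in>?B. pscale (if b = (j, i) then 1 else 0) (pmonom (?wt b) * v b))"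
      unfolding mpoly.scale_left_distrib by (rule sum.distrib)
    also have "\<dots> = pmonom (unit_expo i + unit_expo j) * v (i,j) + pmonom (unit_expo j + unit_expo i) * v (j,i)"
      using that by (subst (1 2) sum_pscale_delta) auto
    finally show ?thesis by (simp add: pmonom_mult[symmetric] algebra_simps)
  qed
  have "(\<forall>\<epsilon>\<in>K2_rel n. (\<Sum>b\<in>?B. pscale (\<epsilon> b) (pmonom (?wt b) * v b)) = 0) \<longleftrightarrow>
      (\<forall>i<n. (\<Sum>b\<in>?B. pscale (if fst b = i then 1 else 0) (pmonom (?wt b) * v b)) = 0) \<and>
      (\<forall>i<n. \<forall>j<n. (\<Sum>b\<in>?B. pscale ((if b = (i, j) then 1 else 0) + (if b = (j, i) then 1 else 0)) (pmonom (?wt b) * v b)) = 0)"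
    unfolding K2_rel_def ball_family by (simp only: simp_thms)
  also have "\<dots> \<longleftrightarrow> (\<forall>i<n. (\<Sum>j<n. var j * v (i,j)) = 0) \<and> (\<forall>i<n. \<forall>j<n. v (i,j) + v (j,i) = 0)"
    by (simp add: row anti cong: conj_cong)
  finally have C: "(\<forall>\<epsilon>\<in>K2_rel n. (\<Sum>b\<in>?B. pscale (\<epsilon> b) (pmonom (?wt b) * v b)) = 0) \<longleftrightarrow>
    (\<forall>i<n. (\<Sum>j<n. var j * v (i,j)) = 0) \<and> (\<forall>i<n. \<forall>j<n. v (i,j) + v (j,i) = 0)" .
  have A: "(\<forall>b\<in>?B. v b \<in> V) \<longleftrightarrow> (\<forall>i<n. \<forall>j<n. v (i,j) \<in> V)" by auto
  have B: "(\<forall>b. b \<notin> ?B \<longrightarrow> v b = 0) \<longleftrightarrow> (\<forall>i j. \<not> (i < n \<and> j < n) \<longrightarrow> v (i,j) = 0)" by auto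
  show ?thesis unfolding K2_def relsp_def mem_Collect_eq A B C ..
qed

text \<open>The number \<open>p\<close> selects first or second syzygies, so that the bounds on both are proved at once.\<close>

definition kd :: "nat \<Rightarrow> nat \<Rightarrow> 'k::field mpoly set \<Rightarrow> nat" where
  "kd p n V = (if p = 1 then tup.dim (K1 n V) else tup.dim (K2 n V))"

lemma K1_subspace: "mpoly.subspace V \<Longrightarrow> tup.subspace (K1 n V)"
  and K2_subspace: "mpoly.subspace V \<Longrightarrow> tup.subspace (K2 n V)"
  and K1_fin_dim: "mpoly.fin_dim V \<Longrightarrow> tup.fin_dim (K1 n V)"
  and K2_fin_dim: "mpoly.fin_dim V \<Longrightarrow> tup.fin_dim (K2 n V)"
  unfolding K1_def K2_def by (simp_all add: relsp_subspace relsp_fin_dim)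

lemma kd_LM:
  fixes V :: "'k::field mpoly set"
  assumes "mpoly.subspace V" "mpoly.fin_dim V"
  shows "kd p n V \<le> kd p n (monspan (LM V) :: 'k mpoly set)"
  unfolding kd_def K1_def K2_def by (cases "p = 1") (simp_all add: relsp_LM[OF _ assms])

lemma kd_union:
  assumes "finite M" "finite N"
  shows "kd p n (monspan M :: 'k::field mpoly set) + kd p n (monspan N :: 'k mpoly set)
    \<le> kd p n (monspan (M \<union> N) :: 'k mpoly set) + kd p n (monspan (M \<inter> N) :: 'k mpoly set)"
  unfolding kd_def K1_def K2_def by (cases "p = 1") (simp_all add: relsp_union[OF _ assms])

text \<open>The condition on \<open>\<phi>\<close> is stated for quadratic coefficients because both kinds of syzygies are of
  this form: the equations of \<open>K2\<close> have weights $x_i x_j$, and a linear relation can be multiplied by a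
  variable.\<close>

lemma kd_exact:
  assumes V: "mpoly.subspace V" "mpoly.fin_dim V"
    and lin: "lin_on pscale pscale V \<phi>"
    and compat: "\<And>(B :: (nat \<times> nat) set) c v. finite B \<Longrightarrow> (\<And>b. b \<in> B \<Longrightarrow> v b \<in> V) \<Longrightarrow>
      (\<And>b. b \<in> B \<Longrightarrow> c b \<in> forms n 2) \<Longrightarrow>
      (\<Sum>b\<in>B. c b * v b) = 0 \<Longrightarrow> (\<Sum>b\<in>B. c b * \<phi> (v b)) = 0"
  shows "kd p n V \<le> kd p n {f \<in> V. \<phi> f = 0} + kd p n (\<phi> ` V)"
proof (cases "p = 1")
  case True
  have "tup.dim (K1 n V) \<le> tup.dim (K1 n {f \<in> V. \<phi> f = 0}) + tup.dim (K1 n (\<phi> ` V))"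
    unfolding K1_def
  proof (rule relsp_exact[OF _ V lin])
    fix v :: "nat \<Rightarrow> 'a mpoly" and \<epsilon> :: "nat \<Rightarrow> 'a"
    assume e: "\<epsilon> \<in> {\<lambda>_. 1}" and v: "\<forall>b\<in>{..<n}. v b \<in> V"
      and s: "(\<Sum>b\<in>{..<n}. pscale (\<epsilon> b) (pmonom (unit_expo b) * v b)) = 0"
    let ?B = "(\<lambda>i. (0::nat,i)) ` {..<n}"
    have inj: "inj_on (\<lambda>i. (0::nat,i)) {..<n}" by (rule inj_onI) simp
    have s': "(\<Sum>b\<in>{..<n}. var b * v b) = 0" using s e by simp
    have "(\<Sum>b\<in>{..<n}. var b * \<phi> (v b)) = 0"
    proof (cases "n = 0")
      case False
      then have n: "0 < n" by simp
      have fm: "var 0 * var i \<in> (forms n 2 :: 'a mpoly set)" if "i < n" for i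
        using forms_mult[OF var_forms[OF n] var_forms[OF that]] by (simp add: numeral_2_eq_2)
      have "(\<Sum>b\<in>?B. (var 0 * var (snd b)) * v (snd b)) = var 0 * (\<Sum>b\<in>{..<n}. var b * v b)"
        by (simp add: sum.reindex[OF inj] sum_distrib_left mult.assoc)
      then have "(\<Sum>b\<in>?B. (var 0 * var (snd b)) * v (snd b)) = 0" using s' by simp
      then have "(\<Sum>b\<in>?B. (var 0 * var (snd b)) * \<phi> (v (snd b))) = 0"
        by (rule compat[rotated 3])
          (use v fm in auto)
      also have "(\<Sum>b\<in>?B. (var 0 * var (snd b)) * \<phi> (v (snd b))) = var 0 * (\<Sum>b\<in>{..<n}. var b * \<phi> (v b))"
        by (simp add: sum.reindex[OF inj] sum_distrib_left mult.assoc)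
      finally show ?thesis by simp
    qed simp
    then show "(\<Sum>b\<in>{..<n}. pscale (\<epsilon> b) (pmonom (unit_expo b) * \<phi> (v b))) = 0" using e by simp
  qed simp
  then show ?thesis using True by (simp add: kd_def)
next
  case False
  have "tup.dim (K2 n V) \<le> tup.dim (K2 n {f \<in> V. \<phi> f = 0}) + tup.dim (K2 n (\<phi> ` V))"
    unfolding K2_def
  proof (rule relsp_exact[OF _ V lin])
    fix v :: "nat \<times> nat \<Rightarrow> 'a mpoly" and \<epsilon> :: "nat \<times> nat \<Rightarrow> 'a"
    let ?B = "{..<n} \<times> {..<n}" and ?m = "\<lambda>b. pmonom (unit_expo (fst b) + unit_expo (snd b)) :: 'a mpoly"
    assume v: "\<forall>b\<in>?B. v b \<in> V" and s: "(\<Sum>b\<in>?B. pscale (\<epsilon> b) (?m b * v b)) = 0"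
    have "(\<Sum>b\<in>?B. pscale (\<epsilon> b) (?m b) * \<phi> (v b)) = 0"
    proof (rule compat)
      fix b assume "b \<in> ?B"
      then have "?m b \<in> forms n 2"
        unfolding pmonom_forms using Mon_add_unit[of "unit_expo (fst b)" n 1 "snd b"]
        by (auto simp: Mon_def single_exponents numeral_2_eq_2)
      then show "pscale (\<epsilon> b) (?m b) \<in> forms n 2" by (rule mpoly.subspace_scale[OF forms_subspace])
    qed (use v s in \<open>auto simp: pscale_mult_left\<close>)
    then show "(\<Sum>b\<in>?B. pscale (\<epsilon> b) (?m b * \<phi> (v b))) = 0" by (simp add: pscale_mult_left)
  qed simp
  then show ?thesis using False by (simp add: kd_def)
qed

definition R1 :: "nat \<Rightarrow> 'k::field mpoly set \<Rightarrow> 'k mpoly set" where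
  "R1 n V = (\<lambda>v. \<Sum>i<n. var i * v i) ` tuples {..<n} V"

lemma lin_on_R1: "lin_on tscale pscale X (\<lambda>v. \<Sum>i<n. var i * v i)"
  by (rule tm.lin_onI)
    (simp_all add: distrib_left sum.distrib tscale_def pscale_mult_right mpoly.scale_sum_right)

lemma R1_subspace: "mpoly.subspace V \<Longrightarrow> mpoly.subspace (R1 n V)"
  unfolding R1_def by (rule tm.lin_on_subspace_image[OF lin_on_R1 relsp_subspace])

lemma R1_fin_dim: "mpoly.subspace V \<Longrightarrow> mpoly.fin_dim V \<Longrightarrow> mpoly.fin_dim (R1 n V)"
  unfolding R1_def
  by (rule tm.rank_nullity(2)[OF lin_on_R1 relsp_subspace relsp_fin_dim]) simp_all

lemma R1I: "(\<And>i. i < n \<Longrightarrow> v i \<in> V) \<Longrightarrow> (\<Sum>i<n. var i * v i) \<in> R1 n V"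
proof -
  assume v: "\<And>i. i < n \<Longrightarrow> v i \<in> V"
  let ?v = "\<lambda>i. if i < n then v i else 0"
  have "?v \<in> tuples {..<n} V" using v by (simp add: tuples_iff)
  then have "(\<Sum>i<n. var i * ?v i) \<in> R1 n V" unfolding R1_def by (rule imageI)
  then show ?thesis by simp
qed

lemma R1E:
  assumes "f \<in> R1 n V"
  obtains v where "\<And>i. i < n \<Longrightarrow> v i \<in> V" "f = (\<Sum>i<n. var i * v i)"
proof -
  from assms obtain v where v: "v \<in> tuples {..<n} V" "f = (\<Sum>i<n. var i * v i)"
    unfolding R1_def by blast
  have "v i \<in> V" if "i < n" for i using v(1) that by (simp add: tuples_iff)
  then show ?thesis using v(2) by (rule that)
qed

lemma R1_var: "mpoly.subspace V \<Longrightarrow> f \<in> V \<Longrightarrow> i < n \<Longrightarrow> var i * f \<in> R1 n V"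
proof -
  assume a: "mpoly.subspace V" "f \<in> V" "i < n"
  have "(\<Sum>k<n. var k * (if k = i then f else 0)) \<in> R1 n V"
    by (rule R1I) (use a mpoly.subspace_0 in auto)
  moreover have "(\<Sum>k<n. var k * (if k = i then f else 0)) = var i * f"
    using a(3) by (simp add: if_distrib[of "(*) _"] cong: if_cong)
  ultimately show ?thesis by simp
qed

lemma R1_mono: "V \<subseteq> W \<Longrightarrow> R1 n V \<subseteq> R1 n W"
  unfolding R1_def by (rule image_mono, rule tuples_mono)

lemma R1_subsetI:
  assumes "mpoly.subspace W" "\<And>i f. i < n \<Longrightarrow> f \<in> V \<Longrightarrow> var i * f \<in> W"
  shows "R1 n V \<subseteq> W"
  using assms by (auto elim!: R1E intro!: mpoly.subspace_sum)

lemma R1_monspan: "R1 n (monspan M :: 'k::field mpoly set) = monspan (up n M)"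
proof
  show "R1 n (monspan M :: 'k mpoly set) \<subseteq> monspan (up n M)"
  proof (rule R1_subsetI[OF monspan_subspace])
    fix i and f :: "'k mpoly" assume i: "i < n" and f: "f \<in> monspan M"
    show "var i * f \<in> monspan (up n M)"
      unfolding monspan_iff keys_monom_mult
    proof
      fix p assume "p \<in> (+) (unit_expo i) ` keys f"
      then obtain q where "q \<in> M" "p = q + unit_expo i"
        using f unfolding monspan_iff by (auto simp: add.commute)
      then show "p \<in> up n M" using upI i by simp
    qed
  qed
  show "monspan (up n M) \<subseteq> R1 n (monspan M :: 'k mpoly set)"
  proof
    fix f :: "'k mpoly" assume f: "f \<in> monspan (up n M)"
    have "pmonom p \<in> R1 n (monspan M :: 'k mpoly set)" if "p \<in> keys f" for p
    proof -
      have "p \<in> up n M" using f that unfolding monspan_iff by blast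
      then obtain q i where q: "q \<in> M" "i < n" "p = q + unit_expo i" by (rule upE)
      have "var i * pmonom q \<in> R1 n (monspan M :: 'k mpoly set)"
        by (rule R1_var[OF monspan_subspace]) (use q in \<open>auto simp: monspan_iff\<close>)
      then show ?thesis using q(3) by (simp add: pmonom_mult add.commute)
    qed
    then show "f \<in> R1 n (monspan M)"
      by (subst poly_expansion[of "keys f" f])
        (auto intro!: mpoly.subspace_sum mpoly.subspace_scale R1_subspace monspan_subspace)
  qed
qed

text \<open>Rank-nullity for $(v_i) \mapsto \sum_i x_i v_i$, whose image is $R_1 V$.\<close>

lemma kd_1_R1:
  assumes "mpoly.subspace V" "mpoly.fin_dim V"
  shows "kd 1 n V + mpoly.dim (R1 n V) = n * mpoly.dim V"
proof -
  have "tup.dim (tuples {..<n} V) = tup.dim {v \<in> tuples {..<n} V. (\<Sum>i<n. var i * v i) = 0} + mpoly.dim (R1 n V)"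
    unfolding R1_def by (rule tm.rank_nullity(1)[OF lin_on_R1 relsp_subspace relsp_fin_dim]) (use assms in auto)
  moreover have "{v \<in> tuples {..<n} V. (\<Sum>i<n. var i * v i) = 0} = K1 n V"
    by (auto simp: K1_iff tuples_iff not_less)
  moreover have "tup.dim (tuples {..<n} V) = n * mpoly.dim V"
    using tuples_fin_dim_dim[of "{..<n}" V] assms by simp
  ultimately show ?thesis by (simp add: kd_def)
qed

lemma kd_1_monspan:
  assumes "finite M"
  shows "kd 1 n (monspan M :: 'k::field mpoly set) + card (up n M) = n * card M"
  using kd_1_R1[OF monspan_subspace monspan_fin_dim[OF assms], of n]
  by (simp add: R1_monspan dim_monspan assms finite_up)

lemma double_eq_0:
  fixes f :: "'k::field_char_0 mpoly"
  assumes "f + f = 0"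
  shows "f = 0"
proof (rule poly_mapping_eqI)
  fix p
  have "lookup f p + lookup f p = 0" using assms lookup_add[of f f p] by (metis lookup_zero)
  then show "lookup f p = lookup 0 p" by simp
qed

lemma card_pairs_less: "card {(i,j). i < j \<and> j < n} = n choose 2"
proof -
  have "{(i,j). i < j \<and> j < n} = prod.swap ` Sigma {..<n} (\<lambda>j. {..<j})" by (auto simp: image_iff)
  then have "card {(i,j). i < j \<and> j < n} = card (Sigma {..<n} (\<lambda>j. {..<j}))"
    by (simp add: card_image)
  also have "\<dots> = (\<Sum>j<n. j)" by simp
  also have "\<dots> = n choose 2" using sum_atLeastLessThan_id[of 0 n] by (simp add: atLeast0LessThan numeral_2_eq_2)
  finally show ?thesis .
qed

lemma finite_pairs_less: "finite {(i,j). i < j \<and> j < (n::nat)}"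
  by (rule finite_subset[of _ "{..<n} \<times> {..<n}"]) auto

text \<open>An alternating matrix over \<open>V\<close> is determined by its entries above the diagonal. Its vector of
  row sums $\sum_j x_j v_{ij}$ is a linear syzygy over $R_1 V$, because $\sum_{i,j} x_i x_j v_{ij} = 0$,
  and the row sums vanish exactly for the elements of \<open>K2\<close>. Characteristic zero enters through
  $2 f = 0 \Rightarrow f = 0$.\<close>

lemma kd_2_R1:
  fixes V :: "'k::field_char_0 mpoly set"
  assumes V: "mpoly.subspace V" "mpoly.fin_dim V"
  shows "(n choose 2) * mpoly.dim V \<le> kd 2 n V + kd 1 n (R1 n V)"
proof -
  let ?P = "{(i,j). i < j \<and> j < n}"
  define a :: "(nat \<times> nat \<Rightarrow> 'k mpoly) \<Rightarrow> nat \<times> nat \<Rightarrow> 'k mpoly"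
    where "a v = (\<lambda>(i,j). if i < j \<and> j < n then v (i,j) else if j < i \<and> i < n then - v (j,i) else 0)" for v
  define F where "F v i = (if i < n then \<Sum>j<n. var j * a v (i,j) else 0)" for v i
  have a_add: "a (v + w) = a v + a w" for v w by (auto simp: a_def fun_eq_iff)
  have a_scale: "a (tscale c v) = tscale c (a v)" for c v by (auto simp: a_def fun_eq_iff tscale_def)
  have linF: "lin_on tscale tscale X F" for X
    by (rule tt.lin_onI)
      (auto simp: F_def a_add a_scale[unfolded tscale_def] fun_eq_iff distrib_left sum.distrib tscale_def pscale_mult_right
        mpoly.scale_sum_right)
  have lina: "lin_on tscale tscale X a" for X
    by (rule tt.lin_onI) (simp_all add: a_add a_scale)
  have aV: "a v (i,j) \<in> V" if "v \<in> tuples ?P V" for v i j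
    using that mpoly.subspace_0[OF V(1)] mpoly.subspace_neg[OF V(1)] by (auto simp: a_def tuples_iff)
  have anti: "a v (i,j) + a v (j,i) = 0" for v i j by (auto simp: a_def)
  have out: "a v (i,j) = 0" if "\<not> (i < n \<and> j < n)" for v i j using that by (auto simp: a_def)
  have sub: "tup.subspace (tuples ?P V)" by (rule relsp_subspace[OF V(1)])
  have fd: "tup.fin_dim (tuples ?P V)" by (rule relsp_fin_dim[OF finite_pairs_less V(2)])
  have "tup.dim (tuples ?P V) = tup.dim {v \<in> tuples ?P V. F v = 0} + tup.dim (F ` tuples ?P V)"
    by (rule tt.rank_nullity(1)[OF linF sub fd])
  moreover have "tup.dim (tuples ?P V) = (n choose 2) * mpoly.dim V"
    using tuples_fin_dim_dim[OF finite_pairs_less V] by (simp add: card_pairs_less)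
  moreover have "tup.dim (F ` tuples ?P V) \<le> tup.dim (K1 n (R1 n V))"
  proof (rule tup.dim_mono_fin[OF K1_fin_dim[OF R1_fin_dim[OF V]]])
    show "F ` tuples ?P V \<subseteq> K1 n (R1 n V)"
    proof
      fix w assume "w \<in> F ` tuples ?P V"
      then obtain v where v: "v \<in> tuples ?P V" "w = F v" by blast
      let ?S = "\<Sum>i<n. \<Sum>j<n. var i * var j * a v (i,j)"
      have "?S + ?S = ?S + (\<Sum>i<n. \<Sum>j<n. var j * var i * a v (j,i))"
        by (subst (2) sum.swap) simp
      also have "\<dots> = (\<Sum>i<n. \<Sum>j<n. var i * var j * (a v (i,j) + a v (j,i)))"
        unfolding sum.distrib[symmetric] by (intro sum.cong refl) (simp add: algebra_simps)
      also have "\<dots> = 0" unfolding anti by simp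
      finally have S: "?S = 0" by (rule double_eq_0)
      have "(\<Sum>i<n. var i * w i) = ?S"
        unfolding v(2) F_def by (intro sum.cong refl) (simp add: sum_distrib_left mult.assoc)
      moreover have "w i \<in> R1 n V" if "i < n" for i
        unfolding v(2) F_def using that aV[OF v(1)] by (simp add: R1I)
      ultimately show "w \<in> K1 n (R1 n V)"
        unfolding K1_iff using S by (simp add: v(2) F_def)
    qed
  qed
  moreover have "tup.dim {v \<in> tuples ?P V. F v = 0} \<le> tup.dim (K2 n V)"
  proof (rule tt.dim_le_inj[OF lina])
    show "tup.subspace {v \<in> tuples ?P V. F v = 0}" by (rule tt.lin_on_subspace_kernel[OF linF sub])
    show "tup.fin_dim {v \<in> tuples ?P V. F v = 0}" by (rule tup.fin_dim_subset[OF fd]) auto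
    show "tup.fin_dim (K2 n V)" by (rule K2_fin_dim[OF V(2)])
    show "v = 0" if "v \<in> {v \<in> tuples ?P V. F v = 0}" and z: "a v = 0" for v
    proof
      fix b :: "nat \<times> nat"
      show "v b = 0 b"
      proof (cases b)
        case (Pair i j)
        then show ?thesis
          using that(1) fun_cong[OF z, of "(i,j)"] by (cases "b \<in> ?P") (auto simp: tuples_iff a_def)
      qed
    qed
    show "a ` {v \<in> tuples ?P V. F v = 0} \<subseteq> K2 n V"
    proof
      fix w assume "w \<in> a ` {v \<in> tuples ?P V. F v = 0}"
      then obtain v where v: "v \<in> tuples ?P V" "F v = 0" "w = a v" by blast
      have "(\<Sum>j<n. var j * a v (i,j)) = 0" if "i < n" for i
        using fun_cong[OF v(2), of i] that by (simp add: F_def)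
      then show "w \<in> K2 n V"
        unfolding K2_iff v(3) using aV[OF v(1)] anti out by blast
    qed
  qed
  ultimately show ?thesis by (simp add: kd_def)
qed

text \<open>The inequality that drives persistence: few second syzygies of \<open>V\<close> force many first syzygies of
  $R_1 V$, hence slow growth from $R_1 V$ to $R_1 R_1 V$.\<close>

lemma R2_bound:
  fixes V :: "'k::field_char_0 mpoly set"
  assumes "mpoly.subspace V" "mpoly.fin_dim V"
  shows "mpoly.dim (R1 n (R1 n V)) + (n choose 2) * mpoly.dim V \<le> n * mpoly.dim (R1 n V) + kd 2 n V"
proof -
  have "kd 1 n (R1 n V) + mpoly.dim (R1 n (R1 n V)) = n * mpoly.dim (R1 n V)"
    by (rule kd_1_R1[OF R1_subspace[OF assms(1)] R1_fin_dim[OF assms]])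
  then show ?thesis using kd_2_R1[OF assms, of n] by linarith
qed

lemma kd_zero_vars: "mpoly.subspace V \<Longrightarrow> kd p 0 V = 0"
proof -
  assume V: "mpoly.subspace V"
  have "K1 0 V = {0}" "K2 0 V = {0}" by (auto simp: K1_iff K2_iff fun_eq_iff)
  then show ?thesis by (simp add: kd_def)
qed

section \<open>Restriction to a hyperplane\<close>

lemma lookup_var_mult:
  fixes f :: "'k::field mpoly"
  assumes "\<And>u. u \<in> keys f \<Longrightarrow> lookup u m = 0" "i \<noteq> m"
  shows "lookup (var i * f) (unit_expo m + q) = 0"
proof (rule ccontr)
  assume "lookup (var i * f) (unit_expo m + q) \<noteq> 0"
  then have "unit_expo m + q \<in> (+) (unit_expo i) ` keys f" unfolding keys_monom_mult[symmetric] in_keys_iff .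
  then obtain u where u: "u \<in> keys f" "unit_expo m + q = unit_expo i + u" by blast
  have "lookup (unit_expo m + q) m = lookup (unit_expo i + u) m" using u(2) by simp
  then show False using assms(1)[OF u(1)] assms(2) by (simp add: lookup_add lookup_single)
qed

text \<open>All terms but the last are free of $x_m$, and the last is divisible by $x_m$.\<close>

lemma last_coordinate_zero:
  fixes v :: "nat \<Rightarrow> 'k::field mpoly"
  assumes s: "(\<Sum>i<Suc m. var i * v i) = 0" and z: "\<And>i u. i < m \<Longrightarrow> u \<in> keys (v i) \<Longrightarrow> lookup u m = 0"
  shows "v m = 0"
proof (rule poly_mapping_eqI)
  fix q
  have "0 = lookup (\<Sum>i<Suc m. var i * v i) (unit_expo m + q)" using s by simp
  also have "\<dots> = (\<Sum>i<m. lookup (var i * v i) (unit_expo m + q)) + lookup (v m) q"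
    by (simp add: lookup_add lookup_sum lookup_monom_mult)
  also have "(\<Sum>i<m. lookup (var i * v i) (unit_expo m + q)) = 0"
    by (rule sum.neutral, rule ballI, rule lookup_var_mult) (use z in auto)
  finally show "lookup (v m) q = lookup 0 q" by simp
qed

lemma lin_on_coeff: "lin_on tscale (*) X (\<lambda>v. lookup (v b) u)"
  by (rule tf.lin_onI) (simp_all add: tscale_def lookup_add)

text \<open>Requiring the entries with indices below \<open>m\<close> to have no monomials divisible by $x_m$ costs one
  linear condition for each such monomial of \<open>M\<close> and each entry, respectively each pair \<open>i < j\<close> of indices
  below \<open>m\<close>. What remains is a syzygy in \<open>m\<close> variables, since the entries with index \<open>m\<close> are then forced
  to vanish.\<close>

lemma kd_hyperplane:
  fixes M :: "expo set" and m :: nat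
  assumes M: "finite M" and p: "p = 1 \<or> p = 2"
  defines "M0 \<equiv> {u \<in> M. lookup u m = 0}"
  shows "kd p (Suc m) (monspan M :: 'k::field_char_0 mpoly set)
    \<le> (m choose p) * card (M - M0) + kd p m (monspan M0 :: 'k mpoly set)"
proof -
  let ?V = "monspan M :: 'k mpoly set" and ?W = "monspan M0 :: 'k mpoly set"
  have fd: "mpoly.fin_dim ?V" and fd0: "mpoly.fin_dim ?W"
    by (rule monspan_fin_dim, use M in \<open>simp add: M0_def\<close>)+
  have V0I: "f \<in> ?W" if "f \<in> ?V" "\<forall>u\<in>M - M0. lookup f u = 0" for f
    using that by (auto simp: monspan_iff in_keys_iff)
  have V0z: "lookup u m = 0" if "f \<in> ?W" "u \<in> keys f" for f u
    using that unfolding monspan_iff M0_def by blast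
  show ?thesis
  proof (cases "p = 1")
    case True
    let ?L = "{..<m} \<times> (M - M0)" and ?c = "\<lambda>(v :: nat \<Rightarrow> 'k mpoly) x. lookup (v (fst x)) (snd x)"
    have "tup.dim (K1 (Suc m) ?V) \<le> card ?L + tup.dim {v \<in> K1 (Suc m) ?V. \<forall>x\<in>?L. ?c v x = 0}"
    proof (rule tf.dim_le_functionals[OF span_one_field _ K1_subspace[OF monspan_subspace] K1_fin_dim[OF fd]])
      show "finite ?L" using M by simp
      show "lin_on tscale (*) (K1 (Suc m) ?V) (\<lambda>v. ?c v x)" for x by (rule lin_on_coeff)
    qed
    also have "tup.dim {v \<in> K1 (Suc m) ?V. \<forall>x\<in>?L. ?c v x = 0} \<le> tup.dim (K1 m ?W)"
    proof (rule tup.dim_mono_fin[OF K1_fin_dim[OF fd0]], rule subsetI)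
      fix v assume a: "v \<in> {v \<in> K1 (Suc m) ?V. \<forall>x\<in>?L. ?c v x = 0}"
      note v = conjunct1[OF a[unfolded mem_Collect_eq]] and az = conjunct2[OF a[unfolded mem_Collect_eq]]
      have z: "lookup (v i) u = 0" if "i < m" "u \<in> M - M0" for i u
      proof -
        have "(i,u) \<in> ?L" using that by (intro SigmaI) simp_all
        from az[rule_format, OF this] show ?thesis unfolding fst_conv snd_conv .
      qed
      have inV: "v i \<in> ?V" if "i < Suc m" for i using v that unfolding K1_iff by blast
      have v0: "v i \<in> ?W" if "i < m" for i
        using that z by (intro V0I inV) simp_all
      have vm: "v m = 0"
      proof (rule last_coordinate_zero)
        show "(\<Sum>i<Suc m. var i * v i) = 0" using v unfolding K1_iff by blast
      qed (use V0z[OF v0] in blast)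
      have "v i = 0" if "m \<le> i" for i
      proof (cases "i = m")
        case False
        then have "Suc m \<le> i" using that by simp
        then show ?thesis using v unfolding K1_iff by blast
      qed (simp add: vm)
      moreover have "(\<Sum>i<m. var i * v i) = 0" using v vm unfolding K1_iff by simp
      ultimately show "v \<in> K1 m ?W" using v0 unfolding K1_iff by blast
    qed
    finally show ?thesis using True M by (simp add: kd_def)
  next
    case False
    let ?P = "{(i,j). i < j \<and> j < m}"
    let ?L = "?P \<times> (M - M0)" and ?c = "\<lambda>(v :: nat \<times> nat \<Rightarrow> 'k mpoly) x. lookup (v (fst x)) (snd x)"
    have "tup.dim (K2 (Suc m) ?V) \<le> card ?L + tup.dim {v \<in> K2 (Suc m) ?V. \<forall>x\<in>?L. ?c v x = 0}"
    proof (rule tf.dim_le_functionals[OF span_one_field _ K2_subspace[OF monspan_subspace] K2_fin_dim[OF fd]])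
      show "finite ?L" using M finite_pairs_less by simp
      show "lin_on tscale (*) (K2 (Suc m) ?V) (\<lambda>v. ?c v x)" for x by (rule lin_on_coeff)
    qed
    also have "tup.dim {v \<in> K2 (Suc m) ?V. \<forall>x\<in>?L. ?c v x = 0} \<le> tup.dim (K2 m ?W)"
    proof (rule tup.dim_mono_fin[OF K2_fin_dim[OF fd0]], rule subsetI)
      fix v assume a: "v \<in> {v \<in> K2 (Suc m) ?V. \<forall>x\<in>?L. ?c v x = 0}"
      note v = conjunct1[OF a[unfolded mem_Collect_eq]] and az = conjunct2[OF a[unfolded mem_Collect_eq]]
      have z: "lookup (v (i,j)) u = 0" if "i < j" "j < m" "u \<in> M - M0" for i j u
      proof -
        have "((i,j),u) \<in> ?L" using that by (intro SigmaI) simp_all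
        from az[rule_format, OF this] show ?thesis unfolding fst_conv snd_conv .
      qed
      have anti: "v (i,j) + v (j,i) = 0" for i j
      proof (cases "i < Suc m \<and> j < Suc m")
        case True
        then show ?thesis using v unfolding K2_iff by blast
      next
        case False
        then have "v (i,j) = 0" "v (j,i) = 0" using v unfolding K2_iff by blast+
        then show ?thesis by simp
      qed
      have neg: "v (j,i) = - v (i,j)" for i j using anti[of i j] by (simp add: eq_neg_iff_add_eq_0 add.commute)
      have row: "(\<Sum>j<Suc m. var j * v (i,j)) = 0" if "i < Suc m" for i
        using v that unfolding K2_iff by blast
      have inV: "v (i,j) \<in> ?V" if "i < Suc m" "j < Suc m" for i j using v that unfolding K2_iff by blast
      have out: "v (i,j) = 0" if "\<not> (i < Suc m \<and> j < Suc m)" for i j using v that unfolding K2_iff by blast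
      have v00: "v (i,j) \<in> ?W" if "i < j" "j < m" for i j
        using that z by (intro V0I inV) simp_all
      have v0: "v (i,j) \<in> ?W" if "i < m" "j < m" for i j
      proof (cases i j rule: linorder_cases)
        case less
        then show ?thesis using v00 that by blast
      next
        case equal
        then have "v (i,j) = 0" using double_eq_0 anti[of i i] by blast
        then show ?thesis by (simp add: mpoly.subspace_0[OF monspan_subspace])
      next
        case greater
        then have "v (j,i) \<in> ?W" using v00 that by blast
        then have "- v (j,i) \<in> ?W" by (rule mpoly.subspace_neg[OF monspan_subspace])
        then show ?thesis unfolding neg[of i j] .
      qed
      have vm: "v (i,m) = 0" if "i < m" for i
      proof (rule last_coordinate_zero[where m = m and v = "\<lambda>j. v (i,j)"])
        show "(\<Sum>j<Suc m. var j * v (i,j)) = 0" using row that by simp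
      qed (use V0z[OF v0[OF that]] in blast)
      have vmm: "v (i,j) = 0" if h: "\<not> (i < m \<and> j < m)" for i j
      proof (cases "i < Suc m \<and> j < Suc m")
        case True
        then consider "i = m" "j = m" | "i < m" "j = m" | "i = m" "j < m" using h by linarith
        then show ?thesis
        proof cases
          case 1 then show ?thesis using double_eq_0 anti[of m m] by blast
        next
          case 2 then show ?thesis using vm by blast
        next
          case 3 then show ?thesis using vm[of j] neg[of j m] by simp
        qed
      qed (use out in blast)
      have "(\<Sum>j<m. var j * v (i,j)) = 0" if "i < m" for i
        using row[of i] vm[OF that] that by simp
      then show "v \<in> K2 m ?W" unfolding K2_iff using v0 vmm anti by blast
    qed
    finally show ?thesis using False p M by (simp add: kd_def card_cartesian_product card_pairs_less)
  qed
qed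

section \<open>A change of coordinates\<close>

text \<open>The linear map with prescribed values \<open>\<phi> p\<close> at the monomials; substitutions are of this form.\<close>

definition linext :: "(expo \<Rightarrow> 'k::field mpoly) \<Rightarrow> 'k mpoly \<Rightarrow> 'k mpoly" where
  "linext \<phi> f = (\<Sum>p\<in>keys f. pscale (lookup f p) (\<phi> p))"

lemma linext_superset:
  assumes "finite A" "keys f \<subseteq> A"
  shows "linext \<phi> f = (\<Sum>p\<in>A. pscale (lookup f p) (\<phi> p))"
  unfolding linext_def by (rule sum.mono_neutral_left) (use assms in \<open>auto simp: in_keys_iff\<close>)

lemma linext_add: "linext \<phi> (f + g) = linext \<phi> f + linext \<phi> g"
proof -
  let ?A = "keys f \<union> keys g"
  have "keys (f + g) \<subseteq> ?A" by (rule keys_add)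
  then show ?thesis
    using linext_superset[of ?A f \<phi>] linext_superset[of ?A g \<phi>] linext_superset[of ?A "f + g" \<phi>]
    by (simp add: lookup_add mpoly.scale_left_distrib sum.distrib)
qed

lemma linext_pscale: "linext \<phi> (pscale c f) = pscale c (linext \<phi> f)"
  using linext_superset[of "keys f" "pscale c f" \<phi>] keys_pscale[of c f]
  by (simp add: linext_def mpoly.scale_sum_right)

lemma linext_0 [simp]: "linext \<phi> 0 = 0"
  by (simp add: linext_def)

lemma linext_sum: "linext \<phi> (sum f A) = (\<Sum>a\<in>A. linext \<phi> (f a))"
  by (induction A rule: infinite_finite_induct) (simp_all add: linext_add)

lemma linext_mult:
  assumes "\<And>p. \<phi> (unit_expo k + p) = a * \<phi> p"
  shows "linext \<phi> (var k * f) = a * linext \<phi> f"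
proof -
  have "linext \<phi> (var k * f) = (\<Sum>p\<in>(+) (unit_expo k) ` keys f. pscale (lookup (var k * f) p) (\<phi> p))"
    unfolding linext_def keys_monom_mult ..
  also have "\<dots> = (\<Sum>p\<in>keys f. pscale (lookup f p) (a * \<phi> p))"
    by (subst sum.reindex) (auto intro: inj_onI simp: lookup_monom_mult assms)
  finally show ?thesis by (simp add: linext_def sum_distrib_left pscale_mult_right)
qed

definition zero_at :: "nat \<Rightarrow> expo \<Rightarrow> expo" where
  "zero_at m p = p - Poly_Mapping.single m (lookup p m)"

lemma lookup_zero_at: "lookup (zero_at m p) j = (if j = m then 0 else lookup p j)"
  by (simp add: zero_at_def lookup_minus lookup_single when_def)

text \<open>The image of a monomial under the substitution $x_m \mapsto x_m + x_i$.\<close>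

definition subst_monom :: "nat \<Rightarrow> nat \<Rightarrow> expo \<Rightarrow> 'k::field mpoly" where
  "subst_monom m i p = pmonom (zero_at m p) * (var m + var i) ^ lookup p m"

abbreviation subst_var :: "nat \<Rightarrow> nat \<Rightarrow> 'k::field mpoly \<Rightarrow> 'k mpoly" where
  "subst_var m i \<equiv> linext (subst_monom m i)"

lemma subst_var_other:
  assumes "k \<noteq> m"
  shows "subst_var m i (var k * f) = var k * subst_var m i f"
proof (rule linext_mult)
  fix p
  have "zero_at m (unit_expo k + p) = unit_expo k + zero_at m p"
    by (rule poly_mapping_eqI) (use assms in \<open>auto simp: lookup_zero_at lookup_add lookup_single when_def\<close>)
  moreover have "lookup (unit_expo k + p) m = lookup p m"
    using assms by (simp add: lookup_add lookup_single)
  ultimately show "subst_monom m i (unit_expo k + p) = var k * subst_monom m i p"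
    by (simp add: subst_monom_def pmonom_mult[symmetric] mult.assoc)
qed

lemma subst_var_same: "subst_var m i (var m * f) = (var m + var i) * subst_var m i f"
proof (rule linext_mult)
  fix p
  have "zero_at m (unit_expo m + p) = zero_at m p"
    by (rule poly_mapping_eqI) (auto simp: lookup_zero_at lookup_add lookup_single)
  moreover have "lookup (unit_expo m + p) m = Suc (lookup p m)" by (simp add: lookup_add)
  ultimately show "subst_monom m i (unit_expo m + p) = (var m + var i) * subst_monom m i p"
    by (simp add: subst_monom_def algebra_simps)
qed

text \<open>The monomials that can be transformed into each other by trading $x_m$ for $x_i$ form a class;
  this representative of the class has no $x_m$. The substitution maps each class into its span.\<close>

definition fibre :: "nat \<Rightarrow> nat \<Rightarrow> expo \<Rightarrow> expo" where
  "fibre m i p = zero_at m p + Poly_Mapping.single i (lookup p m)"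

text \<open>The element of the class of \<open>y\<close> that has exponent \<open>b\<close> at $x_m$, for $b$ at most the
  exponent of \<open>y\<close> at $x_i$.\<close>

definition fibre_elem :: "nat \<Rightarrow> nat \<Rightarrow> expo \<Rightarrow> nat \<Rightarrow> expo" where
  "fibre_elem m i y b = y - Poly_Mapping.single i b + Poly_Mapping.single m b"

lemma lookup_fibre: 
  "i \<noteq> m \<Longrightarrow> lookup (fibre m i p) j = (if j = m then 0 else if j = i then lookup p i + lookup p m else lookup p j)"
  by (auto simp: fibre_def lookup_add lookup_zero_at lookup_single when_def)

lemma fibre_inj:
  assumes "i \<noteq> m" "fibre m i p = fibre m i q" "lookup p m = lookup q m"
  shows "p = q"
proof (rule poly_mapping_eqI)
  fix j
  have "lookup (fibre m i p) j = lookup (fibre m i q) j" using assms(2) by simp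
  then show "lookup p j = lookup q j"
    using assms(1,3) by (auto simp: lookup_fibre split: if_splits)
qed

lemma tdeg_fibre: "tdeg (fibre m i p) = tdeg p"
proof -
  have "p = zero_at m p + Poly_Mapping.single m (lookup p m)"
    by (rule poly_mapping_eqI) (simp add: lookup_add lookup_zero_at lookup_single when_def)
  then have "tdeg p = tdeg (zero_at m p) + lookup p m" using tdeg_add tdeg_single by metis
  then show ?thesis by (simp add: fibre_def tdeg_add)
qed

lemma lookup_var_power: "(var m :: 'k::field mpoly) ^ b = pmonom (Poly_Mapping.single m b)"
  by (induction b) (simp_all add: pmonom_mult single_add[symmetric])

lemma lookup_of_nat_mult: "lookup (of_nat c * f) p = of_nat c * lookup (f :: 'k::field mpoly) p"
proof -
  have "of_nat c * f = pscale (of_nat c) f" by (simp add: pscale_def)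
  then show ?thesis by simp
qed

lemma lookup_subst_monom:
  assumes im: "i \<noteq> m"
  shows "lookup (subst_monom m i q :: 'k::field mpoly) r
    = (if fibre m i q = fibre m i r then of_nat (lookup q m choose lookup r m) else 0)"
proof -
  let ?n = "lookup q m"
  have "subst_monom m i q = (\<Sum>b\<le>?n. of_nat (?n choose b) *
      pmonom (zero_at m q + Poly_Mapping.single m b + Poly_Mapping.single i (?n - b)) :: 'k mpoly)"
    unfolding subst_monom_def binomial_ring lookup_var_power sum_distrib_left
    by (rule sum.cong[OF refl]) (simp add: pmonom_mult[symmetric] algebra_simps)
  then have "lookup (subst_monom m i q :: 'k mpoly) r = (\<Sum>b\<le>?n. of_nat (?n choose b) *
      (if zero_at m q + Poly_Mapping.single m b + Poly_Mapping.single i (?n - b) = r then 1 else 0))"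
    by (simp only: lookup_sum lookup_of_nat_mult lookup_pmonom)
  also have "\<dots> = (\<Sum>b\<le>?n. of_nat (?n choose b) * (if b = lookup r m then (if fibre m i q = fibre m i r then 1 else 0) else 0))"
  proof (rule sum.cong[OF refl])
    fix b assume b: "b \<in> {..?n}"
    have "zero_at m q + Poly_Mapping.single m b + Poly_Mapping.single i (?n - b) = r \<longleftrightarrow>
        b = lookup r m \<and> fibre m i q = fibre m i r" (is "?l = r \<longleftrightarrow> _")
    proof
      assume "?l = r"
      then have lr: "lookup r j = lookup ?l j" for j by simp
      have "lookup r m = b" using lr[of m] im by (simp add: lookup_add lookup_zero_at lookup_single)
      moreover have "fibre m i q = fibre m i r"
        by (rule poly_mapping_eqI)
          (use im b in \<open>auto simp: lookup_fibre lr lookup_add lookup_zero_at lookup_single when_def\<close>)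
      ultimately show "b = lookup r m \<and> fibre m i q = fibre m i r" by simp
    next
      assume a: "b = lookup r m \<and> fibre m i q = fibre m i r"
      show "?l = r"
      proof (rule poly_mapping_eqI)
        fix j
        have "lookup (fibre m i q) j = lookup (fibre m i r) j" "lookup (fibre m i q) i = lookup (fibre m i r) i"
          by (simp_all only: conjunct2[OF a])
        then show "lookup ?l j = lookup r j"
          using conjunct1[OF a] b im by (auto simp: lookup_fibre lookup_add lookup_zero_at lookup_single when_def split: if_splits)
      qed
    qed
    then show "of_nat (?n choose b) * (if ?l = r then 1 else 0 :: 'k)
      = of_nat (?n choose b) * (if b = lookup r m then (if fibre m i q = fibre m i r then 1 else 0) else 0)"
      by auto
  qed
  also have "\<dots> = (\<Sum>b\<le>?n. if b = lookup r m then of_nat (?n choose b) * (if fibre m i q = fibre m i r then 1 else 0) else 0)"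
    by (rule sum.cong) auto
  also have "\<dots> = (if fibre m i q = fibre m i r then of_nat (?n choose lookup r m) else 0)"
    by (auto simp: binomial_eq_0 not_le)
  finally show ?thesis .
qed

lemma lookup_subst_var:
  assumes im: "i \<noteq> m" and A: "finite A" "keys f \<subseteq> A"
  shows "lookup (subst_var m i f) r
    = (\<Sum>q\<in>{q\<in>A. fibre m i q = fibre m i r}. lookup f q * of_nat (lookup q m choose lookup r m))"
proof -
  have "lookup (subst_var m i f) r
    = (\<Sum>q\<in>A. if fibre m i q = fibre m i r then lookup f q * of_nat (lookup q m choose lookup r m) else 0)"
    unfolding linext_superset[OF A] lookup_sum lookup_pscale lookup_subst_monom[OF im]
    by (rule sum.cong) auto
  then show ?thesis using A by (simp add: sum.inter_filter)
qed

text \<open>The polynomials $e \mapsto {e \choose b}$ with $b < |A|$ span those of degree below $|A|$, and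
  so can separate the points of \<open>A\<close> in characteristic zero. In the induction the coefficient at the new
  point \<open>a\<close> is removed by the factor $e - a$, since $(e - a) {e \choose b}$ is a combination of
  ${e \choose b+1}$ and ${e \choose b}$.\<close>

lemma binomial_vandermonde:
  fixes c :: "nat \<Rightarrow> 'k::field_char_0"
  assumes "finite A" and "\<And>b. b < card A \<Longrightarrow> (\<Sum>e\<in>A. c e * of_nat (e choose b)) = 0" and "e \<in> A"
  shows "c e = 0"
  using assms
proof (induction A arbitrary: c e rule: finite_induct)
  case empty
  then show ?case by simp
next
  case (insert a A)
  note eqs = insert.prems(1)
  have mult: "of_nat (e choose b) * (of_nat e - of_nat a)
      = of_nat (Suc b) * of_nat (e choose Suc b) + (of_nat b - of_nat a) * (of_nat (e choose b) :: 'k)" for e b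
  proof -
    have "Suc b * (e choose Suc b) + b * (e choose b) = e * (e choose b)"
    proof (cases "b \<le> e")
      case True
      have "Suc b * (e choose Suc b) = (e - b) * (e choose b)"
        by (simp only: binomial_absorption binomial_absorb_comp)
      then show ?thesis using True by (simp flip: add_mult_distrib)
    qed (simp add: binomial_eq_0)
    then have "of_nat (Suc b) * of_nat (e choose Suc b) + of_nat b * of_nat (e choose b) = of_nat e * (of_nat (e choose b) :: 'k)"
      by (metis of_nat_add of_nat_mult)
    then show ?thesis by (simp add: algebra_simps)
  qed
  have "(\<Sum>e\<in>A. (c e * (of_nat e - of_nat a)) * of_nat (e choose b)) = 0" if b: "b < card A" for b
  proof -
    have "(\<Sum>e\<in>A. (c e * (of_nat e - of_nat a)) * of_nat (e choose b))
      = (\<Sum>e\<in>insert a A. (c e * (of_nat e - of_nat a)) * of_nat (e choose b))"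
      by (simp only: sum.insert[OF insert.hyps] diff_self mult_zero_right mult_zero_left add_0)
    also have "\<dots> = (\<Sum>e\<in>insert a A. of_nat (Suc b) * (c e * of_nat (e choose Suc b))
        + (of_nat b - of_nat a) * (c e * of_nat (e choose b)))"
    proof (rule sum.cong[OF refl])
      fix e
      have "c e * (of_nat e - of_nat a) * of_nat (e choose b) = c e * (of_nat (e choose b) * (of_nat e - of_nat a))"
        by (simp only: mult.assoc mult.commute[of "of_nat e - of_nat a" "of_nat (e choose b)"])
      also have "\<dots> = of_nat (Suc b) * (c e * of_nat (e choose Suc b))
        + (of_nat b - of_nat a) * (c e * of_nat (e choose b))"
        unfolding mult distrib_left by (simp only: mult.left_commute)
      finally show "c e * (of_nat e - of_nat a) * of_nat (e choose b) = \<dots>" .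
    qed
    also have "\<dots> = of_nat (Suc b) * (\<Sum>e\<in>insert a A. c e * of_nat (e choose Suc b))
        + (of_nat b - of_nat a) * (\<Sum>e\<in>insert a A. c e * of_nat (e choose b))"
      by (simp only: sum.distrib sum_distrib_left)
    also have "\<dots> = 0" using eqs[of b] eqs[of "Suc b"] b insert.hyps by simp
    finally show ?thesis .
  qed
  then have "c e * (of_nat e - of_nat a) = 0" if "e \<in> A" for e
    using insert.IH[of "\<lambda>e. c e * (of_nat e - of_nat a)"] that by blast
  then have z: "c e = 0" if "e \<in> A" for e using that insert.hyps by fastforce
  have "(\<Sum>e\<in>insert a A. c e * of_nat (e choose 0)) = 0" using eqs[of 0] insert.hyps by simp
  then have "c a = 0" using insert.hyps z by simp
  then show ?case using z insert.prems(2) by blast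
qed

text \<open>On a class the coefficients of the transform of \<open>f\<close> are binomial sums of the coefficients of
  \<open>f\<close>. If as many of them vanish as \<open>M\<close> has elements in the class, those with the smallest exponents at
  $x_m$, then the coefficients of \<open>f\<close> vanish on the class.\<close>

lemma subst_var_vanish:
  fixes f :: "'k::field_char_0 mpoly"
  assumes im: "i \<noteq> m" and M: "finite M" "keys f \<subseteq> M"
    and z: "\<And>r. fibre m i r = y \<Longrightarrow> lookup r m < card {q\<in>M. fibre m i q = y} \<Longrightarrow> lookup (subst_var m i f) r = 0"
    and full: "\<And>b. b < card {q\<in>M. fibre m i q = y} \<Longrightarrow> b \<le> lookup y i"
    and y: "lookup y m = 0" and q: "fibre m i q = y"
  shows "lookup f q = 0"
proof -
  let ?F = "{q\<in>M. fibre m i q = y}"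
  have inj: "inj_on (\<lambda>q. lookup q m) ?F"
    by (rule inj_onI) (use fibre_inj[OF im] in auto)
  define c where "c e = lookup f (fibre_elem m i y e)" for e
  have fe: "fibre_elem m i y (lookup p m) = p" if "fibre m i p = y" for p
  proof (rule poly_mapping_eqI)
    fix j
    show "lookup (fibre_elem m i y (lookup p m)) j = lookup p j"
      unfolding that[symmetric] using im
      by (auto simp: fibre_elem_def lookup_add lookup_minus lookup_fibre lookup_single when_def)
  qed
  have eqs: "(\<Sum>e\<in>(\<lambda>q. lookup q m) ` ?F. c e * of_nat (e choose b)) = 0"
    if "b < card ((\<lambda>q. lookup q m) ` ?F)" for b
  proof -
    have b: "b < card ?F" using that card_image[OF inj] by simp
    define r where "r = fibre_elem m i y b"
    have rm: "lookup r m = b" using im y by (simp add: r_def fibre_elem_def lookup_add lookup_minus lookup_single)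
    have ry: "fibre m i r = y"
      by (rule poly_mapping_eqI)
        (use full[OF b] im y rm in \<open>auto simp: lookup_fibre r_def fibre_elem_def lookup_add lookup_minus lookup_single when_def\<close>)
    have "0 = (\<Sum>q\<in>?F. lookup f q * of_nat (lookup q m choose b))"
      using z[OF ry] rm b lookup_subst_var[OF im M, of r] ry by simp
    also have "\<dots> = (\<Sum>e\<in>(\<lambda>q. lookup q m) ` ?F. c e * of_nat (e choose b))"
      by (subst sum.reindex[OF inj]) (auto simp: c_def fe intro!: sum.cong)
    finally show ?thesis by simp
  qed
  show ?thesis
  proof (cases "q \<in> M")
    case True
    then have "lookup q m \<in> (\<lambda>q. lookup q m) ` ?F" using q by blast
    then have "c (lookup q m) = 0" by (intro binomial_vandermonde[OF _ eqs]) (use M in auto)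
    then show ?thesis by (simp add: c_def fe[OF q])
  next
    case False
    then show ?thesis using M(2) by (auto simp: in_keys_iff)
  qed
qed

lemma fibre_card_bound:
  assumes im: "i \<noteq> m" and M: "finite M" and b: "b < card {q\<in>M. fibre m i q = y}"
  shows "b \<le> lookup y i"
proof -
  let ?F = "{q\<in>M. fibre m i q = y}"
  have "inj_on (\<lambda>q. lookup q m) ?F" by (rule inj_onI) (use fibre_inj[OF im] in auto)
  then have "card ?F \<le> card {..lookup y i}"
    by (rule card_inj_on_le) (use im in \<open>auto simp: lookup_fibre\<close>)
  then show ?thesis using b by simp
qed

lemma subst_var_inj:
  fixes f :: "'k::field_char_0 mpoly"
  assumes im: "i \<noteq> m" and z: "subst_var m i f = 0"
  shows "f = 0"
proof (rule poly_mapping_eqI)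
  fix q
  have "lookup f q = 0"
  proof (rule subst_var_vanish[OF im finite_keys subset_refl, of "fibre m i q"])
    show "b \<le> lookup (fibre m i q) i" if "b < card {qa \<in> keys f. fibre m i qa = fibre m i q}" for b
      using that by (rule fibre_card_bound[OF im finite_keys])
  qed (simp_all add: z lookup_fibre[OF im])
  then show "lookup f q = lookup 0 q" by simp
qed

lemma lin_on_subst_var: "lin_on pscale pscale X (subst_var m i)"
  by (rule mm.lin_onI) (simp_all add: linext_add linext_pscale)

text \<open>As $i < m$, the lex-largest monomials of a class are those with the smallest exponents at
  $x_m$. If the leading monomial \<open>p\<close> had a large exponent at $x_m$, the coefficients at all larger
  monomials of its class would vanish, and with them the whole part of \<open>f\<close> in this class.\<close>

lemma LM_subst_var:
  fixes M :: "expo set"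
  assumes im: "i < m" and M: "finite M" and p: "p \<in> LM (subst_var m i ` (monspan M :: 'k::field_char_0 mpoly set))"
  shows "lookup p m < card {q\<in>M. fibre m i q = fibre m i p}"
proof (rule ccontr)
  assume n: "\<not> ?thesis"
  have im': "i \<noteq> m" using im by simp
  from p obtain f where f: "f \<in> monspan M" "subst_var m i f \<noteq> (0 :: 'k mpoly)"
    "p = Max (keys (subst_var m i f))" unfolding LM_def by blast
  have kf: "keys f \<subseteq> M" using f(1) by (simp add: monspan_iff)
  have pk: "p \<in> keys (subst_var m i f)" unfolding f(3) by (rule Max_in) (use f(2) in auto)
  have above: "lookup (subst_var m i f) r = 0" if "p < r" for r
  proof (rule ccontr)
    assume "lookup (subst_var m i f) r \<noteq> 0"
    then have "r \<le> p" unfolding f(3) by (intro Max_ge) (auto simp: in_keys_iff)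
    then show False using that by simp
  qed
  have "lookup f q = 0" if "fibre m i q = fibre m i p" for q
  proof (rule subst_var_vanish[OF im' M kf _ fibre_card_bound[OF im' M] _ that])
    fix r assume r: "fibre m i r = fibre m i p" "lookup r m < card {q\<in>M. fibre m i q = fibre m i p}"
    then have rp: "lookup r m < lookup p m" using n by simp
    have l: "lookup (fibre m i r) j = lookup (fibre m i p) j" for j using r(1) by simp
    have "lookup p i < lookup r i" using l[of i] im' rp by (simp add: lookup_fibre)
    moreover have "lookup p j = lookup r j" if "j < i" for j using l[of j] that im by (simp add: lookup_fibre)
    ultimately have "p < r" by (intro less_expoI[of _ i]) auto
    then show "lookup (subst_var m i f) r = 0" by (rule above)
  next
    show "lookup (fibre m i p) m = 0" by (simp only: lookup_fibre[OF im'] if_True refl)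
  qed
  then have "lookup (subst_var m i f) p = 0"
    unfolding lookup_subst_var[OF im' M kf] by (intro sum.neutral) auto
  then show False using pk by (simp add: in_keys_iff)
qed

lemma lessThan_sum_le:
  fixes A :: "nat set"
  assumes "finite A"
  shows "\<Sum>{..<card A} \<le> \<Sum>A" and "A \<noteq> {..<card A} \<Longrightarrow> \<Sum>{..<card A} < \<Sum>A"
proof -
  have "\<Sum>{..<card A} \<le> \<Sum>A \<and> (A \<noteq> {..<card A} \<longrightarrow> \<Sum>{..<card A} < \<Sum>A)"
    using assms
  proof (induction A rule: finite_linorder_max_induct)
    case empty
    then show ?case by simp
  next
    case (insert b A)
    have b: "b \<notin> A" using insert.hyps by blast
    have "A \<subseteq> {..<b}" using insert.hyps by auto
    then have cb: "card A \<le> b" using card_mono[of "{..<b}" A] by simp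
    have c: "card (insert b A) = Suc (card A)" using b insert.hyps by simp
    have s: "\<Sum>(insert b A) = b + \<Sum>A" using b insert.hyps by simp
    have t: "\<Sum>{..<card (insert b A)} = card A + \<Sum>{..<card A}" by (simp add: c lessThan_Suc)
    have "insert b A = {..<card (insert b A)}" if "A = {..<card A}" "b = card A"
    proof -
      have "insert b A = insert b {..<card A}" by (rule arg_cong[OF that(1)])
      also have "\<dots> = {..<Suc (card A)}" unfolding that(2) lessThan_Suc ..
      finally show ?thesis unfolding c .
    qed
    then show ?case using insert.IH cb unfolding s t by linarith
  qed
  then show "\<Sum>{..<card A} \<le> \<Sum>A" and "A \<noteq> {..<card A} \<Longrightarrow> \<Sum>{..<card A} < \<Sum>A" by auto
qed

text \<open>In every class \<open>N\<close> takes up the exponents $0, \dots, k - 1$ of $x_m$, where $k$ is the number of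
  elements of \<open>M\<close> in the class; no set of $k$ exponents has a smaller sum. A monomial of \<open>M\<close> for which one
  factor $x_m$ cannot be traded for $x_i$ inside \<open>M\<close> is preceded by a gap, so the sum for \<open>M\<close> is
  strictly larger.\<close>

lemma weight_decreases:
  assumes im: "i < m" and M: "finite M" and N: "finite N" "card N = card M"
    and small: "\<And>p. p \<in> N \<Longrightarrow> lookup p m < card {q\<in>M. fibre m i q = fibre m i p}"
    and u: "u \<in> M" "0 < lookup u m" "u - unit_expo m + unit_expo i \<notin> M"
  shows "(\<Sum>p\<in>N. lookup p m) < (\<Sum>p\<in>M. lookup p m)"
proof -
  let ?f = "fibre m i"
  let ?Y = "?f ` M \<union> ?f ` N"
  have im': "i \<noteq> m" using im by simp
  have Y: "finite ?Y" using M N by simp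
  define FM FN where "FM y = {q\<in>M. ?f q = y}" and "FN y = {q\<in>N. ?f q = y}" for y
  have fin: "finite (FM y)" "finite (FN y)" for y using M N by (auto simp: FM_def FN_def)
  have inj: "inj_on (\<lambda>q. lookup q m) (FM y)" "inj_on (\<lambda>q. lookup q m) (FN y)" for y
    by (rule inj_onI; use fibre_inj[OF im'] in \<open>auto simp: FM_def FN_def\<close>)+
  have sumM: "sum g M = (\<Sum>y\<in>?Y. sum g (FM y))" for g :: "expo \<Rightarrow> nat"
    unfolding FM_def by (rule sum.group[symmetric]) (use M Y in auto)
  have sumN: "sum g N = (\<Sum>y\<in>?Y. sum g (FN y))" for g :: "expo \<Rightarrow> nat"
    unfolding FN_def by (rule sum.group[symmetric]) (use N Y in auto)
  have imN: "(\<lambda>q. lookup q m) ` FN y \<subseteq> {..<card (FM y)}" for y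
    using small by (auto simp: FN_def FM_def)
  have le: "card (FN y) \<le> card (FM y)" for y
    using card_mono[OF _ imN[of y]] card_image[OF inj(2), of y] by simp
  have "(\<Sum>y\<in>?Y. card (FN y)) = (\<Sum>y\<in>?Y. card (FM y))"
    using sumM[of "\<lambda>_. 1"] sumN[of "\<lambda>_. 1"] N(2) by simp
  then have eq: "card (FN y) = card (FM y)" if "y \<in> ?Y" for y
    using sum_mono_inv[OF _ le that Y, of "\<lambda>y. y"] le by (metis (no_types, lifting) Y le sum_mono_inv that)
  have sN: "(\<Sum>p\<in>FN y. lookup p m) = \<Sum>{..<card (FM y)}" if "y \<in> ?Y" for y
  proof -
    have "(\<lambda>q. lookup q m) ` FN y = {..<card (FM y)}"
      by (rule card_subset_eq[OF _ imN]) (simp_all add: card_image[OF inj(2)] eq[OF that])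
    then show ?thesis using sum.reindex[OF inj(2)[of y], of "\<lambda>x. x"] by simp
  qed
  have sM: "(\<Sum>p\<in>FM y. lookup p m) = \<Sum>((\<lambda>q. lookup q m) ` FM y)" for y
    using sum.reindex[OF inj(1)[of y], of "\<lambda>x. x"] by simp
  note cM = card_image[OF inj(1)]
  have leS: "(\<Sum>p\<in>FN y. lookup p m) \<le> (\<Sum>p\<in>FM y. lookup p m)" if "y \<in> ?Y" for y
    unfolding sN[OF that] sM using lessThan_sum_le(1)[of "(\<lambda>q. lookup q m) ` FM y"] fin cM by simp
  let ?u = "u - unit_expo m + unit_expo i" and ?y = "?f u"
  have lu: "lookup ?u j = (if j = m then lookup u m - 1 else if j = i then lookup u i + 1 else lookup u j)" for j
    using im' by (simp add: lookup_add lookup_minus lookup_single when_def)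
  have fu: "?f ?u = ?y"
    by (rule poly_mapping_eqI) (use im' u(2) in \<open>auto simp: lookup_fibre lu\<close>)
  have y: "?y \<in> ?Y" using u(1) by blast
  have notin: "lookup u m - 1 \<notin> (\<lambda>q. lookup q m) ` FM ?y"
  proof
    assume "lookup u m - 1 \<in> (\<lambda>q. lookup q m) ` FM ?y"
    then obtain q where q: "q \<in> M" "?f q = ?y" "lookup q m = lookup u m - 1" unfolding FM_def by auto
    have "q = ?u" by (rule fibre_inj[OF im']) (use q fu lu in auto)
    then show False using q(1) u(3) by simp
  qed
  have inn: "lookup u m \<in> (\<lambda>q. lookup q m) ` FM ?y" using u(1) by (auto simp: FM_def)
  have "(\<lambda>q. lookup q m) ` FM ?y \<noteq> {..<card ((\<lambda>q. lookup q m) ` FM ?y)}"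
  proof
    assume e: "(\<lambda>q. lookup q m) ` FM ?y = {..<card ((\<lambda>q. lookup q m) ` FM ?y)}"
    have "lookup u m < card ((\<lambda>q. lookup q m) ` FM ?y)" using inn unfolding e[symmetric] using e by blast
    then have "lookup u m - 1 \<in> {..<card ((\<lambda>q. lookup q m) ` FM ?y)}" by simp
    then show False using notin e by blast
  qed
  then have "(\<Sum>p\<in>FN ?y. lookup p m) < (\<Sum>p\<in>FM ?y. lookup p m)"
    unfolding sN[OF y] sM using lessThan_sum_le(2)[of "(\<lambda>q. lookup q m) ` FM ?y"] fin cM by simp
  then show ?thesis
    unfolding sumM sumN using leS y by (intro sum_strict_mono_ex1[OF Y]) blast+
qed

text \<open>The substitution maps \<open>V\<close> onto its image and turns $\sum_k x_k v_k = 0$ into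
  $\sum_k x_k s(v_k) + x_i s(v_m) = 0$, a syzygy of the tuple in which the $i$-th entry is
  $s(v_i) + s(v_m)$; matrices are treated in the same way in rows and columns. This is an injective
  map on syzygies.\<close>

lemma kd_subst_var:
  fixes V :: "'k::field_char_0 mpoly set"
  assumes V: "mpoly.subspace V" "mpoly.fin_dim V" and im: "i < m"
  shows "kd p (Suc m) V \<le> kd p (Suc m) (subst_var m i ` V)"
proof -
  let ?s = "subst_var m i :: 'k mpoly \<Rightarrow> 'k mpoly" and ?n = "Suc m"
  let ?W = "?s ` V"
  have im': "i \<noteq> m" "m \<noteq> i" "i < ?n" "m < ?n" using im by auto
  have W: "mpoly.subspace ?W" by (rule mm.lin_on_subspace_image[OF lin_on_subst_var V(1)])
  have fdW: "mpoly.fin_dim ?W" by (rule mm.rank_nullity(2)[OF lin_on_subst_var V])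
  have srow: "(\<Sum>k<?n. var k * ?s (v k)) + var i * ?s (v m) = 0" if "(\<Sum>k<?n. var k * v k) = 0" for v
  proof -
    have "0 = ?s (\<Sum>k<?n. var k * v k)" using that by simp
    also have "\<dots> = (\<Sum>k<m. ?s (var k * v k)) + ?s (var m * v m)" by (simp add: linext_sum linext_add)
    also have "(\<Sum>k<m. ?s (var k * v k)) = (\<Sum>k<m. var k * ?s (v k))"
      by (rule sum.cong) (auto simp: subst_var_other)
    also have "?s (var m * v m) = (var m + var i) * ?s (v m)" by (rule subst_var_same)
    finally show ?thesis by (simp add: distrib_right add.assoc)
  qed
  show ?thesis
  proof (cases "p = 1")
    case True
    define F where "F v k = (if k = i then ?s (v i) + ?s (v m) else ?s (v k))" for v :: "nat \<Rightarrow> 'k mpoly" and k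
    have sumF: "(\<Sum>k<?n. var k * F v k) = (\<Sum>k<?n. var k * ?s (v k)) + var i * ?s (v m)" for v
    proof -
      have "(\<Sum>k<?n. var k * F v k) = (\<Sum>k<?n. var k * ?s (v k) + (if k = i then var i * ?s (v m) else 0))"
        by (rule sum.cong) (auto simp: F_def algebra_simps)
      then show ?thesis using im' by (simp only: sum.distrib) simp
    qed
    have "tup.dim (K1 ?n V) \<le> tup.dim (K1 ?n ?W)"
    proof (rule tt.dim_le_inj[OF _ K1_subspace[OF V(1)] K1_fin_dim[OF V(2)] _ _ K1_fin_dim[OF fdW]])
      show "lin_on tscale tscale (K1 ?n V) F"
        by (rule tt.lin_onI)
          (auto simp: F_def fun_eq_iff tscale_def linext_add linext_pscale mpoly.scale_right_distrib)
      show "v = 0" if v: "v \<in> K1 ?n V" "F v = 0" for v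
      proof
        fix k
        have F0: "F v k = 0" for k using v(2) by simp
        have s0: "?s (v k) = 0" if "k \<noteq> i" for k using F0[of k] that by (simp add: F_def)
        have "?s (v i) = 0" using F0[of i] s0[of m] im' by (simp add: F_def)
        then have "?s (v k) = 0" using s0 by (cases "k = i") auto
        then show "v k = 0 k" using subst_var_inj[OF im'(1)] by simp
      qed
      show "F ` K1 ?n V \<subseteq> K1 ?n ?W"
      proof
        fix w assume "w \<in> F ` K1 ?n V"
        then obtain v where v: "v \<in> K1 ?n V" "w = F v" by blast
        have "v k \<in> V" if "k < ?n" for k using v(1) that unfolding K1_iff by blast
        then have vV: "?s (v k) \<in> ?W" if "k < ?n" for k using that by blast
        have vz: "v k = 0" if "k \<ge> ?n" for k using v(1) that unfolding K1_iff by blast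
        have vs: "(\<Sum>k<?n. var k * v k) = 0" using v(1) unfolding K1_iff by blast
        have "F v k \<in> ?W" if "k < ?n" for k
        proof (cases "k = i")
          case True
          then show ?thesis
            unfolding F_def using mpoly.subspace_add[OF W vV[OF im'(3)] vV[OF im'(4)]] by simp
        next
          case False
          then show ?thesis unfolding F_def using vV[OF that] by simp
        qed
        moreover have "F v k = 0" if "k \<ge> ?n" for k
        proof -
          have "k \<noteq> i" using that im'(3) by linarith
          then show ?thesis by (simp add: F_def vz[OF that])
        qed
        moreover have "(\<Sum>k<?n. var k * F v k) = 0" unfolding sumF by (rule srow[OF vs])
        ultimately show "w \<in> K1 ?n ?W" unfolding K1_iff v(2) by blast
      qed
    qed
    then show ?thesis using True by (simp add: kd_def)
  next
    case False
    define F where "F v = (\<lambda>(k,l). ?s (v (k,l)) + (if k = i then ?s (v (m,l)) else 0) +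
        (if l = i then ?s (v (k,m)) else 0) + (if k = i \<and> l = i then ?s (v (m,m)) else 0))"
      for v :: "nat \<times> nat \<Rightarrow> 'k mpoly"
    have sumF: "(\<Sum>l<?n. var l * F v (k,l)) = ((\<Sum>l<?n. var l * ?s (v (k,l))) + var i * ?s (v (k,m))) +
       (if k = i then (\<Sum>l<?n. var l * ?s (v (m,l))) + var i * ?s (v (m,m)) else 0)" for v k
    proof -
      have "(\<Sum>l<?n. var l * F v (k,l)) = (\<Sum>l<?n. var l * ?s (v (k,l)) + (if l = i then var i * ?s (v (k,m)) else 0)
          + (if k = i then var l * ?s (v (m,l)) else 0)
          + (if l = i then (if k = i then var i * ?s (v (m,m)) else 0) else 0))"
        by (rule sum.cong) (auto simp: F_def algebra_simps)
      then show ?thesis using im' by (simp only: sum.distrib) (simp add: algebra_simps)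
    qed
    have "tup.dim (K2 ?n V) \<le> tup.dim (K2 ?n ?W)"
    proof (rule tt.dim_le_inj[OF _ K2_subspace[OF V(1)] K2_fin_dim[OF V(2)] _ _ K2_fin_dim[OF fdW]])
      show "lin_on tscale tscale (K2 ?n V) F"
        by (rule tt.lin_onI)
          (auto simp: F_def fun_eq_iff tscale_def linext_add linext_pscale mpoly.scale_right_distrib)
      show "v = 0" if v: "v \<in> K2 ?n V" "F v = 0" for v
      proof
        fix b :: "nat \<times> nat"
        obtain k l where b: "b = (k,l)" by (cases b)
        have F0: "F v (k,l) = 0" for k l using v(2) by simp
        have s0: "?s (v (k,l)) = 0" if "k \<noteq> i" "l \<noteq> i" for k l using F0[of k l] that by (simp add: F_def)
        have s1: "?s (v (k,i)) = 0" if "k \<noteq> i" for k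
          using F0[of k i] s0[of k m] that im' by (simp add: F_def)
        have s2: "?s (v (i,l)) = 0" if "l \<noteq> i" for l
          using F0[of i l] s0[of m l] that im' by (simp add: F_def)
        have "?s (v (i,i)) = 0"
          using F0[of i i] s0[of m m] s1[of m] s2[of m] im' by (simp add: F_def)
        then have "?s (v (k,l)) = 0" using s0 s1 s2 by (cases "k = i"; cases "l = i") auto
        then show "v b = 0 b" using subst_var_inj[OF im'(1)] b by simp
      qed
      show "F ` K2 ?n V \<subseteq> K2 ?n ?W"
      proof
        fix w assume "w \<in> F ` K2 ?n V"
        then obtain v where v: "v \<in> K2 ?n V" "w = F v" by blast
        have "v (k,l) \<in> V" if "k < ?n" "l < ?n" for k l using v(1) that unfolding K2_iff by blast
        then have vV: "?s (v (k,l)) \<in> ?W" if "k < ?n" "l < ?n" for k l using that by blast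
        have W0: "0 \<in> ?W" by (rule mpoly.subspace_0[OF W])
        have out: "v (k,l) = 0" if "\<not> (k < ?n \<and> l < ?n)" for k l using v(1) that unfolding K2_iff by blast
        have "F v (k,l) \<in> ?W" if "k < ?n" "l < ?n" for k l
          unfolding F_def prod.case
          using that im' W0 by (intro mpoly.subspace_add[OF W]) (auto intro!: vV)
        moreover have "F v (k,l) = 0" if "\<not> (k < ?n \<and> l < ?n)" for k l
          using that im' out by (auto simp: F_def)
        moreover have "(\<Sum>l<?n. var l * F v (k,l)) = 0" if "k < ?n" for k
        proof -
          have r: "(\<Sum>l<?n. var l * v (k,l)) = 0" if "k < ?n" for k using v(1) that unfolding K2_iff by blast
          show ?thesis unfolding sumF using srow[OF r[OF that]] srow[OF r[OF im'(4)]] by simp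
        qed
        moreover have "F v (k,l) + F v (l,k) = 0" if "k < ?n" "l < ?n" for k l
        proof -
          have e: "v (k,l) + v (l,k) = 0" if "k < ?n" "l < ?n" for k l using v(1) that unfolding K2_iff by blast
          have a: "?s (v (k,l)) + ?s (v (l,k)) = 0" if "k < ?n" "l < ?n" for k l
            unfolding linext_add[symmetric] e[OF that] by (rule linext_0)
          have "F v (k,l) + F v (l,k) = (?s (v (k,l)) + ?s (v (l,k)))
            + (if k = i then ?s (v (m,l)) + ?s (v (l,m)) else 0)
            + (if l = i then ?s (v (k,m)) + ?s (v (m,k)) else 0)
            + (if k = i \<and> l = i then ?s (v (m,m)) + ?s (v (m,m)) else 0)"
            by (simp add: F_def algebra_simps)
          then show ?thesis
            unfolding a[OF that] a[OF im'(4) that(2)] a[OF that(1) im'(4)] a[OF im'(4) im'(4)] by simp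
        qed
        ultimately show "w \<in> K2 ?n ?W" unfolding K2_iff v(2) by blast
      qed
    qed
    then show ?thesis using False by (simp add: kd_def)
  qed
qed

lemma keys_subst_var:
  assumes im: "i \<noteq> m" and r: "r \<in> keys (subst_var m i f)"
  obtains q where "q \<in> keys f" "fibre m i q = fibre m i r"
proof -
  have ne: "lookup (subst_var m i f) r \<noteq> 0" using r by (simp add: in_keys_iff)
  let ?S = "{q \<in> keys f. fibre m i q = fibre m i r}"
  have "?S \<noteq> {}"
  proof
    assume e: "?S = {}"
    have "lookup (subst_var m i f) r = 0"
      unfolding lookup_subst_var[OF im finite_keys subset_refl] e by simp
    then show False using ne by simp
  qed
  then obtain q where "q \<in> ?S" by blast
  then have "q \<in> keys f" "fibre m i q = fibre m i r" by blast+
  then show ?thesis by (rule that)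
qed

lemma subst_var_forms:
  assumes im: "i < m" and f: "f \<in> forms (Suc m) d"
  shows "subst_var m i f \<in> forms (Suc m) d"
  unfolding forms_iff
proof
  fix r assume "r \<in> keys (subst_var m i f)"
  then obtain q where q: "q \<in> keys f" "fibre m i q = fibre m i r"
    using im by (elim keys_subst_var[rotated]) simp_all
  then have qM: "q \<in> Mon (Suc m) d" using f unfolding forms_iff by blast
  have "lookup r j = 0" if "j \<ge> Suc m" for j
  proof -
    have "lookup (fibre m i q) j = lookup (fibre m i r) j" by (simp only: q(2))
    then have "lookup r j = lookup q j" using that im by (simp add: lookup_fibre)
    then show ?thesis using Mon_exponents[OF qM] that by (simp add: exponents_iff)
  qed
  moreover have "tdeg r = d"
    using tdeg_fibre[of m i q] tdeg_fibre[of m i r] q(2) Mon_tdeg[OF qM] by simp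
  ultimately show "r \<in> Mon (Suc m) d" by (simp add: Mon_def exponents_iff)
qed

section \<open>Slicing sets of monomials by the last variable\<close>

definition slice :: "nat \<Rightarrow> expo set \<Rightarrow> nat \<Rightarrow> expo set" where
  "slice m M j = {u \<in> exponents m. u + Poly_Mapping.single m j \<in> M}"

text \<open>The inverse of slicing: the union of the $x_m^j A_j$.\<close>

definition stack :: "nat \<Rightarrow> nat \<Rightarrow> (nat \<Rightarrow> expo set) \<Rightarrow> expo set" where
  "stack m d A = (\<Union>j\<le>d. (\<lambda>u. u + Poly_Mapping.single m j) ` A j)"

lemma card_stack:
  assumes A: "\<And>j. j \<le> d \<Longrightarrow> finite (A j)" "\<And>j. j \<le> d \<Longrightarrow> A j \<subseteq> exponents m"
  shows "card (stack m d A) = (\<Sum>j\<le>d. card (A j))"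
proof -
  have z: "lookup u m = 0" if "j \<le> d" "u \<in> A j" for j u
    using A(2)[OF that(1)] that(2) by (auto simp: exponents_iff subset_iff)
  have "card (stack m d A) = (\<Sum>j\<le>d. card ((\<lambda>u. u + Poly_Mapping.single m j) ` A j))"
    unfolding stack_def
  proof (rule card_UN_disjoint)
    show "\<forall>j\<in>{..d}. \<forall>k\<in>{..d}. j \<noteq> k \<longrightarrow>
        (\<lambda>u. u + Poly_Mapping.single m j) ` A j \<inter> (\<lambda>u. u + Poly_Mapping.single m k) ` A k = {}"
    proof (intro ballI impI)
      fix j k assume j: "j \<in> {..d}" and k: "k \<in> {..d}" and jk: "j \<noteq> k"
      show "(\<lambda>u. u + Poly_Mapping.single m j) ` A j \<inter> (\<lambda>u. u + Poly_Mapping.single m k) ` A k = {}"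
      proof (rule ccontr)
        assume "\<not> ?thesis"
        then obtain u v where uv: "u \<in> A j" "v \<in> A k"
          "u + Poly_Mapping.single m j = v + Poly_Mapping.single m k" by auto
        then have "lookup (u + Poly_Mapping.single m j) m = lookup (v + Poly_Mapping.single m k) m" by simp
        then show False using z[OF _ uv(1)] z[OF _ uv(2)] j k jk by (simp add: lookup_add)
      qed
    qed
  qed (use A(1) in auto)
  also have "\<dots> = (\<Sum>j\<le>d. card (A j))"
    by (rule sum.cong[OF refl], rule card_image) (auto intro: inj_onI)
  finally show ?thesis .
qed

lemma slice_subset_Mon:
  assumes "M \<subseteq> Mon (Suc m) d" "u \<in> slice m M j"
  shows "j \<le> d" "u \<in> Mon m (d - j)"
proof -
  have u: "u \<in> exponents m" "u + Poly_Mapping.single m j \<in> Mon (Suc m) d"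
    using assms by (auto simp: slice_def)
  then have "tdeg u + j = d" by (simp add: Mon_def tdeg_add)
  then show "j \<le> d" "u \<in> Mon m (d - j)" using u(1) by (auto simp: Mon_def)
qed

lemma split_last:
  assumes "u \<in> exponents (Suc m)"
  shows "zero_at m u \<in> exponents m" "u = zero_at m u + Poly_Mapping.single m (lookup u m)"
proof -
  show "zero_at m u \<in> exponents m"
    using assms by (auto simp: exponents_iff lookup_zero_at)
  show "u = zero_at m u + Poly_Mapping.single m (lookup u m)"
    by (rule poly_mapping_eqI) (simp add: lookup_add lookup_zero_at lookup_single when_def)
qed

lemma stack_slice:
  assumes M: "M \<subseteq> Mon (Suc m) d"
  shows "M = stack m d (slice m M)"
proof
  show "M \<subseteq> stack m d (slice m M)"
  proof
    fix u assume u: "u \<in> M"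
    then have uM: "u \<in> Mon (Suc m) d" using M by blast
    note sp = split_last[OF Mon_exponents[OF uM]]
    have "zero_at m u \<in> slice m M (lookup u m)"
      unfolding slice_def using sp u by simp
    moreover from slice_subset_Mon(1)[OF M this] have "lookup u m \<le> d" .
    ultimately show "u \<in> stack m d (slice m M)"
      unfolding stack_def using sp(2) by blast
  qed
qed (auto simp: stack_def slice_def)

lemma slice_0: "M \<subseteq> exponents (Suc m) \<Longrightarrow> slice m M 0 = {u \<in> M. lookup u m = 0}"
proof
  assume M: "M \<subseteq> exponents (Suc m)"
  show "{u \<in> M. lookup u m = 0} \<subseteq> slice m M 0"
  proof
    fix u assume "u \<in> {u \<in> M. lookup u m = 0}"
    then have u: "u \<in> M" "lookup u m = 0" by simp_all
    have "u \<in> exponents (Suc m)" using u(1) M by blast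
    from split_last[OF this] show "u \<in> slice m M 0" using u by (simp add: slice_def)
  qed
qed (auto simp: slice_def exponents_iff)

lemma Mon_last_zero: "{u \<in> Mon (Suc m) d. lookup u m = 0} = Mon m d"
proof
  show "{u \<in> Mon (Suc m) d. lookup u m = 0} \<subseteq> Mon m d"
  proof
    fix u assume "u \<in> {u \<in> Mon (Suc m) d. lookup u m = 0}"
    then have u: "u \<in> Mon (Suc m) d" "lookup u m = 0" by simp_all
    from split_last[OF Mon_exponents[OF u(1)]] show "u \<in> Mon m d"
      using u Mon_tdeg[OF u(1)] by (simp add: Mon_def)
  qed
  show "Mon m d \<subseteq> {u \<in> Mon (Suc m) d. lookup u m = 0}"
    by (auto simp: Mon_def exponents_iff)
qed

lemma Mon_lastI: "u \<in> Mon (Suc m) d \<Longrightarrow> lookup u m = 0 \<Longrightarrow> u \<in> Mon m d"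
  and Mon_SucI: "u \<in> Mon m d \<Longrightarrow> u \<in> Mon (Suc m) d"
  and Mon_last: "u \<in> Mon m d \<Longrightarrow> lookup u m = 0"
  by (subst Mon_last_zero[symmetric], simp)
    (drule equalityD2[OF Mon_last_zero, THEN subsetD], simp)+

lemma lexseg_last_zero:
  assumes L: "lexseg (Suc m) d L"
  shows "lexseg m d {u \<in> L. lookup u m = 0}"
  unfolding lexseg_def
proof (intro conjI ballI impI subsetI)
  fix u assume u: "u \<in> {u \<in> L. lookup u m = 0}"
  have "u \<in> Mon (Suc m) d" by (rule subsetD[OF lexseg_subset[OF L]]) (use u in simp)
  then show "u \<in> Mon m d" by (rule Mon_lastI) (use u in simp)
next
  fix u v assume u: "u \<in> {u \<in> L. lookup u m = 0}" and v: "v \<in> Mon m d" "u < v"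
  have "v \<in> L" by (rule lexsegD[OF L _ Mon_SucI[OF v(1)], of u]) (use u v(2) in simp_all)
  then show "v \<in> {u \<in> L. lookup u m = 0}" using Mon_last[OF v(1)] by simp
qed

section \<open>Lex segments have the most syzygies\<close>

text \<open>One factor $x_m$ may be traded for any earlier variable; strong stability would ask this of
  every variable in place of $x_m$.\<close>

definition stable_last :: "nat \<Rightarrow> expo set \<Rightarrow> bool" where
  "stable_last m M \<longleftrightarrow> (\<forall>i<m. \<forall>u\<in>M. 0 < lookup u m \<longrightarrow> u - unit_expo m + unit_expo i \<in> M)"

lemma stable_slice:
  assumes st: "stable_last m M"
  shows "up m (slice m M (Suc j)) \<subseteq> slice m M j"
proof
  fix w assume "w \<in> up m (slice m M (Suc j))"
  then obtain u i where u: "u \<in> slice m M (Suc j)" "i < m" "w = u + unit_expo i" by (rule upE)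
  then have uM: "u \<in> exponents m" "u + Poly_Mapping.single m (Suc j) \<in> M" by (simp_all add: slice_def)
  have "0 < lookup (u + Poly_Mapping.single m (Suc j)) m" by (simp add: lookup_add)
  with st u(2) uM(2) have "u + Poly_Mapping.single m (Suc j) - unit_expo m + unit_expo i \<in> M"
    unfolding stable_last_def by blast
  also have "u + Poly_Mapping.single m (Suc j) - unit_expo m + unit_expo i
      = u + unit_expo i + Poly_Mapping.single m j"
    by (rule poly_mapping_eqI) (auto simp: lookup_add lookup_minus lookup_single when_def)
  finally show "w \<in> slice m M j"
    using u(2,3) uM(1) by (simp add: slice_def exponents_add single_exponents)
qed

text \<open>Green's hyperplane restriction for stable sets. Replace every slice of \<open>M\<close> by the lex segment
  $A_j$ of the same size. Macaulay's bound in \<open>m\<close> variables and stability of \<open>M\<close> give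
  \<open>up m (A (Suc j)) \<subseteq> A j\<close>. If the part of \<open>L\<close> without $x_m$ were larger than $A_0$, some
  $u \in L$ without $x_m$ would be smaller than all of $A_0$. Then $u$ is smaller than every element of
  the stack of the $A_j$, so the stack is a proper subset of \<open>L\<close>; but both have the size of \<open>M\<close>.\<close>

lemma lex_restriction_le:
  assumes m: "0 < m" and M: "M \<subseteq> Mon (Suc m) d" and st: "stable_last m M"
    and macaulay: "\<And>d N A. N \<subseteq> Mon m d \<Longrightarrow> lexseg m d A \<Longrightarrow> card A = card N \<Longrightarrow> card (up m A) \<le> card (up m N)"
    and L: "lexseg (Suc m) d L" "card L = card M"
  shows "card {u \<in> L. lookup u m = 0} \<le> card {u \<in> M. lookup u m = 0}"
proof -
  have Mex: "M \<subseteq> exponents (Suc m)" using M Mon_exponents by blast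
  have sl: "slice m M j \<subseteq> Mon m (d - j)" for j using slice_subset_Mon(2)[OF M] by blast
  have "\<exists>A. lexseg m (d - j) A \<and> card A = card (slice m M j)" for j
    by (rule lexseg_exists) (rule card_mono[OF finite_Mon sl])
  then obtain A where "\<forall>j. lexseg m (d - j) (A j) \<and> card (A j) = card (slice m M j)"
    using choice[of "\<lambda>j B. lexseg m (d - j) B \<and> card B = card (slice m M j)"] by blast
  then have A: "lexseg m (d - j) (A j)" "card (A j) = card (slice m M j)" for j by simp_all
  have AM: "A j \<subseteq> Mon m (d - j)" for j by (rule lexseg_subset[OF A(1)])
  have Aex: "A j \<subseteq> exponents m" for j using AM[of j] Mon_exponents by blast
  have upA: "up m (A (Suc j)) \<subseteq> A j" if j: "Suc j \<le> d" for j
  proof (rule lexseg_le[OF _ A(1)])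
    have "Suc (d - Suc j) = d - j" using j by simp
    then show "lexseg m (d - j) (up m (A (Suc j)))" using lexseg_up[OF m A(1)[of "Suc j"]] by simp
    have "card (up m (A (Suc j))) \<le> card (up m (slice m M (Suc j)))"
      by (rule macaulay[OF sl A(1) A(2)])
    also have "\<dots> \<le> card (slice m M j)"
      by (rule card_mono[OF finite_subset[OF sl finite_Mon] stable_slice[OF st]])
    finally show "card (up m (A (Suc j))) \<le> card (A j)" by (simp add: A(2))
  qed
  \<comment> \<open>Trading the factors $x_m$ for $x_{m-1}$ leads from the slice $j$ into the slice $0$.\<close>
  have shift: "u + Poly_Mapping.single (m - 1) j \<in> A 0" if "j \<le> d" "u \<in> A j" for j u
    using that
  proof (induction j arbitrary: u)
    case 0
    then show ?case by simp
  next
    case (Suc j)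
    have "u + unit_expo (m - 1) \<in> A j" using upI[OF Suc.prems(2), of "m - 1" m] upA[OF Suc.prems(1)] m by auto
    from Suc.IH[OF _ this] Suc.prems(1) have "u + unit_expo (m - 1) + Poly_Mapping.single (m - 1) j \<in> A 0" by simp
    also have "u + unit_expo (m - 1) + Poly_Mapping.single (m - 1) j = u + Poly_Mapping.single (m - 1) (Suc j)"
      by (simp add: add.assoc single_add[symmetric])
    finally show ?case .
  qed
  let ?L0 = "{u \<in> L. lookup u m = 0}"
  have LM: "L \<subseteq> Mon (Suc m) d" by (rule lexseg_subset[OF L(1)])
  have L0: "lexseg m d ?L0" by (rule lexseg_last_zero[OF L(1)])
  have A0: "lexseg m d (A 0)" using A(1)[of 0] by simp
  show ?thesis
  proof (rule ccontr)
    assume n: "\<not> ?thesis"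
    have "card (A 0) < card ?L0" using n A(2)[of 0] slice_0[OF Mex] by simp
    then have "\<not> ?L0 \<subseteq> A 0" using card_mono[OF lexseg_finite[OF A0]] by (metis not_less)
    then obtain u where u: "u \<in> L" "lookup u m = 0" "u \<notin> A 0" by blast
    have uM: "u \<in> Mon m d" using u(1,2) lexseg_subset[OF L0] by blast
    have above: "u < w" if w: "w \<in> stack m d A" for w
    proof (rule ccontr)
      assume nw: "\<not> u < w"
      obtain j a where ja: "j \<le> d" "a \<in> A j" "w = a + Poly_Mapping.single m j"
        using w unfolding stack_def by auto
      define w' where "w' = a + Poly_Mapping.single (m - 1) j"
      have w': "w' \<in> A 0" unfolding w'_def by (rule shift[OF ja(1,2)])
      have w'M: "w' \<in> Mon m d" using w' lexseg_subset[OF A0] by blast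
      have "u < w'" using lexsegD[OF A0 w' uM] u(3) by (meson not_le)
      then obtain k where k: "lookup u k < lookup w' k" "\<And>i. i < k \<Longrightarrow> lookup u i = lookup w' i"
        by (rule less_expoE) blast
      have agree: "lookup w i = lookup w' i" if "i < m - 1" for i
        using that m by (auto simp: ja(3) w'_def lookup_add lookup_single when_def)
      show False
      proof (cases "k < m - 1")
        case True
        have "u < w" by (rule less_expoI[of _ k]) (use k agree True in auto)
        then show False using nw by simp
      next
        case False
        have "lookup w' k \<noteq> 0" using k(1) by simp
        then have "k < m" using Mon_exponents[OF w'M] by (metis exponents_iff not_le)
        then have km: "k = m - 1" using False by simp
        have deg: "tdeg v = (\<Sum>i<k. lookup v i) + lookup v k" if "v \<in> Mon m d" for v
        proof -
          have "tdeg v = (\<Sum>i<Suc k. lookup v i)"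
            by (rule tdeg_sum) (use that km m in \<open>auto simp: Mon_def exponents_def\<close>)
          then show ?thesis by simp
        qed
        have "(\<Sum>i<k. lookup u i) = (\<Sum>i<k. lookup w' i)" by (rule sum.cong) (use k(2) in auto)
        then show False using deg[OF uM] deg[OF w'M] Mon_tdeg[OF uM] Mon_tdeg[OF w'M] k(1) by simp
      qed
    qed
    have BM: "stack m d A \<subseteq> Mon (Suc m) d"
    proof
      fix w assume "w \<in> stack m d A"
      then obtain j a where ja: "j \<le> d" "a \<in> A j" "w = a + Poly_Mapping.single m j"
        unfolding stack_def by auto
      have "a \<in> Mon m (d - j)" using AM ja(2) by blast
      then have "a \<in> Mon (Suc m) (d - j)" by (rule Mon_SucI)
      then show "w \<in> Mon (Suc m) d"
        using Mon_add[of a "Suc m" "d - j" "Poly_Mapping.single m j" j] ja by (simp add: Mon_def single_exponents)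
    qed
    have "stack m d A \<subseteq> L - {u}"
    proof
      fix w assume w: "w \<in> stack m d A"
      have "w \<in> L" by (rule lexsegD[OF L(1) u(1)]) (use BM w above[OF w] in auto)
      then show "w \<in> L - {u}" using above[OF w] by blast
    qed
    then have "card (stack m d A) \<le> card (L - {u})"
      by (rule card_mono[rotated]) (simp add: lexseg_finite[OF L(1)])
    also have "\<dots> < card L" by (rule card_Diff1_less[OF lexseg_finite[OF L(1)] u(1)])
    also have "card L = card (stack m d (slice m M))" using L(2) stack_slice[OF M] by simp
    also have "\<dots> = (\<Sum>j\<le>d. card (slice m M j))"
      by (rule card_stack) (use sl finite_subset[OF sl finite_Mon] Mon_exponents in \<open>auto simp: slice_def\<close>)
    also have "\<dots> = card (stack m d A)"
      using card_stack[of d A m] Aex lexseg_finite[OF A(1)] by (simp add: A(2))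
    finally show False by simp
  qed
qed

lemma mxsum_split_last:
  assumes "lexseg (Suc m) d L"
  shows "mxsum p L = mxsum p {u \<in> L. lookup u m = 0} + (m choose p) * card (L - {u \<in> L. lookup u m = 0})"
proof -
  let ?L0 = "{u \<in> L. lookup u m = 0}"
  have fin: "finite L" by (rule lexseg_finite[OF assms])
  have "mxsum p L = mxsum p ?L0 + (\<Sum>u\<in>L - ?L0. mxv u choose p)"
    unfolding mxsum_def using sum.subset_diff[of ?L0 L "\<lambda>u. mxv u choose p"] fin by (simp add: add.commute)
  also have "(\<Sum>u\<in>L - ?L0. mxv u choose p) = (\<Sum>u\<in>L - ?L0. m choose p)"
  proof (rule sum.cong[OF refl])
    fix u assume u: "u \<in> L - ?L0"
    then have "u \<in> exponents (Suc m)" using lexseg_subset[OF assms] Mon_exponents by blast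
    then have "mxv u = m" using u by (intro mxv_eqI) (auto simp: exponents_iff)
    then show "mxv u choose p = m choose p" by simp
  qed
  finally show ?thesis by simp
qed

lemma choose_le_choose: "a \<le> b \<Longrightarrow> a choose p \<le> b choose p"
proof -
  assume "a \<le> b"
  have "card {B. B \<subseteq> {..<a} \<and> card B = p} \<le> card {B. B \<subseteq> {..<b} \<and> card B = p}"
    by (rule card_mono) (use \<open>a \<le> b\<close> in auto)
  then show ?thesis by (simp add: n_subsets)
qed

text \<open>Every monomial in \<open>m\<close> variables contributes at most \<open>m choose p\<close>.\<close>

lemma mxsum_le_superset:
  assumes m: "0 < m" and A: "lexseg m d A" and B: "B \<subseteq> A"
  shows "mxsum p A \<le> mxsum p B + (m choose p) * (card A - card B)"
proof -
  have fin: "finite A" by (rule lexseg_finite[OF A])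
  have "mxsum p A = mxsum p B + (\<Sum>u\<in>A - B. mxv u choose p)"
    unfolding mxsum_def using sum.subset_diff[OF B fin, of "\<lambda>u. mxv u choose p"] by (simp add: add.commute)
  also have "(\<Sum>u\<in>A - B. mxv u choose p) \<le> (\<Sum>u\<in>A - B. m choose p)"
  proof (rule sum_mono, rule choose_le_choose)
    fix u assume "u \<in> A - B"
    then have "u \<in> exponents m" using lexseg_subset[OF A] Mon_exponents by blast
    then show "mxv u \<le> m" using mxv_less[of u m] m by simp
  qed
  also have "\<dots> = (m choose p) * (card A - card B)"
    using card_Diff_subset[OF finite_subset[OF B fin] B] by simp
  finally show ?thesis by simp
qed

text \<open>Take a set of monomials of the same size with at least as many syzygies for which the total
  exponent of $x_m$ is least. If a factor $x_m$ could not be traded for $x_i$, the leading monomials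
  after the substitution $x_m \mapsto x_m + x_i$ would have at least as many syzygies and a smaller
  total exponent.\<close>

lemma exists_stable:
  assumes M: "M \<subseteq> Mon (Suc m) d"
  obtains N where "N \<subseteq> Mon (Suc m) d" "card N = card M" "stable_last m N"
    "kd p (Suc m) (monspan M :: 'k::field_char_0 mpoly set) \<le> kd p (Suc m) (monspan N :: 'k mpoly set)"
proof -
  let ?k = "\<lambda>N. kd p (Suc m) (monspan N :: 'k mpoly set)"
  let ?P = "\<lambda>N. N \<subseteq> Mon (Suc m) d \<and> card N = card M \<and> ?k M \<le> ?k N"
  let ?w = "\<lambda>N. \<Sum>u\<in>N. lookup u m"
  have "?P M" using M by simp
  then obtain N where N: "?P N" and least: "\<And>N'. ?P N' \<Longrightarrow> ?w N \<le> ?w N'"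
    using ex_has_least_nat[of ?P M ?w] by blast
  have NM: "N \<subseteq> Mon (Suc m) d" and cN: "card N = card M" and kN: "?k M \<le> ?k N" using N by simp_all
  have fin: "finite N" by (rule finite_subset[OF NM finite_Mon])
  have "stable_last m N"
    unfolding stable_last_def
  proof (intro allI ballI impI)
    fix i u assume i: "i < m" and u: "u \<in> N" "0 < lookup u m"
    let ?V = "monspan N :: 'k mpoly set" and ?s = "subst_var m i :: 'k mpoly \<Rightarrow> 'k mpoly"
    let ?N' = "LM (?s ` ?V)"
    have im: "i \<noteq> m" using i by simp
    have fdV: "mpoly.fin_dim ?V" by (rule monspan_fin_dim[OF fin])
    note rn = mm.rank_nullity[OF lin_on_subst_var monspan_subspace fdV, of m i]
    have W: "mpoly.subspace (?s ` ?V)" by (rule mm.lin_on_subspace_image[OF lin_on_subst_var monspan_subspace])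
    note LMW = LM_dim[OF W rn(2)]
    have "{f \<in> ?V. ?s f = 0} = {0}"
      using subst_var_inj[OF im] mpoly.subspace_0[OF monspan_subspace] by auto
    moreover have "mpoly.dim ?V = card N" by (rule dim_monspan[OF fin])
    ultimately have "mpoly.dim (?s ` ?V) = card N" using rn(1) by simp
    then have c: "card ?N' = card N" using LMW(2) by simp
    have "?V \<subseteq> forms (Suc m) d" unfolding forms_eq_monspan using NM by (auto simp: monspan_iff)
    then have "?s ` ?V \<subseteq> monspan (Mon (Suc m) d)"
      using subst_var_forms[OF i] unfolding forms_eq_monspan[symmetric] by blast
    then have sub: "?N' \<subseteq> Mon (Suc m) d" by (rule LM_subset)
    have k: "?k M \<le> ?k ?N'"
      using kN kd_subst_var[OF monspan_subspace fdV i, of p] kd_LM[OF W rn(2), of p "Suc m"] by linarith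
    have "?w N \<le> ?w ?N'" using least[of ?N'] sub c cN k by simp
    show "u - unit_expo m + unit_expo i \<in> N"
    proof (rule ccontr)
      assume n: "u - unit_expo m + unit_expo i \<notin> N"
      have "?w ?N' < ?w N"
      proof (rule weight_decreases[OF i fin LMW(1) c _ u n])
        fix q assume "q \<in> ?N'"
        then show "lookup q m < card {r \<in> N. fibre m i r = fibre m i q}" by (rule LM_subst_var[OF i fin])
      qed
      then show False using \<open>?w N \<le> ?w ?N'\<close> by simp
    qed
  qed
  then show ?thesis using that NM cN kN by blast
qed

text \<open>The theorem of Macaulay, for \<open>p = 1\<close>, and of Bigatti and Hulett, for \<open>p = 2\<close>, on linear
  syzygies. After passing to a stable set, the restriction to the hyperplane $x_m = 0$ and the
  induction hypothesis bound the number of syzygies by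
  \<open>(m choose p) * card (N - ?N0) + mxsum p B\<close>, with \<open>B\<close> the lex segment as large as \<open>?N0\<close>. Since
  \<open>B\<close> contains the part \<open>?L0\<close> of \<open>A\<close> without $x_m$, and each monomial in \<open>B - ?L0\<close> counts at most as
  much as one with last variable $x_m$, the bound is at most \<open>mxsum p A\<close>.\<close>

theorem kd_monspan_bound:
  assumes "M \<subseteq> Mon n d" "lexseg n d A" "card A = card M" "p = 1 \<or> p = 2"
  shows "kd p n (monspan M :: 'k::field_char_0 mpoly set) \<le> mxsum p A"
  using assms
proof (induction n arbitrary: M d A p)
  case 0
  have "kd p 0 (monspan M :: 'k mpoly set) = 0" by (rule kd_zero_vars[OF monspan_subspace])
  then show ?case by simp
next
  case (Suc m)
  show ?case
  proof (cases "m = 0")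
    case True
    have finM: "finite M" by (rule finite_subset[OF Suc.prems(1) finite_Mon])
    have z: "(0::nat) choose p = 0" using Suc.prems(4) by (auto simp: binomial_eq_0)
    have "kd p (Suc m) (monspan M :: 'k mpoly set) \<le> kd p 0 (monspan {u \<in> M. lookup u 0 = 0} :: 'k mpoly set)"
      using kd_hyperplane[OF finM Suc.prems(4), of 0, where 'k = 'k] unfolding True z mult_zero_left add_0 .
    also have "\<dots> = 0" by (rule kd_zero_vars[OF monspan_subspace])
    finally show ?thesis by simp
  next
    case False
    then have m: "0 < m" by simp
    obtain N where N: "N \<subseteq> Mon (Suc m) d" "card N = card M" "stable_last m N"
      "kd p (Suc m) (monspan M :: 'k mpoly set) \<le> kd p (Suc m) (monspan N :: 'k mpoly set)"
      using exists_stable[OF Suc.prems(1), of p, where 'k = 'k] by blast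
    have fin: "finite N" by (rule finite_subset[OF N(1) finite_Mon])
    \<comment> \<open>The induction hypothesis for first syzygies is Macaulay's bound in \<open>m\<close> variables.\<close>
    have macaulay: "card (up m A) \<le> card (up m M)"
      if "M \<subseteq> Mon m d" "lexseg m d A" "card A = card M" for d M A
    proof -
      have "kd 1 m (monspan M :: 'k mpoly set) \<le> mxsum 1 A" using Suc.IH[OF that, of 1] by simp
      moreover have "kd 1 m (monspan M :: 'k mpoly set) + card (up m M) = m * card M"
        by (rule kd_1_monspan[OF finite_subset[OF that(1) finite_Mon]])
      moreover have "card (up m A) + mxsum 1 A = m * card A" by (rule card_up_lexseg[OF m that(2)])
      ultimately show ?thesis using that(3) by simp
    qed
    let ?N0 = "{u \<in> N. lookup u m = 0}" and ?L0 = "{u \<in> A. lookup u m = 0}"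
    have le: "card ?L0 \<le> card ?N0"
      by (rule lex_restriction_le[OF m N(1,3) macaulay Suc.prems(2)]) (simp_all add: Suc.prems(3) N(2))
    have N0M: "?N0 \<subseteq> Mon m d" using N(1) by (auto intro: Mon_lastI)
    obtain B where B: "lexseg m d B" "card B = card ?N0"
      using lexseg_exists[OF card_mono[OF finite_Mon N0M]] by blast
    have AM: "A \<subseteq> Mon (Suc m) d" by (rule lexseg_subset[OF Suc.prems(2)])
    have L0: "lexseg m d ?L0" by (rule lexseg_last_zero[OF Suc.prems(2)])
    have "?L0 \<subseteq> B" by (rule lexseg_le[OF L0 B(1)]) (simp add: le B(2))
    then have 1: "mxsum p B \<le> mxsum p ?L0 + (m choose p) * (card ?N0 - card ?L0)"
      using mxsum_le_superset[OF m B(1), of ?L0 p] B(2) by simp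
    have 2: "kd p m (monspan ?N0 :: 'k mpoly set) \<le> mxsum p B"
      by (rule Suc.IH[OF N0M B Suc.prems(4)])
    have 3: "kd p (Suc m) (monspan N :: 'k mpoly set)
        \<le> (m choose p) * card (N - ?N0) + kd p m (monspan ?N0 :: 'k mpoly set)"
      by (rule kd_hyperplane[OF fin Suc.prems(4)])
    have c1: "card (N - ?N0) = card N - card ?N0" by (rule card_Diff_subset) (use fin in auto)
    have c2: "card (A - ?L0) = card A - card ?L0"
      by (rule card_Diff_subset) (use lexseg_finite[OF Suc.prems(2)] in auto)
    have c3: "card ?N0 \<le> card N" by (rule card_mono[OF fin]) auto
    have eq: "(card N - card ?N0) + (card ?N0 - card ?L0) = card A - card ?L0"
      using le c3 N(2) Suc.prems(3) by simp
    have "kd p (Suc m) (monspan M :: 'k mpoly set)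
        \<le> (m choose p) * (card N - card ?N0) + (mxsum p ?L0 + (m choose p) * (card ?N0 - card ?L0))"
      using N(4) 1 2 3 unfolding c1 by linarith
    also have "\<dots> = mxsum p ?L0 + (m choose p) * ((card N - card ?N0) + (card ?N0 - card ?L0))"
      by (simp add: distrib_left)
    also have "\<dots> = mxsum p A"
      unfolding eq using mxsum_split_last[OF Suc.prems(2), of p] c2 by simp
    finally show ?thesis .
  qed
qed

lemma dim_forms_subspace:
  fixes V :: "'k::field mpoly set"
  assumes "mpoly.subspace V" "V \<subseteq> forms n d"
  shows "mpoly.fin_dim V" "finite (LM V)" "mpoly.dim V = card (LM V)" "LM V \<subseteq> Mon n d"
proof -
  show fd: "mpoly.fin_dim V" by (rule mpoly.fin_dim_subset[OF forms_fin_dim assms(2)])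
  show "finite (LM V)" "mpoly.dim V = card (LM V)" using LM_dim[OF assms(1) fd] by blast+
  show "LM V \<subseteq> Mon n d" using assms(2) LM_subset unfolding forms_eq_monspan by blast
qed

theorem kd_bound:
  fixes V :: "'k::field_char_0 mpoly set"
  assumes V: "mpoly.subspace V" "V \<subseteq> forms n d" and n: "2 \<le> n" and p: "p = 1 \<or> p = 2"
  shows "kd p n V \<le> lexsum n p (mpoly.dim V)"
proof -
  note L = dim_forms_subspace[OF V]
  obtain A where A: "lexseg n d A" "card A = card (LM V)"
    using lexseg_exists[OF card_mono[OF finite_Mon L(4)]] by blast
  have "kd p n V \<le> kd p n (monspan (LM V) :: 'k mpoly set)" by (rule kd_LM[OF V(1) L(1)])
  also have "\<dots> \<le> mxsum p A" by (rule kd_monspan_bound[OF L(4) A p])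
  also have "\<dots> = lexsum n p (mpoly.dim V)" using lexsum_eq[OF n A(1)] A(2) L(3) by simp
  finally show ?thesis .
qed

section \<open>Superadditivity of the lex bound\<close>

text \<open>Syzygies are bounded below by growth alone: sets that grow as a lex segment does, in two
  steps, have at least its number of syzygies.\<close>

lemma kd_ge_mxsum:
  assumes n: "0 < n" and M: "finite M" and A: "lexseg n d A" and p: "p = 1 \<or> p = 2"
    and c: "card M = card A" "card (up n M) = card (up n A)" "card (up n (up n M)) = card (up n (up n A))"
  shows "mxsum p A \<le> kd p n (monspan M :: 'k::field_char_0 mpoly set)"
proof (cases "p = 1")
  case True
  have "kd 1 n (monspan M :: 'k mpoly set) + card (up n M) = n * card M" by (rule kd_1_monspan[OF M])
  moreover have "card (up n A) + mxsum 1 A = n * card A" by (rule card_up_lexseg[OF n A])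
  ultimately show ?thesis unfolding True using c by simp
next
  case False
  then have p2: "p = 2" using p by simp
  have "mpoly.dim (R1 n (R1 n (monspan M :: 'k mpoly set))) + (n choose 2) * mpoly.dim (monspan M :: 'k mpoly set)
    \<le> n * mpoly.dim (R1 n (monspan M :: 'k mpoly set)) + kd 2 n (monspan M :: 'k mpoly set)"
    by (rule R2_bound[OF monspan_subspace monspan_fin_dim[OF M]])
  then have "card (up n (up n A)) + (n choose 2) * card A \<le> n * card (up n A) + kd 2 n (monspan M :: 'k mpoly set)"
    by (simp add: R1_monspan dim_monspan M finite_up c)
  moreover have "card (up n (up n A)) + mxsum 1 (up n A) = n * card (up n A)"
    by (rule card_up_lexseg[OF n lexseg_up[OF n A]])
  moreover have "mxsum 1 (up n A) + mxsum 2 A = (n choose 2) * card A" by (rule mxsum_up_lexseg[OF n A])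
  ultimately show ?thesis unfolding p2 by linarith
qed

definition swap01 :: "nat \<Rightarrow> nat" where
  "swap01 i = (if i = 0 then 1 else if i = 1 then 0 else i)"

lemma swap01_swap01 [simp]: "swap01 (swap01 i) = i"
  by (auto simp: swap01_def)

lemma inj_swap01: "inj swap01"
  by (rule injI) (metis swap01_swap01)

text \<open>Exchanging $x_0$ and $x_1$; it serves to place two lex segments in one degree so that one
  lies in the multiples of $x_0^a$ and the other in those of $x_1^b$.\<close>

definition swapx :: "expo \<Rightarrow> expo" where
  "swapx p = Poly_Mapping.map_key swap01 p"

lemma lookup_swapx: "lookup (swapx p) i = lookup p (swap01 i)"
  unfolding swapx_def map_key.rep_eq[OF inj_swap01] by simp

lemma swapx_swapx [simp]: "swapx (swapx p) = p"
  by (rule poly_mapping_eqI) (simp add: lookup_swapx)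

lemma swapx_add: "swapx (p + q) = swapx p + swapx q"
  by (rule poly_mapping_eqI) (simp add: lookup_swapx lookup_add)

lemma swapx_single: "swapx (Poly_Mapping.single i c) = Poly_Mapping.single (swap01 i) c"
  by (rule poly_mapping_eqI) (auto simp: lookup_swapx lookup_single when_def)

lemma inj_swapx: "inj_on swapx A"
  by (rule inj_onI) (metis swapx_swapx)

lemma swap01_less: "2 \<le> n \<Longrightarrow> swap01 i < n \<longleftrightarrow> i < n"
  by (auto simp: swap01_def)

lemma swapx_Mon:
  assumes n: "2 \<le> n" and p: "p \<in> Mon n d"
  shows "swapx p \<in> Mon n d"
proof -
  have ex: "swapx p \<in> exponents n"
    using Mon_exponents[OF p] n by (auto simp: exponents_iff lookup_swapx swap01_def)
  have "tdeg (swapx p) = (\<Sum>i<n. lookup (swapx p) i)"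
    by (rule tdeg_sum) (use ex in \<open>auto simp: exponents_def\<close>)
  also have "\<dots> = (\<Sum>i<n. lookup p i)"
    by (rule sum.reindex_bij_witness[of _ swap01 swap01]) (auto simp: lookup_swapx swap01_less[OF n])
  also have "\<dots> = tdeg p"
    by (rule tdeg_sum[symmetric]) (use Mon_exponents[OF p] in \<open>auto simp: exponents_def\<close>)
  finally show ?thesis using ex Mon_tdeg[OF p] by (simp add: Mon_def)
qed

lemma up_swapx:
  assumes n: "2 \<le> n"
  shows "up n (swapx ` A) = swapx ` up n A"
proof
  show "up n (swapx ` A) \<subseteq> swapx ` up n A"
  proof
    fix w assume "w \<in> up n (swapx ` A)"
    then obtain u i where u: "u \<in> A" "i < n" "w = swapx u + unit_expo i" by (auto elim!: upE)
    have "w = swapx (u + unit_expo (swap01 i))" by (simp add: u(3) swapx_add swapx_single)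
    moreover have "u + unit_expo (swap01 i) \<in> up n A"
      by (rule upI[OF u(1)]) (simp add: swap01_less[OF n] u(2))
    ultimately show "w \<in> swapx ` up n A" by (rule image_eqI)
  qed
  show "swapx ` up n A \<subseteq> up n (swapx ` A)"
  proof
    fix w assume "w \<in> swapx ` up n A"
    then obtain v where v: "v \<in> up n A" "w = swapx v" by (rule imageE)
    from v(1) obtain u i where u: "u \<in> A" "i < n" "v = u + unit_expo i" by (rule upE)
    have "swapx u + unit_expo (swap01 i) \<in> up n (swapx ` A)"
      by (rule upI) (use u swap01_less[OF n] in auto)
    then show "w \<in> up n (swapx ` A)" by (simp add: v(2) u(3) swapx_add swapx_single)
  qed
qed

lemma lexsum_obtain:
  assumes "2 \<le> n" "m \<le> d"
  obtains A where "lexseg n d A" "card A = m" "mxsum p A = lexsum n p m"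
proof -
  have "m \<le> card (Mon n d)" using card_Mon_ge[OF assms(1), of d] assms(2) by simp
  then obtain A where A: "lexseg n d A" "card A = m" using lexseg_exists by blast
  show ?thesis by (rule that[OF A]) (use lexsum_eq[OF assms(1) A(1)] A(2) in simp)
qed

text \<open>Let \<open>A\<close>, \<open>B\<close> be lex segments of sizes \<open>a\<close>, \<open>b\<close>, in degrees in which they contain
  $x_0^a R_k$ and $x_0^b R_k$. The sets $x_1^b A$ and $x_0^a B'$, where $B'$ is \<open>B\<close> with
  $x_0$ and $x_1$ exchanged, lie in one degree and meet in $x_0^a x_1^b R_k$. The claim is the
  modular inequality for syzygies over the union and the intersection, with the union bounded by
  the lex segment of its size.\<close>

lemma lexsum_superadd:
  assumes n: "2 \<le> n" and p: "p = 1 \<or> p = 2"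
    and c: "card (Mon n k) \<le> a" "card (Mon n k) \<le> b"
  shows "lexsum n p a + lexsum n p b \<le> lexsum n p (a + b - card (Mon n k)) + lexsum n p (card (Mon n k))"
proof -
  have n0: "0 < n" using n by simp
  obtain A where A: "lexseg n (a + k) A" "card A = a" "mxsum p A = lexsum n p a"
    by (rule lexsum_obtain[OF n, of a "a + k" p]) simp_all
  obtain B where B: "lexseg n (b + k) B" "card B = b" "mxsum p B = lexsum n p b"
    by (rule lexsum_obtain[OF n, of b "b + k" p]) simp_all
  let ?S = "Mon n k" and ?x = "Poly_Mapping.single 0 a :: expo" and ?y = "Poly_Mapping.single (Suc 0) b :: expo"
  let ?x' = "Poly_Mapping.single 0 b :: expo"
  have SA: "(+) ?x ` ?S \<subseteq> A"
    by (rule lexseg_le[OF lexseg_translate[OF n0 lexseg_Mon] A(1)]) (simp add: card_translate A(2) c)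
  have SB: "(+) ?x' ` ?S \<subseteq> B"
    by (rule lexseg_le[OF lexseg_translate[OF n0 lexseg_Mon] B(1)]) (simp add: card_translate B(2) c)
  have AM: "A \<subseteq> Mon n (a + k)" and BM: "B \<subseteq> Mon n (b + k)"
    by (rule lexseg_subset[OF A(1)], rule lexseg_subset[OF B(1)])
  have finA: "finite A" and finB: "finite B" by (rule lexseg_finite[OF A(1)], rule lexseg_finite[OF B(1)])
  have xM: "?x \<in> Mon n a" and yM: "?y \<in> Mon n b" using n by (simp_all add: Mon_def single_exponents)
  define M where "M = (+) ?y ` A"
  define N where "N = (+) ?x ` swapx ` B"
  let ?D = "a + b + k"
  have MM: "M \<subseteq> Mon n ?D"
  proof
    fix w assume "w \<in> M"
    then obtain u where u: "u \<in> A" "w = ?y + u" unfolding M_def by blast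
    then have "w \<in> Mon n (b + (a + k))" using Mon_add[OF yM subsetD[OF AM]] by simp
    then show "w \<in> Mon n ?D" by (simp add: add.commute add.left_commute)
  qed
  have NM: "N \<subseteq> Mon n ?D"
  proof
    fix w assume "w \<in> N"
    then obtain u where u: "u \<in> B" "w = ?x + swapx u" unfolding N_def by blast
    then have "w \<in> Mon n (a + (b + k))" using Mon_add[OF xM swapx_Mon[OF n subsetD[OF BM]]] by simp
    then show "w \<in> Mon n ?D" by (simp add: add.assoc)
  qed
  have finM: "finite M" and finN: "finite N" using finA finB by (simp_all add: M_def N_def)
  have MN: "M \<inter> N = (+) (?x + ?y) ` ?S"
  proof
    show "M \<inter> N \<subseteq> (+) (?x + ?y) ` ?S"
    proof
      fix w assume w: "w \<in> M \<inter> N"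
      then obtain u v where uv: "w = ?y + u" "w = ?x + v" unfolding M_def N_def by blast
      have "b \<le> lookup w 1" unfolding uv(1) by (simp add: lookup_add)
      moreover have "a \<le> lookup w 0" unfolding uv(2) by (simp add: lookup_add)
      ultimately have e: "w = (?x + ?y) + (w - (?x + ?y))"
        by (intro poly_mapping_eqI) (auto simp: lookup_add lookup_minus lookup_single when_def)
      have "w \<in> Mon n ?D" using w MM by blast
      then have "(?x + ?y) + (w - (?x + ?y)) \<in> Mon n ?D" using e by simp
      then have "w - (?x + ?y) \<in> ?S"
        unfolding Mon_def mem_Collect_eq tdeg_add expo_add_iff by simp
      then show "w \<in> (+) (?x + ?y) ` ?S" using e by (rule image_eqI[rotated])
    qed
    show "(+) (?x + ?y) ` ?S \<subseteq> M \<inter> N"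
    proof
      fix w assume "w \<in> (+) (?x + ?y) ` ?S"
      then obtain s where s: "s \<in> ?S" "w = ?x + ?y + s" by blast
      have "?x + s \<in> A" using SA s(1) by blast
      then have "?y + (?x + s) \<in> M" unfolding M_def by blast
      moreover have "?x' + swapx s \<in> B" using SB swapx_Mon[OF n s(1)] by blast
      then have "?x + swapx (?x' + swapx s) \<in> N" unfolding N_def by blast
      ultimately show "w \<in> M \<inter> N"
        by (simp add: s(2) swapx_add swapx_single swap01_def add.assoc add.left_commute)
    qed
  qed
  have cM: "card M = a" by (simp add: M_def card_translate A(2))
  have cN: "card N = b" by (simp add: N_def card_translate card_image[OF inj_swapx] B(2))
  have cI: "card (M \<inter> N) = card ?S" unfolding MN by (rule card_translate)
  have cU: "card (M \<union> N) = a + b - card ?S" using card_Un_Int[OF finM finN] cM cN cI by simp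
  \<comment> \<open>The inequality is about numbers only, so any field of characteristic zero will do.\<close>
  have up_bound: "kd p n (monspan X :: rat mpoly set) \<le> lexsum n p (card X)" if "X \<subseteq> Mon n ?D" for X
  proof -
    have "finite X" by (rule finite_subset[OF that finite_Mon])
    then have d: "mpoly.dim (monspan X :: rat mpoly set) = card X" by (rule dim_monspan)
    have "(monspan X :: rat mpoly set) \<subseteq> forms n ?D"
      unfolding forms_eq_monspan using that by (auto simp: monspan_iff)
    from kd_bound[OF monspan_subspace this n p] show ?thesis unfolding d .
  qed
  have "lexsum n p a \<le> kd p n (monspan M :: rat mpoly set)"
    unfolding A(3)[symmetric]
    by (rule kd_ge_mxsum[OF n0 finM A(1) p]) (simp_all add: M_def up_translate card_translate)
  moreover have "lexsum n p b \<le> kd p n (monspan N :: rat mpoly set)"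
    unfolding B(3)[symmetric]
    by (rule kd_ge_mxsum[OF n0 finN B(1) p])
      (simp_all add: N_def up_translate card_translate up_swapx[OF n] card_image[OF inj_swapx])
  moreover have "kd p n (monspan M :: rat mpoly set) + kd p n (monspan N :: rat mpoly set)
    \<le> kd p n (monspan (M \<union> N) :: rat mpoly set) + kd p n (monspan (M \<inter> N) :: rat mpoly set)"
    by (rule kd_union[OF finM finN])
  moreover have "kd p n (monspan (M \<union> N) :: rat mpoly set) \<le> lexsum n p (a + b - card ?S)"
    using up_bound[of "M \<union> N"] MM NM cU by simp
  moreover have "kd p n (monspan (M \<inter> N) :: rat mpoly set) \<le> lexsum n p (card ?S)"
    using up_bound[of "M \<inter> N"] MM cI by (metis le_infI1)
  ultimately show ?thesis by linarith
qed

lemma lexsum_mono: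
  assumes n: "2 \<le> n" and "a \<le> b"
  shows "lexsum n p a \<le> lexsum n p b"
proof -
  obtain A where A: "lexseg n b A" "card A = a" "mxsum p A = lexsum n p a"
    by (rule lexsum_obtain[OF n assms(2)])
  obtain B where B: "lexseg n b B" "card B = b" "mxsum p B = lexsum n p b"
    by (rule lexsum_obtain[OF n order_refl])
  have "A \<subseteq> B" by (rule lexseg_le[OF A(1) B(1)]) (simp add: A(2) B(2) assms(2))
  then have "mxsum p A \<le> mxsum p B"
    unfolding mxsum_def by (intro sum_mono2 lexseg_finite[OF B(1)]) auto
  then show ?thesis using A(3) B(3) by simp
qed

lemma lexsum_small:
  assumes n: "2 \<le> n" and p: "p = 1 \<or> p = 2"
  shows "lexsum n p 0 = 0" "lexsum n p 1 = 0"
proof -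
  have "mxsum p {} = lexsum n p (card ({} :: expo set))" by (rule lexsum_eq[OF n lexseg_empty[of n 0]])
  then show "lexsum n p 0 = 0" by (simp add: mxsum_def)
  have "mxsum p (Mon n 0) = lexsum n p (card (Mon n 0))" by (rule lexsum_eq[OF n lexseg_Mon])
  then show "lexsum n p 1 = 0" using p by (auto simp: mxsum_def mxv_def binomial_eq_0)
qed

lemma lexsum_add:
  assumes n: "2 \<le> n" and p: "p = 1 \<or> p = 2"
  shows "lexsum n p a + lexsum n p b \<le> lexsum n p (a + b)"
proof (cases "a = 0 \<or> b = 0")
  case True
  then show ?thesis using lexsum_small(1)[OF n p] by auto
next
  case False
  have "lexsum n p a + lexsum n p b \<le> lexsum n p (a + b - 1) + lexsum n p 1"
    using lexsum_superadd[OF n p, of 0 a b] False by simp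
  also have "\<dots> \<le> lexsum n p (a + b)"
    using lexsum_small(2)[OF n p] lexsum_mono[OF n, of "a + b - 1" "a + b" p] by simp
  finally show ?thesis .
qed

text \<open>The values \<open>vs\<close> are merged into \<open>u\<close> one after the other, by superadditivity. For each \<open>k\<close> in
  \<open>ks\<close> a copy of $R_k$ is split off; the values in excess of \<open>ks\<close> are merged with nothing split off.\<close>

lemma lexsum_accumulate:
  assumes n: "2 \<le> n" and p: "p = 1 \<or> p = 2"
  shows "length ks \<le> length vs \<Longrightarrow> (\<forall>i<length ks. card (Mon n (ks ! i)) \<le> vs ! i \<and> card (Mon n (ks ! i)) \<le> u) \<Longrightarrow>
    sum_list (map (\<lambda>k. card (Mon n k)) ks) \<le> sum_list vs \<and>
    lexsum n p u + sum_list (map (lexsum n p) vs)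
      \<le> lexsum n p (u + sum_list vs - sum_list (map (\<lambda>k. card (Mon n k)) ks))
        + sum_list (map (\<lambda>k. lexsum n p (card (Mon n k))) ks)"
proof (induction vs arbitrary: ks u)
  case Nil
  then show ?case by simp
next
  case (Cons v vs)
  show ?case
  proof (cases ks)
    case Nil
    have IH: "lexsum n p (u + v) + sum_list (map (lexsum n p) vs) \<le> lexsum n p (u + v + sum_list vs)"
      using Cons.IH[of "[]" "u + v"] by simp
    then show ?thesis using lexsum_add[OF n p, of u v] Nil by (simp add: add.assoc)
  next
    case (Cons k ks')
    let ?c = "card (Mon n k)"
    have c: "?c \<le> v" "?c \<le> u" using Cons.prems(2) Cons by auto
    have IH: "sum_list (map (\<lambda>k. card (Mon n k)) ks') \<le> sum_list vs \<and>
      lexsum n p (u + v - ?c) + sum_list (map (lexsum n p) vs)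
      \<le> lexsum n p (u + v - ?c + sum_list vs - sum_list (map (\<lambda>k. card (Mon n k)) ks'))
        + sum_list (map (\<lambda>k. lexsum n p (card (Mon n k))) ks')"
    proof (rule Cons.IH)
      show "length ks' \<le> length vs" using Cons.prems(1) Cons by simp
      show "\<forall>i<length ks'. card (Mon n (ks' ! i)) \<le> vs ! i \<and> card (Mon n (ks' ! i)) \<le> u + v - ?c"
      proof (intro allI impI)
        fix i assume "i < length ks'"
        then have "card (Mon n (ks' ! i)) \<le> vs ! i \<and> card (Mon n (ks' ! i)) \<le> u"
          using Cons.prems(2)[rule_format, of "Suc i"] Cons by simp
        then show "card (Mon n (ks' ! i)) \<le> vs ! i \<and> card (Mon n (ks' ! i)) \<le> u + v - ?c"
          using c by linarith
      qed
    qed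
    have "lexsum n p u + lexsum n p v \<le> lexsum n p (u + v - ?c) + lexsum n p ?c"
      by (rule lexsum_superadd[OF n p c(2,1)])
    moreover have "u + v - ?c + sum_list vs - sum_list (map (\<lambda>k. card (Mon n k)) ks')
        = u + sum_list (v # vs) - sum_list (map (\<lambda>k. card (Mon n k)) ks)"
      using c by (simp add: Cons)
    ultimately show ?thesis using IH c by (simp add: Cons)
  qed
qed

section \<open>Splitting a space by coordinate maps\<close>

text \<open>The condition on \<open>\<phi>\<close> that makes syzygies over \<open>V\<close> split into syzygies over its kernel and
  its image. It is not linearity over $R$, for \<open>V\<close> is no module; \<open>\<phi>\<close> must respect those relations with
  quadratic coefficients that hold inside \<open>V\<close>.\<close>

definition compat :: "nat \<Rightarrow> 'k::field mpoly set \<Rightarrow> ('k mpoly \<Rightarrow> 'k mpoly) \<Rightarrow> bool" where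
  "compat n V \<phi> \<longleftrightarrow> (\<forall>(B :: (nat \<times> nat) set) c v. finite B \<and> (\<forall>b\<in>B. v b \<in> V \<and> c b \<in> forms n 2) \<and>
      (\<Sum>b\<in>B. c b * v b) = 0 \<longrightarrow> (\<Sum>b\<in>B. c b * \<phi> (v b)) = 0)"

lemma compat_subset: "compat n V \<phi> \<Longrightarrow> W \<subseteq> V \<Longrightarrow> compat n W \<phi>"
  unfolding compat_def by (meson subsetD)

lemma kd_exact_compat:
  assumes "mpoly.subspace V" "mpoly.fin_dim V" "lin_on pscale pscale V \<phi>" "compat n V \<phi>"
  shows "kd p n V \<le> kd p n {f \<in> V. \<phi> f = 0} + kd p n (\<phi> ` V)"
proof (rule kd_exact[OF assms(1-3)])
  fix B :: "(nat \<times> nat) set" and c v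
  assume a: "finite B" "\<And>b. b \<in> B \<Longrightarrow> v b \<in> V" "\<And>b. b \<in> B \<Longrightarrow> c b \<in> forms n 2" "(\<Sum>b\<in>B. c b * v b) = 0"
  show "(\<Sum>b\<in>B. c b * \<phi> (v b)) = 0"
    by (rule assms(4)[unfolded compat_def, rule_format, of B v c]) (use a in simp)
qed

lemma kd_zero_space:
  assumes "mpoly.subspace V" "V \<subseteq> {0}"
  shows "kd p n V = 0"
proof -
  have V: "V = {0}" using assms mpoly.subspace_0 by blast
  have "K1 n V = {0}"
  proof
    show "K1 n V \<subseteq> {0}"
    proof
      fix v assume v: "v \<in> K1 n V"
      have "v i = 0" for i using v unfolding V K1_iff by (cases "i < n") auto
      then show "v \<in> {0}" by (auto simp: fun_eq_iff)
    qed
  qed (auto simp: V K1_iff)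
  moreover have "K2 n V = {0}"
  proof
    show "K2 n V \<subseteq> {0}"
    proof
      fix v assume v: "v \<in> K2 n V"
      have "v (i,j) = 0" for i j using v unfolding V K2_iff by (cases "i < n \<and> j < n") auto
      then show "v \<in> {0}" by (auto simp: fun_eq_iff)
    qed
  qed (auto simp: V K2_iff)
  ultimately show ?thesis by (simp add: kd_def)
qed

text \<open>Split \<open>V\<close> along a jointly injective list of coordinate maps: \<open>us ! i\<close> is the dimension of the
  image under the \<open>i\<close>-th map of the common kernel of the maps before it. The last clause identifies
  spaces that this number is at least as large as.\<close>

lemma kd_coordinates:
  fixes V :: "'k::field_char_0 mpoly set"
  assumes n: "2 \<le> n" and p: "p = 1 \<or> p = 2"
  shows "mpoly.subspace V \<Longrightarrow> mpoly.fin_dim V \<Longrightarrow>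
    (\<forall>\<phi>\<in>set \<Phi>. lin_on pscale pscale V \<phi> \<and> compat n V \<phi> \<and> \<phi> ` V \<subseteq> forms n e) \<Longrightarrow>
    (\<forall>v\<in>V. (\<forall>\<phi>\<in>set \<Phi>. \<phi> v = 0) \<longrightarrow> v = 0) \<Longrightarrow>
    \<exists>us. length us = length \<Phi> \<and> sum_list us = mpoly.dim V \<and> kd p n V \<le> sum_list (map (lexsum n p) us) \<and>
      (\<forall>i<length \<Phi>. \<forall>W. mpoly.subspace W \<and> W \<subseteq> V \<and> (\<forall>w\<in>W. \<forall>j<i. (\<Phi> ! j) w = 0) \<and>
         (\<forall>w\<in>W. (\<Phi> ! i) w = 0 \<longrightarrow> w = 0) \<longrightarrow> mpoly.dim W \<le> us ! i)"
proof (induction \<Phi> arbitrary: V)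
  case Nil
  then have V: "V \<subseteq> {0}" by auto
  then have "V = {0}" using mpoly.subspace_0[OF Nil.prems(1)] by blast
  then have "mpoly.dim V = 0" by simp
  then show ?case using kd_zero_space[OF Nil.prems(1) V] by simp
next
  case (Cons \<phi> \<Phi>)
  note sub = Cons.prems(1) and fd = Cons.prems(2)
  have \<phi>: "lin_on pscale pscale V \<phi>" "compat n V \<phi>" "\<phi> ` V \<subseteq> forms n e" using Cons.prems(3) by simp_all
  let ?V' = "{v \<in> V. \<phi> v = 0}"
  have V': "?V' \<subseteq> V" by blast
  note rn = mm.rank_nullity[OF \<phi>(1) sub fd]
  have "\<exists>us. length us = length \<Phi> \<and> sum_list us = mpoly.dim ?V' \<and> kd p n ?V' \<le> sum_list (map (lexsum n p) us) \<and>
      (\<forall>i<length \<Phi>. \<forall>W. mpoly.subspace W \<and> W \<subseteq> ?V' \<and> (\<forall>w\<in>W. \<forall>j<i. (\<Phi> ! j) w = 0) \<and>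
         (\<forall>w\<in>W. (\<Phi> ! i) w = 0 \<longrightarrow> w = 0) \<longrightarrow> mpoly.dim W \<le> us ! i)"
  proof (rule Cons.IH)
    show "mpoly.subspace ?V'" by (rule mm.lin_on_subspace_kernel[OF \<phi>(1) sub])
    show "mpoly.fin_dim ?V'" by (rule mpoly.fin_dim_subset[OF fd V'])
    show "\<forall>\<psi>\<in>set \<Phi>. lin_on pscale pscale ?V' \<psi> \<and> compat n ?V' \<psi> \<and> \<psi> ` ?V' \<subseteq> forms n e"
    proof
      fix \<psi> assume "\<psi> \<in> set \<Phi>"
      then have "lin_on pscale pscale V \<psi>" "compat n V \<psi>" "\<psi> ` V \<subseteq> forms n e"
        using Cons.prems(3) by simp_all
      then show "lin_on pscale pscale ?V' \<psi> \<and> compat n ?V' \<psi> \<and> \<psi> ` ?V' \<subseteq> forms n e"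
        using mm.lin_on_subset[OF _ V'] compat_subset[OF _ V'] by auto
    qed
    show "\<forall>v\<in>?V'. (\<forall>\<psi>\<in>set \<Phi>. \<psi> v = 0) \<longrightarrow> v = 0" using Cons.prems(4) by simp
  qed
  then obtain us where us: "length us = length \<Phi>" "sum_list us = mpoly.dim ?V'"
    "kd p n ?V' \<le> sum_list (map (lexsum n p) us)"
    "\<And>i W. i < length \<Phi> \<Longrightarrow> mpoly.subspace W \<Longrightarrow> W \<subseteq> ?V' \<Longrightarrow> (\<forall>w\<in>W. \<forall>j<i. (\<Phi> ! j) w = 0) \<Longrightarrow>
         (\<forall>w\<in>W. (\<Phi> ! i) w = 0 \<longrightarrow> w = 0) \<Longrightarrow> mpoly.dim W \<le> us ! i" by auto
  have imsub: "mpoly.subspace (\<phi> ` V)" by (rule mm.lin_on_subspace_image[OF \<phi>(1) sub])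
  show ?case
  proof (intro exI[of _ "mpoly.dim (\<phi> ` V) # us"] conjI allI impI)
    show "length (mpoly.dim (\<phi> ` V) # us) = length (\<phi> # \<Phi>)" using us(1) by simp
    show "sum_list (mpoly.dim (\<phi> ` V) # us) = mpoly.dim V" using rn(1) us(2) by simp
    have "kd p n V \<le> kd p n ?V' + kd p n (\<phi> ` V)" by (rule kd_exact_compat[OF sub fd \<phi>(1,2)])
    moreover have "kd p n (\<phi> ` V) \<le> lexsum n p (mpoly.dim (\<phi> ` V))"
      by (rule kd_bound[OF imsub \<phi>(3) n p])
    ultimately show "kd p n V \<le> sum_list (map (lexsum n p) (mpoly.dim (\<phi> ` V) # us))" using us(3) by simp
    fix i W
    assume i: "i < length (\<phi> # \<Phi>)" and W: "mpoly.subspace W \<and> W \<subseteq> V \<and> (\<forall>w\<in>W. \<forall>j<i. ((\<phi> # \<Phi>) ! j) w = 0) \<and>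
         (\<forall>w\<in>W. ((\<phi> # \<Phi>) ! i) w = 0 \<longrightarrow> w = 0)"
    show "mpoly.dim W \<le> (mpoly.dim (\<phi> ` V) # us) ! i"
    proof (cases i)
      case 0
      have "mpoly.dim W \<le> mpoly.dim (\<phi> ` V)"
      proof (rule mm.dim_le_inj[OF mm.lin_on_subset[OF \<phi>(1)] _ mpoly.fin_dim_subset[OF fd] _ _ rn(2)])
        show "x = 0" if "x \<in> W" "\<phi> x = 0" for x using W that 0 by simp
      qed (use W in auto)
      then show ?thesis using 0 by simp
    next
      case (Suc i')
      have "mpoly.dim W \<le> us ! i'"
      proof (rule us(4))
        show "i' < length \<Phi>" using i Suc by simp
        show "mpoly.subspace W" using W by blast
        show "W \<subseteq> ?V'" using W Suc by force
        show "\<forall>w\<in>W. \<forall>j<i'. (\<Phi> ! j) w = 0"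
        proof (intro ballI allI impI)
          fix w j assume "w \<in> W" "j < i'"
          then have "((\<phi> # \<Phi>) ! Suc j) w = 0" using W Suc by blast
          then show "(\<Phi> ! j) w = 0" by simp
        qed
        show "\<forall>w\<in>W. (\<Phi> ! i') w = 0 \<longrightarrow> w = 0" using W Suc by simp
      qed
      then show ?thesis using Suc by simp
    qed
  qed
qed

section \<open>Coordinates over a common denominator\<close>

text \<open>Linear independence over $R$, tested on coefficients that are forms of one degree at most
  \<open>E\<close>.\<close>

definition small_indep :: "nat \<Rightarrow> nat \<Rightarrow> 'k::field mpoly set \<Rightarrow> bool" where
  "small_indep n E G \<longleftrightarrow> (\<forall>e\<le>E. \<forall>h. (\<forall>g\<in>G. h g \<in> forms n e) \<and> (\<Sum>g\<in>G. h g * g) = 0 \<longrightarrow> (\<forall>g\<in>G. h g = 0))"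

lemma small_indepD:
  "small_indep n E G \<Longrightarrow> e \<le> E \<Longrightarrow> (\<And>g. g \<in> G \<Longrightarrow> h g \<in> forms n e) \<Longrightarrow> (\<Sum>g\<in>G. h g * g) = 0 \<Longrightarrow> g \<in> G \<Longrightarrow> h g = 0"
  unfolding small_indep_def by blast

lemma small_indep_mono: "small_indep n E G \<Longrightarrow> E' \<le> E \<Longrightarrow> small_indep n E' G"
  unfolding small_indep_def by (meson le_trans)

lemma small_indep_unique:
  assumes "small_indep n E G" "e \<le> E" "\<And>g. g \<in> G \<Longrightarrow> h g \<in> forms n e" "\<And>g. g \<in> G \<Longrightarrow> h' g \<in> forms n e"
    "(\<Sum>g\<in>G. h g * g) = (\<Sum>g\<in>G. h' g * g)" "g \<in> G"
  shows "h g = h' g"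
proof -
  have "h g - h' g = 0"
  proof (rule small_indepD[OF assms(1,2), of "\<lambda>g. h g - h' g"])
    show "h g - h' g \<in> forms n e" if "g \<in> G" for g
      by (rule mpoly.subspace_diff[OF forms_subspace assms(3)[OF that] assms(4)[OF that]])
    show "(\<Sum>g\<in>G. (h g - h' g) * g) = 0" using assms(5) by (simp add: left_diff_distrib sum_subtractf)
  qed (rule assms(6))
  then show ?thesis by simp
qed

text \<open>The degree up to which a set must be independent if \<open>c\<close> of \<open>m\<close> vectors are not yet in it, in
  order that a common denominator \<open>r\<close> for these vectors exists with independence left up to degree
  $\deg r + T$: either one of the vectors can be added, or each of the \<open>m\<close> has a denominator of degree
  at most \<open>den_bound m T c\<close>, and one multiplies these.\<close>

fun den_bound :: "nat \<Rightarrow> nat \<Rightarrow> nat \<Rightarrow> nat" where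
  "den_bound m T 0 = T"
| "den_bound m T (Suc c) = m * den_bound m T c + T"

lemma den_bound_mono:
  assumes "m \<le> m'" "c \<le> c'"
  shows "den_bound m T c \<le> den_bound m' T c'"
proof -
  have T: "T \<le> den_bound m T c" for m c by (induction c) auto
  have "den_bound m T c \<le> den_bound m' T (c + k)" for k
  proof (induction c)
    case 0
    show ?case using T by simp
  next
    case (Suc c)
    then show ?case using assms(1) by (simp add: mult_le_mono)
  qed
  from this[of "c' - c"] show ?thesis using assms(2) by simp
qed

lemma one_forms: "(1 :: 'k::field mpoly) \<in> forms n 0"
  by (simp add: forms_iff)

lemma zero_forms: "0 \<in> forms n d"
  by (rule mpoly.subspace_0[OF forms_subspace])

lemma forms_prod:
  fixes r :: "'a \<Rightarrow> 'k::field mpoly"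
  assumes "\<And>b. b \<in> A \<Longrightarrow> r b \<in> forms n (e b)"
  shows "prod r A \<in> forms n (sum e A)"
  using assms
proof (induction A rule: infinite_finite_induct)
  case (insert b A)
  have "r b * prod r A \<in> forms n (e b + sum e A)"
    by (rule forms_mult) (use insert in simp_all)
  then show ?case using insert.hyps by simp
qed (simp_all add: one_forms)

text \<open>A basis of the space spanned by \<open>Bs\<close> over the fraction field, except that only relations in
  low degree are available. Vectors of \<open>Bs\<close> are added to \<open>G\<close> as long as enough independence is left;
  when none can be added, every vector has a multiple in the module generated by \<open>G\<close>.\<close>

lemma common_denominator:
  fixes G :: "'k::field mpoly set"
  assumes Bs: "finite Bs" "card Bs \<le> m"
  shows "finite G \<Longrightarrow> card (Bs - G) \<le> c \<Longrightarrow> small_indep n (den_bound m T c) G \<Longrightarrow>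
    \<exists>G' e r. G \<subseteq> G' \<and> finite G' \<and> small_indep n (e + T) G' \<and> r \<in> forms n e \<and> r \<noteq> 0 \<and>
      (\<forall>b\<in>Bs. \<exists>h. (\<forall>g\<in>G'. h g \<in> forms n e) \<and> r * b = (\<Sum>g\<in>G'. h g * g))"
proof (induction c arbitrary: G)
  case 0
  then have BG: "Bs \<subseteq> G" using Bs by simp
  have "\<exists>h. (\<forall>g\<in>G. h g \<in> forms n 0) \<and> 1 * b = (\<Sum>g\<in>G. h g * g)" if "b \<in> Bs" for b
  proof (intro exI[of _ "\<lambda>g. if g = b then 1 else 0"] conjI ballI)
    show "(if g = b then 1 else 0 :: 'k mpoly) \<in> forms n 0" for g by (simp add: one_forms zero_forms)
    have "(\<Sum>g\<in>G. (if g = b then 1 else 0) * g) = (\<Sum>g\<in>G. if g = b then g else 0)"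
      by (rule sum.cong) simp_all
    also have "\<dots> = b" using 0(1) BG that by auto
    finally show "1 * b = (\<Sum>g\<in>G. (if g = b then 1 else 0) * g)" by simp
  qed
  then show ?case
    using 0 one_forms by (intro exI[of _ G] exI[of _ 0] exI[of _ 1]) simp
next
  case (Suc c)
  show ?case
  proof (cases "\<exists>b\<in>Bs - G. small_indep n (den_bound m T c) (insert b G)")
    case True
    then obtain b where b: "b \<in> Bs - G" "small_indep n (den_bound m T c) (insert b G)" by blast
    have "card (Bs - insert b G) < card (Bs - G)"
      by (rule psubset_card_mono) (use b Bs in auto)
    then have "card (Bs - insert b G) \<le> c" using Suc.prems(2) by simp
    from Suc.IH[OF _ this b(2)] Suc.prems(1) obtain G' e r where G': "insert b G \<subseteq> G'" "finite G'"
      "small_indep n (e + T) G'" "r \<in> forms n e" "r \<noteq> 0"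
      "\<forall>b\<in>Bs. \<exists>h. (\<forall>g\<in>G'. h g \<in> forms n e) \<and> r * b = (\<Sum>g\<in>G'. h g * g)" by auto
    then have "G \<subseteq> G'" by blast
    then show ?thesis using G' by blast
  next
    case False
    let ?E = "den_bound m T c"
    have each: "\<exists>x. fst x \<le> ?E \<and> fst (snd x) \<in> forms n (fst x) \<and> fst (snd x) \<noteq> 0 \<and>
        (\<forall>g\<in>G. snd (snd x) g \<in> forms n (fst x)) \<and> fst (snd x) * b = (\<Sum>g\<in>G. snd (snd x) g * g)"
      if b: "b \<in> Bs" for b
    proof (cases "b \<in> G")
      case True
      have "(\<Sum>g\<in>G. (if g = b then 1 else 0) * g) = (\<Sum>g\<in>G. if g = b then g else 0)"
        by (rule sum.cong) simp_all
      also have "\<dots> = b" using Suc.prems(1) True by simp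
      finally show ?thesis
        by (intro exI[of _ "(0, 1, \<lambda>g. if g = b then 1 else 0)"]) (simp add: one_forms zero_forms)
    next
      case nb: False
      then have "\<not> small_indep n ?E (insert b G)" using False b by blast
      then obtain e h where eh: "e \<le> ?E" "\<forall>g\<in>insert b G. h g \<in> forms n e"
        "(\<Sum>g\<in>insert b G. h g * g) = 0" "\<exists>g\<in>insert b G. h g \<noteq> 0"
        unfolding small_indep_def by blast
      have s: "h b * b + (\<Sum>g\<in>G. h g * g) = 0" using eh(3) nb Suc.prems(1) by simp
      have hb: "h b \<noteq> 0"
      proof
        assume z: "h b = 0"
        then have s0: "(\<Sum>g\<in>G. h g * g) = 0" using s by simp
        have "e \<le> den_bound m T (Suc c)"
        proof -
          have "0 < card Bs" using b Bs(1) by (auto simp: card_gt_0_iff)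
          then have "0 < m" using Bs(2) by simp
          then have "1 * ?E \<le> m * ?E" by (intro mult_right_mono) simp_all
          then show ?thesis using eh(1) unfolding den_bound.simps by linarith
        qed
        then have "h g = 0" if "g \<in> G" for g
          using small_indepD[OF Suc.prems(3) _ _ s0 that] eh(2) by blast
        then show False using eh(4) z by blast
      qed
      have "h b * b = (\<Sum>g\<in>G. - h g * g)" using s by (simp add: sum_negf eq_neg_iff_add_eq_0)
      moreover have "\<forall>g\<in>G. - h g \<in> forms n e"
        using eh(2) mpoly.subspace_neg[OF forms_subspace] by blast
      ultimately show ?thesis
        using eh(1,2) hb by (intro exI[of _ "(e, h b, \<lambda>g. - h g)"]) simp
    qed
    then obtain x where x: "\<forall>b\<in>Bs. fst (x b) \<le> ?E \<and> fst (snd (x b)) \<in> forms n (fst (x b)) \<and> fst (snd (x b)) \<noteq> 0 \<and>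
        (\<forall>g\<in>G. snd (snd (x b)) g \<in> forms n (fst (x b))) \<and> fst (snd (x b)) * b = (\<Sum>g\<in>G. snd (snd (x b)) g * g)"
      using bchoice[of Bs "\<lambda>b x. fst x \<le> ?E \<and> fst (snd x) \<in> forms n (fst x) \<and> fst (snd x) \<noteq> 0 \<and>
        (\<forall>g\<in>G. snd (snd x) g \<in> forms n (fst x)) \<and> fst (snd x) * b = (\<Sum>g\<in>G. snd (snd x) g * g)"] by blast
    define ee rr hh where "ee b = fst (x b)" and "rr b = fst (snd (x b))" and "hh b = snd (snd (x b))" for b
    have X: "ee b \<le> ?E" "rr b \<in> forms n (ee b)" "rr b \<noteq> 0" "\<And>g. g \<in> G \<Longrightarrow> hh b g \<in> forms n (ee b)"
      "rr b * b = (\<Sum>g\<in>G. hh b g * g)" if "b \<in> Bs" for b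
      using x that by (simp_all add: ee_def rr_def hh_def)
    let ?e = "sum ee Bs" and ?r = "prod rr Bs"
    have "?e \<le> card Bs * ?E" using sum_bounded_above[of Bs ee ?E] X(1) by simp
    also have "\<dots> \<le> m * ?E" using Bs(2) by simp
    finally have le: "?e + T \<le> den_bound m T (Suc c)" by simp
    have "\<exists>h. (\<forall>g\<in>G. h g \<in> forms n ?e) \<and> ?r * b = (\<Sum>g\<in>G. h g * g)" if b: "b \<in> Bs" for b
    proof (intro exI[of _ "\<lambda>g. prod rr (Bs - {b}) * hh b g"] conjI ballI)
      have e: "?e = sum ee (Bs - {b}) + ee b" using sum.remove[OF Bs(1) b, of ee] by simp
      fix g assume g: "g \<in> G"
      show "prod rr (Bs - {b}) * hh b g \<in> forms n ?e"
        unfolding e by (rule forms_mult[OF forms_prod X(4)[OF b g]]) (use X(2) in simp)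
    next
      have "?r * b = prod rr (Bs - {b}) * (rr b * b)"
        using prod.remove[OF Bs(1) b, of rr] by (simp add: mult_ac)
      also have "\<dots> = (\<Sum>g\<in>G. prod rr (Bs - {b}) * hh b g * g)"
        unfolding X(5)[OF b] sum_distrib_left by (simp add: mult.assoc)
      finally show "?r * b = (\<Sum>g\<in>G. prod rr (Bs - {b}) * hh b g * g)" .
    qed
    moreover have "?r \<in> forms n ?e" by (rule forms_prod) (rule X(2))
    moreover have "?r \<noteq> 0" using Bs(1) X(3) by simp
    ultimately show ?thesis
      using Suc.prems(1) small_indep_mono[OF Suc.prems(3) le] by (intro exI[of _ G] exI[of _ ?e] exI[of _ ?r]) simp
  qed
qed

text \<open>The refinement of the lex bound for spaces that contain $R_{k_i} f_i$ for forms $f_i$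
  without relations in low degree. Over a common denominator \<open>r\<close> the elements of \<open>V\<close> have unique
  coordinates with respect to a set that contains the forms $g_i = x_0^{k_i} f_i$, all of one
  degree, and \<open>V\<close> is split along these coordinates. The space $R_{k_i} f_i$ lives on the coordinate of
  $g_i$, and so the \<open>i\<close>-th part has dimension at least that of $R_{k_i}$. Superadditivity merges all parts
  into the first one, leaving for every \<open>i > 0\<close> exactly the share of $R_{k_i}$. The result is the number of
  syzygies of a lex segment together with disjoint multiples of $f_2, f_3, \dots$, which is the shape of
  a component of an LPP ideal.\<close>

theorem kd_regular_bound:
  fixes V :: "'k::field_char_0 mpoly set"
  assumes n: "2 \<le> n" and p: "p = 1 \<or> p = 2" and V: "mpoly.subspace V" "mpoly.fin_dim V"
    and len: "length fs = Suc (length ks)"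
    and inV: "\<And>i q. i < length fs \<Longrightarrow> q \<in> forms n ((k0 # ks) ! i) \<Longrightarrow> q * fs ! i \<in> V"
    and ks: "\<And>k. k \<in> set ks \<Longrightarrow> k \<le> k0"
    and gs: "gs = map (\<lambda>i. pmonom (Poly_Mapping.single 0 ((k0 # ks) ! i)) * fs ! i) [0..<length fs]"
    and dist: "distinct gs"
    and ind: "small_indep n (den_bound (mpoly.dim V) (k0 + 2) (mpoly.dim V)) (set gs)"
  shows "sum_list (map (\<lambda>k. card (Mon n k)) (k0 # ks)) \<le> mpoly.dim V"
    and "kd p n V \<le> lexsum n p (mpoly.dim V - sum_list (map (\<lambda>k. card (Mon n k)) ks))
      + sum_list (map (\<lambda>k. lexsum n p (card (Mon n k))) ks)"
proof -
  \<comment> \<open>Above the degree of the denominator, compatibility with quadratic relations takes degree 2, and the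
    comparison of $x_0^{k_i} q f_i$ with $q g_i$ takes degree at most \<open>k0\<close>.\<close>
  let ?T = "k0 + 2" and ?m = "mpoly.dim V"
  have n0: "0 < n" using n by simp
  have lgs: "length gs = length fs" using gs by simp
  obtain Bs where Bs: "finite Bs" "Bs \<subseteq> V" "mpoly.independent Bs" "V \<subseteq> mpoly.span Bs" "card Bs = mpoly.dim V"
    by (rule mpoly.fin_dim_basis[OF V(2)])
  have "card (Bs - set gs) \<le> ?m" using Bs(1,5) card_mono[of Bs "Bs - set gs"] by auto
  from common_denominator[OF Bs(1) eq_refl[OF Bs(5)] _ this ind] obtain G e r where
    G: "set gs \<subseteq> G" "finite G" and indG: "small_indep n (e + ?T) G" and r: "r \<in> forms n e" "r \<noteq> 0"
    and hB: "\<forall>b\<in>Bs. \<exists>h. (\<forall>g\<in>G. h g \<in> forms n e) \<and> r * b = (\<Sum>g\<in>G. h g * g)" by auto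
  from bchoice[OF hB] obtain hb where
    "\<forall>b\<in>Bs. (\<forall>g\<in>G. hb b g \<in> forms n e) \<and> r * b = (\<Sum>g\<in>G. hb b g * g)" by (rule exE)
  then have hb: "\<And>b g. b \<in> Bs \<Longrightarrow> g \<in> G \<Longrightarrow> hb b g \<in> forms n e"
    "\<And>b. b \<in> Bs \<Longrightarrow> r * b = (\<Sum>g\<in>G. hb b g * g)" by simp_all
  have ex: "\<exists>h. (\<forall>g\<in>G. h g \<in> forms n e) \<and> r * v = (\<Sum>g\<in>G. h g * g)" if "v \<in> V" for v
  proof -
    have "v \<in> mpoly.span Bs" using that Bs(4) by (rule subsetD[rotated])
    then obtain u where u: "v = (\<Sum>b\<in>Bs. pscale (u b) b)"
      unfolding mpoly.span_finite[OF Bs(1)] by (rule imageE)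
    let ?h = "\<lambda>g. \<Sum>b\<in>Bs. pscale (u b) (hb b g)"
    have "?h g \<in> forms n e" if "g \<in> G" for g
      by (intro mpoly.subspace_sum[OF forms_subspace] mpoly.subspace_scale[OF forms_subspace] hb(1) that)
    moreover have "r * v = (\<Sum>g\<in>G. ?h g * g)"
    proof -
      have "r * v = (\<Sum>b\<in>Bs. pscale (u b) (\<Sum>g\<in>G. hb b g * g))"
        unfolding u sum_distrib_left pscale_mult_right by (rule sum.cong[OF refl]) (simp add: hb(2))
      also have "\<dots> = (\<Sum>b\<in>Bs. \<Sum>g\<in>G. pscale (u b) (hb b g) * g)"
        by (simp only: mpoly.scale_sum_right pscale_mult_left)
      also have "\<dots> = (\<Sum>g\<in>G. ?h g * g)" unfolding sum_distrib_right by (rule sum.swap)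
      finally show ?thesis .
    qed
    ultimately show ?thesis by (intro exI[of _ ?h]) simp
  qed
  have "\<forall>v\<in>V. \<exists>h. (\<forall>g\<in>G. h g \<in> forms n e) \<and> r * v = (\<Sum>g\<in>G. h g * g)" by (intro ballI ex)
  from bchoice[OF this] obtain H where
    "\<forall>v\<in>V. (\<forall>g\<in>G. H v g \<in> forms n e) \<and> r * v = (\<Sum>g\<in>G. H v g * g)" by (rule exE)
  then have H: "\<And>v g. v \<in> V \<Longrightarrow> g \<in> G \<Longrightarrow> H v g \<in> forms n e"
    "\<And>v. v \<in> V \<Longrightarrow> r * v = (\<Sum>g\<in>G. H v g * g)" by simp_all
  note unique = small_indep_unique[OF indG]
  have lin: "lin_on pscale pscale V (\<lambda>v. H v g)" if g: "g \<in> G" for g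
  proof (rule mm.lin_onI)
    fix v w assume vw: "v \<in> V" "w \<in> V"
    have vw': "v + w \<in> V" by (rule mpoly.subspace_add[OF V(1) vw])
    show "H (v + w) g = H v g + H w g"
    proof (rule unique[of e "H (v + w)" "\<lambda>g. H v g + H w g"])
      show "(\<Sum>g\<in>G. H (v + w) g * g) = (\<Sum>g\<in>G. (H v g + H w g) * g)"
        unfolding H(2)[OF vw', symmetric] distrib_right sum.distrib
        unfolding H(2)[OF vw(1), symmetric] H(2)[OF vw(2), symmetric] by (rule distrib_left)
    qed (use H(1)[OF vw'] mpoly.subspace_add[OF forms_subspace H(1)[OF vw(1)] H(1)[OF vw(2)]] g in simp_all)
  next
    fix c v assume v: "v \<in> V"
    have v': "pscale c v \<in> V" by (rule mpoly.subspace_scale[OF V(1) v])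
    show "H (pscale c v) g = pscale c (H v g)"
    proof (rule unique[of e "H (pscale c v)" "\<lambda>g. pscale c (H v g)"])
      show "(\<Sum>g\<in>G. H (pscale c v) g * g) = (\<Sum>g\<in>G. pscale c (H v g) * g)"
        unfolding H(2)[OF v', symmetric] pscale_mult_left mpoly.scale_sum_right[symmetric]
        unfolding H(2)[OF v, symmetric] by (rule pscale_mult_right)
    qed (use H(1)[OF v'] mpoly.subspace_scale[OF forms_subspace H(1)[OF v]] g in simp_all)
  qed
  have comp: "compat n V (\<lambda>v. H v g)" if g: "g \<in> G" for g
    unfolding compat_def
  proof (intro allI impI)
    fix B :: "(nat \<times> nat) set" and c v
    assume a: "finite B \<and> (\<forall>b\<in>B. v b \<in> V \<and> c b \<in> forms n 2) \<and> (\<Sum>b\<in>B. c b * v b) = 0"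
    have vb: "v b \<in> V" and cb: "c b \<in> forms n 2" if "b \<in> B" for b using a that by simp_all
    show "(\<Sum>b\<in>B. c b * H (v b) g) = 0"
    proof (rule small_indepD[OF indG, of "2 + e" "\<lambda>g. \<Sum>b\<in>B. c b * H (v b) g"])
      show "(\<Sum>b\<in>B. c b * H (v b) g) \<in> forms n (2 + e)" if "g \<in> G" for g
        by (intro mpoly.subspace_sum[OF forms_subspace] forms_mult cb H(1) vb that)
      have "(\<Sum>g\<in>G. (\<Sum>b\<in>B. c b * H (v b) g) * g) = (\<Sum>b\<in>B. c b * (\<Sum>g\<in>G. H (v b) g * g))"
        unfolding sum_distrib_right sum_distrib_left mult.assoc by (rule sum.swap)
      also have "\<dots> = (\<Sum>b\<in>B. r * (c b * v b))"
        by (rule sum.cong[OF refl]) (simp add: H(2)[OF vb, symmetric] mult.left_commute)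
      also have "\<dots> = 0" using a by (simp flip: sum_distrib_left)
      finally show "(\<Sum>g\<in>G. (\<Sum>b\<in>B. c b * H (v b) g) * g) = 0" .
    qed (use g in simp_all)
  qed
  obtain rest where rest: "set rest = G - set gs" "distinct rest"
    using finite_distinct_list[of "G - set gs"] G(2) by blast
  let ?\<Phi> = "map (\<lambda>g v. H v g) (gs @ rest)"
  have setG: "set (gs @ rest) = G" using rest G(1) by auto
  have "\<exists>us. length us = length ?\<Phi> \<and> sum_list us = mpoly.dim V \<and> kd p n V \<le> sum_list (map (lexsum n p) us) \<and>
      (\<forall>i<length ?\<Phi>. \<forall>W. mpoly.subspace W \<and> W \<subseteq> V \<and> (\<forall>w\<in>W. \<forall>j<i. (?\<Phi> ! j) w = 0) \<and>
         (\<forall>w\<in>W. (?\<Phi> ! i) w = 0 \<longrightarrow> w = 0) \<longrightarrow> mpoly.dim W \<le> us ! i)"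
  proof (rule kd_coordinates[OF n p V])
    show "\<forall>\<phi>\<in>set ?\<Phi>. lin_on pscale pscale V \<phi> \<and> compat n V \<phi> \<and> \<phi> ` V \<subseteq> forms n e"
    proof
      fix \<phi> assume "\<phi> \<in> set ?\<Phi>"
      then obtain g where g: "g \<in> G" "\<phi> = (\<lambda>v. H v g)" using setG by auto
      then show "lin_on pscale pscale V \<phi> \<and> compat n V \<phi> \<and> \<phi> ` V \<subseteq> forms n e"
        using lin[OF g(1)] comp[OF g(1)] H(1)[OF _ g(1)] by auto
    qed
    show "\<forall>v\<in>V. (\<forall>\<phi>\<in>set ?\<Phi>. \<phi> v = 0) \<longrightarrow> v = 0"
    proof (intro ballI impI)
      fix v assume v: "v \<in> V" and z: "\<forall>\<phi>\<in>set ?\<Phi>. \<phi> v = 0"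
      have "H v g = 0" if "g \<in> G" for g
      proof -
        have "(\<lambda>v. H v g) \<in> set ?\<Phi>"
          unfolding set_map setG using imageI[OF that, of "\<lambda>g v. H v g"] .
        from bspec[OF z this] show ?thesis .
      qed
      then have "r * v = 0" unfolding H(2)[OF v] by simp
      then show "v = 0" using r(2) by simp
    qed
  qed
  then obtain us where us0: "length us = length ?\<Phi> \<and> sum_list us = mpoly.dim V \<and> kd p n V \<le> sum_list (map (lexsum n p) us) \<and>
      (\<forall>i<length ?\<Phi>. \<forall>W. mpoly.subspace W \<and> W \<subseteq> V \<and> (\<forall>w\<in>W. \<forall>j<i. (?\<Phi> ! j) w = 0) \<and>
         (\<forall>w\<in>W. (?\<Phi> ! i) w = 0 \<longrightarrow> w = 0) \<longrightarrow> mpoly.dim W \<le> us ! i)" by (rule exE)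
  note us = conjunct1[OF us0] conjunct1[OF conjunct2[OF us0]] conjunct1[OF conjunct2[OF conjunct2[OF us0]]]
    and us4 = conjunct2[OF conjunct2[OF conjunct2[OF us0]]]
  have dimW: "mpoly.dim W \<le> us ! i"
    if "i < length ?\<Phi>" "mpoly.subspace W" "W \<subseteq> V" "\<forall>w\<in>W. \<forall>j<i. (?\<Phi> ! j) w = 0"
      "\<forall>w\<in>W. (?\<Phi> ! i) w = 0 \<longrightarrow> w = 0" for i W
    by (rule mp[OF spec[OF mp[OF spec[OF us4, of i] that(1)], of W]]) (intro conjI that(2-5))
  have kle: "(k0 # ks) ! i \<le> k0" if "i < length fs" for i
    using that len ks by (cases i) auto
  have big: "card (Mon n ((k0 # ks) ! i)) \<le> us ! i" if i: "i < length fs" for i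
  proof -
    let ?k = "(k0 # ks) ! i" and ?f = "fs ! i"
    let ?x = "pmonom (Poly_Mapping.single 0 ?k) :: 'k mpoly"
    have gi: "gs ! i = ?x * ?f" using i gs by simp
    have giG: "gs ! i \<in> G" using G(1) i lgs by (auto intro: nth_mem)
    have xf: "?x \<in> forms n ?k" using n0 by (simp add: pmonom_forms Mon_def single_exponents)
    let ?W = "(\<lambda>q. q * ?f) ` forms n ?k"
    have linf: "lin_on pscale pscale (forms n ?k) (\<lambda>q. q * ?f)"
      by (rule mm.lin_onI) (simp_all add: distrib_right pscale_mult_left)
    have WV: "?W \<subseteq> V" using inV[OF i] by blast
    have HW: "?x * H (q * ?f) g = (if g = gs ! i then r * q else 0)" if q: "q \<in> forms n ?k" and g: "g \<in> G" for q g
    proof (rule unique[of "?k + e" "\<lambda>g. ?x * H (q * ?f) g" "\<lambda>g. if g = gs ! i then r * q else 0"])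
      have qV: "q * ?f \<in> V" by (rule inV[OF i q])
      show "?k + e \<le> e + (k0 + 2)" using kle[OF i] by simp
      show "?x * H (q * ?f) g \<in> forms n (?k + e)" if "g \<in> G" for g
        by (rule forms_mult[OF xf H(1)[OF qV that]])
      show "(if g = gs ! i then r * q else 0) \<in> forms n (?k + e)" for g
        using forms_mult[OF r(1) q] by (cases "g = gs ! i") (simp_all add: zero_forms add.commute)
      have "(\<Sum>g\<in>G. ?x * H (q * ?f) g * g) = ?x * (r * (q * ?f))"
        unfolding H(2)[OF qV] sum_distrib_left mult.assoc ..
      also have "\<dots> = r * q * (gs ! i)" unfolding gi by (simp add: mult_ac)
      also have "\<dots> = (\<Sum>g\<in>G. if g = gs ! i then r * q * g else 0)"
        using giG G(2) by simp
      also have "\<dots> = (\<Sum>g\<in>G. (if g = gs ! i then r * q else 0) * g)"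
        by (rule sum.cong) simp_all
      finally show "(\<Sum>g\<in>G. ?x * H (q * ?f) g * g) = (\<Sum>g\<in>G. (if g = gs ! i then r * q else 0) * g)" .
    qed (rule g)
    have f0: "?f \<noteq> 0"
    proof
      assume "?f = 0"
      then have g0: "gs ! i = 0" using gi by simp
      have "(\<Sum>g\<in>G. (if g = gs ! i then 1 else 0) * g) = (\<Sum>g\<in>G. if g = gs ! i then g else 0)"
        by (rule sum.cong) simp_all
      also have "\<dots> = 0" using g0 G(2) by simp
      finally have "(if gs ! i = gs ! i then 1 else 0 :: 'k mpoly) = 0"
        by (intro small_indepD[OF indG, of 0 "\<lambda>g. if g = gs ! i then 1 else 0", OF _ _ _ giG])
          (simp_all add: one_forms zero_forms)
      then show False by simp
    qed
    have x0: "?x \<noteq> 0" by simp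
    have "card (Mon n ?k) = mpoly.dim (forms n ?k :: 'k mpoly set)"
      unfolding forms_eq_monspan by (rule dim_monspan[symmetric]) simp
    also have "\<dots> \<le> mpoly.dim ?W"
      by (rule mm.dim_le_inj[OF linf forms_subspace forms_fin_dim _ order_refl mm.rank_nullity(2)[OF linf forms_subspace forms_fin_dim]])
        (use f0 in simp)
    also have "\<dots> \<le> us ! i"
    proof (rule dimW[OF _ mm.lin_on_subspace_image[OF linf forms_subspace] WV])
      show "i < length ?\<Phi>" using i lgs by simp
      show "\<forall>w\<in>?W. \<forall>j<i. (?\<Phi> ! j) w = 0"
      proof (intro ballI allI impI)
        fix w j assume "w \<in> ?W" and j: "j < i"
        then obtain q where q: "q \<in> forms n ?k" "w = q * ?f" by blast
        have jl: "j < length gs" using j i lgs by simp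
        have ne: "gs ! j \<noteq> gs ! i" using dist j i lgs by (simp add: nth_eq_iff_index_eq)
        have jG: "gs ! j \<in> G" using G(1) jl by (auto intro: nth_mem)
        have "?x * H w (gs ! j) = 0" using HW[OF q(1) jG] ne q(2) by simp
        then have "H w (gs ! j) = 0" using x0 by simp
        then show "(?\<Phi> ! j) w = 0" using jl by (simp add: nth_append)
      qed
      show "\<forall>w\<in>?W. (?\<Phi> ! i) w = 0 \<longrightarrow> w = 0"
      proof (intro ballI impI)
        fix w assume "w \<in> ?W" and z: "(?\<Phi> ! i) w = 0"
        then obtain q where q: "q \<in> forms n ?k" "w = q * ?f" by blast
        have "H w (gs ! i) = 0" using z i lgs by (simp add: nth_append)
        then have "r * q = 0" using HW[OF q(1) giG] q(2) by simp
        then show "w = 0" using r(2) q(2) by simp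
      qed
    qed
    finally show ?thesis .
  qed
  have lus: "Suc (length ks) \<le> length us" using us(1) lgs len by simp
  then obtain u vs where uvs: "us = u # vs" by (cases us) auto
  have bu: "card (Mon n k0) \<le> u" using big[of 0] len uvs by simp
  have card_mono_k: "card (Mon n k) \<le> card (Mon n k')" if "k \<le> k'" for k k'
  proof -
    have "card ((+) (Poly_Mapping.single 0 (k' - k)) ` Mon n k) \<le> card (Mon n k')"
      using lexseg_subset[OF lexseg_translate[OF n0 lexseg_Mon, of "k' - k" k]] that
      by (intro card_mono) simp_all
    then show ?thesis by (simp add: card_translate)
  qed
  have "sum_list (map (\<lambda>k. card (Mon n k)) ks) \<le> sum_list vs \<and>
    lexsum n p u + sum_list (map (lexsum n p) vs)
      \<le> lexsum n p (u + sum_list vs - sum_list (map (\<lambda>k. card (Mon n k)) ks))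
        + sum_list (map (\<lambda>k. lexsum n p (card (Mon n k))) ks)"
  proof (rule lexsum_accumulate[OF n p])
    show "length ks \<le> length vs" using lus uvs by simp
    show "\<forall>i<length ks. card (Mon n (ks ! i)) \<le> vs ! i \<and> card (Mon n (ks ! i)) \<le> u"
    proof (intro allI impI)
      fix i assume i: "i < length ks"
      have "card (Mon n (ks ! i)) \<le> card (Mon n k0)" by (rule card_mono_k) (use ks i in simp)
      then show "card (Mon n (ks ! i)) \<le> vs ! i \<and> card (Mon n (ks ! i)) \<le> u"
        using big[of "Suc i"] i len uvs bu by simp
    qed
  qed
  then show "sum_list (map (\<lambda>k. card (Mon n k)) (k0 # ks)) \<le> mpoly.dim V"
    and "kd p n V \<le> lexsum n p (mpoly.dim V - sum_list (map (\<lambda>k. card (Mon n k)) ks))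
      + sum_list (map (\<lambda>k. lexsum n p (card (Mon n k))) ks)"
    using us(2,3) uvs bu by simp_all
qed

section \<open>Ideals of the polynomial ring\<close>

context vector_space
begin

lemma dim_sum_le:
  assumes X: "fin_dim X" and S: "finite S" and Y: "Y \<subseteq> {x + y | x y. x \<in> X \<and> y \<in> span S}"
  shows "dim Y \<le> dim X + card S"
proof -
  obtain B where B: "finite B" "B \<subseteq> X" "independent B" "X \<subseteq> span B" "card B = dim X"
    by (rule fin_dim_basis[OF X])
  have "Y \<subseteq> span (B \<union> S)"
  proof
    fix z assume "z \<in> Y"
    then obtain x y where xy: "z = x + y" "x \<in> X" "y \<in> span S" using Y by blast
    have "x \<in> span (B \<union> S)" using B(4) xy(2) span_mono[of B "B \<union> S"] by blast
    moreover have "y \<in> span (B \<union> S)" using xy(3) span_mono[of S "B \<union> S"] by blast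
    ultimately show "z \<in> span (B \<union> S)" unfolding xy(1) by (rule span_add)
  qed
  then have "dim Y \<le> card (B \<union> S)" by (rule dim_le_card) (simp add: B(1) S)
  also have "\<dots> \<le> card B + card S" by (rule card_Un_le)
  finally show ?thesis using B(5) by simp
qed

lemma dim_sum_ge:
  assumes X: "subspace X" "X \<subseteq> Y" and Y: "fin_dim Y" and S: "finite S" "S \<subseteq> Y"
    and ind: "\<And>s. s \<in> S \<Longrightarrow> s \<notin> {x + y | x y. x \<in> X \<and> y \<in> span (S - {s})}"
  shows "dim X + card S \<le> dim Y"
proof -
  have "\<exists>B. finite B \<and> independent B \<and> B \<subseteq> Y \<and> card B = dim X + card S' \<and>
      B \<subseteq> {x + y | x y. x \<in> X \<and> y \<in> span S'}" if "S' \<subseteq> S" for S'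
    using finite_subset[OF that S(1)] that
  proof (induction S' rule: finite_induct)
    case empty
    obtain B where B: "finite B" "B \<subseteq> X" "independent B" "X \<subseteq> span B" "card B = dim X"
      by (rule fin_dim_basis[OF fin_dim_subset[OF Y X(2)]])
    have "B \<subseteq> {x + y | x y. x \<in> X \<and> y \<in> span {}}"
    proof
      fix b assume "b \<in> B"
      then have "b = b + 0 \<and> b \<in> X \<and> 0 \<in> span {}" using B(2) by auto
      then show "b \<in> {x + y | x y. x \<in> X \<and> y \<in> span {}}" by blast
    qed
    then show ?case using B X(2) by (intro exI[of _ B]) auto
  next
    case (insert s S')
    then obtain B where B: "finite B" "independent B" "B \<subseteq> Y" "card B = dim X + card S'"
      "B \<subseteq> {x + y | x y. x \<in> X \<and> y \<in> span S'}" by auto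
    let ?Z = "\<lambda>S. {x + y | x y. x \<in> X \<and> y \<in> span S}"
    have mono: "?Z A \<subseteq> ?Z A'" if "A \<subseteq> A'" for A A' using span_mono[OF that] by blast
    have "span B \<subseteq> ?Z S'" by (rule span_minimal[OF B(5) subspace_sums[OF X(1) subspace_span]])
    moreover have "?Z S' \<subseteq> ?Z (S - {s})" by (rule mono) (use insert in auto)
    ultimately have ns: "s \<notin> span B" using ind[of s] insert.prems by blast
    show ?case
    proof (intro exI[of _ "insert s B"] conjI)
      show "independent (insert s B)" by (rule independent_insertI[OF ns B(2)])
      have "s \<notin> B" using ns span_base by blast
      then show "card (insert s B) = dim X + card (insert s S')" using B(1,4) insert.hyps by simp
      have "s = 0 + s \<and> 0 \<in> X \<and> s \<in> span (insert s S')"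
        using subspace_0[OF X(1)] span_base[of s "insert s S'"] by simp
      then have "s \<in> ?Z (insert s S')" by blast
      moreover have "?Z S' \<subseteq> ?Z (insert s S')" by (rule mono) blast
      ultimately show "insert s B \<subseteq> ?Z (insert s S')" using B(5) by blast
    qed (use B(1,3) insert.prems S(2) in auto)
  qed
  from this[OF order_refl] show ?thesis using card_independent_le_dim[OF Y] by metis
qed

end

abbreviation PR :: "nat \<Rightarrow> ('k::field mpoly) ring" where "PR \<equiv> poly_ring"

lemma carrier_iff: "f \<in> carrier (PR n) \<longleftrightarrow> keys f \<subseteq> exponents n"
  by (simp add: poly_ring_def)

lemma PR_simps: "a \<otimes>\<^bsub>PR n\<^esub> b = a * b" "a \<oplus>\<^bsub>PR n\<^esub> b = a + b" "\<zero>\<^bsub>PR n\<^esub> = 0" "\<one>\<^bsub>PR n\<^esub> = 1"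
  by (simp_all add: poly_ring_def)

lemma ring_PR: "ring (PR n :: ('k::field mpoly) ring)"
  using cring_poly_ring cring.axioms(1) by blast

lemma forms_carrier: "f \<in> forms n d \<Longrightarrow> f \<in> carrier (PR n)"
  by (simp add: forms_def)

lemma carrier_closed:
  fixes f g :: "'k::field mpoly"
  shows "(0 :: 'k mpoly) \<in> carrier (PR n)" "(1 :: 'k mpoly) \<in> carrier (PR n)"
    "f \<in> carrier (PR n) \<Longrightarrow> g \<in> carrier (PR n) \<Longrightarrow> f + g \<in> carrier (PR n)"
    "f \<in> carrier (PR n) \<Longrightarrow> g \<in> carrier (PR n) \<Longrightarrow> f * g \<in> carrier (PR n)"
    "f \<in> carrier (PR n) \<Longrightarrow> - f \<in> carrier (PR n)"
    "f \<in> carrier (PR n) \<Longrightarrow> pscale c f \<in> carrier (PR n)"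
proof -
  interpret ring "PR n :: ('k mpoly) ring" by (rule ring_PR)
  show "(0 :: 'k mpoly) \<in> carrier (PR n)" "(1 :: 'k mpoly) \<in> carrier (PR n)" by (simp_all add: carrier_iff)
  show "f \<in> carrier (PR n) \<Longrightarrow> g \<in> carrier (PR n) \<Longrightarrow> f + g \<in> carrier (PR n)"
    using a_closed[of f g] by (simp add: PR_simps)
  show "f \<in> carrier (PR n) \<Longrightarrow> g \<in> carrier (PR n) \<Longrightarrow> f * g \<in> carrier (PR n)"
    using m_closed[of f g] by (simp add: PR_simps)
  show "f \<in> carrier (PR n) \<Longrightarrow> - f \<in> carrier (PR n)" by (simp add: carrier_iff)
  show "f \<in> carrier (PR n) \<Longrightarrow> pscale c f \<in> carrier (PR n)"
    using keys_pscale[of c f] unfolding carrier_iff by (rule order_trans)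
qed

lemma poly_idealI:
  fixes I :: "'k::field mpoly set"
  assumes "I \<subseteq> carrier (PR n)" "0 \<in> I" "\<And>f g. f \<in> I \<Longrightarrow> g \<in> I \<Longrightarrow> f + g \<in> I"
    "\<And>f h. f \<in> I \<Longrightarrow> h \<in> carrier (PR n) \<Longrightarrow> h * f \<in> I"
  shows "ideal I (PR n)"
proof (rule idealI[OF ring_PR])
  interpret ring "PR n :: ('k mpoly) ring" by (rule ring_PR)
  show "subgroup I (add_monoid (PR n))"
  proof (rule add.subgroupI)
    show "I \<noteq> {}" using assms(2) by blast
    fix f assume f: "f \<in> I"
    have fc: "f \<in> carrier (PR n)" using f assms(1) by blast
    have "\<ominus>\<^bsub>PR n\<^esub> f = - f"
      by (rule minus_equality) (simp_all add: PR_simps fc carrier_closed(5))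
    moreover have "(- 1) * f \<in> I" by (rule assms(4)[OF f]) (simp add: carrier_closed)
    ultimately show "\<ominus>\<^bsub>PR n\<^esub> f \<in> I" by simp
  qed (use assms in \<open>auto simp: PR_simps\<close>)
qed (use assms(4) in \<open>auto simp: PR_simps mult.commute\<close>)

lemma ideal_closed:
  fixes I :: "'k::field mpoly set"
  assumes "ideal I (PR n)"
  shows "I \<subseteq> carrier (PR n)" "0 \<in> I" "f \<in> I \<Longrightarrow> g \<in> I \<Longrightarrow> f + g \<in> I"
    "f \<in> I \<Longrightarrow> h \<in> carrier (PR n) \<Longrightarrow> h * f \<in> I" "f \<in> I \<Longrightarrow> pscale c f \<in> I"
    "(\<And>a. a \<in> A \<Longrightarrow> F a \<in> I) \<Longrightarrow> sum F A \<in> I"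
proof -
  interpret ideal I "PR n" by (rule assms)
  show "I \<subseteq> carrier (PR n)" by (rule a_subset)
  note sg = ideal.axioms(1)[OF assms]
  show z: "0 \<in> I" using additive_subgroup.zero_closed[OF sg] by (simp add: PR_simps)
  show a: "f \<in> I \<Longrightarrow> g \<in> I \<Longrightarrow> f + g \<in> I" for f g
    using additive_subgroup.a_closed[OF sg, of f g] by (simp add: PR_simps)
  show m: "f \<in> I \<Longrightarrow> h \<in> carrier (PR n) \<Longrightarrow> h * f \<in> I" for f h using I_l_closed[of f h] by (simp add: PR_simps)
  show "f \<in> I \<Longrightarrow> pscale c f \<in> I"
    unfolding pscale_def by (rule m) (auto simp: carrier_iff)
  show "(\<And>a. a \<in> A \<Longrightarrow> F a \<in> I) \<Longrightarrow> sum F A \<in> I"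
    by (induction A rule: infinite_finite_induct) (simp_all add: z a)
qed

lemma genideal_is_ideal:
  fixes G :: "'k::field mpoly set"
  assumes "G \<subseteq> carrier (PR n)"
  shows "ideal (Idl\<^bsub>PR n\<^esub> G) (PR n)" "G \<subseteq> Idl\<^bsub>PR n\<^esub> G"
  using ring.genideal_ideal[OF ring_PR assms] ring.genideal_self[OF ring_PR assms] by blast+

lemma genideal_least:
  fixes G :: "'k::field mpoly set"
  assumes "ideal I (PR n)" "G \<subseteq> I"
  shows "Idl\<^bsub>PR n\<^esub> G \<subseteq> I"
  by (rule ring.genideal_minimal[OF ring_PR assms])

lemma genideal_finite:
  fixes G :: "'k::field mpoly set"
  assumes G: "finite G" "G \<subseteq> carrier (PR n)"
  shows "f \<in> Idl\<^bsub>PR n\<^esub> G \<longleftrightarrow> (\<exists>h. (\<forall>g\<in>G. h g \<in> carrier (PR n)) \<and> f = (\<Sum>g\<in>G. h g * g))"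
proof
  let ?J = "{f. \<exists>h. (\<forall>g\<in>G. h g \<in> carrier (PR n)) \<and> f = (\<Sum>g\<in>G. h g * g)}"
  have sumc: "(\<Sum>g\<in>G. h g * g) \<in> carrier (PR n)" if "\<forall>g\<in>G. h g \<in> carrier (PR n)" for h
  proof -
    interpret ring "PR n :: ('k mpoly) ring" by (rule ring_PR)
    show ?thesis
      by (rule ideal_closed(6)[OF oneideal]) (use that G(2) carrier_closed(4) in blast)
  qed
  have "ideal ?J (PR n)"
  proof (rule poly_idealI)
    show "?J \<subseteq> carrier (PR n)" using sumc by auto
    show "0 \<in> ?J" by (intro CollectI exI[of _ "\<lambda>_. 0"]) (simp add: carrier_closed)
    show "f1 + f2 \<in> ?J" if f12: "f1 \<in> ?J" "f2 \<in> ?J" for f1 f2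
    proof -
      obtain h1 where h1: "\<forall>g\<in>G. h1 g \<in> carrier (PR n)" "f1 = (\<Sum>g\<in>G. h1 g * g)" using f12(1) by auto
      obtain h2 where h2: "\<forall>g\<in>G. h2 g \<in> carrier (PR n)" "f2 = (\<Sum>g\<in>G. h2 g * g)" using f12(2) by auto
      show ?thesis
        by (intro CollectI exI[of _ "\<lambda>g. h1 g + h2 g"])
          (simp add: h1 h2 carrier_closed(3) distrib_right sum.distrib)
    qed
    show "q * f1 \<in> ?J" if f1: "f1 \<in> ?J" and q: "q \<in> carrier (PR n)" for f1 q
    proof -
      obtain h1 where h1: "\<forall>g\<in>G. h1 g \<in> carrier (PR n)" "f1 = (\<Sum>g\<in>G. h1 g * g)" using f1 by auto
      show ?thesis
        by (intro CollectI exI[of _ "\<lambda>g. q * h1 g"])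
          (simp add: h1 q carrier_closed(4) sum_distrib_left mult.assoc)
    qed
  qed
  moreover have "G \<subseteq> ?J"
  proof
    fix g assume g: "g \<in> G"
    have "(\<Sum>x\<in>G. (if x = g then 1 else 0) * x) = (\<Sum>x\<in>G. if x = g then x else 0)"
      by (rule sum.cong) simp_all
    also have "\<dots> = g" using G(1) g by simp
    finally have "g = (\<Sum>x\<in>G. (if x = g then 1 else 0) * x)" by simp
    moreover have "\<forall>x\<in>G. (if x = g then 1 else 0) \<in> carrier (PR n)" by (simp add: carrier_closed)
    ultimately show "g \<in> ?J" by (intro CollectI exI[of _ "\<lambda>x. if x = g then 1 else 0"] conjI)
  qed
  ultimately have "Idl\<^bsub>PR n\<^esub> G \<subseteq> ?J" by (rule genideal_least)
  then show "f \<in> Idl\<^bsub>PR n\<^esub> G \<Longrightarrow> \<exists>h. (\<forall>g\<in>G. h g \<in> carrier (PR n)) \<and> f = (\<Sum>g\<in>G. h g * g)" by blast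
next
  assume "\<exists>h. (\<forall>g\<in>G. h g \<in> carrier (PR n)) \<and> f = (\<Sum>g\<in>G. h g * g)"
  then obtain h where h: "\<forall>g\<in>G. h g \<in> carrier (PR n)" "f = (\<Sum>g\<in>G. h g * g)" by blast
  note I = genideal_is_ideal[OF G(2)]
  show "f \<in> Idl\<^bsub>PR n\<^esub> G"
    unfolding h(2) by (rule ideal_closed(6)[OF I(1)], rule ideal_closed(4)[OF I(1)]) (use h(1) I(2) in blast)+
qed

section \<open>Homogeneous components\<close>

definition hc :: "nat \<Rightarrow> 'k::field mpoly \<Rightarrow> 'k mpoly" where
  "hc d f = restr {p. tdeg p = d} f"

lemma hc_forms: "f \<in> carrier (PR n) \<Longrightarrow> hc d f \<in> forms n d"
  unfolding forms_def hc_def carrier_iff using keys_restr[of "{p. tdeg p = d}" f]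
  by (simp add: carrier_iff le_infI1)

lemma hc_add: "hc d (f + g) = hc d f + hc d g"
  by (simp add: hc_def restr_add)

lemma hc_sum: "hc d (sum F A) = (\<Sum>a\<in>A. hc d (F a))"
  by (induction A rule: infinite_finite_induct) (simp_all add: hc_add, simp_all add: hc_def)

lemma hc_form: "f \<in> forms n e \<Longrightarrow> hc d f = (if d = e then f else 0)"
  by (rule poly_mapping_eqI) (auto simp: hc_def lookup_restr forms_def in_keys_iff)

lemma hc_decompose: "f = (\<Sum>d\<in>tdeg ` keys f. hc d f)"
proof (rule poly_mapping_eqI)
  fix p
  have "lookup (\<Sum>d\<in>tdeg ` keys f. hc d f) p = (\<Sum>d\<in>tdeg ` keys f. if tdeg p = d then lookup f p else 0)"
    unfolding lookup_sum by (rule sum.cong) (simp_all add: hc_def lookup_restr)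
  also have "\<dots> = (if tdeg p \<in> tdeg ` keys f then lookup f p else 0)" by simp
  also have "\<dots> = lookup f p" by (auto simp: in_keys_iff)
  finally show "lookup f p = lookup (\<Sum>d\<in>tdeg ` keys f. hc d f) p" by simp
qed

lemma hc_mult:
  assumes h: "h \<in> carrier (PR n)" and g: "g \<in> forms n e"
  shows "hc d (h * g) = (if e \<le> d then hc (d - e) h * g else 0)"
proof -
  have "hc d (h * g) = hc d (\<Sum>k\<in>tdeg ` keys h. hc k h * g)"
    by (subst hc_decompose[of h]) (simp add: sum_distrib_right)
  also have "\<dots> = (\<Sum>k\<in>tdeg ` keys h. if d = k + e then hc k h * g else 0)"
    unfolding hc_sum by (rule sum.cong[OF refl]) (rule hc_form[OF forms_mult[OF hc_forms[OF h] g]])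
  also have "\<dots> = (\<Sum>k\<in>tdeg ` keys h. if k = d - e then (if e \<le> d then hc (d - e) h * g else 0) else 0)"
    by (rule sum.cong) auto
  also have "\<dots> = (if d - e \<in> tdeg ` keys h then (if e \<le> d then hc (d - e) h * g else 0) else 0)" by simp
  also have "\<dots> = (if e \<le> d then hc (d - e) h * g else 0)"
  proof (cases "d - e \<in> tdeg ` keys h")
    case False
    have "hc (d - e) h = 0"
    proof (rule poly_mapping_eqI)
      fix k
      have "lookup h k = 0" if "tdeg k = d - e"
      proof (rule ccontr)
        assume "lookup h k \<noteq> 0"
        then have "tdeg k \<in> tdeg ` keys h" by (intro imageI) (simp add: in_keys_iff)
        then show False using False that by simp
      qed
      then show "lookup (hc (d - e) h) k = lookup 0 k" by (simp add: hc_def lookup_restr)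
    qed
    then show ?thesis by simp
  qed simp
  finally show ?thesis .
qed

text \<open>The degree of a nonzero form; for other polynomials, merely the degree of the leading
  monomial.\<close>

definition fdeg :: "'k::field mpoly \<Rightarrow> nat" where
  "fdeg f = tdeg (Max (keys f))"

lemma fdeg_eq: "f \<in> forms n d \<Longrightarrow> f \<noteq> 0 \<Longrightarrow> fdeg f = d"
  unfolding fdeg_def forms_def using Max_in[of "keys f"] by simp

text \<open>The coefficients in a representation of a form may be replaced by their homogeneous parts of the
  right degrees.\<close>

lemma graded_rep:
  fixes G :: "'k::field mpoly set"
  assumes G: "finite G" "\<And>g. g \<in> G \<Longrightarrow> g \<in> forms n (dg g)" and f: "f \<in> Idl\<^bsub>PR n\<^esub> G" "f \<in> forms n d"
  obtains h where "\<And>g. g \<in> G \<Longrightarrow> dg g \<le> d \<Longrightarrow> h g \<in> forms n (d - dg g)"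
    "f = (\<Sum>g\<in>{g\<in>G. dg g \<le> d}. h g * g)"
proof -
  have Gc: "G \<subseteq> carrier (PR n)" using G(2) forms_carrier by blast
  obtain h where h: "\<forall>g\<in>G. h g \<in> carrier (PR n)" "f = (\<Sum>g\<in>G. h g * g)"
    using f(1) genideal_finite[OF G(1) Gc] by blast
  have "f = hc d f" using hc_form[OF f(2), of d] by simp
  also have "\<dots> = (\<Sum>g\<in>G. if dg g \<le> d then hc (d - dg g) (h g) * g else 0)"
    unfolding h(2) hc_sum by (rule sum.cong[OF refl]) (rule hc_mult, use h(1) G(2) in auto)
  also have "\<dots> = (\<Sum>g\<in>{g\<in>G. dg g \<le> d}. hc (d - dg g) (h g) * g)"
    using G(1) by (simp add: sum.inter_filter)
  finally show ?thesis
    by (rule that[of "\<lambda>g. hc (d - dg g) (h g)", rotated]) (use h(1) hc_forms in blast)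
qed

lemma component_subspace:
  fixes I :: "'k::field mpoly set"
  assumes "ideal I (PR n)"
  shows "mpoly.subspace (component n I d)"
proof (rule mpoly.subspaceI)
  note c = ideal_closed[OF assms]
  show "0 \<in> component n I d" by (simp add: component_def c(2) zero_forms)
  show "x + y \<in> component n I d" if "x \<in> component n I d" "y \<in> component n I d" for x y
    using that by (auto simp: component_def intro: c(3) mpoly.subspace_add[OF forms_subspace])
  show "pscale r x \<in> component n I d" if "x \<in> component n I d" for r x
    using that by (auto simp: component_def intro: c(5) mpoly.subspace_scale[OF forms_subspace])
qed

lemma component_forms: "component n I d \<subseteq> forms n d"
  by (simp add: component_def)

lemma component_fin_dim: "mpoly.fin_dim (component n I d)"
  by (rule mpoly.fin_dim_subset[OF forms_fin_dim component_forms])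

lemma R1_component:
  fixes I :: "'k::field mpoly set"
  assumes I: "ideal I (PR n)"
  shows "R1 n (component n I d) \<subseteq> component n I (Suc d)"
proof (rule R1_subsetI[OF component_subspace[OF I]])
  fix i f assume i: "i < n" and f: "f \<in> component n I d"
  have "var i * f \<in> forms n (1 + d)"
    by (rule forms_mult[OF var_forms[OF i]]) (use f in \<open>simp add: component_def\<close>)
  moreover have "var i * f \<in> I"
    by (rule ideal_closed(4)[OF I _ forms_carrier[OF var_forms[OF i]]]) (use f in \<open>simp add: component_def\<close>)
  ultimately show "var i * f \<in> component n I (Suc d)" by (simp add: component_def)
qed

lemma R1_forms_eq: "0 < n \<Longrightarrow> R1 n (forms n d :: 'k::field mpoly set) = forms n (Suc d)"
  unfolding forms_eq_monspan R1_monspan by (simp add: up_Mon)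

lemma component_step:
  fixes I :: "'k::field mpoly set"
  assumes n: "0 < n" and G: "finite G" "\<And>g. g \<in> G \<Longrightarrow> g \<in> forms n (dg g)" and GI: "Idl\<^bsub>PR n\<^esub> G = I"
  shows "component n I (Suc d) \<subseteq>
    {x + y | x y. x \<in> R1 n (component n I d) \<and> y \<in> mpoly.span {g \<in> G. dg g = Suc d}}"
proof
  fix f assume f: "f \<in> component n I (Suc d)"
  have Gc: "G \<subseteq> carrier (PR n)" using G(2) forms_carrier by blast
  have I: "ideal I (PR n)" and GsI: "G \<subseteq> I" using genideal_is_ideal[OF Gc] GI by simp_all
  have fI: "f \<in> Idl\<^bsub>PR n\<^esub> G" and ff: "f \<in> forms n (Suc d)" using f GI by (simp_all add: component_def)
  obtain h where h: "\<And>g. g \<in> G \<Longrightarrow> dg g \<le> Suc d \<Longrightarrow> h g \<in> forms n (Suc d - dg g)"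
    "f = (\<Sum>g\<in>{g\<in>G. dg g \<le> Suc d}. h g * g)"
    using graded_rep[OF G fI ff] by blast
  let ?A = "{g\<in>G. dg g \<le> d}" and ?B = "{g\<in>G. dg g = Suc d}"
  have "{g\<in>G. dg g \<le> Suc d} = ?A \<union> ?B" by auto
  then have "f = (\<Sum>g\<in>?A. h g * g) + (\<Sum>g\<in>?B. h g * g)"
    unfolding h(2) by (simp add: sum.union_disjoint G(1) disjoint_iff)
  moreover have "(\<Sum>g\<in>?A. h g * g) \<in> R1 n (component n I d)"
  proof (rule mpoly.subspace_sum[OF R1_subspace[OF component_subspace[OF I]]])
    fix g assume "g \<in> ?A"
    then have g: "g \<in> G" "dg g \<le> d" by simp_all
    then have "h g \<in> forms n (Suc (d - dg g))" using h(1)[of g] by (simp add: Suc_diff_le)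
    then have "h g \<in> R1 n (forms n (d - dg g))" using R1_forms_eq[OF n] by blast
    then obtain v where v: "\<And>i. i < n \<Longrightarrow> v i \<in> forms n (d - dg g)" "h g = (\<Sum>i<n. var i * v i)"
      by (rule R1E) blast
    have "v i * g \<in> component n I d" if "i < n" for i
    proof -
      have "v i * g \<in> forms n (d - dg g + dg g)" by (rule forms_mult[OF v(1)[OF that] G(2)[OF g(1)]])
      moreover have "v i * g \<in> I"
        by (rule ideal_closed(4)[OF I _ forms_carrier[OF v(1)[OF that]]]) (use g GsI in blast)
      ultimately show ?thesis using g(2) by (simp add: component_def)
    qed
    then have "(\<Sum>i<n. var i * (v i * g)) \<in> R1 n (component n I d)" by (rule R1I)
    then show "h g * g \<in> R1 n (component n I d)" by (simp add: v(2) sum_distrib_right mult.assoc)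
  qed
  moreover have "(\<Sum>g\<in>?B. h g * g) \<in> mpoly.span ?B"
  proof (rule mpoly.span_sum)
    fix g assume g: "g \<in> ?B"
    then have "h g \<in> forms n 0" using h(1)[of g] by simp
    then have k: "keys (h g) \<subseteq> {0}" by (simp add: forms_iff)
    have "h g = pscale (lookup (h g) 0) 1" using poly_expansion[OF _ k] by simp
    then have "h g * g = pscale (lookup (h g) 0) g" by (metis pscale_mult_left mult_1)
    then show "h g * g \<in> mpoly.span ?B" using mpoly.span_scale[OF mpoly.span_base[OF g]] by metis
  qed
  ultimately show "f \<in> {x + y | x y. x \<in> R1 n (component n I d) \<and> y \<in> mpoly.span ?B}" by blast
qed

lemma R1_mult_eq:
  fixes V :: "'k::field mpoly set"
  assumes V: "mpoly.subspace V"
  shows "R1_mult n V = R1 n V"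
proof
  show "R1_mult n V \<subseteq> R1 n V"
    unfolding R1_mult_def
  proof (rule mpoly.span_minimal[OF _ R1_subspace[OF V]], rule subsetI)
    fix x assume "x \<in> {r * g |r g. r \<in> forms n 1 \<and> g \<in> V}"
    then obtain r g where x: "x = r * g" "r \<in> forms n 1" "g \<in> V" by blast
    have "pmonom p * g \<in> R1 n V" if p: "p \<in> keys r" for p
    proof -
      have pM: "p \<in> Mon n (Suc 0)" using p x(2) unfolding forms_iff by auto
      then have "p \<noteq> 0" by (auto simp: Mon_def)
      have "drop_mx p \<in> Mon n 0" by (rule drop_mx_Mon[OF pM])
      then have "p = unit_expo (mxv p)" using drop_mx_add[OF \<open>p \<noteq> 0\<close>] by simp
      moreover have "mxv p \<in> keys p" by (rule mxv_in_keys[OF \<open>p \<noteq> 0\<close>])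
      then have "mxv p < n" using Mon_exponents[OF pM] by (auto simp: exponents_def)
      ultimately show ?thesis using R1_var[OF V x(3), of "mxv p" n] by simp
    qed
    then have "(\<Sum>p\<in>keys r. pscale (lookup r p) (pmonom p * g)) \<in> R1 n V"
      by (intro mpoly.subspace_sum[OF R1_subspace[OF V]] mpoly.subspace_scale[OF R1_subspace[OF V]])
    also have "(\<Sum>p\<in>keys r. pscale (lookup r p) (pmonom p * g)) = r * g"
      by (subst (3) poly_expansion[OF finite_keys order_refl, of r])
        (simp only: sum_distrib_right pscale_mult_left)
    finally show "x \<in> R1 n V" unfolding x(1) .
  qed
  show "R1 n V \<subseteq> R1_mult n V"
  proof (rule R1_subsetI)
    show "mpoly.subspace (R1_mult n V)" unfolding R1_mult_def by (rule mpoly.subspace_span)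
    show "var i * f \<in> R1_mult n V" if "i < n" "f \<in> V" for i f
      unfolding R1_mult_def by (rule mpoly.span_base) (use var_forms[OF that(1)] that(2) in blast)
  qed
qed

section \<open>Regular sequences\<close>

lemma idl_degree_ge:
  fixes G :: "'k::field mpoly set"
  assumes G: "G \<subseteq> carrier (PR n)" "\<And>g p. g \<in> G \<Longrightarrow> p \<in> keys g \<Longrightarrow> c \<le> tdeg p"
    and f: "f \<in> Idl\<^bsub>PR n\<^esub> G" and p: "p \<in> keys f"
  shows "c \<le> tdeg p"
proof -
  let ?J = "{f \<in> carrier (PR n). \<forall>p\<in>keys f. c \<le> tdeg p} :: 'k mpoly set"
  have "ideal ?J (PR n)"
  proof (rule poly_idealI)
    show "f + g \<in> ?J" if "f \<in> ?J" "g \<in> ?J" for f g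
      using that keys_add[of f g] carrier_closed(3)[of f n g] by blast
    show "h * f \<in> ?J" if f: "f \<in> ?J" and h: "h \<in> carrier (PR n)" for f h
    proof -
      have "c \<le> tdeg p" if pk: "p \<in> keys (h * f)" for p
      proof -
        obtain a b where "a \<in> keys h" "b \<in> keys f" "p = a + b" using pk keys_mult[of h f] by blast
        then show ?thesis using f by (simp add: tdeg_add trans_le_add2)
      qed
      then show ?thesis using carrier_closed(4)[OF h, of f] f by blast
    qed
  qed (auto simp: carrier_closed)
  moreover have "G \<subseteq> ?J" using G by blast
  ultimately have "Idl\<^bsub>PR n\<^esub> G \<subseteq> ?J" by (rule genideal_least)
  then show ?thesis using f p by blast
qed

lemma regular_seq_carrier: "regular_seq n fs \<Longrightarrow> set fs \<subseteq> carrier (PR n)"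
  by (simp add: regular_seq_def)

lemma take_carrier: "regular_seq n fs \<Longrightarrow> set (take k fs) \<subseteq> carrier (PR n)"
  using regular_seq_carrier set_take_subset by (rule order_trans[rotated])

lemma regular_seqD:
  assumes "regular_seq n fs" "i < length fs" "g \<in> carrier (PR n)" "g * fs ! i \<in> Idl\<^bsub>PR n\<^esub> (set (take i fs))"
  shows "g \<in> Idl\<^bsub>PR n\<^esub> (set (take i fs))"
  using assms unfolding regular_seq_def by blast

text \<open>In a relation with coefficients of degree below those of all $f_i$, the last coefficient lies
  in the ideal of the preceding $f_i$ by regularity, hence vanishes for reasons of degree.\<close>

lemma regular_seq_no_small_relation:
  fixes fs :: "'k::field mpoly list"
  assumes reg: "regular_seq n fs" and deg: "\<And>f p. f \<in> set fs \<Longrightarrow> p \<in> keys f \<Longrightarrow> c \<le> tdeg p"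
    and h: "\<And>i. i < length fs \<Longrightarrow> h i \<in> carrier (PR n)"
      "\<And>i p. i < length fs \<Longrightarrow> p \<in> keys (h i) \<Longrightarrow> tdeg p < c"
    and s: "(\<Sum>i<length fs. h i * fs ! i) = 0" and i: "i < length fs"
  shows "h i = 0"
proof -
  have "k \<le> length fs \<Longrightarrow> (\<Sum>i<k. h i * fs ! i) = 0 \<Longrightarrow> \<forall>i<k. h i = 0" for k
  proof (induction k)
    case (Suc k)
    then have k: "k < length fs" by simp
    have tc: "set (take k fs) \<subseteq> carrier (PR n)" by (rule take_carrier[OF reg])
    note I = genideal_is_ideal[OF tc]
    have m: "fs ! j \<in> set (take k fs)" if "j < k" for j
      using that k by (metis length_take min.absorb2 less_imp_le nth_mem nth_take)
    have "(\<Sum>i<k. (- h i) * fs ! i) \<in> Idl\<^bsub>PR n\<^esub> (set (take k fs))"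
    proof (rule ideal_closed(6)[OF I(1)])
      fix j assume "j \<in> {..<k}"
      then have j: "j < k" by simp
      show "(- h j) * fs ! j \<in> Idl\<^bsub>PR n\<^esub> (set (take k fs))"
      proof (rule ideal_closed(4)[OF I(1)])
        show "fs ! j \<in> Idl\<^bsub>PR n\<^esub> (set (take k fs))" using m[OF j] I(2) by blast
        show "- h j \<in> carrier (PR n)" by (rule carrier_closed(5)) (use h(1) j k in simp)
      qed
    qed
    also have "(\<Sum>i<k. (- h i) * fs ! i) = h k * fs ! k"
      using Suc.prems(2) by (simp add: sum_negf add_eq_0_iff)
    finally have hk: "h k \<in> Idl\<^bsub>PR n\<^esub> (set (take k fs))" by (rule regular_seqD[OF reg k h(1)[OF k]])
    have ge: "c \<le> tdeg p" if "p \<in> keys (h k)" for p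
    proof (rule idl_degree_ge[OF tc _ hk that])
      fix f q assume "f \<in> set (take k fs)" "q \<in> keys f"
      then show "c \<le> tdeg q" by (intro deg[of f q] in_set_takeD[of f k fs])
    qed
    have "h k = 0"
    proof (rule ccontr)
      assume "h k \<noteq> 0"
      then obtain p where "p \<in> keys (h k)" by (metis all_not_in_conv keys_eq_empty)
      then show False using ge h(2)[OF k] by (meson not_le)
    qed
    then show ?case using Suc.IH Suc.prems by (simp add: less_Suc_eq)
  qed simp
  from this[OF order_refl s] show ?thesis using i by blast
qed

text \<open>Regular forms of high degree behave in low degrees like a basis of a free module; the powers
  of $x_0$ bring them to a common degree.\<close>

lemma regular_shifted_independent:
  fixes fs :: "'k::field mpoly list"
  assumes n: "0 < n" and reg: "regular_seq n fs" and deg: "\<And>f p. f \<in> set fs \<Longrightarrow> p \<in> keys f \<Longrightarrow> c \<le> tdeg p"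
    and k: "\<And>i. i < length fs \<Longrightarrow> ks ! i \<le> k0" and c: "E + k0 < c"
    and gs: "gs = map (\<lambda>i. pmonom (Poly_Mapping.single 0 (ks ! i)) * fs ! i) [0..<length fs]"
  shows "distinct gs" "small_indep n E (set gs)"
proof -
  let ?x = "\<lambda>i. pmonom (Poly_Mapping.single 0 (ks ! i)) :: 'k mpoly"
  have xc: "?x i \<in> forms n (ks ! i)" for i using n by (simp add: pmonom_forms Mon_def single_exponents)
  have lgs: "length gs = length fs" and gi: "\<And>i. i < length fs \<Longrightarrow> gs ! i = ?x i * fs ! i" using gs by simp_all
  note rel = regular_seq_no_small_relation[OF reg deg]
  show d: "distinct gs"
    unfolding distinct_conv_nth
  proof (intro allI impI)
    fix i j assume ij: "i < length gs" "j < length gs" "i \<noteq> j"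
    show "gs ! i \<noteq> gs ! j"
    proof
      assume e: "gs ! i = gs ! j"
      let ?h = "\<lambda>l. if l = i then ?x i else if l = j then - ?x j else 0"
      have "(\<Sum>l<length fs. ?h l * fs ! l) = (\<Sum>l\<in>{i,j}. ?h l * fs ! l)"
        by (rule sum.mono_neutral_right) (use ij lgs in auto)
      also have "\<dots> = ?x i * fs ! i - ?x j * fs ! j" using ij(3) by simp
      also have "\<dots> = 0" using e gi ij lgs by simp
      finally have "?h i = 0"
      proof (rule rel[rotated -2])
        show "i < length fs" using ij lgs by simp
        show "?h l \<in> carrier (PR n)" for l
          using forms_carrier[OF xc] by (simp add: carrier_closed)
        show "tdeg p < c" if "l < length fs" "p \<in> keys (?h l)" for l p
          using that k[OF that(1)] c by (auto split: if_splits)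
      qed
      then show False by simp
    qed
  qed
  show "small_indep n E (set gs)"
    unfolding small_indep_def
  proof (intro allI impI ballI)
    fix e h g assume e: "e \<le> E" and h: "(\<forall>g\<in>set gs. h g \<in> forms n e) \<and> (\<Sum>g\<in>set gs. h g * g) = 0" and g: "g \<in> set gs"
    obtain i where i: "i < length fs" "g = gs ! i" using g lgs by (metis in_set_conv_nth)
    have "(\<Sum>g\<in>set gs. h g * g) = (\<Sum>l<length gs. h (gs ! l) * gs ! l)"
      by (rule sum.reindex_bij_betw[symmetric]) (rule bij_betw_nth[OF d refl refl])
    then have "(\<Sum>l<length fs. (h (gs ! l) * ?x l) * fs ! l) = 0"
      using h lgs gi by (simp add: mult.assoc)
    then have "h (gs ! i) * ?x i = 0"
    proof (rule rel[rotated -2])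
      have F: "h (gs ! l) * ?x l \<in> forms n (e + ks ! l)" if "l < length fs" for l
        by (rule forms_mult[OF _ xc]) (use h that lgs in simp)
      show "h (gs ! l) * ?x l \<in> carrier (PR n)" if "l < length fs" for l
        by (rule forms_carrier[OF F[OF that]])
      show "tdeg p < c" if "l < length fs" "p \<in> keys (h (gs ! l) * ?x l)" for l p
        using F[OF that(1)] that k[OF that(1)] e c by (auto simp: forms_def)
    qed (rule i(1))
    then show "h g = 0" using i(2) by simp
  qed
qed

section \<open>The length of a regular sequence\<close>

definition Mle :: "nat \<Rightarrow> nat \<Rightarrow> expo set" where
  "Mle n N = {p \<in> exponents n. tdeg p \<le> N}"

lemma Mle_bound: "finite (Mle n N)" "card (Mle n N) \<le> (N + 1) ^ n"
proof -
  have "Mle n N = (\<Union>d\<le>N. Mon n d)" by (auto simp: Mle_def Mon_def)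
  then show fin: "finite (Mle n N)" by simp
  have "card (Mle n N) \<le> card ({..<n} \<rightarrow>\<^sub>E {..N})"
  proof (rule card_inj_on_le)
    show "inj_on (\<lambda>p. restrict (lookup p) {..<n}) (Mle n N)"
    proof (rule inj_onI, rule poly_mapping_eqI)
      fix p q i assume pq: "p \<in> Mle n N" "q \<in> Mle n N" "restrict (lookup p) {..<n} = restrict (lookup q) {..<n}"
      show "lookup p i = lookup q i"
      proof (cases "i < n")
        case True
        then show ?thesis using fun_cong[OF pq(3), of i] by simp
      next
        case False
        then show ?thesis using pq(1,2) by (simp add: Mle_def exponents_iff)
      qed
    qed
    show "(\<lambda>p. restrict (lookup p) {..<n}) ` Mle n N \<subseteq> {..<n} \<rightarrow>\<^sub>E {..N}"
    proof
      fix x assume "x \<in> (\<lambda>p. restrict (lookup p) {..<n}) ` Mle n N"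
      then obtain p where p: "p \<in> Mle n N" "x = restrict (lookup p) {..<n}" by blast
      have "lookup p i \<le> N" for i using lookup_le_tdeg[of p i] p(1) by (simp add: Mle_def)
      then show "x \<in> {..<n} \<rightarrow>\<^sub>E {..N}" unfolding p(2) by (intro restrict_PiE_iff[THEN iffD2]) simp
    qed
  qed (simp add: finite_PiE)
  then show "card (Mle n N) \<le> (N + 1) ^ n" by (simp add: card_PiE)
qed

lemma pow_le_binomial: "(k + 1) ^ m \<le> ((k + m) choose m) * fact m"
proof (induction m)
  case (Suc m)
  have "((k + Suc m) choose Suc m) * fact (Suc m) = (((Suc (k + m)) choose Suc m) * Suc m) * fact m"
    by (simp only: fact_Suc of_nat_id add_Suc_right mult.assoc)
  also have "\<dots> = Suc (k + m) * (((k + m) choose m) * fact m)"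
    by (simp only: Suc_times_binomial_eq[symmetric] mult.assoc)
  finally show ?case using mult_le_mono[OF _ Suc.IH, of "k + 1" "Suc (k + m)"] by simp
qed simp

text \<open>Let $R_{\le N}$ be the space of polynomials of degree at most $N$, and $S_i(N)$ the dimension of
  its image modulo the first $i$ elements. Since $f_i$ is a nonzerodivisor modulo its predecessors,
  $S_{i+1}(N + D) + S_i(N) \le S_i(N + D)$, where $D$ bounds the degrees. So $S_0$ grows at least like a
  polynomial whose degree is the length of the sequence, but $\dim R_{\le N} \le (N+1)^n$.\<close>

lemma regular_length_le:
  fixes fs :: "'k::field mpoly list"
  assumes reg: "regular_seq n fs"
  shows "length fs \<le> n"
proof (rule ccontr)
  assume "\<not> ?thesis"
  then have long: "Suc n \<le> length fs" by simp
  let ?L = "length fs"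
  define Q where "Q i = Idl\<^bsub>PR n\<^esub> (set (take i fs))" for i
  note tc = take_carrier[OF reg]
  have Qid: "ideal (Q i) (PR n)" and Qs: "set (take i fs) \<subseteq> Q i" for i
    unfolding Q_def using genideal_is_ideal[OF tc] by blast+
  have Qmono: "Q i \<subseteq> Q j" if "i \<le> j" for i j
    unfolding Q_def
    by (rule genideal_least[OF Qid[unfolded Q_def]])
      (use set_take_subset_set_take[OF that, of fs] Qs[of j] in \<open>auto simp: Q_def\<close>)
  define R where "R N = (monspan (Mle n N) :: 'k mpoly set)" for N
  have Rsub: "mpoly.subspace (R N)" and Rfd: "mpoly.fin_dim (R N)" and Rdim: "mpoly.dim (R N) = card (Mle n N)" for N
    unfolding R_def by (rule monspan_subspace, rule monspan_fin_dim[OF Mle_bound(1)], rule dim_monspan[OF Mle_bound(1)])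
  have Rc: "R N \<subseteq> carrier (PR n)" for N by (auto simp: R_def monspan_iff carrier_iff Mle_def)
  define W where "W i N = Q i \<inter> R N" for i N
  have Wsub: "mpoly.subspace (W i N)" for i N
  proof -
    have "mpoly.subspace (Q i)"
      using ideal_closed(2,3,5)[OF Qid] by (intro mpoly.subspaceI)
    then show ?thesis unfolding W_def by (rule mpoly.subspace_inter[OF _ Rsub])
  qed
  have WR: "W i N \<subseteq> R N" for i N by (simp add: W_def)
  have Wfd: "mpoly.fin_dim (W i N)" for i N by (rule mpoly.fin_dim_subset[OF Rfd WR])
  define S where "S i N = mpoly.dim (R N) - mpoly.dim (W i N)" for i N
  have dimWR: "mpoly.dim (W i N) \<le> mpoly.dim (R N)" for i N by (rule mpoly.dim_mono_fin[OF Rfd WR])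
  have Smono: "S j N \<le> S i N" if "i \<le> j" for i j N
  proof -
    have "mpoly.dim (W i N) \<le> mpoly.dim (W j N)"
      by (rule mpoly.dim_mono_fin[OF Wfd]) (use Qmono[OF that] in \<open>auto simp: W_def\<close>)
    then show ?thesis by (simp add: S_def)
  qed
  obtain D where D: "D \<ge> 1" "\<And>f p. f \<in> set fs \<Longrightarrow> p \<in> keys f \<Longrightarrow> tdeg p \<le> D"
  proof -
    let ?A = "insert 1 (\<Union>f\<in>set fs. tdeg ` keys f)"
    have fin: "finite ?A" by simp
    show ?thesis
    proof (rule that[of "Max ?A"])
      show "1 \<le> Max ?A" by (rule Max_ge[OF fin]) simp
      show "tdeg p \<le> Max ?A" if "f \<in> set fs" "p \<in> keys f" for f p
        by (rule Max_ge[OF fin]) (use that in blast)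
    qed
  qed
  have step: "S (Suc i) (N + D) + S i N \<le> S i (N + D)" if i: "i < ?L" for i N
  proof -
    let ?f = "fs ! i"
    have fset: "?f \<in> set fs" by (rule nth_mem[OF i])
    have fc: "?f \<in> carrier (PR n)" using fset regular_seq_carrier[OF reg] by blast
    obtain B where B: "finite B" "B \<subseteq> W i N" "mpoly.independent B" "W i N \<subseteq> mpoly.span B" "card B = mpoly.dim (W i N)"
      by (rule mpoly.fin_dim_basis[OF Wfd])
    have BR: "B \<subseteq> R N" using B(2) WR by (rule order_trans)
    obtain B' where B': "B \<subseteq> B'" "B' \<subseteq> R N" "mpoly.independent B'" "R N \<subseteq> mpoly.span B'"
      by (rule mpoly.maximal_independent_subset_extend[OF BR B(3)])
    have finB': "finite B'" by (rule mpoly.fin_dim_independent[OF Rfd B'(3,2)])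
    have cB': "card B' = mpoly.dim (R N)" by (rule mpoly.basis_card_eq_dim[OF B'(2,4,3)])
    let ?C = "B' - B"
    have cC: "card ?C = S i N" using card_Diff_subset[OF B(1) B'(1)] cB' B(5) by (simp add: S_def)
    have lin: "Vector_Spaces.linear pscale pscale (\<lambda>c. ?f * c)"
      by unfold_locales (simp_all add: distrib_left pscale_mult_right)
    have key: "c - y \<in> mpoly.span B" if c: "c \<in> R N" and y: "y \<in> R N" and q: "?f * (c - y) \<in> Q i" for c y
    proof -
      have cy: "c - y \<in> R N" by (rule mpoly.subspace_diff[OF Rsub c y])
      have "(c - y) * ?f \<in> Idl\<^bsub>PR n\<^esub> (set (take i fs))" using q by (simp add: Q_def mult.commute)
      then have "c - y \<in> Q i" unfolding Q_def by (rule regular_seqD[OF reg i, rotated]) (use Rc cy in blast)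
      then show ?thesis using cy B(4) by (auto simp: W_def)
    qed
    have ns: "c \<notin> mpoly.span (B' - {c})" if "c \<in> B'" for c
      using B'(3) that unfolding mpoly.dependent_def by blast
    have inj: "inj_on (\<lambda>c. ?f * c) ?C"
    proof (rule inj_onI, rule ccontr)
      fix c d assume cd: "c \<in> ?C" "d \<in> ?C" "?f * c = ?f * d" "c \<noteq> d"
      have z: "?f * (c - d) = 0" using cd(3) by (simp only: right_diff_distrib diff_self)
      have "?f * (c - d) \<in> Q i" unfolding z by (rule ideal_closed(2)[OF Qid])
      then have "c - d \<in> mpoly.span B" using key cd(1,2) B'(2) by blast
      then have "c - d \<in> mpoly.span (B' - {c})" using mpoly.span_mono[of B "B' - {c}"] cd(1) B'(1) by blast
      moreover have "d \<in> mpoly.span (B' - {c})" using cd by (intro mpoly.span_base) blast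
      ultimately have "c - d + d \<in> mpoly.span (B' - {c})" by (rule mpoly.span_add)
      then show False using ns[of c] cd(1) by simp
    qed
    have fC: "?f * c \<in> W (Suc i) (N + D)" if c: "c \<in> R N" for c
    proof -
      have "?f \<in> Q (Suc i)" using Qs[of "Suc i"] i by (auto simp: take_Suc_conv_app_nth)
      then have "c * ?f \<in> Q (Suc i)" by (rule ideal_closed(4)[OF Qid]) (use Rc c in blast)
      moreover have "?f * c \<in> R (N + D)"
        unfolding R_def monspan_iff
      proof
        fix p assume "p \<in> keys (?f * c)"
        then obtain a b where ab: "a \<in> keys ?f" "b \<in> keys c" "p = a + b" using keys_mult[of ?f c] by blast
        have "b \<in> Mle n N" using c ab(2) by (auto simp: R_def monspan_iff)
        moreover have "a \<in> exponents n" using fc ab(1) by (auto simp: carrier_iff)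
        ultimately show "p \<in> Mle n (N + D)"
          using D(2)[OF fset ab(1)] by (simp add: Mle_def ab(3) tdeg_add exponents_add)
      qed
      ultimately show ?thesis by (simp add: W_def mult.commute)
    qed
    have "mpoly.dim (W i (N + D)) + card ((\<lambda>c. ?f * c) ` ?C) \<le> mpoly.dim (W (Suc i) (N + D))"
    proof (rule mpoly.dim_sum_ge[OF Wsub _ Wfd])
      show "W i (N + D) \<subseteq> W (Suc i) (N + D)" using Qmono[of i "Suc i"] by (auto simp: W_def)
      show "finite ((\<lambda>c. ?f * c) ` ?C)" using finB' by simp
      show "(\<lambda>c. ?f * c) ` ?C \<subseteq> W (Suc i) (N + D)" using fC B'(2) by blast
      fix s assume "s \<in> (\<lambda>c. ?f * c) ` ?C"
      then obtain c where c: "c \<in> ?C" "s = ?f * c" by blast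
      show "s \<notin> {x + y |x y. x \<in> W i (N + D) \<and> y \<in> mpoly.span ((\<lambda>c. ?f * c) ` ?C - {s})}"
      proof
        assume "s \<in> {x + y |x y. x \<in> W i (N + D) \<and> y \<in> mpoly.span ((\<lambda>c. ?f * c) ` ?C - {s})}"
        then obtain x y where xy: "s = x + y" "x \<in> W i (N + D)" "y \<in> mpoly.span ((\<lambda>c. ?f * c) ` ?C - {s})" by blast
        have "(\<lambda>c. ?f * c) ` ?C - {s} \<subseteq> (\<lambda>c. ?f * c) ` (?C - {c})" unfolding c(2) by blast
        then have "y \<in> mpoly.span ((\<lambda>c. ?f * c) ` (?C - {c}))" using xy(3) mpoly.span_mono by blast
        then have "y \<in> (\<lambda>c. ?f * c) ` mpoly.span (?C - {c})"
          unfolding mm.linear_span_image[OF lin] .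
        then obtain z where z: "z \<in> mpoly.span (?C - {c})" "y = ?f * z" by blast
        have zR: "z \<in> R N" using z(1) mpoly.span_minimal[OF _ Rsub, of "?C - {c}"] B'(2) by blast
        have "?f * (c - z) = x" using xy(1) c(2) z(2) by (simp add: right_diff_distrib)
        then have "c - z \<in> mpoly.span B" using key[OF _ zR] xy(2) c(1) B'(2) by (auto simp: W_def)
        then have "c - z \<in> mpoly.span (B' - {c})" using mpoly.span_mono[of B "B' - {c}"] c(1) B'(1) by blast
        moreover have "z \<in> mpoly.span (B' - {c})" using z(1) mpoly.span_mono[of "?C - {c}" "B' - {c}"] by blast
        ultimately have "c - z + z \<in> mpoly.span (B' - {c})" by (rule mpoly.span_add)
        then show False using ns[of c] c(1) by simp
      qed
    qed
    then show ?thesis using card_image[OF inj] cC dimWR[of "Suc i" "N + D"] dimWR[of i "N + D"] by (simp add: S_def)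
  qed
  have base: "1 \<le> S ?L N" for N
  proof -
    have "(1 :: 'k mpoly) \<notin> Q ?L"
    proof
      assume one: "(1 :: 'k mpoly) \<in> Q ?L"
      have "carrier (PR n) \<subseteq> Q ?L"
        using ideal_closed(4)[OF Qid one] by fastforce
      then have "Idl\<^bsub>PR n\<^esub> (set fs) = carrier (PR n)" using ideal_closed(1)[OF Qid, of ?L] by (simp add: Q_def)
      then show False using reg by (simp add: regular_seq_def)
    qed
    moreover have "(1 :: 'k mpoly) \<in> R N" by (simp add: R_def monspan_iff Mle_def)
    ultimately have "W ?L N \<noteq> R N" by (auto simp: W_def)
    then have "\<not> mpoly.dim (R N) \<le> mpoly.dim (W ?L N)"
      using mpoly.subspace_eqI_dim[OF Rfd Wsub WR] by blast
    then show ?thesis by (simp add: S_def)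
  qed
  have grow: "i \<le> ?L \<Longrightarrow> (k + i) choose i \<le> S (?L - i) (k * D)" for i k
  proof (induction i arbitrary: k)
    case 0
    then show ?case using base by simp
  next
    case (Suc i)
    note IHi = Suc.IH and le = Suc.prems
    have e: "Suc (?L - Suc i) = ?L - i" using le by simp
    show ?case
    proof (induction k)
      case 0
      have "1 \<le> S (?L - i) 0" using IHi[of 0] le by simp
      also have "\<dots> \<le> S (?L - Suc i) 0" by (rule Smono) simp
      finally show ?case by simp
    next
      case (Suc k)
      have "(Suc k + Suc i) choose Suc i = ((Suc k + i) choose i) + ((k + Suc i) choose Suc i)" by simp
      also have "\<dots> \<le> S (?L - i) (Suc k * D) + S (?L - Suc i) (k * D)"
        using IHi[of "Suc k"] le Suc.IH by linarith
      also have "\<dots> \<le> S (?L - Suc i) (Suc k * D)"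
        using step[of "?L - Suc i" "k * D"] le unfolding e by (simp add: add.commute)
      finally show ?case .
    qed
  qed
  \<comment> \<open>For this \<open>k\<close> the lower bound $(k+1)^{n+1} / (n+1)!$ exceeds the upper bound $((k+1) D)^n$.\<close>
  define k where "k = fact (Suc n) * D ^ n"
  have "(k + 1) ^ Suc n \<le> ((k + Suc n) choose Suc n) * fact (Suc n)" by (rule pow_le_binomial)
  also have "\<dots> \<le> card (Mle n (k * D)) * fact (Suc n)"
    by (rule mult_le_mono1) (use grow[OF long, of k] Rdim in \<open>simp add: S_def\<close>)
  also have "\<dots> \<le> (k * D + 1) ^ n * fact (Suc n)" by (rule mult_le_mono1[OF Mle_bound(2)])
  also have "\<dots> \<le> ((k + 1) * D) ^ n * fact (Suc n)"
    by (intro mult_le_mono1 power_mono) (use D(1) in simp_all)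
  also have "\<dots> = (k + 1) ^ n * k"
  proof -
    have "D ^ n * fact (Suc n) = k" by (simp only: k_def mult.commute)
    then show ?thesis unfolding power_mult_distrib mult.assoc by (rule arg_cong)
  qed
  also have "\<dots> < (k + 1) ^ Suc n" by simp
  finally show False by simp
qed

section \<open>Minimal generators and the growth of components\<close>

lemma min_gens_facts:
  fixes I :: "'k::field mpoly set"
  assumes G: "min_gens n I G"
  shows "finite G" "G \<subseteq> carrier (PR n)" "Idl\<^bsub>PR n\<^esub> G = I" "ideal I (PR n)" "G \<subseteq> I"
    "0 \<notin> G" "\<And>g. g \<in> G \<Longrightarrow> g \<in> forms n (fdeg g)" "G \<inter> forms n d = {g \<in> G. fdeg g = d}"
proof -
  show fin: "finite G" and id: "Idl\<^bsub>PR n\<^esub> G = I" using G by (simp_all add: min_gens_def)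
  have hom: "\<exists>d. g \<in> forms n d" if "g \<in> G" for g using G that by (auto simp: min_gens_def)
  show c: "G \<subseteq> carrier (PR n)" using hom forms_carrier by blast
  show I: "ideal I (PR n)" and sub: "G \<subseteq> I" using genideal_is_ideal[OF c] id by simp_all
  show z: "0 \<notin> G"
  proof
    assume z: "0 \<in> G"
    have c': "G - {0} \<subseteq> carrier (PR n)" using c by blast
    note J = genideal_is_ideal[OF c']
    have "Idl\<^bsub>PR n\<^esub> G \<subseteq> Idl\<^bsub>PR n\<^esub> (G - {0})"
      by (rule genideal_least[OF J(1)]) (use J(2) ideal_closed(2)[OF J(1)] in blast)
    moreover have "Idl\<^bsub>PR n\<^esub> (G - {0}) \<subseteq> Idl\<^bsub>PR n\<^esub> G"
      by (rule genideal_least) (use I sub id in auto)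
    ultimately have "Idl\<^bsub>PR n\<^esub> (G - {0}) = I" using id by simp
    moreover have "G - {0} \<subset> G" using z by blast
    ultimately show False using G unfolding min_gens_def by blast
  qed
  show f: "g \<in> forms n (fdeg g)" if g: "g \<in> G" for g
  proof -
    obtain d where "g \<in> forms n d" using hom[OF g] by blast
    moreover have "g \<noteq> 0" using g z by blast
    ultimately show ?thesis using fdeg_eq[of g n d] by simp
  qed
  show "G \<inter> forms n d = {g \<in> G. fdeg g = d}"
  proof
    show "G \<inter> forms n d \<subseteq> {g \<in> G. fdeg g = d}"
    proof
      fix g assume g: "g \<in> G \<inter> forms n d"
      then have "g \<noteq> 0" using z by blast
      then show "g \<in> {g \<in> G. fdeg g = d}" using g fdeg_eq[of g n d] by simp
    qed
  qed (use f in auto)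
qed

text \<open>Otherwise \<open>g0\<close> could be left out: in degree $d$, and hence in $R_1 I_d$, it is not used for
  reasons of degree.\<close>

lemma min_gens_new:
  fixes I :: "'k::field mpoly set"
  assumes G: "min_gens n I G" and g0: "g0 \<in> G" "fdeg g0 = Suc d"
  shows "g0 \<notin> {x + y | x y. x \<in> R1 n (component n I d) \<and> y \<in> mpoly.span ({g \<in> G. fdeg g = Suc d} - {g0})}"
proof
  note F = min_gens_facts[OF G]
  assume "g0 \<in> {x + y | x y. x \<in> R1 n (component n I d) \<and> y \<in> mpoly.span ({g \<in> G. fdeg g = Suc d} - {g0})}"
  then obtain x y where xy: "g0 = x + y" "x \<in> R1 n (component n I d)"
    "y \<in> mpoly.span ({g \<in> G. fdeg g = Suc d} - {g0})" by blast
  have c': "G - {g0} \<subseteq> carrier (PR n)" using F(2) by blast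
  let ?J = "Idl\<^bsub>PR n\<^esub> (G - {g0})"
  note J = genideal_is_ideal[OF c']
  have Jsub: "mpoly.subspace ?J" using ideal_closed(2,3,5)[OF J(1)] by (intro mpoly.subspaceI)
  have "y \<in> ?J" using xy(3) mpoly.span_minimal[OF _ Jsub, of "{g \<in> G. fdeg g = Suc d} - {g0}"] J(2) by blast
  moreover have "R1 n (component n I d) \<subseteq> ?J"
  proof (rule R1_subsetI[OF Jsub])
    fix i f assume i: "i < n" and f: "f \<in> component n I d"
    have fI: "f \<in> Idl\<^bsub>PR n\<^esub> G" and ff: "f \<in> forms n d" using f F(3) by (simp_all add: component_def)
    obtain h where h: "\<And>g. g \<in> G \<Longrightarrow> fdeg g \<le> d \<Longrightarrow> h g \<in> forms n (d - fdeg g)"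
      "f = (\<Sum>g\<in>{g\<in>G. fdeg g \<le> d}. h g * g)"
      using graded_rep[OF F(1) F(7) fI ff] by blast
    have "f \<in> ?J"
      unfolding h(2)
    proof (rule ideal_closed(6)[OF J(1)])
      fix g assume g: "g \<in> {g\<in>G. fdeg g \<le> d}"
      then have "g \<in> G - {g0}" using g0(2) by auto
      then have "g \<in> ?J" using J(2) by blast
      then show "h g * g \<in> ?J" by (rule ideal_closed(4)[OF J(1)]) (use h(1) g forms_carrier in blast)
    qed
    then show "var i * f \<in> ?J" by (rule ideal_closed(4)[OF J(1) _ forms_carrier[OF var_forms[OF i]]])
  qed
  then have "x \<in> ?J" using xy(2) by blast
  ultimately have "x + y \<in> ?J" using ideal_closed(3)[OF J(1)] by blast
  with xy(1)[symmetric] have "g0 \<in> ?J" by (rule subst[where P = "\<lambda>z. z \<in> ?J"])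
  then have "G \<subseteq> ?J" using J(2) by blast
  then have "I \<subseteq> ?J" using genideal_least[OF J(1)] F(3) by blast
  moreover have "?J \<subseteq> I" by (rule genideal_least[OF F(4)]) (use F(5) in blast)
  ultimately have "?J = I" by blast
  moreover have "G - {g0} \<subset> G" using g0(1) by blast
  ultimately show False using G unfolding min_gens_def by blast
qed

text \<open>New elements of $I_{d+1}$ come from the minimal generators of this degree, and these are
  independent modulo $R_1 I_d$.\<close>

lemma component_growth:
  fixes I :: "'k::field mpoly set"
  assumes n: "0 < n" and G: "min_gens n I G"
  shows "mpoly.dim (component n I (Suc d)) \<le> mpoly.dim (R1 n (component n I d)) + card (G \<inter> forms n (Suc d))"
    and "S \<subseteq> G \<inter> forms n (Suc d) \<Longrightarrow>
      mpoly.dim (R1 n (component n I d)) + card S \<le> mpoly.dim (component n I (Suc d))"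
proof -
  note F = min_gens_facts[OF G]
  have fd: "mpoly.fin_dim (R1 n (component n I d))"
    by (rule R1_fin_dim[OF component_subspace[OF F(4)] component_fin_dim])
  show "mpoly.dim (component n I (Suc d)) \<le> mpoly.dim (R1 n (component n I d)) + card (G \<inter> forms n (Suc d))"
    unfolding F(8) by (rule mpoly.dim_sum_le[OF fd _ component_step[OF n F(1) F(7) F(3)]]) (simp add: F(1))
  assume S: "S \<subseteq> G \<inter> forms n (Suc d)"
  then have S': "S \<subseteq> {g \<in> G. fdeg g = Suc d}" unfolding F(8) .
  show "mpoly.dim (R1 n (component n I d)) + card S \<le> mpoly.dim (component n I (Suc d))"
  proof (rule mpoly.dim_sum_ge[OF R1_subspace[OF component_subspace[OF F(4)]] R1_component[OF F(4)] component_fin_dim])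
    show "finite S" by (rule finite_subset[OF S']) (simp add: F(1))
    show "S \<subseteq> component n I (Suc d)" using S F(5) by (auto simp: component_def)
    fix s assume s: "s \<in> S"
    have "mpoly.span (S - {s}) \<subseteq> mpoly.span ({g \<in> G. fdeg g = Suc d} - {s})"
      by (rule mpoly.span_mono) (use S' in blast)
    then show "s \<notin> {x + y |x y. x \<in> R1 n (component n I d) \<and> y \<in> mpoly.span (S - {s})}"
      using min_gens_new[OF G, of s d] s S' by blast
  qed
qed

lemma initial_deg_facts:
  fixes I :: "'k::field mpoly set"
  assumes G: "min_gens n I G" and nz: "f \<in> I" "f \<noteq> 0"
  shows "d < initial_deg n I \<Longrightarrow> component n I d = {0}" "component n I (initial_deg n I) \<noteq> {0}"
proof -
  note F = min_gens_facts[OF G]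
  let ?P = "\<lambda>d. \<exists>G. min_gens n I G \<and> G \<inter> forms n d \<noteq> {}"
  have "G \<noteq> {}"
  proof
    assume "G = {}"
    then have "Idl\<^bsub>PR n\<^esub> {} = I" using F(3) by simp
    moreover have "Idl\<^bsub>PR n\<^esub> {} \<subseteq> {0 :: 'k mpoly}"
      by (rule genideal_least[OF poly_idealI]) (simp_all add: carrier_closed)
    ultimately show False using nz by blast
  qed
  then obtain g where "g \<in> G" by blast
  then have ex: "?P (fdeg g)" using G F(7)[of g] by blast
  have at: "?P (initial_deg n I)" unfolding initial_deg_def by (rule LeastI[of ?P, OF ex])
  have below: "\<not> ?P d" if "d < initial_deg n I" for d
    using that not_less_Least[of d ?P] unfolding initial_deg_def by blast
  have le: "initial_deg n I \<le> fdeg g" if "g \<in> G" for g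
    using below[of "fdeg g"] G F(7)[OF that] that by (meson disjoint_iff not_le)
  show "component n I d = {0}" if d: "d < initial_deg n I"
  proof -
    have "f = 0" if f: "f \<in> component n I d" for f
    proof -
      have fI: "f \<in> Idl\<^bsub>PR n\<^esub> G" and ff: "f \<in> forms n d" using f F(3) by (simp_all add: component_def)
      obtain h where "f = (\<Sum>g\<in>{g\<in>G. fdeg g \<le> d}. h g * g)"
        using graded_rep[OF F(1) F(7) fI ff] by blast
      moreover have "{g\<in>G. fdeg g \<le> d} = {}" using le d by force
      ultimately show ?thesis by simp
    qed
    moreover have "0 \<in> component n I d" by (rule mpoly.subspace_0[OF component_subspace[OF F(4)]])
    ultimately show ?thesis by blast
  qed
  from at obtain G' g where G': "min_gens n I G'" "g \<in> G'" "g \<in> forms n (initial_deg n I)" by blast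
  note F' = min_gens_facts[OF G'(1)]
  have "g \<in> component n I (initial_deg n I)" "g \<noteq> 0" using G' F'(5,6) by (auto simp: component_def)
  then show "component n I (initial_deg n I) \<noteq> {0}" by blast
qed

section \<open>Monomial ideals\<close>

lemma monomial_ideal_iff:
  assumes M: "M \<subseteq> exponents n"
  shows "f \<in> Idl\<^bsub>PR n\<^esub> (pmonom ` M) \<longleftrightarrow>
    f \<in> carrier (PR n) \<and> (\<forall>p\<in>keys (f :: 'k::field mpoly). \<exists>u\<in>M. \<exists>w\<in>exponents n. p = u + w)"
proof
  let ?J = "{f \<in> carrier (PR n). \<forall>p\<in>keys f. \<exists>u\<in>M. \<exists>w\<in>exponents n. p = u + w} :: 'k mpoly set"
  have J: "ideal ?J (PR n)"
  proof (rule poly_idealI)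
    show "f + g \<in> ?J" if "f \<in> ?J" "g \<in> ?J" for f g
      using that keys_add[of f g] carrier_closed(3)[of f n g] by blast
    show "h * f \<in> ?J" if f: "f \<in> ?J" and h: "h \<in> carrier (PR n)" for f h
    proof -
      have "\<exists>u\<in>M. \<exists>w\<in>exponents n. p = u + w" if pk: "p \<in> keys (h * f)" for p
      proof -
        obtain a b where ab: "a \<in> keys h" "b \<in> keys f" "p = a + b" using pk keys_mult[of h f] by blast
        then obtain u w where uw: "u \<in> M" "w \<in> exponents n" "b = u + w" using f by blast
        have "a \<in> exponents n" using h ab(1) by (auto simp: carrier_iff)
        then have "a + w \<in> exponents n" by (rule exponents_add[OF _ uw(2)])
        moreover have "p = u + (a + w)" by (simp add: ab(3) uw(3) add.left_commute)
        ultimately show ?thesis using uw(1) by blast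
      qed
      then show ?thesis using carrier_closed(4)[OF h, of f] f by blast
    qed
  qed (auto simp: carrier_closed)
  have "pmonom ` M \<subseteq> ?J"
  proof
    fix g :: "'k mpoly" assume "g \<in> pmonom ` M"
    then obtain u where u: "u \<in> M" "g = pmonom u" by blast
    have "u = u + 0 \<and> (0 :: expo) \<in> exponents n" by simp
    then have "\<exists>v\<in>M. \<exists>w\<in>exponents n. u = v + w" using u(1) by blast
    then show "g \<in> ?J" using u M by (auto simp: carrier_iff)
  qed
  then have "Idl\<^bsub>PR n\<^esub> (pmonom ` M) \<subseteq> ?J" by (rule genideal_least[OF J])
  then show "f \<in> Idl\<^bsub>PR n\<^esub> (pmonom ` M) \<Longrightarrow>
    f \<in> carrier (PR n) \<and> (\<forall>p\<in>keys f. \<exists>u\<in>M. \<exists>w\<in>exponents n. p = u + w)" by blast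
next
  assume f: "f \<in> carrier (PR n) \<and> (\<forall>p\<in>keys f. \<exists>u\<in>M. \<exists>w\<in>exponents n. p = u + w)"
  have c: "(pmonom ` M :: 'k mpoly set) \<subseteq> carrier (PR n)" using M by (auto simp: carrier_iff)
  note I = genideal_is_ideal[OF c]
  have "(\<Sum>p\<in>keys f. pscale (lookup f p) (pmonom p)) \<in> Idl\<^bsub>PR n\<^esub> (pmonom ` M)"
  proof (rule ideal_closed(6)[OF I(1)], rule ideal_closed(5)[OF I(1)])
    fix p assume "p \<in> keys f"
    then obtain u w where uw: "u \<in> M" "w \<in> exponents n" "p = u + w" using f by blast
    have "pmonom w * pmonom u \<in> Idl\<^bsub>PR n\<^esub> (pmonom ` M :: 'k mpoly set)"
      by (rule ideal_closed(4)[OF I(1)]) (use uw I(2) in \<open>auto simp: carrier_iff\<close>)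
    then show "pmonom p \<in> Idl\<^bsub>PR n\<^esub> (pmonom ` M :: 'k mpoly set)"
      by (simp add: pmonom_mult uw(3) add.commute)
  qed
  then show "f \<in> Idl\<^bsub>PR n\<^esub> (pmonom ` M)"
    using poly_expansion[OF finite_keys order_refl, of f] by simp
qed

lemma up_extend:
  assumes "0 < n"
  shows "up n (\<Union>u\<in>A. (+) u ` Mon n e) = (\<Union>u\<in>A. (+) u ` Mon n (Suc e))"
proof -
  have "up n (\<Union>u\<in>A. (+) u ` Mon n e) = (\<Union>u\<in>A. up n ((+) u ` Mon n e))"
    unfolding up_def by (simp only: image_UN) (rule SUP_commute)
  also have "\<dots> = (\<Union>u\<in>A. (+) u ` Mon n (Suc e))" by (simp only: up_translate up_Mon[OF assms])
  finally show ?thesis .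
qed

lemma lexseg_extend:
  assumes n: "0 < n" and A: "lexseg n c A"
  shows "lexseg n (c + e) (\<Union>u\<in>A. (+) u ` Mon n e)"
proof (induction e)
  case 0
  have "(\<Union>u\<in>A. (+) u ` Mon n 0) = A" by simp
  then show ?case using A by simp
next
  case (Suc e)
  show ?case using lexseg_up[OF n Suc.IH] by (simp only: add_Suc_right up_extend[OF n])
qed

text \<open>The monomials of degree \<open>d\<close> that are divisible by $x_i^c$.\<close>

definition pure_power :: "nat \<Rightarrow> nat \<Rightarrow> nat \<Rightarrow> nat \<Rightarrow> expo set" where
  "pure_power n i c d = (if c \<le> d then (+) (Poly_Mapping.single i c) ` Mon n (d - c) else {})"

lemma pure_power_iff:
  assumes "i < n"
  shows "p \<in> pure_power n i c d \<longleftrightarrow> p \<in> Mon n d \<and> (\<exists>w\<in>exponents n. p = Poly_Mapping.single i c + w)"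
proof
  assume p: "p \<in> pure_power n i c d"
  then have cd: "c \<le> d" by (auto simp: pure_power_def split: if_splits)
  then obtain w where w: "w \<in> Mon n (d - c)" "p = Poly_Mapping.single i c + w"
    using p by (auto simp: pure_power_def)
  have "Poly_Mapping.single i c \<in> Mon n c" using assms by (simp add: Mon_def single_exponents)
  from Mon_add[OF this w(1)] show "p \<in> Mon n d \<and> (\<exists>w\<in>exponents n. p = Poly_Mapping.single i c + w)"
    using cd w Mon_exponents[OF w(1)] by auto
next
  assume "p \<in> Mon n d \<and> (\<exists>w\<in>exponents n. p = Poly_Mapping.single i c + w)"
  then obtain w where w: "p \<in> Mon n d" "w \<in> exponents n" "p = Poly_Mapping.single i c + w" by blast
  have "c + tdeg w = d" using Mon_tdeg[OF w(1)] by (simp add: w(3) tdeg_add)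
  then have "c \<le> d" "w \<in> Mon n (d - c)" using w(2) by (auto simp: Mon_def)
  then show "p \<in> pure_power n i c d" using w(3) by (simp add: pure_power_def)
qed

lemma finite_pure_power [simp]: "finite (pure_power n i c d)"
  by (simp add: pure_power_def)

lemma card_pure_power: "card (pure_power n i c d) = (if c \<le> d then card (Mon n (d - c)) else 0)"
  by (simp add: pure_power_def card_translate)

lemma up_pure_power: "0 < n \<Longrightarrow> c \<le> d \<Longrightarrow> up n (pure_power n i c d) = pure_power n i c (Suc d)"
  by (simp add: pure_power_def up_translate up_Mon Suc_diff_le)

lemma up_pure_power_empty: "\<not> c \<le> d \<Longrightarrow> up n (pure_power n i c d) = {}"
  by (simp add: pure_power_def up_def)

text \<open>Every element of a short lex segment is divisible by a power of $x_0$ so high that no room is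
  left for $x_i^\alpha$. In degree below $2 \alpha$ no monomial is a multiple of two of the pure
  powers.\<close>

lemma card_lex_plus_powers:
  assumes n: "2 \<le> n" and A: "lexseg n d A" "card A < \<alpha>" and d: "d < 2 * \<alpha>"
    and I: "finite I" "\<And>i. i \<in> I \<Longrightarrow> 0 < i \<and> i < n" and c: "\<And>i. i \<in> I \<Longrightarrow> \<alpha> \<le> c i"
  shows "card (A \<union> (\<Union>i\<in>I. pure_power n i (c i) d)) = card A + (\<Sum>i\<in>I. card (pure_power n i (c i) d))"
proof -
  have pp: "c i + lookup p 0 \<le> d \<and> c i \<le> lookup p i" if iI: "i \<in> I" and ppi: "p \<in> pure_power n i (c i) d" for i p
  proof -
    have i: "0 < i" "i < n" using I(2)[OF iI] by simp_all
    obtain w where w: "p \<in> Mon n d" "p = Poly_Mapping.single i (c i) + w"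
      using ppi pure_power_iff[OF i(2)] by blast
    have "lookup p 0 = lookup w 0" using i by (simp add: w(2) lookup_add lookup_single)
    moreover have "c i + tdeg w = d" using Mon_tdeg[OF w(1)] by (simp add: w(2) tdeg_add)
    ultimately show ?thesis using lookup_le_tdeg[of w 0] by (simp add: w(2) lookup_add)
  qed
  have "A \<inter> (\<Union>i\<in>I. pure_power n i (c i) d) = {}"
  proof (rule ccontr)
    assume "\<not> ?thesis"
    then obtain p i where p: "p \<in> A" "i \<in> I" "p \<in> pure_power n i (c i) d" by blast
    have "d < lookup p 0 + card A" by (rule lexseg_lookup_0[OF n A(1) p(1)])
    then show False using pp[OF p(2,3)] c[OF p(2)] A(2) by linarith
  qed
  then have "card (A \<union> (\<Union>i\<in>I. pure_power n i (c i) d)) = card A + card (\<Union>i\<in>I. pure_power n i (c i) d)"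
    by (intro card_Un_disjoint lexseg_finite[OF A(1)]) (use I(1) in simp_all)
  also have "card (\<Union>i\<in>I. pure_power n i (c i) d) = (\<Sum>i\<in>I. card (pure_power n i (c i) d))"
  proof (rule card_UN_disjoint[OF I(1)])
    show "\<forall>i\<in>I. \<forall>j\<in>I. i \<noteq> j \<longrightarrow> pure_power n i (c i) d \<inter> pure_power n j (c j) d = {}"
    proof (intro ballI impI, rule ccontr)
      fix i j assume ij: "i \<in> I" "j \<in> I" "i \<noteq> j" "pure_power n i (c i) d \<inter> pure_power n j (c j) d \<noteq> {}"
      then obtain p where p: "p \<in> pure_power n i (c i) d" "p \<in> pure_power n j (c j) d" by blast
      have "p \<in> Mon n d" using p(1) pure_power_iff I(2)[OF ij(1)] by blast
      then have "d = (\<Sum>k<n. lookup p k)"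
        using tdeg_sum[of "{..<n}" p] by (simp add: Mon_def exponents_def)
      also have "\<dots> \<ge> (\<Sum>k\<in>{i,j}. lookup p k)"
        by (rule sum_mono2) (use I(2) ij in auto)
      finally have "lookup p i + lookup p j \<le> d" using ij(3) by simp
      then show False
        using pp[OF ij(1) p(1)] pp[OF ij(2) p(2)] c[OF ij(1)] c[OF ij(2)] d by linarith
    qed
  qed simp
  finally show ?thesis .
qed

definition lpp_monomials :: "nat \<Rightarrow> nat \<Rightarrow> nat list \<Rightarrow> expo set \<Rightarrow> nat \<Rightarrow> expo set" where
  "lpp_monomials n \<alpha> a A d = A \<union> (\<Union>i<length a. pure_power n i (\<alpha> + a ! i) d)"

lemma lpp_component:
  fixes L :: "'k::field mpoly set"
  assumes la: "length a \<le> n" and M: "M \<subseteq> exponents n" and L: "L = Idl\<^bsub>PR n\<^esub> (pmonom ` M)"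
    and J: "J = L <+>\<^bsub>PR n\<^esub> Idl\<^bsub>PR n\<^esub> ((\<lambda>i. pmonom (Poly_Mapping.single i (\<alpha> + a ! i))) ` {..<length a})"
  shows "component n J d = monspan (lpp_monomials n \<alpha> a {p \<in> Mon n d. pmonom p \<in> L} d)"
proof -
  let ?P = "(\<lambda>i. Poly_Mapping.single i (\<alpha> + a ! i)) ` {..<length a}"
  have P: "?P \<subseteq> exponents n" using la by (auto intro!: single_exponents)
  let ?K = "Idl\<^bsub>PR n\<^esub> (pmonom ` ?P) :: 'k mpoly set"
  have JK: "J = {x + y | x y. x \<in> L \<and> y \<in> ?K}"
    unfolding J image_image set_add_def' by (auto simp: PR_simps)
  have Lm: "f \<in> L \<longleftrightarrow> f \<in> carrier (PR n) \<and> (\<forall>p\<in>keys f. pmonom p \<in> L)" for f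
    unfolding L monomial_ideal_iff[OF M] by (auto simp: carrier_iff)
  have Km: "f \<in> ?K \<longleftrightarrow> f \<in> carrier (PR n) \<and> (\<forall>p\<in>keys f. pmonom p \<in> ?K)" for f
    unfolding monomial_ideal_iff[OF P] by (auto simp: carrier_iff)
  have Kp: "pmonom p \<in> ?K \<longleftrightarrow> p \<in> (\<Union>i<length a. pure_power n i (\<alpha> + a ! i) d)" if p: "p \<in> Mon n d" for p
  proof -
    have "pmonom p \<in> ?K \<longleftrightarrow> (\<exists>i<length a. \<exists>w\<in>exponents n. p = Poly_Mapping.single i (\<alpha> + a ! i) + w)"
      unfolding monomial_ideal_iff[OF P] using Mon_exponents[OF p] by (auto simp: carrier_iff)
    also have "\<dots> \<longleftrightarrow> (\<exists>i<length a. p \<in> pure_power n i (\<alpha> + a ! i) d)"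
      using pure_power_iff la p by (metis (no_types, lifting) less_le_trans)
    finally show ?thesis by auto
  qed
  show ?thesis
  proof
    show "component n J d \<subseteq> monspan (lpp_monomials n \<alpha> a {p \<in> Mon n d. pmonom p \<in> L} d)"
    proof
      fix f assume f: "f \<in> component n J d"
      then obtain x y where xy: "f = x + y" "x \<in> L" "y \<in> ?K" unfolding component_def JK by blast
      have fM: "keys f \<subseteq> Mon n d" using f by (simp add: component_def forms_iff)
      show "f \<in> monspan (lpp_monomials n \<alpha> a {p \<in> Mon n d. pmonom p \<in> L} d)"
        unfolding monspan_iff lpp_monomials_def
      proof
        fix p assume p: "p \<in> keys f"
        then have pM: "p \<in> Mon n d" using fM by blast
        have "p \<in> keys x \<or> p \<in> keys y" using p keys_add[of x y] unfolding xy(1) by blast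
        then have "pmonom p \<in> L \<or> pmonom p \<in> ?K" using Lm[of x] Km[of y] xy(2,3) by blast
        then show "p \<in> {p \<in> Mon n d. pmonom p \<in> L} \<union> (\<Union>i<length a. pure_power n i (\<alpha> + a ! i) d)"
          using Kp[OF pM] pM by blast
      qed
    qed
    show "monspan (lpp_monomials n \<alpha> a {p \<in> Mon n d. pmonom p \<in> L} d) \<subseteq> component n J d"
    proof
      fix f :: "'k mpoly" assume f: "f \<in> monspan (lpp_monomials n \<alpha> a {p \<in> Mon n d. pmonom p \<in> L} d)"
      have k: "p \<in> Mon n d \<and> (pmonom p \<in> L \<or> pmonom p \<in> ?K)" if "p \<in> keys f" for p
      proof -
        have "p \<in> {p \<in> Mon n d. pmonom p \<in> L} \<union> (\<Union>i<length a. pure_power n i (\<alpha> + a ! i) d)"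
          using f that unfolding monspan_iff lpp_monomials_def by blast
        then show ?thesis
        proof
          assume u: "p \<in> (\<Union>i<length a. pure_power n i (\<alpha> + a ! i) d)"
          then obtain i where i: "i < length a" "p \<in> pure_power n i (\<alpha> + a ! i) d" by blast
          have "p \<in> Mon n d" using i pure_power_iff[of i n p] la by simp
          then show ?thesis using Kp u by blast
        qed simp
      qed
      have ff: "f \<in> forms n d" unfolding forms_iff using k by blast
      let ?A = "{p. pmonom p \<in> L}"
      have "restr ?A f \<in> L"
        unfolding Lm[of "restr ?A f"] keys_restr carrier_iff using k Mon_exponents by blast
      moreover have "restr (- ?A) f \<in> ?K"
        unfolding Km[of "restr (- ?A) f"] keys_restr carrier_iff using k Mon_exponents by blast
      moreover have "f = restr ?A f + restr (- ?A) f"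
        by (rule poly_mapping_eqI) (simp add: lookup_add lookup_restr)
      ultimately have "f \<in> J" unfolding JK by blast
      then show "f \<in> component n J d" using ff by (simp add: component_def)
    qed
  qed
qed

lemma lex_ideal_segment:
  fixes L :: "'k::field mpoly set"
  assumes "lex_ideal n L"
  shows "lexseg n d {p \<in> Mon n d. pmonom p \<in> L}"
  unfolding lexseg_def
proof (intro conjI ballI impI)
  fix u v assume u: "u \<in> {p \<in> Mon n d. pmonom p \<in> L}" and v: "v \<in> Mon n d" "u < v"
  have "lex_greater v u" using v(2) by (simp add: less_expo_iff)
  moreover have "u \<in> exponents n" "v \<in> exponents n" "tdeg v = tdeg u"
    using u v(1) by (auto simp: Mon_def)
  ultimately have "pmonom v \<in> L" using assms u unfolding lex_ideal_def by blast
  then show "v \<in> {p \<in> Mon n d. pmonom p \<in> L}" using v(1) by simp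
qed auto

text \<open>The pure powers other than the first one that are present in degree $\alpha + j$. The first one is
  left out because $x_0^\alpha$ is part of the lex segment. The two numbers below count their multiples
  in degree $\alpha + j$, and the multiples of these in the next degree.\<close>

definition later :: "nat list \<Rightarrow> nat \<Rightarrow> nat set" where
  "later a j = {i \<in> {1..<length a}. a ! i \<le> j}"

definition power_part :: "nat \<Rightarrow> nat list \<Rightarrow> nat \<Rightarrow> nat" where
  "power_part n a j = (\<Sum>i\<in>later a j. card (Mon n (j - a ! i)))"

definition power_part_up :: "nat \<Rightarrow> nat list \<Rightarrow> nat \<Rightarrow> nat" where
  "power_part_up n a j = (\<Sum>i\<in>later a j. card (Mon n (Suc j - a ! i)))"

lemma finite_later [simp]: "finite (later a j)"
  by (simp add: later_def)

lemma power_part_Suc: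
  "power_part n a (Suc j) = power_part_up n a j + card {i \<in> {1..<length a}. a ! i = Suc j}"
proof -
  let ?N = "{i \<in> {1..<length a}. a ! i = Suc j}"
  have "later a (Suc j) = later a j \<union> ?N" by (auto simp: later_def)
  then have "power_part n a (Suc j) = (\<Sum>i\<in>later a j. card (Mon n (Suc j - a ! i))) + (\<Sum>i\<in>?N. card (Mon n (Suc j - a ! i)))"
    unfolding power_part_def by (simp add: sum.union_disjoint disjoint_iff later_def)
  also have "(\<Sum>i\<in>?N. card (Mon n (Suc j - a ! i))) = (\<Sum>i\<in>?N. 1)"
    by (rule sum.cong) auto
  finally show ?thesis by (simp add: power_part_up_def)
qed

lemma lpp_monomials_split:
  assumes "0 < length a" "a ! 0 = 0"
  shows "lpp_monomials n \<alpha> a A (\<alpha> + j) = (A \<union> (+) (Poly_Mapping.single 0 \<alpha>) ` Mon n j)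
    \<union> (\<Union>i\<in>{1..<length a}. pure_power n i (\<alpha> + a ! i) (\<alpha> + j))"
proof -
  have split: "{..<length a} = insert 0 {1..<length a}" using assms(1) by auto
  have "pure_power n 0 (\<alpha> + a ! 0) (\<alpha> + j) = (+) (Poly_Mapping.single 0 \<alpha>) ` Mon n j"
    by (simp add: pure_power_def assms(2))
  then show ?thesis unfolding lpp_monomials_def split by (simp add: Un_assoc)
qed

text \<open>\<open>A'\<close> is the lex part together with the multiples of $x_0^\alpha$, again a lex segment; its
  shortness makes the union with the other pure powers disjoint, also in the next degree.\<close>

lemma lpp_monomials_size:
  assumes n: "2 \<le> n" and la: "0 < length a" "length a \<le> n" and a0: "a ! 0 = 0"
    and A: "lexseg n (\<alpha> + j) A" and A': "A' = A \<union> (+) (Poly_Mapping.single 0 \<alpha>) ` Mon n j"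
    and small: "n * card A' < \<alpha>" and j: "Suc j < \<alpha>"
  shows "lexseg n (\<alpha> + j) A'"
    "card (lpp_monomials n \<alpha> a A (\<alpha> + j)) = card A' + power_part n a j"
    "card (up n (lpp_monomials n \<alpha> a A (\<alpha> + j))) = card (up n A') + power_part_up n a j"
proof -
  have n0: "0 < n" using n by simp
  let ?d = "\<alpha> + j" and ?I = "{1..<length a}"
  let ?PP = "\<lambda>d. \<Union>i\<in>?I. pure_power n i (\<alpha> + a ! i) d"
  show ls: "lexseg n ?d A'" unfolding A' by (rule lexseg_Un[OF A lexseg_translate[OF n0 lexseg_Mon]])
  have eq: "lpp_monomials n \<alpha> a A ?d = A' \<union> ?PP ?d"
    unfolding A' by (rule lpp_monomials_split[OF la(1) a0])
  have "card A' \<le> n * card A'" using n0 by simp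
  then have cA: "card A' < \<alpha>" using small by (rule le_less_trans)
  have I: "finite ?I" "\<And>i. i \<in> ?I \<Longrightarrow> 0 < i \<and> i < n" using la by auto
  have s1: "(\<Sum>i\<in>?I. card (pure_power n i (\<alpha> + a ! i) ?d)) = power_part n a j"
    unfolding power_part_def later_def card_pure_power
    by (simp add: sum.inter_filter[symmetric])
  show "card (lpp_monomials n \<alpha> a A ?d) = card A' + power_part n a j"
    unfolding eq s1[symmetric] by (rule card_lex_plus_powers[OF n ls cA _ I]) (use j in simp_all)
  have upA: "lexseg n (Suc ?d) (up n A')" by (rule lexseg_up[OF n0 ls])
  have cuA: "card (up n A') < \<alpha>" using card_up_lexseg[OF n0 ls] small by linarith
  have upeq: "up n (lpp_monomials n \<alpha> a A ?d) = up n A' \<union> (\<Union>i\<in>later a j. pure_power n i (\<alpha> + a ! i) (Suc ?d))"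
  proof -
    have "up n (?PP ?d) = (\<Union>i\<in>?I. up n (pure_power n i (\<alpha> + a ! i) ?d))"
      unfolding up_def by (simp only: image_UN) (rule SUP_commute)
    also have "\<dots> = (\<Union>i\<in>?I. if a ! i \<le> j then pure_power n i (\<alpha> + a ! i) (Suc ?d) else {})"
      by (intro SUP_cong refl) (simp add: up_pure_power n0 up_pure_power_empty)
    also have "\<dots> = (\<Union>i\<in>later a j. pure_power n i (\<alpha> + a ! i) (Suc ?d))"
      by (auto simp: later_def split: if_splits)
    finally show ?thesis unfolding eq up_Un by simp
  qed
  have "card (up n (lpp_monomials n \<alpha> a A ?d))
    = card (up n A') + (\<Sum>i\<in>later a j. card (pure_power n i (\<alpha> + a ! i) (Suc ?d)))"
    unfolding upeq by (rule card_lex_plus_powers[OF n upA cuA]) (use j la in \<open>auto simp: later_def\<close>)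
  also have "(\<Sum>i\<in>later a j. card (pure_power n i (\<alpha> + a ! i) (Suc ?d))) = power_part_up n a j"
    unfolding power_part_up_def card_pure_power by (rule sum.cong) (auto simp: later_def)
  finally show "card (up n (lpp_monomials n \<alpha> a A ?d)) = card (up n A') + power_part_up n a j" .
qed

section \<open>Growth of lex segments\<close>

text \<open>The size of \<open>up n A\<close> for a lex segment \<open>A\<close> of size \<open>m\<close>.\<close>

definition grow :: "nat \<Rightarrow> nat \<Rightarrow> nat" where
  "grow n m = n * m - lexsum n 1 m"

lemma card_up_grow:
  assumes "2 \<le> n" "lexseg n d A"
  shows "card (up n A) = grow n (card A)"
  using card_up_lexseg[of n d A] lexsum_eq[OF assms, of 1] assms unfolding grow_def by simp

text \<open>The formulas of Eliahou and Kervaire for a lex segment of size \<open>m\<close>; in particular the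
  subtraction in \<open>grow\<close> does not truncate.\<close>

lemma grow_lexsum:
  assumes n: "2 \<le> n"
  shows "grow n m + lexsum n 1 m = n * m"
    and "lexsum n 1 (grow n m) + lexsum n 2 m = (n choose 2) * m"
proof -
  have n0: "0 < n" using n by simp
  obtain A where A: "lexseg n m A" "card A = m" "mxsum 1 A = lexsum n 1 m"
    by (rule lexsum_obtain[OF n order_refl])
  have c: "card (up n A) = grow n m" using card_up_grow[OF n A(1)] A(2) by simp
  show "grow n m + lexsum n 1 m = n * m"
    using card_up_lexseg[OF n0 A(1)] c A(2,3) by simp
  have "mxsum 1 (up n A) = lexsum n 1 (grow n m)"
    using lexsum_eq[OF n lexseg_up[OF n0 A(1)], of 1] c by simp
  then show "lexsum n 1 (grow n m) + lexsum n 2 m = (n choose 2) * m"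
    using mxsum_up_lexseg[OF n0 A(1)] lexsum_eq[OF n A(1), of 2] A(2) by simp
qed

lemma grow_twice:
  assumes "2 \<le> n"
  shows "n * grow n m + lexsum n 2 m = grow n (grow n m) + (n choose 2) * m"
  using grow_lexsum(1)[OF assms, of "grow n m"] grow_lexsum(2)[OF assms, of m] by linarith

lemma grow_Mon: "2 \<le> n \<Longrightarrow> grow n (card (Mon n d)) = card (Mon n (Suc d))"
  using card_up_grow[OF _ lexseg_Mon, of n d] up_Mon[of n d] by simp

lemma grow_1: "2 \<le> n \<Longrightarrow> grow n 1 = n"
  using lexsum_small(2)[of n 1] unfolding grow_def by simp

lemma card_Mon_1: "2 \<le> n \<Longrightarrow> card (Mon n 1) = n"
  using grow_Mon[of n 0] grow_1[of n] by simp

section \<open>The jumps of $\gamma$\<close>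

lemma sorted_prefix:
  fixes a :: "nat list"
  assumes "sorted a"
  shows "{i. i < length a \<and> a ! i \<le> j} = {..<length (takeWhile (\<lambda>x. x \<le> j) a)}"
proof -
  let ?m = "length (takeWhile (\<lambda>x. x \<le> j) a)"
  have ml: "?m \<le> length a" by (rule length_takeWhile_le)
  have 1: "a ! i \<le> j" if i: "i < ?m" for i
    using nth_mem[OF i] set_takeWhileD takeWhile_nth[OF i] by fastforce
  have 2: "i < ?m" if i: "i < length a" "a ! i \<le> j" for i
  proof (rule ccontr)
    assume c: "\<not> i < ?m"
    then have "?m < length a" using i(1) by linarith
    then have "\<not> a ! ?m \<le> j" by (rule nth_length_takeWhile)
    moreover have "a ! ?m \<le> a ! i" using sorted_nth_mono[OF assms, of ?m i] c i(1) by simp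
    ultimately show False using i(2) by simp
  qed
  show ?thesis using 1 2 ml by fastforce
qed

lemma gamma_card:
  assumes a: "sorted a" and \<alpha>: "initial_deg n I = \<alpha>"
  shows "gamma n I a (\<alpha> + j) = card {i. i < length a \<and> a ! i \<le> j}" "d < \<alpha> \<Longrightarrow> gamma n I a d = 0"
proof -
  let ?m = "length (takeWhile (\<lambda>x. x \<le> j) a)"
  have e: "\<alpha> + a ! (i - 1) \<le> \<alpha> + j \<longleftrightarrow> i - 1 < ?m" if "i \<in> {1..length a}" for i
  proof -
    have "i - 1 < length a" using that by auto
    then have "a ! (i - 1) \<le> j \<longleftrightarrow> i - 1 \<in> {i. i < length a \<and> a ! i \<le> j}" by simp
    then show ?thesis unfolding sorted_prefix[OF a] by simp
  qed
  have e1: "{i \<in> {1..length a}. \<alpha> + a ! (i - 1) \<le> \<alpha> + j} = {1..?m}"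
  proof (rule Set.set_eqI)
    fix i
    show "i \<in> {i \<in> {1..length a}. \<alpha> + a ! (i - 1) \<le> \<alpha> + j} \<longleftrightarrow> i \<in> {1..?m}"
    proof (cases "i \<in> {1..length a}")
      case True
      then show ?thesis using e[OF True] by auto
    next
      case False
      then show ?thesis using length_takeWhile_le[of "\<lambda>x. x \<le> j" a] by auto
    qed
  qed
  have e0: "{0} \<union> {i \<in> {1..length a}. \<alpha> + a ! (i - 1) \<le> \<alpha> + j} = {0..?m}" unfolding e1 by auto
  have "gamma n I a (\<alpha> + j) = Max {0..?m}" unfolding gamma_def \<alpha> e0 ..
  also have "\<dots> = ?m" by (rule Max_eqI) simp_all
  finally have "gamma n I a (\<alpha> + j) = ?m" .
  then show "gamma n I a (\<alpha> + j) = card {i. i < length a \<and> a ! i \<le> j}"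
    unfolding sorted_prefix[OF a] by simp
  show "gamma n I a d = 0" if "d < \<alpha>"
  proof -
    have "{i \<in> {1..length a}. \<alpha> + a ! (i - 1) \<le> d} = {}" using that by auto
    then show ?thesis unfolding gamma_def \<alpha> by (simp only:) simp
  qed
qed

text \<open>The jumps of $\gamma$ after degree $\alpha$ count the new pure powers; as \<open>a ! 0 = 0\<close>, the first
  one is not among them.\<close>

lemma gamma_step:
  assumes a: "sorted a" "0 < length a" "a ! 0 = 0" and \<alpha>: "initial_deg n I = \<alpha>"
  shows "gamma n I a (Suc (\<alpha> + j)) - gamma n I a (\<alpha> + j) = card {i \<in> {1..<length a}. a ! i = Suc j}"
proof -
  let ?N = "{i \<in> {1..<length a}. a ! i = Suc j}" and ?O = "{i. i < length a \<and> a ! i \<le> j}"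
  have "{i. i < length a \<and> a ! i \<le> Suc j} = ?O \<union> ?N"
  proof (rule Set.set_eqI)
    fix i show "i \<in> {i. i < length a \<and> a ! i \<le> Suc j} \<longleftrightarrow> i \<in> ?O \<union> ?N"
      using a(3) by (cases "i = 0") auto
  qed
  moreover have "card (?O \<union> ?N) = card ?O + card ?N" by (rule card_Un_disjoint) auto
  ultimately show ?thesis
    using gamma_card(1)[OF a(1) \<alpha>, of j] gamma_card(1)[OF a(1) \<alpha>, of "Suc j"] by simp
qed

section \<open>Growth in ideals of large initial degree\<close>

lemma den_bound_mono_step: "T \<le> T' \<Longrightarrow> den_bound m T c \<le> den_bound m T' c"
  by (induction c) (auto intro: add_mono mult_le_mono2)

lemma regular_seq_take:
  fixes fs :: "'k::field mpoly list"
  assumes reg: "regular_seq n fs"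
  shows "regular_seq n (take m fs)"
proof -
  have c: "set fs \<subseteq> carrier (PR n)" by (rule regular_seq_carrier[OF reg])
  have ct: "set (take m fs) \<subseteq> carrier (PR n)" by (rule take_carrier[OF reg])
  have "Idl\<^bsub>PR n\<^esub> (set (take m fs)) \<subseteq> Idl\<^bsub>PR n\<^esub> (set fs)"
    by (rule genideal_least[OF genideal_is_ideal(1)[OF c]])
      (rule order_trans[OF set_take_subset genideal_is_ideal(2)[OF c]])
  moreover have "Idl\<^bsub>PR n\<^esub> (set fs) \<subset> carrier (PR n)"
    using ideal_closed(1)[OF genideal_is_ideal(1)[OF c]] reg unfolding regular_seq_def by blast
  ultimately have ne: "Idl\<^bsub>PR n\<^esub> (set (take m fs)) \<noteq> carrier (PR n)" by blast
  have "\<forall>i<length (take m fs). \<forall>g\<in>carrier (PR n).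
      g * take m fs ! i \<in> Idl\<^bsub>PR n\<^esub> (set (take i (take m fs))) \<longrightarrow> g \<in> Idl\<^bsub>PR n\<^esub> (set (take i (take m fs)))"
  proof (intro allI impI ballI)
    fix i and g :: "'k mpoly"
    assume i: "i < length (take m fs)" and g: "g \<in> carrier (PR n)"
      and gi: "g * take m fs ! i \<in> Idl\<^bsub>PR n\<^esub> (set (take i (take m fs)))"
    have e: "take m fs ! i = fs ! i" "take i (take m fs) = take i fs" "i < length fs" using i by (simp_all add: min_absorb1)
    show "g \<in> Idl\<^bsub>PR n\<^esub> (set (take i (take m fs)))"
      using reg gi g e(3) unfolding e(1,2) regular_seq_def by blast
  qed
  then show ?thesis using ct ne unfolding regular_seq_def by blast
qed

text \<open>The situation of the theorem. The condition \<open>a ! 0 = 0\<close> holds for every minimal type, as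
  $\rho(1) = \alpha$. The bound \<open>H\<close> on the Hilbert function in degrees $\alpha, \dots, \alpha + t$ is one
  that depends only on the type. The last assumption makes $\alpha$ so large that lex segments of size
  \<open>H\<close>, and their multiples by variables, are short in the sense needed for LPP ideals, and that
  $f_1, \dots, f_\ell$ have no relations in the degrees of common denominators for spaces of dimension
  \<open>H\<close>.\<close>

locale regular_type =
  fixes n :: nat and I G :: "'k::field_char_0 mpoly set" and fs :: "'k mpoly list"
    and a :: "nat list" and \<alpha> t H :: nat
  assumes n: "2 \<le> n"
    and gens: "min_gens n I G" and fsG: "set fs \<subseteq> G"
    and reg: "regular_seq n fs" and len: "length fs = length a"
    and sorted: "sorted a" and a_nonempty: "0 < length a" and a0: "a ! 0 = 0"
    and deg: "i < length a \<Longrightarrow> fs ! i \<in> forms n (\<alpha> + a ! i)"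
    and bounded: "j \<le> t \<Longrightarrow> mpoly.dim (component n I (\<alpha> + j)) \<le> H"
    and large: "n * H + t + 2 + den_bound H (t + 2) H < \<alpha>"
begin

abbreviation comp :: "nat \<Rightarrow> 'k mpoly set" where "comp j \<equiv> component n I (\<alpha> + j)"
definition h :: "nat \<Rightarrow> nat" where "h j = mpoly.dim (comp j)"
text \<open>The size that the lex segment of an LPP ideal with the same Hilbert function must have in
  degree $\alpha + j$. The subtraction does not truncate for $j \le t$.\<close>

definition lexpart :: "nat \<Rightarrow> nat" where "lexpart j = h j - power_part n a j"
definition new :: "nat \<Rightarrow> 'k mpoly set" where "new j = (!) fs ` {i. i < length a \<and> a ! i = j}"

lemma n0: "0 < n" using n by simp

lemmas gen_facts = min_gens_facts[OF gens]

lemma fsI: "set fs \<subseteq> I" using fsG gen_facts(5) by (rule order_trans)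

lemma fs_keys:
  assumes "f \<in> set fs" "p \<in> keys f"
  shows "\<alpha> \<le> tdeg p"
proof -
  obtain i where i: "i < length a" "f = fs ! i" using assms(1) len by (metis in_set_conv_nth)
  have "tdeg p = \<alpha> + a ! i" using deg[OF i(1)] assms(2) unfolding i(2) forms_def by blast
  then show ?thesis by simp
qed

lemma distinct_fs: "distinct fs"
proof -
  let ?gs = "map (\<lambda>i. pmonom (Poly_Mapping.single 0 (replicate (length fs) 0 ! i)) * fs ! i) [0..<length fs]"
  have "distinct ?gs"
    by (rule regular_shifted_independent(1)[OF n0 reg, where c = \<alpha> and ?k0.0 = 0 and E = 0 and ks = "replicate (length fs) 0"])
      (use fs_keys large in simp_all)
  moreover have "?gs = fs" by (rule nth_equalityI) simp_all
  ultimately show ?thesis by (simp only:)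
qed

lemma comp_subspace: "mpoly.subspace (comp j)" by (rule component_subspace[OF gen_facts(4)])

lemmas comp_fin_dim = component_fin_dim[of n I]

lemma new_0_insert: "{i. i < length a \<and> a ! i = 0} = insert 0 (later a 0)"
  using a_nonempty a0 by (auto simp: later_def)

lemma new_Suc: "{i. i < length a \<and> a ! i = Suc j} = {i \<in> {1..<length a}. a ! i = Suc j}"
proof (rule Set.set_eqI)
  fix i show "i \<in> {i. i < length a \<and> a ! i = Suc j} \<longleftrightarrow> i \<in> {i \<in> {1..<length a}. a ! i = Suc j}"
    using a0 by (cases "i = 0") auto
qed

lemma card_new: "card (new j) = card {i. i < length a \<and> a ! i = j}"
  unfolding new_def by (rule card_image) (rule inj_on_nth[OF distinct_fs], simp add: len)

lemma new_gens: "new j \<subseteq> G \<inter> forms n (\<alpha> + j)"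
proof
  fix f assume "f \<in> new j"
  then obtain i where i: "i < length a" "a ! i = j" "f = fs ! i" unfolding new_def by blast
  have "f \<in> set fs" unfolding i(3) by (rule nth_mem) (simp add: i(1) len)
  then show "f \<in> G \<inter> forms n (\<alpha> + j)" using fsG deg[OF i(1)] i(2,3) by blast
qed

text \<open>The refined lex bound for $I_{\alpha + j}$ and those elements of the regular sequence whose
  degree is at most $\alpha + j$.\<close>

lemma comp_bounds:
  assumes j: "j \<le> t"
  shows "power_part n a j + card (Mon n j) \<le> h j"
    and "p = 1 \<or> p = 2 \<Longrightarrow> kd p n (comp j) \<le> lexsum n p (lexpart j)
      + (\<Sum>i\<in>later a j. lexsum n p (card (Mon n (j - a ! i))))"
proof -
  define m where "m = length (takeWhile (\<lambda>x. x \<le> j) a)"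
  have m: "{i. i < length a \<and> a ! i \<le> j} = {..<m}" unfolding m_def by (rule sorted_prefix[OF sorted])
  have mle: "m \<le> length a" unfolding m_def by (rule length_takeWhile_le)
  have "0 \<in> {i. i < length a \<and> a ! i \<le> j}" using a_nonempty a0 by simp
  then have m0: "0 < m" by (simp only: m lessThan_iff)
  have ai: "a ! i \<le> j" if i: "i < m" for i
  proof -
    have "i \<in> {i. i < length a \<and> a ! i \<le> j}" unfolding m using i by simp
    then show ?thesis by simp
  qed
  have later: "later a j = {1..<m}"
  proof (rule Set.set_eqI)
    fix i
    have "i \<in> later a j \<longleftrightarrow> 1 \<le> i \<and> i \<in> {i. i < length a \<and> a ! i \<le> j}"
      by (simp add: later_def conj_assoc)
    then show "i \<in> later a j \<longleftrightarrow> i \<in> {1..<m}" by (simp only: m lessThan_iff atLeastLessThan_iff)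
  qed
  define ks where "ks = map (\<lambda>i. j - a ! i) [1..<m]"
  have ksi: "(j # ks) ! i = j - a ! i" if i: "i < m" for i
  proof (cases i)
    case (Suc k)
    have "[1..<m] ! k = 1 + k" by (rule nth_upt) (use i Suc in simp)
    then show ?thesis using i Suc by (simp add: ks_def)
  qed (simp add: a0)
  let ?fs = "take m fs"
  have lfs: "length ?fs = m" using mle len by simp
  have lks: "length ?fs = Suc (length ks)" unfolding lfs using m0 by (simp add: ks_def)
  define gs where "gs = map (\<lambda>i. pmonom (Poly_Mapping.single 0 ((j # ks) ! i)) * ?fs ! i) [0..<length ?fs]"
  let ?E = "den_bound (mpoly.dim (comp j)) (j + 2) (mpoly.dim (comp j))"
  have hb: "mpoly.dim (comp j) \<le> H" by (rule bounded[OF j])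
  have "?E \<le> den_bound H (j + 2) H" by (rule den_bound_mono[OF hb hb])
  also have "\<dots> \<le> den_bound H (t + 2) H" by (rule den_bound_mono_step) (use j in simp)
  finally have Ec: "?E + j < \<alpha>" using large j by linarith
  have fk: "\<alpha> \<le> tdeg p" if "f \<in> set ?fs" "p \<in> keys f" for f p
    using fs_keys[OF _ that(2)] in_set_takeD[OF that(1)] by blast
  have kb: "(j # ks) ! i \<le> j" if "i < length ?fs" for i using ksi[of i] that lfs by simp
  have ind: "distinct gs" "small_indep n ?E (set gs)"
    by (rule regular_shifted_independent[OF n0 regular_seq_take[OF reg] fk kb Ec gs_def]; assumption)+
  have inV: "q * ?fs ! i \<in> comp j" if i: "i < length ?fs" and q: "q \<in> forms n ((j # ks) ! i)" for i q
  proof -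
    have im: "i < m" and il: "i < length a" using i lfs mle by simp_all
    have q': "q \<in> forms n (j - a ! i)" using q ksi[OF im] by simp
    have "q * fs ! i \<in> forms n ((j - a ! i) + (\<alpha> + a ! i))" by (rule forms_mult[OF q' deg[OF il]])
    moreover have "(j - a ! i) + (\<alpha> + a ! i) = \<alpha> + j" using ai[OF im] by simp
    moreover have "fs ! i \<in> I" using fsI nth_mem[of i fs] il len by auto
    then have "q * fs ! i \<in> I" by (rule ideal_closed(4)[OF gen_facts(4) _ forms_carrier[OF q']])
    ultimately show ?thesis using im by (simp add: component_def)
  qed
  have ksle: "k \<le> j" if "k \<in> set ks" for k using that by (auto simp: ks_def)
  have conv: "sum_list (map F ks) = (\<Sum>i\<in>later a j. F (j - a ! i))" for F :: "nat \<Rightarrow> nat"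
    unfolding later ks_def map_map by (simp add: interv_sum_list_conv_sum_set_nat)
  note B = kd_regular_bound[OF n _ comp_subspace comp_fin_dim lks inV ksle gs_def ind(1) ind(2)]
  have pp: "sum_list (map (\<lambda>k. card (Mon n k)) ks) = power_part n a j"
    unfolding conv power_part_def ..
  show "power_part n a j + card (Mon n j) \<le> h j"
    using B(1)[of 1] unfolding h_def list.map sum_list.Cons pp by simp
  show "kd p n (comp j) \<le> lexsum n p (lexpart j) + (\<Sum>i\<in>later a j. lexsum n p (card (Mon n (j - a ! i))))"
    if p: "p = 1 \<or> p = 2"
    using B(2)[OF p] unfolding pp conv lexpart_def h_def .
qed

lemma h_split: "j \<le> t \<Longrightarrow> h j = lexpart j + power_part n a j"
  using comp_bounds(1) unfolding lexpart_def by force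

lemma lexpart_ge: "j \<le> t \<Longrightarrow> card (Mon n j) \<le> lexpart j"
  using comp_bounds(1) unfolding lexpart_def by force

lemma lexpart_small: "j \<le> t \<Longrightarrow> lexpart j \<le> H"
  using bounded[of j] unfolding lexpart_def h_def by simp

lemma power_part_grow:
  "n * power_part n a j = power_part_up n a j + (\<Sum>i\<in>later a j. lexsum n 1 (card (Mon n (j - a ! i))))"
proof -
  have "n * power_part n a j = (\<Sum>i\<in>later a j. n * card (Mon n (j - a ! i)))"
    unfolding power_part_def by (rule sum_distrib_left)
  also have "\<dots> = (\<Sum>i\<in>later a j. card (Mon n (Suc j - a ! i)) + lexsum n 1 (card (Mon n (j - a ! i))))"
  proof (rule sum.cong[OF refl])
    fix i assume "i \<in> later a j"
    then have "Suc j - a ! i = Suc (j - a ! i)" by (simp add: later_def Suc_diff_le)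
    then show "n * card (Mon n (j - a ! i)) = card (Mon n (Suc j - a ! i)) + lexsum n 1 (card (Mon n (j - a ! i)))"
      using grow_lexsum(1)[OF n, of "card (Mon n (j - a ! i))"] grow_Mon[OF n, of "j - a ! i"] by simp
  qed
  finally show ?thesis by (simp add: sum.distrib power_part_up_def)
qed

text \<open>The EGH bound: $I$ grows at least as fast as an LPP ideal with the same Hilbert function.\<close>

lemma R1_lower:
  assumes j: "j \<le> t"
  shows "grow n (lexpart j) + power_part_up n a j \<le> mpoly.dim (R1 n (comp j))"
proof -
  have "kd 1 n (comp j) + mpoly.dim (R1 n (comp j)) = n * h j"
    unfolding h_def by (rule kd_1_R1[OF comp_subspace comp_fin_dim])
  moreover have "n * h j = n * lexpart j + n * power_part n a j"
    unfolding h_split[OF j] by (rule distrib_left)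
  ultimately show ?thesis
    using comp_bounds(2)[OF j, of 1] power_part_grow[of j] grow_lexsum(1)[OF n, of "lexpart j"] by linarith
qed

lemma card_new_Suc: "power_part n a (Suc j) = power_part_up n a j + card (new (Suc j))"
  unfolding card_new new_Suc by (rule power_part_Suc)

lemma h_Suc_ge: "mpoly.dim (R1 n (comp j)) + card (new (Suc j)) \<le> h (Suc j)"
  using component_growth(2)[OF n0 gens, of "new (Suc j)" "\<alpha> + j"] new_gens[of "Suc j"] unfolding h_def by simp

lemma lexpart_grow:
  assumes j: "j < t"
  shows "grow n (lexpart j) \<le> lexpart (Suc j)"
  using R1_lower[of j] h_Suc_ge[of j] card_new_Suc[of j] h_split[of "Suc j"] j by linarith

text \<open>Equality in the growth bound.\<close>

definition minimal_growth :: "nat \<Rightarrow> bool" where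
  "minimal_growth j \<longleftrightarrow> mpoly.dim (R1 n (comp j)) = grow n (lexpart j) + power_part_up n a j"

text \<open>All minimal generators of degree $\alpha + j$ may be taken from the regular sequence. The
  subtraction does not truncate, as $\alpha > 0$; for \<open>j = 0\<close> the space $I_{\alpha - 1}$
  is zero if $\alpha$ is the initial degree.\<close>

definition no_other_gens :: "nat \<Rightarrow> bool" where
  "no_other_gens j \<longleftrightarrow> comp j \<subseteq> {x + y | x y. x \<in> R1 n (component n I (\<alpha> + j - 1)) \<and> y \<in> mpoly.span (new j)}"

lemma finite_new [simp]: "finite (new j)"
  unfolding new_def by simp

lemma h_Suc_eq:
  assumes "no_other_gens (Suc j)"
  shows "h (Suc j) = mpoly.dim (R1 n (comp j)) + card (new (Suc j))"
proof (rule antisym)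
  show "h (Suc j) \<le> mpoly.dim (R1 n (comp j)) + card (new (Suc j))"
    unfolding h_def
    by (rule mpoly.dim_sum_le[OF R1_fin_dim[OF comp_subspace comp_fin_dim] finite_new])
      (use assms in \<open>simp add: no_other_gens_def\<close>)
qed (rule h_Suc_ge)

lemma R1_sum_span:
  fixes X S :: "'k mpoly set"
  assumes X: "mpoly.subspace X" "mpoly.fin_dim X" and S: "finite S"
    and Y: "Y \<subseteq> {x + y | x y. x \<in> X \<and> y \<in> mpoly.span S}"
  shows "mpoly.dim (R1 n Y) \<le> mpoly.dim (R1 n X) + n * card S"
proof -
  let ?T = "(\<lambda>(i, g). var i * g) ` ({..<n} \<times> S) :: 'k mpoly set"
  have sp: "var i * y \<in> mpoly.span ?T" if i: "i < n" and y: "y \<in> mpoly.span S" for i y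
    using y
  proof (induction rule: mpoly.span_induct_alt)
    case base
    show ?case using mpoly.span_zero[of ?T] by simp
  next
    case (step c x y)
    have "var i * x \<in> mpoly.span ?T" by (rule mpoly.span_base) (use i step in auto)
    then have "pscale c (var i * x) + var i * y \<in> mpoly.span ?T"
      using step by (intro mpoly.span_add mpoly.span_scale)
    then show ?case by (simp add: distrib_left pscale_mult_right)
  qed
  have "R1 n Y \<subseteq> {x + y | x y. x \<in> R1 n X \<and> y \<in> mpoly.span ?T}"
  proof
    fix f assume "f \<in> R1 n Y"
    then obtain v where v: "\<And>i. i < n \<Longrightarrow> v i \<in> Y" "f = (\<Sum>i<n. var i * v i)" by (rule R1E) blast
    have "\<forall>i. \<exists>x y. i < n \<longrightarrow> v i = x + y \<and> x \<in> X \<and> y \<in> mpoly.span S"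
      using v(1) Y by blast
    then obtain x where "\<forall>i. \<exists>y. i < n \<longrightarrow> v i = x i + y \<and> x i \<in> X \<and> y \<in> mpoly.span S"
      by (rule choice[THEN exE])
    then obtain y where xy: "\<forall>i. i < n \<longrightarrow> v i = x i + y i \<and> x i \<in> X \<and> y i \<in> mpoly.span S"
      by (rule choice[THEN exE])
    have "f = (\<Sum>i<n. var i * x i + var i * y i)"
      unfolding v(2) by (rule sum.cong) (use xy in \<open>simp_all add: distrib_left\<close>)
    then have "f = (\<Sum>i<n. var i * x i) + (\<Sum>i<n. var i * y i)" by (simp add: sum.distrib)
    moreover have "(\<Sum>i<n. var i * x i) \<in> R1 n X" by (rule R1I) (use xy in simp)
    moreover have "(\<Sum>i<n. var i * y i) \<in> mpoly.span ?T"
      by (rule mpoly.span_sum, rule sp) (use xy in simp_all)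
    ultimately show "f \<in> {x + y | x y. x \<in> R1 n X \<and> y \<in> mpoly.span ?T}" by blast
  qed
  then have "mpoly.dim (R1 n Y) \<le> mpoly.dim (R1 n X) + card ?T"
    by (intro mpoly.dim_sum_le R1_fin_dim X) (simp_all add: S)
  also have "card ?T \<le> n * card S"
    using card_image_le[of "{..<n} \<times> S" "\<lambda>(i, g). var i * g :: 'k mpoly"] S by (simp add: card_cartesian_product)
  finally show ?thesis by simp
qed

text \<open>For the pure powers the inequality \<open>R2_bound\<close> is an equality; the pure powers of degree
  $\alpha + j + 1$ enter with their \<open>n\<close> multiples.\<close>

lemma power_part_twice:
  "n * power_part_up n a j + (\<Sum>i\<in>later a j. lexsum n 2 (card (Mon n (j - a ! i)))) + n * card (new (Suc j))
    = power_part_up n a (Suc j) + (n choose 2) * power_part n a j"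
proof -
  have e: "n * card (Mon n (Suc j - a ! i)) + lexsum n 2 (card (Mon n (j - a ! i)))
      = card (Mon n (Suc (Suc j) - a ! i)) + (n choose 2) * card (Mon n (j - a ! i))"
    if "i \<in> later a j" for i
  proof -
    have "Suc j - a ! i = Suc (j - a ! i)" "Suc (Suc j) - a ! i = Suc (Suc (j - a ! i))"
      using that by (simp_all add: later_def Suc_diff_le)
    then show ?thesis
      using grow_twice[OF n, of "card (Mon n (j - a ! i))"] by (simp only: grow_Mon[OF n])
  qed
  let ?N = "{i \<in> {1..<length a}. a ! i = Suc j}"
  have l: "later a (Suc j) = later a j \<union> ?N" by (auto simp: later_def)
  have "power_part_up n a (Suc j) = (\<Sum>i\<in>later a j. card (Mon n (Suc (Suc j) - a ! i))) + (\<Sum>i\<in>?N. card (Mon n (Suc (Suc j) - a ! i)))"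
    unfolding power_part_up_def l by (rule sum.union_disjoint) (auto simp: later_def)
  also have "(\<Sum>i\<in>?N. card (Mon n (Suc (Suc j) - a ! i))) = (\<Sum>i\<in>?N. n)"
    by (rule sum.cong) (use card_Mon_1[OF n] in auto)
  also have "\<dots> = n * card (new (Suc j))" unfolding card_new new_Suc by simp
  finally have u: "power_part_up n a (Suc j) = (\<Sum>i\<in>later a j. card (Mon n (Suc (Suc j) - a ! i))) + n * card (new (Suc j))" .
  have "n * power_part_up n a j + (\<Sum>i\<in>later a j. lexsum n 2 (card (Mon n (j - a ! i))))
    = (\<Sum>i\<in>later a j. n * card (Mon n (Suc j - a ! i)) + lexsum n 2 (card (Mon n (j - a ! i))))"
    unfolding power_part_up_def sum_distrib_left sum.distrib ..
  also have "\<dots> = (\<Sum>i\<in>later a j. card (Mon n (Suc (Suc j) - a ! i)) + (n choose 2) * card (Mon n (j - a ! i)))"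
    by (rule sum.cong[OF refl e])
  also have "\<dots> = (\<Sum>i\<in>later a j. card (Mon n (Suc (Suc j) - a ! i))) + (n choose 2) * power_part n a j"
    unfolding power_part_def sum_distrib_left sum.distrib ..
  finally show ?thesis using u by linarith
qed

text \<open>Persistence. Minimal growth from degree $\alpha + j$ means that $R_1 I_{\alpha + j}$ is as
  small as possible. By \<open>R2_bound\<close> and the bound on second syzygies $R_1 R_1 I_{\alpha + j}$ is then no
  larger than for an LPP ideal; the new elements of the regular sequence add at most \<open>n\<close> dimensions each.
  Since growth cannot be smaller either, it is minimal in the next degree.\<close>

lemma minimal_growth_step:
  assumes g: "minimal_growth j" and no: "no_other_gens (Suc j)" and j: "Suc j \<le> t"
  shows "minimal_growth (Suc j)"
proof -
  have jt: "j \<le> t" using j by simp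
  let ?X = "R1 n (comp j)"
  have g': "mpoly.dim ?X = grow n (lexpart j) + power_part_up n a j" using g by (simp add: minimal_growth_def)
  have X: "mpoly.subspace ?X" "mpoly.fin_dim ?X"
    by (rule R1_subspace[OF comp_subspace], rule R1_fin_dim[OF comp_subspace comp_fin_dim])
  have "h (Suc j) = grow n (lexpart j) + power_part n a (Suc j)"
    using h_Suc_eq[OF no] g' card_new_Suc[of j] by simp
  then have lp: "lexpart (Suc j) = grow n (lexpart j)" using h_split[OF j] by simp
  have up: "mpoly.dim (R1 n (comp (Suc j))) \<le> mpoly.dim (R1 n ?X) + n * card (new (Suc j))"
    by (rule R1_sum_span[OF X finite_new]) (use no in \<open>simp add: no_other_gens_def\<close>)
  have r2: "mpoly.dim (R1 n ?X) + (n choose 2) * h j \<le> n * mpoly.dim ?X + kd 2 n (comp j)"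
    unfolding h_def by (rule R2_bound[OF comp_subspace comp_fin_dim])
  have hs: "(n choose 2) * h j = (n choose 2) * lexpart j + (n choose 2) * power_part n a j"
    unfolding h_split[OF jt] by (rule distrib_left)
  have nd: "n * mpoly.dim ?X = n * grow n (lexpart j) + n * power_part_up n a j"
    unfolding g' by (rule distrib_left)
  have "mpoly.dim (R1 n (comp (Suc j))) \<le> grow n (grow n (lexpart j)) + power_part_up n a (Suc j)"
    using up r2 hs nd comp_bounds(2)[OF jt, of 2] grow_twice[OF n, of "lexpart j"] power_part_twice[of j]
    by linarith
  then show ?thesis using R1_lower[OF j] unfolding minimal_growth_def lp by simp
qed

lemma sharp_imp_minimal_growth:
  assumes j: "Suc j \<le> t" and s: "h (Suc j) = grow n (lexpart j) + power_part n a (Suc j)"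
  shows "minimal_growth j"
  using R1_lower[of j] h_Suc_ge[of j] card_new_Suc[of j] s j unfolding minimal_growth_def by linarith

lemma minimal_growth_imp_sharp:
  assumes "minimal_growth j" "no_other_gens (Suc j)"
  shows "h (Suc j) = grow n (lexpart j) + power_part n a (Suc j)"
  using h_Suc_eq[OF assms(2)] assms(1) card_new_Suc[of j] unfolding minimal_growth_def by linarith

text \<open>If all generators of degree $\alpha$ belong to the regular sequence, $I_\alpha$ has the smallest
  dimension possible, its lex part is the monomial $x_0^\alpha$ alone, and growth is at most \<open>n\<close> for each
  element.\<close>

lemma minimal_growth_start:
  assumes no: "no_other_gens 0" and low: "component n I (\<alpha> - 1) = {0}"
  shows "minimal_growth 0" "h 0 = card (new 0)"
proof -
  have z: "R1 n {0 :: 'k mpoly} = {0}"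
  proof -
    have "R1 n {0 :: 'k mpoly} \<subseteq> {0}" by (rule R1_subsetI) (simp_all add: mpoly.subspace_single_0)
    then show ?thesis using mpoly.subspace_0[OF R1_subspace[OF mpoly.subspace_single_0], of n] by blast
  qed
  have fz: "mpoly.fin_dim {0 :: 'k mpoly}" by (rule mpoly.fin_dimI[of "{}"]) simp_all
  have sub: "comp 0 \<subseteq> {x + y | x y. x \<in> {0} \<and> y \<in> mpoly.span (new 0)}"
    using no low z by (simp add: no_other_gens_def)
  have d0: "mpoly.dim {0 :: 'k mpoly} = 0" by simp
  have le: "h 0 \<le> card (new 0)"
    using mpoly.dim_sum_le[OF fz finite_new sub] unfolding h_def d0 by simp
  have pp: "power_part n a 0 = card (later a 0)" unfolding power_part_def by simp
  have cn: "card (new 0) = 1 + card (later a 0)"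
    unfolding card_new new_0_insert by (simp add: later_def)
  have "1 + card (later a 0) \<le> h 0" using comp_bounds(1)[of 0] pp by simp
  then show h0: "h 0 = card (new 0)" using le cn by simp
  have lp: "lexpart 0 = 1" unfolding lexpart_def h0 cn pp by simp
  have "mpoly.dim (R1 n (comp 0)) \<le> mpoly.dim (R1 n {0 :: 'k mpoly}) + n * card (new 0)"
    by (rule R1_sum_span[OF mpoly.subspace_single_0 fz finite_new sub])
  then have "mpoly.dim (R1 n (comp 0)) \<le> n * card (new 0)" unfolding z d0 by simp
  moreover have "power_part_up n a 0 = n * card (later a 0)"
  proof -
    have "power_part_up n a 0 = (\<Sum>i\<in>later a 0. n)"
      unfolding power_part_up_def by (rule sum.cong) (use card_Mon_1[OF n] in \<open>auto simp: later_def\<close>)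
    then show ?thesis by simp
  qed
  ultimately have "mpoly.dim (R1 n (comp 0)) \<le> grow n (lexpart 0) + power_part_up n a 0"
    unfolding lp grow_1[OF n] cn by simp
  then show "minimal_growth 0" using R1_lower[of 0] unfolding minimal_growth_def by simp
qed

lemma length_le: "length a \<le> n"
  using regular_length_le[OF reg] len by simp

text \<open>A minimal generator in the ideal of the regular sequence is, in its degree, a combination of
  multiples from the degree before and of elements of the sequence.\<close>

lemma no_other_gensI:
  assumes G': "min_gens n I G'" and sub: "G' \<inter> forms n (\<alpha> + j) \<subseteq> Idl\<^bsub>PR n\<^esub> (set fs)"
  shows "no_other_gens j"
proof -
  define d where "d = \<alpha> + j - 1"
  have d: "\<alpha> + j = Suc d" using large unfolding d_def by simp
  note F = min_gens_facts[OF G']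
  have fsc: "set fs \<subseteq> carrier (PR n)" by (rule regular_seq_carrier[OF reg])
  let ?K = "Idl\<^bsub>PR n\<^esub> (set fs)"
  let ?W = "{x + y | x y. x \<in> R1 n (component n I d) \<and> y \<in> mpoly.span (new j)}"
  have sR: "mpoly.subspace (R1 n (component n I d))" by (rule R1_subspace[OF component_subspace[OF gen_facts(4)]])
  have W: "mpoly.subspace ?W" by (rule mpoly.subspace_sums[OF sR mpoly.subspace_span])
  have fsdeg: "g \<in> forms n (fdeg g)" if "g \<in> set fs" for g using that fsG gen_facts(7) by blast
  have new: "{g \<in> set fs. fdeg g = Suc d} \<subseteq> new j"
  proof
    fix g assume g: "g \<in> {g \<in> set fs. fdeg g = Suc d}"
    then obtain i where i: "i < length a" "g = fs ! i" using len by (metis (mono_tags, lifting) in_set_conv_nth mem_Collect_eq)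
    have "g \<noteq> 0" using g fsG gen_facts(6) by blast
    then have "fdeg g = \<alpha> + a ! i" using deg[OF i(1)] fdeg_eq unfolding i(2) by blast
    then have "a ! i = j" using g d by simp
    then show "g \<in> new j" using i unfolding new_def by simp
  qed
  have K: "component n ?K (Suc d) \<subseteq> ?W"
  proof
    fix f assume f: "f \<in> component n ?K (Suc d)"
    have "f \<in> {x + y | x y. x \<in> R1 n (component n ?K d) \<and> y \<in> mpoly.span {g \<in> set fs. fdeg g = Suc d}}"
      by (rule subsetD[OF component_step[OF n0 finite_set fsdeg refl] f])
    then obtain x y where xy: "f = x + y" "x \<in> R1 n (component n ?K d)" "y \<in> mpoly.span {g \<in> set fs. fdeg g = Suc d}"
      by blast
    have "?K \<subseteq> I" by (rule genideal_least[OF gen_facts(4) fsI])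
    then have "component n ?K d \<subseteq> component n I d" unfolding component_def by blast
    then have "x \<in> R1 n (component n I d)" using xy(2) R1_mono by blast
    moreover have "y \<in> mpoly.span (new j)" using xy(3) mpoly.span_mono[OF new] by blast
    ultimately show "f \<in> ?W" using xy(1) by blast
  qed
  have "{g \<in> G'. fdeg g = Suc d} \<subseteq> component n ?K (Suc d)"
    using sub unfolding F(8)[of "\<alpha> + j"] d component_def using F(7) by fastforce
  then have sp: "mpoly.span {g \<in> G'. fdeg g = Suc d} \<subseteq> ?W"
    by (intro mpoly.span_minimal W order_trans[OF _ K])
  have R: "R1 n (component n I d) \<subseteq> ?W"
  proof
    fix x assume x: "x \<in> R1 n (component n I d)"
    have "x = x + 0" by simp
    then show "x \<in> ?W" using x mpoly.span_zero[of "new j"] by blast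
  qed
  have "component n I (Suc d) \<subseteq> ?W"
  proof
    fix f assume "f \<in> component n I (Suc d)"
    then have "f \<in> {x + y | x y. x \<in> R1 n (component n I d) \<and> y \<in> mpoly.span {g \<in> G'. fdeg g = Suc d}}"
      using component_step[OF n0 F(1) F(7) F(3), of d] by (rule rev_subsetD)
    then obtain x y where xy: "f = x + y" "x \<in> R1 n (component n I d)" "y \<in> mpoly.span {g \<in> G'. fdeg g = Suc d}"
      by blast
    have "x \<in> ?W" "y \<in> ?W" using xy(2,3) R sp by blast+
    then show "f \<in> ?W" unfolding xy(1) by (rule mpoly.subspace_add[OF W])
  qed
  then show ?thesis unfolding no_other_gens_def d by simp
qed

abbreviation powers_ideal :: "'k mpoly set" where
  "powers_ideal \<equiv> Idl\<^bsub>PR n\<^esub> ((\<lambda>i. pmonom (Poly_Mapping.single i (\<alpha> + a ! i))) ` {..<length a})"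

lemma finite_lpp_monomials: "finite A \<Longrightarrow> finite (lpp_monomials n \<alpha> a A d)"
  unfolding lpp_monomials_def by simp

lemma large_degree: "j \<le> t \<Longrightarrow> Suc j < \<alpha>" "m \<le> H \<Longrightarrow> n * m < \<alpha>"
proof -
  show "j \<le> t \<Longrightarrow> Suc j < \<alpha>" using large by linarith
  assume "m \<le> H"
  then have "n * m \<le> n * H" by (rule mult_le_mono2)
  then show "n * m < \<alpha>" using large by linarith
qed

text \<open>In every LPP ideal with the right Hilbert function the lex part has size \<open>lexpart j\<close>, so that
  its growth is determined.\<close>

lemma lpp_growth:
  assumes L: "lex_ideal n L" and J: "J = L <+>\<^bsub>PR n\<^esub> powers_ideal"
    and j: "j \<le> t" and dim: "mpoly.dim (component n J (\<alpha> + j)) = h j"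
  shows "mpoly.dim (R1_mult n (component n J (\<alpha> + j))) = grow n (lexpart j) + power_part_up n a j"
proof -
  obtain M where M: "M \<subseteq> exponents n" "L = Idl\<^bsub>PR n\<^esub> (pmonom ` M)"
    using L unfolding lex_ideal_def monomial_ideal_def by blast
  let ?A = "{p \<in> Mon n (\<alpha> + j). pmonom p \<in> L}"
  let ?A' = "?A \<union> (+) (Poly_Mapping.single 0 \<alpha>) ` Mon n j"
  let ?P = "lpp_monomials n \<alpha> a ?A (\<alpha> + j)"
  have A: "lexseg n (\<alpha> + j) ?A" by (rule lex_ideal_segment[OF L])
  have fP: "finite ?P" by (rule finite_lpp_monomials[OF lexseg_finite[OF A]])
  have comp: "component n J (\<alpha> + j) = monspan ?P" by (rule lpp_component[OF length_le M J])
  have cP: "card ?P = h j" using dim unfolding comp dim_monspan[OF fP] .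
  have "?A' \<subseteq> ?P" unfolding lpp_monomials_split[OF a_nonempty a0] by (rule Un_upper1)
  then have "card ?A' \<le> h j" unfolding cP[symmetric] by (rule card_mono[OF fP])
  also have "\<dots> \<le> H" unfolding h_def by (rule bounded[OF j])
  finally have sm: "n * card ?A' < \<alpha>" by (rule large_degree(2))
  note S = lpp_monomials_size[OF n a_nonempty length_le a0 A refl sm large_degree(1)[OF j]]
  have c: "card ?A' = lexpart j" using S(2) unfolding cP h_split[OF j] by simp
  have "R1_mult n (component n J (\<alpha> + j)) = monspan (up n ?P)"
    unfolding comp R1_mult_eq[OF monspan_subspace] by (rule R1_monspan)
  then show ?thesis
    unfolding c[symmetric] card_up_grow[OF n S(1), symmetric] S(3)[symmetric]
    by (simp only: dim_monspan[OF finite_up[OF fP]])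
qed

text \<open>Let $S_j$ be the lex segment of degree $\alpha + j$ of size \<open>lexpart j\<close>. By the growth bound the
  multiples of $S_j$ lie in $S_{j+1}$, and so the ideal generated by all $S_j$ meets degree $\alpha + j$
  in $S_j$ exactly. As it contains all multiples of $x_0^\alpha$ there, the count of monomials gives the
  dimension of $I_{\alpha + j}$.\<close>

lemma lpp_exists:
  obtains L J :: "'k mpoly set" where "lex_ideal n L" "J = L <+>\<^bsub>PR n\<^esub> powers_ideal"
    "\<And>j. j \<le> t \<Longrightarrow> mpoly.dim (component n J (\<alpha> + j)) = h j"
    "\<And>d. d < \<alpha> \<Longrightarrow> mpoly.dim (component n J d) = 0"
proof -
  have "\<forall>j. \<exists>A. j \<le> t \<longrightarrow> lexseg n (\<alpha> + j) A \<and> card A = lexpart j"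
  proof
    fix j show "\<exists>A. j \<le> t \<longrightarrow> lexseg n (\<alpha> + j) A \<and> card A = lexpart j"
    proof (cases "j \<le> t")
      case True
      have "lexpart j \<le> n * lexpart j" using n0 by (cases n) simp_all
      also have "\<dots> < \<alpha>" by (rule large_degree(2)[OF lexpart_small[OF True]])
      finally have "lexpart j \<le> card (Mon n (\<alpha> + j))" using card_Mon_ge[OF n, of "\<alpha> + j"] by linarith
      then show ?thesis using lexseg_exists by blast
    qed simp
  qed
  then obtain S where "\<forall>j. j \<le> t \<longrightarrow> lexseg n (\<alpha> + j) (S j) \<and> card (S j) = lexpart j"
    by (rule choice[THEN exE])
  then have S: "\<And>j. j \<le> t \<Longrightarrow> lexseg n (\<alpha> + j) (S j)" "\<And>j. j \<le> t \<Longrightarrow> card (S j) = lexpart j" by blast+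
  have upS: "up n (S j) \<subseteq> S (Suc j)" if j: "Suc j \<le> t" for j
  proof (rule lexseg_le)
    have jt: "j \<le> t" using j by simp
    show "lexseg n (\<alpha> + Suc j) (up n (S j))" using lexseg_up[OF n0 S(1)[OF jt]] by simp
    show "lexseg n (\<alpha> + Suc j) (S (Suc j))" by (rule S(1)[OF j])
    show "card (up n (S j)) \<le> card (S (Suc j))"
      unfolding card_up_grow[OF n S(1)[OF jt]] S(2)[OF jt] S(2)[OF j] by (rule lexpart_grow) (use j in simp)
  qed
  have ext: "(\<Union>u\<in>S i. (+) u ` Mon n e) \<subseteq> S (i + e)" if "i + e \<le> t" for i e
    using that
  proof (induction e)
    case 0
    then show ?case by simp
  next
    case (Suc e)
    have "up n (\<Union>u\<in>S i. (+) u ` Mon n e) \<subseteq> up n (S (i + e))" by (rule up_mono[OF Suc.IH]) (use Suc.prems in simp)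
    also have "\<dots> \<subseteq> S (i + Suc e)" using upS[of "i + e"] Suc.prems by simp
    finally show ?case unfolding up_extend[OF n0] .
  qed
  define M where "M = (\<Union>j\<in>{..t}. S j)"
  have M: "M \<subseteq> exponents n"
  proof
    fix p assume "p \<in> M"
    then obtain j where "j \<le> t" "p \<in> S j" unfolding M_def by blast
    then show "p \<in> exponents n" using lexseg_subset[OF S(1)] Mon_exponents by blast
  qed
  define L where "L = Idl\<^bsub>PR n\<^esub> (pmonom ` M :: 'k mpoly set)"
  have inL: "pmonom p \<in> L \<longleftrightarrow> (\<exists>j\<le>t. \<exists>e. p \<in> (\<Union>u\<in>S j. (+) u ` Mon n e))" if p: "p \<in> exponents n" for p
  proof
    assume "pmonom p \<in> L"
    then obtain u w where uw: "u \<in> M" "w \<in> exponents n" "p = u + w"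
      unfolding L_def monomial_ideal_iff[OF M] by auto
    then obtain j where j: "j \<le> t" "u \<in> S j" unfolding M_def by blast
    have "w \<in> Mon n (tdeg w)" using uw(2) by (simp add: Mon_def)
    then have "p \<in> (\<Union>u\<in>S j. (+) u ` Mon n (tdeg w))" using j(2) uw(3) by blast
    then show "\<exists>j\<le>t. \<exists>e. p \<in> (\<Union>u\<in>S j. (+) u ` Mon n e)" using j(1) by blast
  next
    assume "\<exists>j\<le>t. \<exists>e. p \<in> (\<Union>u\<in>S j. (+) u ` Mon n e)"
    then obtain j e u w where j: "j \<le> t" "u \<in> S j" "w \<in> Mon n e" "p = u + w" by blast
    have "u \<in> M" using j(1,2) unfolding M_def by blast
    moreover have "w \<in> exponents n" by (rule Mon_exponents[OF j(3)])
    ultimately show "pmonom p \<in> L"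
      unfolding L_def monomial_ideal_iff[OF M] using p j(4) by (auto simp: carrier_iff)
  qed
  have deg_ext: "tdeg p = \<alpha> + j + e" if j: "j \<le> t" and p: "p \<in> (\<Union>u\<in>S j. (+) u ` Mon n e)" for p j e
  proof -
    have "p \<in> Mon n ((\<alpha> + j) + e)" by (rule subsetD[OF lexseg_subset[OF lexseg_extend[OF n0 S(1)[OF j]]] p])
    then show ?thesis by (rule Mon_tdeg)
  qed
  have lexL: "lex_ideal n L"
    unfolding lex_ideal_def
  proof (intro conjI ballI impI)
    show "monomial_ideal n L" unfolding monomial_ideal_def L_def using M by blast
    fix p q assume p: "p \<in> exponents n" and q: "q \<in> exponents n"
      and pq: "pmonom q \<in> L \<and> tdeg p = tdeg q \<and> lex_greater p q"
    obtain j e where j: "j \<le> t" and qe: "q \<in> (\<Union>u\<in>S j. (+) u ` Mon n e)" using pq inL[OF q] by blast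
    have "tdeg p = (\<alpha> + j) + e" using pq deg_ext[OF j qe] by simp
    then have pM: "p \<in> Mon n ((\<alpha> + j) + e)" using p by (simp add: Mon_def)
    have "q < p" using pq by (simp add: less_expo_iff)
    then have "q \<le> p" by (rule less_imp_le)
    from lexsegD[OF lexseg_extend[OF n0 S(1)[OF j]] qe pM this]
    show "pmonom p \<in> L" using inL[OF p] j by blast
  qed
  define J where "J = L <+>\<^bsub>PR n\<^esub> powers_ideal"
  have comp: "component n J d = monspan (lpp_monomials n \<alpha> a {p \<in> Mon n d. pmonom p \<in> L} d)" for d
    by (rule lpp_component[OF length_le M L_def J_def])
  have seg: "{p \<in> Mon n (\<alpha> + j). pmonom p \<in> L} = S j" if j: "j \<le> t" for j
  proof
    show "S j \<subseteq> {p \<in> Mon n (\<alpha> + j). pmonom p \<in> L}"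
    proof
      fix p assume p: "p \<in> S j"
      have pM: "p \<in> Mon n (\<alpha> + j)" by (rule subsetD[OF lexseg_subset[OF S(1)[OF j]] p])
      have "p \<in> (\<Union>u\<in>S j. (+) u ` Mon n 0)" using p by simp
      then have "pmonom p \<in> L" using inL[OF Mon_exponents[OF pM]] j by blast
      then show "p \<in> {p \<in> Mon n (\<alpha> + j). pmonom p \<in> L}" using pM by simp
    qed
    show "{p \<in> Mon n (\<alpha> + j). pmonom p \<in> L} \<subseteq> S j"
    proof
      fix p assume "p \<in> {p \<in> Mon n (\<alpha> + j). pmonom p \<in> L}"
      then have pM: "p \<in> Mon n (\<alpha> + j)" and pL: "pmonom p \<in> L" by simp_all
      obtain i e where i: "i \<le> t" and pe: "p \<in> (\<Union>u\<in>S i. (+) u ` Mon n e)"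
        using pL inL[OF Mon_exponents[OF pM]] by blast
      have "i + e = j" using deg_ext[OF i pe] Mon_tdeg[OF pM] by simp
      then show "p \<in> S j" using subsetD[OF ext pe] j by simp
    qed
  qed
  have dimJ: "mpoly.dim (component n J (\<alpha> + j)) = h j" if j: "j \<le> t" for j
  proof -
    have ls: "lexseg n (\<alpha> + j) (S j)" by (rule S(1)[OF j])
    let ?T = "(+) (Poly_Mapping.single 0 \<alpha>) ` Mon n j"
    have T: "lexseg n (\<alpha> + j) ?T" by (rule lexseg_translate[OF n0 lexseg_Mon])
    have "?T \<subseteq> S j"
      by (rule lexseg_le[OF T ls]) (simp add: card_translate S(2)[OF j] lexpart_ge[OF j])
    then have e: "S j = S j \<union> ?T" by blast
    have sm: "n * card (S j) < \<alpha>" unfolding S(2)[OF j] by (rule large_degree(2)[OF lexpart_small[OF j]])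
    have "card (lpp_monomials n \<alpha> a (S j) (\<alpha> + j)) = h j"
      using lpp_monomials_size(2)[OF n a_nonempty length_le a0 ls e sm large_degree(1)[OF j]]
      unfolding S(2)[OF j] h_split[OF j] .
    then show ?thesis
      unfolding comp seg[OF j] dim_monspan[OF finite_lpp_monomials[OF lexseg_finite[OF ls]]] .
  qed
  have low: "mpoly.dim (component n J d) = 0" if d: "d < \<alpha>" for d
  proof -
    have "{p \<in> Mon n d. pmonom p \<in> L} = {}"
    proof (rule ccontr)
      assume "\<not> ?thesis"
      then obtain p where p: "p \<in> Mon n d" "pmonom p \<in> L" by blast
      obtain j e where "j \<le> t" "p \<in> (\<Union>u\<in>S j. (+) u ` Mon n e)"
        using p(2) inL[OF Mon_exponents[OF p(1)]] by blast
      then have "tdeg p = \<alpha> + j + e" by (rule deg_ext)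
      then show False using Mon_tdeg[OF p(1)] d by simp
    qed
    moreover have "(\<Union>i<length a. pure_power n i (\<alpha> + a ! i) d) = {}"
      using d by (simp add: pure_power_def)
    ultimately have "lpp_monomials n \<alpha> a {p \<in> Mon n d. pmonom p \<in> L} d = {}"
      by (simp only: lpp_monomials_def Un_empty)
    then show ?thesis unfolding comp by (simp only: dim_monspan[OF finite.emptyI] card.empty)
  qed
  show ?thesis by (rule that[OF lexL J_def dimJ low])
qed

end

section \<open>The Hilbert function is bounded by the type\<close>

text \<open>Each degree multiplies the dimension by at most \<open>n\<close> and adds the new generators.\<close>

primrec hilbert_bound :: "nat \<Rightarrow> nat list \<Rightarrow> nat \<Rightarrow> nat" where
  "hilbert_bound n b 0 = b ! 0"
| "hilbert_bound n b (Suc j) = n * hilbert_bound n b j + b ! Suc j"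

lemma hilbert_bound_mono: "0 < n \<Longrightarrow> i \<le> j \<Longrightarrow> hilbert_bound n b i \<le> hilbert_bound n b j"
proof (induction j)
  case (Suc j)
  have "hilbert_bound n b j \<le> n * hilbert_bound n b j" using Suc.prems(1) by (cases n) simp_all
  then have "hilbert_bound n b j \<le> hilbert_bound n b (Suc j)" unfolding hilbert_bound.simps(2) by (rule trans_le_add1)
  then show ?case using Suc by (cases "i = Suc j") (auto intro: order_trans)
qed simp

lemma R1_dim_le: "mpoly.subspace V \<Longrightarrow> mpoly.fin_dim V \<Longrightarrow> mpoly.dim (R1 n V) \<le> n * mpoly.dim V"
  using kd_1_R1[of V n] by linarith

lemma dim_le_hilbert_bound:
  fixes I :: "'k::field mpoly set"
  assumes n: "0 < n" and G: "min_gens n I G" and \<alpha>: "0 < \<alpha>" and low: "component n I (\<alpha> - 1) = {0}"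
    and b: "\<And>j. j \<le> t \<Longrightarrow> card (G \<inter> forms n (\<alpha> + j)) = b ! j"
  shows "j \<le> t \<Longrightarrow> mpoly.dim (component n I (\<alpha> + j)) \<le> hilbert_bound n b j"
proof (induction j)
  case 0
  have "mpoly.dim (R1 n (component n I (\<alpha> - 1))) \<le> n * mpoly.dim (component n I (\<alpha> - 1))"
    by (rule R1_dim_le[OF component_subspace[OF min_gens_facts(4)[OF G]] component_fin_dim])
  then have "mpoly.dim (R1 n (component n I (\<alpha> - 1))) = 0" unfolding low by simp
  then show ?case using component_growth(1)[OF n G, of "\<alpha> - 1"] b[of 0] \<alpha> by simp
next
  case (Suc j)
  have "mpoly.dim (R1 n (component n I (\<alpha> + j))) \<le> n * mpoly.dim (component n I (\<alpha> + j))"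
    by (rule R1_dim_le[OF component_subspace[OF min_gens_facts(4)[OF G]] component_fin_dim])
  also have "\<dots> \<le> n * hilbert_bound n b j" by (rule mult_le_mono2[OF Suc.IH]) (use Suc.prems in simp)
  finally show ?case using component_growth(1)[OF n G, of "\<alpha> + j"] b[OF Suc.prems] by simp
qed

lemma regular_seq_singleton:
  fixes f :: "'k::field mpoly"
  assumes f: "f \<in> forms n d" "f \<noteq> 0" and d: "0 < d"
  shows "regular_seq n [f]"
proof -
  have fc: "{f} \<subseteq> carrier (PR n)" using forms_carrier[OF f(1)] by simp
  have e: "Idl\<^bsub>PR n\<^esub> {} \<subseteq> {0 :: 'k mpoly}"
    by (rule genideal_least[OF poly_idealI]) (simp_all add: carrier_closed)
  have "1 \<notin> Idl\<^bsub>PR n\<^esub> {f}"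
  proof
    assume o: "1 \<in> Idl\<^bsub>PR n\<^esub> {f}"
    have "d \<le> tdeg (0 :: expo)"
      by (rule idl_degree_ge[OF fc _ o]) (use f(1) in \<open>auto simp: forms_def\<close>)
    then show False using d by (simp add: tdeg_def)
  qed
  then have "Idl\<^bsub>PR n\<^esub> {f} \<noteq> carrier (PR n)" using carrier_closed(2) by blast
  moreover have "g \<in> Idl\<^bsub>PR n\<^esub> {}" if "g \<in> carrier (PR n)" "g * f \<in> Idl\<^bsub>PR n\<^esub> {}" for g :: "'k mpoly"
  proof -
    have "g * f = 0" using that(2) e by blast
    then have "g = 0" using f(2) by simp
    then show ?thesis using ideal_closed(2)[OF genideal_is_ideal(1)[of "{}" n]] by simp
  qed
  ultimately show ?thesis unfolding regular_seq_def using fc by simp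
qed

text \<open>Since $I_\alpha$ contains a nonzero form, which is a regular sequence of length one,
  $\rho(1) = \alpha$; this is where minimality of the type yields \<open>a ! 0 = 0\<close>.\<close>

lemma minimal_type_regular:
  fixes I :: "'k::field_char_0 mpoly set"
  assumes n: "2 \<le> n" and lens: "0 < length a" "length b = t + 1"
    and mt: "minimal_type_via n I a b fs"
    and big: "n * hilbert_bound n b t + t + 2 + den_bound (hilbert_bound n b t) (t + 2) (hilbert_bound n b t) < initial_deg n I"
  shows "\<exists>G. regular_type n I G fs a (initial_deg n I) t (hilbert_bound n b t)"
    "d < initial_deg n I \<Longrightarrow> component n I d = {0}"
proof -
  let ?\<alpha> = "initial_deg n I"
  have n0: "0 < n" using n by simp
  have T: "length fs = length a" "regular_seq n fs" "sorted a"
    and deg: "\<And>i. i < length a \<Longrightarrow> fs ! i \<in> forms n (?\<alpha> + a ! i)"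
    using mt unfolding minimal_type_via_def of_type_via_def by blast+
  have rho: "rho n I 1 = ?\<alpha> + a ! 0"
  proof -
    have "\<forall>i\<in>{1..length a}. rho n I i = ?\<alpha> + a ! (i - 1)"
      using mt unfolding minimal_type_via_def by blast
    moreover have "1 \<in> {1..length a}" using lens(1) by (simp add: Suc_le_eq)
    ultimately have "rho n I 1 = ?\<alpha> + a ! (1 - 1)" by (rule bspec)
    then show ?thesis by simp
  qed
  obtain G where G: "min_gens n I G" "set fs \<subseteq> G" using mt unfolding minimal_type_via_def by blast
  obtain G' where G': "min_gens n I G'" "\<forall>j<length b. card (G' \<inter> forms n (?\<alpha> + j)) = b ! j"
    using mt unfolding minimal_type_via_def of_type_via_def by blast
  note F = min_gens_facts[OF G(1)]
  have f0: "fs ! 0 \<in> G" using G(2) nth_mem[of 0 fs] lens(1) T(1) by auto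
  have nz: "fs ! 0 \<in> I" by (rule subsetD[OF F(5) f0])
  have nz0: "fs ! 0 \<noteq> 0" using f0 F(6) by metis
  note init = initial_deg_facts[OF G(1) nz nz0]
  show low: "component n I d = {0}" if "d < ?\<alpha>" for d by (rule init(1)[OF that])
  have \<alpha>0: "0 < ?\<alpha>" using big by simp
  have a0: "a ! 0 = 0"
  proof -
    have "0 \<in> component n I ?\<alpha>" by (rule mpoly.subspace_0[OF component_subspace[OF F(4)]])
    then obtain f where f: "f \<in> component n I ?\<alpha>" "f \<noteq> 0" using init(2) by blast
    have "regular_seq n [f]"
      by (rule regular_seq_singleton[OF _ f(2) \<alpha>0]) (use f(1) in \<open>simp add: component_def\<close>)
    then have "\<exists>gs. regular_seq n gs \<and> length gs = 1 \<and> set gs \<subseteq> component n I ?\<alpha>"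
      using f(1) by (intro exI[of _ "[f]"]) simp
    then have "rho n I 1 \<le> ?\<alpha>" unfolding rho_def by (rule Least_le)
    then show ?thesis using rho by simp
  qed
  have lowp: "component n I (?\<alpha> - 1) = {0}" using low \<alpha>0 by simp
  have b: "card (G' \<inter> forms n (?\<alpha> + j)) = b ! j" if "j \<le> t" for j using G'(2) that lens(2) by simp
  have bounded: "mpoly.dim (component n I (?\<alpha> + j)) \<le> hilbert_bound n b t" if j: "j \<le> t" for j
    by (rule order_trans[OF dim_le_hilbert_bound[OF n0 G'(1) \<alpha>0 lowp b j] hilbert_bound_mono[OF n0 j]])
  have "regular_type n I G fs a ?\<alpha> t (hilbert_bound n b t)"
    by (rule regular_type.intro[OF n G(1) G(2) T(2) T(1) T(3) lens(1) a0 deg bounded big])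
  then show "\<exists>G. regular_type n I G fs a ?\<alpha> t (hilbert_bound n b t)" by blast
qed

lemma dim_R1_mult_zero:
  fixes V :: "'k::field mpoly set"
  assumes "V \<subseteq> {0}"
  shows "mpoly.dim (R1_mult n V) = 0"
proof -
  have "R1_mult n V \<subseteq> {0}"
    unfolding R1_mult_def
    by (rule mpoly.span_minimal[OF _ mpoly.subspace_single_0]) (use assms in auto)
  moreover have "mpoly.fin_dim {0 :: 'k mpoly}" by (rule mpoly.fin_dimI[of "{}"]) simp_all
  ultimately have "mpoly.dim (R1_mult n V) \<le> mpoly.dim {0 :: 'k mpoly}" by (intro mpoly.dim_mono_fin)
  then show ?thesis by simp
qed

text \<open>The new pure powers are counted by the jump of $\gamma$ on one side and by
  \<open>power_part\<close> on the other.\<close>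

lemma (in regular_type) sharp_iff:
  assumes \<alpha>: "initial_deg n I = \<alpha>" and L: "lex_ideal n L" and J: "J = L <+>\<^bsub>PR n\<^esub> powers_ideal"
    and j: "j < t" and dim: "mpoly.dim (component n J (\<alpha> + j)) = h j"
  shows "egh_sharp n I a J (\<alpha> + j) \<longleftrightarrow> h (Suc j) = grow n (lexpart j) + power_part n a (Suc j)"
proof -
  have "mpoly.dim (R1_mult n (component n J (\<alpha> + j))) = grow n (lexpart j) + power_part_up n a j"
    by (rule lpp_growth[OF L J _ dim]) (use j in simp)
  moreover have "gamma n I a (\<alpha> + j + 1) - gamma n I a (\<alpha> + j) = card {i \<in> {1..<length a}. a ! i = Suc j}"
    using gamma_step[OF sorted a_nonempty a0 \<alpha>, of j] by simp
  ultimately show ?thesis unfolding egh_sharp_def power_part_Suc h_def by (auto simp: add.commute add.left_commute)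
qed

text \<open>Below degree $\alpha - 1$ the ideals vanish. In degree $\alpha - 1$, sharpness says that
  $I_\alpha$ is spanned by elements of the regular sequence, which holds if $q < \alpha$. From degree
  $\alpha$ on, sharpness in a degree followed by one without other generators is minimal growth.
  Minimal growth starts with sharpness in degree $q$ or, if $q < \alpha$, with $I_\alpha$.\<close>

lemma (in regular_type) sharp_persists:
  assumes \<alpha>: "initial_deg n I = \<alpha>" and low: "\<And>d. d < \<alpha> \<Longrightarrow> component n I d = {0}"
    and L: "lex_ideal n L" and J: "J = L <+>\<^bsub>PR n\<^esub> powers_ideal"
    and dim: "\<And>d. d \<le> \<alpha> + t \<Longrightarrow> mpoly.dim (component n J d) = mpoly.dim (component n I d)"
    and no: "\<And>j. j \<le> t \<Longrightarrow> q < \<alpha> + j \<Longrightarrow> no_other_gens j"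
    and sharp: "egh_sharp n I a J q" and d: "q < d" "d < \<alpha> + t"
  shows "egh_sharp n I a J d"
proof -
  have dimJ: "mpoly.dim (component n J (\<alpha> + j)) = h j" if "j \<le> t" for j
    unfolding h_def by (rule dim) (use that in simp)
  have dim0: "mpoly.dim {0 :: 'k mpoly} = 0" by simp
  have R0: "mpoly.dim (R1_mult n (component n J e)) = 0" if e: "e < \<alpha>" for e
  proof (rule dim_R1_mult_zero)
    have "mpoly.dim (component n J e) = 0" using dim[of e] low[OF e] e dim0 by simp
    then show "component n J e \<subseteq> {0}" by (rule mpoly.dim_eq_0_fin[OF component_fin_dim])
  qed
  have \<alpha>0: "0 < \<alpha>" using large by simp
  have lowp: "component n I (\<alpha> - 1) = {0}" by (rule low) (use \<alpha>0 in simp)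
  have grow: "minimal_growth j" if "j < t" "q < \<alpha> + j" for j
    using that
  proof (induction j)
    case 0
    show ?case by (rule minimal_growth_start(1)[OF no lowp]) (use 0 in simp_all)
  next
    case (Suc j)
    have "minimal_growth j"
    proof (cases "q < \<alpha> + j")
      case True
      then show ?thesis using Suc by simp
    next
      case False
      then have q: "q = \<alpha> + j" using Suc.prems(2) by simp
      have jt: "j < t" "j \<le> t" using Suc.prems(1) by simp_all
      have "h (Suc j) = grow n (lexpart j) + power_part n a (Suc j)"
        using sharp sharp_iff[OF \<alpha> L J jt(1) dimJ[OF jt(2)]] unfolding q by simp
      then show ?thesis by (rule sharp_imp_minimal_growth[rotated]) (use jt in simp)
    qed
    then show ?case by (rule minimal_growth_step) (use Suc.prems no in simp_all)
  qed
  consider (low) "Suc d < \<alpha>" | (initial) "Suc d = \<alpha>" | (high) j where "d = \<alpha> + j"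
  proof -
    assume h: "Suc d < \<alpha> \<Longrightarrow> thesis" "Suc d = \<alpha> \<Longrightarrow> thesis" "\<And>j. d = \<alpha> + j \<Longrightarrow> thesis"
    show thesis
    proof (cases "\<alpha> \<le> d")
      case True
      then have "d = \<alpha> + (d - \<alpha>)" by simp
      then show ?thesis by (rule h(3))
    next
      case False
      then have "Suc d < \<alpha> \<or> Suc d = \<alpha>" by linarith
      then show ?thesis using h(1,2) by blast
    qed
  qed
  then show ?thesis
  proof cases
    case low': low
    have "gamma n I a (d + 1) = 0" "gamma n I a d = 0"
      using gamma_card(2)[OF sorted \<alpha>, of "d + 1"] gamma_card(2)[OF sorted \<alpha>, of d] low' by simp_all
    then show ?thesis using low[of "d + 1"] R0[of d] low' dim0 unfolding egh_sharp_def by simp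
  next
    case initial
    have "no_other_gens 0" by (rule no) (use d initial in simp_all)
    then have h0: "h 0 = card (new 0)" by (rule minimal_growth_start(2)[OF _ lowp])
    have e: "d + 1 = \<alpha> + 0" using initial by simp
    have "gamma n I a (d + 1) = card (new 0)"
      unfolding card_new e gamma_card(1)[OF sorted \<alpha>] by simp
    moreover have "gamma n I a d = 0" by (rule gamma_card(2)[OF sorted \<alpha>]) (use initial in simp)
    moreover have "mpoly.dim (component n I (d + 1)) = h 0" unfolding h_def e ..
    ultimately show ?thesis using R0[of d] initial h0 unfolding egh_sharp_def by simp
  next
    case (high j)
    have jt: "j < t" "j \<le> t" using d high by simp_all
    have "h (Suc j) = grow n (lexpart j) + power_part n a (Suc j)"
      by (rule minimal_growth_imp_sharp[OF grow no]) (use jt d high in simp_all)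
    then show ?thesis unfolding high using sharp_iff[OF \<alpha> L J jt(1) dimJ[OF jt(2)]] by simp
  qed
qed

theorem theorem1p6:
  fixes n l t :: nat and a b :: "nat list"
  assumes "n \<ge> 3" and "l \<ge> 1" and "length a = l" and "length b = t + 1"
  shows "\<exists>D::nat. \<forall>I :: 'k::field_char_0 mpoly set.
    hom_ideal n I \<and> minimal_type n I a b \<and> initial_deg n I \<ge> D \<longrightarrow>
      (\<exists>J. lpp_ideal n I a J \<and> same_hilbert_upto n J I (initial_deg n I + t)) \<and>
      (\<forall>J q. lpp_ideal n I a J \<and> same_hilbert_upto n J I (initial_deg n I + t) \<and>
         generated_le n I a b q \<and> egh_sharp n I a J q \<longrightarrow>
         (\<forall>d. q + 1 \<le> d \<and> d < initial_deg n I + t \<longrightarrow> egh_sharp n I a J d))"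
proof -
  define H where "H = hilbert_bound n b t"
  \<comment> \<open>One more than the bound in \<open>regular_type\<close>, whose inequality is strict.\<close>
  define D where "D = n * H + t + 3 + den_bound H (t + 2) H"
  have n: "2 \<le> n" and la: "0 < length a" using assms by simp_all
  show ?thesis
  proof (intro exI[of _ D] allI impI)
    fix I :: "'k mpoly set"
    assume as: "hom_ideal n I \<and> minimal_type n I a b \<and> initial_deg n I \<ge> D"
    define \<alpha> where "\<alpha> = initial_deg n I"
    have init: "initial_deg n I = \<alpha>" by (simp add: \<alpha>_def)
    have big: "n * hilbert_bound n b t + t + 2 + den_bound (hilbert_bound n b t) (t + 2) (hilbert_bound n b t) < initial_deg n I"
      using as unfolding D_def H_def by linarith
    note reg = minimal_type_regular[OF n la assms(4) _ big]
    obtain fs where fs: "minimal_type_via n I a b fs" using as unfolding minimal_type_def by blast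
    have low: "component n I d = {0}" if "d < \<alpha>" for d using reg(2)[OF fs] that unfolding init .
    have dim0: "mpoly.dim {0 :: 'k mpoly} = 0" by simp
    have part1: "\<exists>J. lpp_ideal n I a J \<and> same_hilbert_upto n J I (\<alpha> + t)"
    proof -
      obtain G where "regular_type n I G fs a \<alpha> t H" using reg(1)[OF fs] unfolding init H_def by blast
      then interpret regular_type n I G fs a \<alpha> t H .
      obtain L J where J: "lex_ideal n L" "J = L <+>\<^bsub>PR n\<^esub> powers_ideal"
        "\<And>j. j \<le> t \<Longrightarrow> mpoly.dim (component n J (\<alpha> + j)) = h j"
        "\<And>d. d < \<alpha> \<Longrightarrow> mpoly.dim (component n J d) = 0"
        by (rule lpp_exists) blast
      have "lpp_ideal n I a J" unfolding lpp_ideal_def init using J(1,2) by blast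
      moreover have "same_hilbert_upto n J I (\<alpha> + t)"
        unfolding same_hilbert_upto_def
      proof (intro allI impI)
        fix d assume d: "d \<le> \<alpha> + t"
        show "mpoly.dim (component n J d) = mpoly.dim (component n I d)"
        proof (cases "d < \<alpha>")
          case True
          then show ?thesis using J(4)[OF True] low[OF True] dim0 by simp
        next
          case False
          then have e: "d = \<alpha> + (d - \<alpha>)" by simp
          have "mpoly.dim (component n J (\<alpha> + (d - \<alpha>))) = mpoly.dim (component n I (\<alpha> + (d - \<alpha>)))"
            using J(3)[of "d - \<alpha>"] d unfolding h_def by simp
          then show ?thesis using e by simp
        qed
      qed
      ultimately show ?thesis by blast
    qed
    have part2: "egh_sharp n I a J d"
      if J: "lpp_ideal n I a J" and hf: "same_hilbert_upto n J I (\<alpha> + t)"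
        and gen: "generated_le n I a b q" and sharp: "egh_sharp n I a J q"
        and d: "q + 1 \<le> d" "d < \<alpha> + t" for J q d
    proof -
      \<comment> \<open>The regular sequence is the one with respect to which generation is bounded; it need not be
        \<open>fs\<close>.\<close>
      obtain fs' G' where g: "minimal_type_via n I a b fs'" "min_gens n I G'"
        "\<forall>d. q < d \<and> d \<le> \<alpha> + (length b - 1) \<longrightarrow> G' \<inter> forms n d \<subseteq> Idl\<^bsub>PR n\<^esub> (set fs')"
        using gen unfolding generated_le_def init by blast
      obtain G where "regular_type n I G fs' a \<alpha> t H" using reg(1)[OF g(1)] unfolding init H_def by blast
      then interpret regular_type n I G fs' a \<alpha> t H .
      obtain L where L: "lex_ideal n L" "J = L <+>\<^bsub>PR n\<^esub> powers_ideal"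
        using J unfolding lpp_ideal_def init by blast
      have no: "no_other_gens j" if j: "j \<le> t" "q < \<alpha> + j" for j
        by (rule no_other_gensI[OF g(2)]) (use g(3) j assms(4) in simp)
      have dims: "mpoly.dim (component n J d) = mpoly.dim (component n I d)" if "d \<le> \<alpha> + t" for d
        using hf that unfolding same_hilbert_upto_def by blast
      show ?thesis
        by (rule sharp_persists[OF init low L dims no sharp _ d(2)]) (use d(1) in simp_all)
    qed
    show "(\<exists>J. lpp_ideal n I a J \<and> same_hilbert_upto n J I (initial_deg n I + t)) \<and>
      (\<forall>J q. lpp_ideal n I a J \<and> same_hilbert_upto n J I (initial_deg n I + t) \<and>
         generated_le n I a b q \<and> egh_sharp n I a J q \<longrightarrow>
         (\<forall>d. q + 1 \<le> d \<and> d < initial_deg n I + t \<longrightarrow> egh_sharp n I a J d))"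
      unfolding init using part1 part2 by blast
  qed
qed

end
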